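(* Let $\mathbb{F}$ be a totally real number field with set of real embeddings $I_{\mathbb{F}}$, and let $M$ and $M'$ be motives over $\mathbb{F}$ with coefficients in a number field $\mathbb{E}$. Suppose that: (1) the rank $d(M)$ is even and the rank $d(M')$ is odd; (2) all the nonzero Hodge numbers $h^{p,q}_{M}$ and $h^{p,q}_{M'}$ are equal to $1$; (3) the motive $M\otimes M'$ is critical. For $\sigma\in I_{\mathbb{F}}$ let $\epsilon(\sigma,M')$ be the scalar by which complex conjugation $\rho_\sigma$ acts on the rank-one middle Hodge type of $H_B(\sigma,M')$. Then: (i) for each $\sigma\in I_{\mathbb{F}}$, as elements of $(\mathbb{E}\otimes\mathbb{C})^\times$, \[ \frac{c^{+}(\sigma, M\otimes M')}{c^{-}(\sigma,M\otimes M')} = \left( \frac{c^{+}(\sigma,M)}{c^{-}(\sigma,M)}\right)^{\epsilon(\sigma, M')} \pmod{(\mathbb{E}\otimes \sigma(\mathbb{F}))^{\times}}; \] (ii) as elements of $(\mathbb{E}\otimes\mathbb{C})^\times$, \[ \frac{c^{+}(R_{\mathbb{F}|\mathbb{Q}}(M \otimes M'))}{ c^{-}(R_{\mathbb{F}|\mathbb{Q}}(M \otimes M'))} = \prod_{\sigma \in I_{\mathbb{F}}} \left( \frac{ c^{+}(\sigma, M)} {c^{-}(\sigma, M)} \right)^{\epsilon(\sigma,M')} \pmod{(\mathbb{E}\otimes \mathcal{F})^{\times}}, \] where $\mathcal{F}$ is any subfield of $\mathbb{C}$ containing $\sigma(\mathbb{F})$ for all $\sigma\in I_{\mathbb{F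}}$.
   Context: A motive $M$ over the totally real field $\mathbb{F}$ with coefficients in $\mathbb{E}$ has, for each real embedding $\sigma$, a Betti realization $H_B(\sigma,M)$: a $d(M)$-dimensional $\mathbb{E}$-vector space with an involution $\rho_\sigma$ (complex conjugation), whose $\pm1$-eigenspaces have dimensions $d^{\pm}(M)$; a de Rham realization $H_{DR}(M)$, a free $\mathbb{E}\otimes_{\mathbb{Q}}\mathbb{F}$-module of rank $d(M)$ with a decreasing Hodge filtration $F^p$; comparison isomorphisms $I_\sigma:H_B(\sigma,M)\otimes_{\mathbb{Q}}\mathbb{C}\to H_{DR}(M)\otimes_{\mathbb{F},\sigma}\mathbb{C}$; and Hodge decompositions $H_B(\sigma,M)\otimes\mathbb{C}=\bigoplus H^{p,q}_\sigma(M)$ with $\rho_\sigma(H^{p,q}_\sigma)=H^{q,p}_\sigma$, the rank $h^{p,q}_M$ of $H^{p,q}_\sigma$ being independent of $\sigma$. $M$ is critical if there are Hodge filtration steps $F^{\pm}$ with $\mathrm{rank}(H_{DR}/F^{\mp})=d^{\pm}(M)$. The periods $c^{\pm}(\sigma,M)$ are the determinants of $H_B^{\pm}(\sigma,M)\otimes\mathbb{C}\to H_{DR}(M)\otimes_{\mathbb{F},\sigma}\mathbb{C}\to (H_{DR}(M)/F^{\mp})\otimes_{\mathbb{F},\sigma}\mathbb{C}$ with respect to rational bases, well defined in $(\mathbb{E}\otimes\mathbb{C})^\times$ modulo $(\mathbb{E}\otimes\sigma(\mathbb{F}))^\times$. $R_{\mathbb{F}|\mathbb{Q}}(M)$ is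 the restriction of scalars, a motive over $\mathbb{Q}$ with coefficients in $\mathbb{E}$ with $H_{DR}(R_{\mathbb{F}|\mathbb{Q}}M)=H_{DR}(M)$ (as $\mathbb{E}$-space) and $H_B(R_{\mathbb{F}|\mathbb{Q}}M)=\bigoplus_{\sigma}H_B(\sigma,M)$; its periods $c^{\pm}$ are Deligne's periods for motives over $\mathbb{Q}$ (determinants of $H_B^{\pm}\otimes\mathbb{C}\to (H_{DR}/F^{\mp})\otimes\mathbb{C}$ in rational bases). *)

theory Defs
  imports "Jordan_Normal_Form.VS_Connect" "HOL-Algebra.Subrings" "HOL-Library.Multiset"
begin

section \<open>Modules and tensor products\<close>

text \<open>
  Coefficient rings are types, used as ring records through \<^const>\<open>class_ring\<close>; modules are
  module records of HOL-Algebra, so that submodules, quotients and tensor products are again modules.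
\<close>

definition field_mod :: "('r \<Rightarrow> 'a::comm_ring_1) \<Rightarrow> ('r, 'a) module" where
  "field_mod \<phi> = \<lparr>carrier = UNIV, mult = (*), one = 1, zero = 0, add = (+),
     smult = (\<lambda>r x. \<phi> r * x)\<rparr>"

definition restrict_scalars :: "('r \<Rightarrow> 's) \<Rightarrow> ('s, 'a) module \<Rightarrow> ('r, 'a) module" where
  "restrict_scalars \<phi> M = \<lparr>carrier = carrier M, mult = mult M, one = one M, zero = zero M,
     add = add M, smult = (\<lambda>r x. smult M (\<phi> r) x)\<rparr>"

definition submod :: "('r, 'a) module \<Rightarrow> 'a set \<Rightarrow> ('r, 'a) module" where
  "submod M N = M\<lparr>carrier := N\<rparr>"

definition quot_mod :: "('r, 'a) module \<Rightarrow> 'a set \<Rightarrow> ('r, 'a set) module" where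
  "quot_mod M N = \<lparr>carrier = a_rcosets\<^bsub>M\<^esub> N, mult = undefined, one = undefined, zero = N,
     add = set_add M, smult = (\<lambda>r X. \<Union>x\<in>X. N +>\<^bsub>M\<^esub> (r \<odot>\<^bsub>M\<^esub> x))\<rparr>"

definition is_basis :: "('r::comm_ring_1, 'a) module \<Rightarrow> 'a list \<Rightarrow> bool" where
  "is_basis M bs \<longleftrightarrow> set bs \<subseteq> carrier M \<and>
     (\<forall>x\<in>carrier M. \<exists>!c::'r list. length c = length bs \<and>
        x = (\<Oplus>\<^bsub>M\<^esub>i\<in>{..<length bs}. c ! i \<odot>\<^bsub>M\<^esub> bs ! i))"

definition has_rank :: "('r::comm_ring_1, 'a) module \<Rightarrow> nat \<Rightarrow> bool" where
  "has_rank M n \<longleftrightarrow> (\<exists>bs. is_basis M bs \<and> length bs = n)"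

definition mrank :: "('r::comm_ring_1, 'a) module \<Rightarrow> nat" where
  "mrank M = (THE n. has_rank M n)"

definition direct_decomposition :: "('r, 'a) module \<Rightarrow> ('i \<Rightarrow> 'a set) \<Rightarrow> bool" where
  "direct_decomposition M H \<longleftrightarrow> (\<forall>i. H i \<subseteq> carrier M) \<and>
     (\<forall>x\<in>carrier M. \<exists>!c. (\<forall>i. c i \<in> H i) \<and> finite {i. c i \<noteq> \<zero>\<^bsub>M\<^esub>} \<and>
        x = (\<Oplus>\<^bsub>M\<^esub>i\<in>{i. c i \<noteq> \<zero>\<^bsub>M\<^esub>}. c i))"

text \<open>
  A list of pairs stands for the formal sum of its entries \<open>a \<otimes> b\<close>. The relation is the congruence
  on formal sums generated by bilinearity, and \<open>M \<otimes> N\<close> consists of its classes. (Additive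
  inverses come for free, as \<open>- a \<otimes> b\<close> is inverse to \<open>a \<otimes> b\<close>.)
\<close>

inductive teq :: "('r, 'a) module \<Rightarrow> ('r, 'b) module \<Rightarrow> ('a \<times> 'b) list \<Rightarrow> ('a \<times> 'b) list \<Rightarrow> bool"
  for M N where
  refl: "set xs \<subseteq> carrier M \<times> carrier N \<Longrightarrow> teq M N xs xs"
| sym: "teq M N xs ys \<Longrightarrow> teq M N ys xs"
| trans: "teq M N xs ys \<Longrightarrow> teq M N ys zs \<Longrightarrow> teq M N xs zs"
| append: "teq M N xs ys \<Longrightarrow> teq M N xs' ys' \<Longrightarrow> teq M N (xs @ xs') (ys @ ys')"
| comm: "set (xs @ ys) \<subseteq> carrier M \<times> carrier N \<Longrightarrow> teq M N (xs @ ys) (ys @ xs)"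
| add_left: "a \<in> carrier M \<Longrightarrow> a' \<in> carrier M \<Longrightarrow> b \<in> carrier N \<Longrightarrow>
    teq M N [(a \<oplus>\<^bsub>M\<^esub> a', b)] [(a, b), (a', b)]"
| add_right: "a \<in> carrier M \<Longrightarrow> b \<in> carrier N \<Longrightarrow> b' \<in> carrier N \<Longrightarrow>
    teq M N [(a, b \<oplus>\<^bsub>N\<^esub> b')] [(a, b), (a, b')]"
| zero_left: "b \<in> carrier N \<Longrightarrow> teq M N [(\<zero>\<^bsub>M\<^esub>, b)] []"
| zero_right: "a \<in> carrier M \<Longrightarrow> teq M N [(a, \<zero>\<^bsub>N\<^esub>)] []"
| balanced: "a \<in> carrier M \<Longrightarrow> b \<in> carrier N \<Longrightarrow>
    teq M N [(r \<odot>\<^bsub>M\<^esub> a, b)] [(a, r \<odot>\<^bsub>N\<^esub> b)]"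

definition tclass :: "('r, 'a) module \<Rightarrow> ('r, 'b) module \<Rightarrow> ('a \<times> 'b) list \<Rightarrow> ('a \<times> 'b) list set" where
  "tclass M N xs = {ys. teq M N xs ys}"

definition trep :: "('a \<times> 'b) list set \<Rightarrow> ('a \<times> 'b) list" where
  "trep X = (SOME xs. xs \<in> X)"

text \<open>
  The scalars of \<open>M \<otimes> N\<close> may be larger than the ring over which the tensor product is formed:
  \<open>act s x y\<close> is the formal sum \<open>s \<cdot> (x \<otimes> y)\<close>.
\<close>

definition tensor_mod :: "('r, 'a) module \<Rightarrow> ('r, 'b) module \<Rightarrow> ('s \<Rightarrow> 'a \<Rightarrow> 'b \<Rightarrow> ('a \<times> 'b) list) \<Rightarrow>
    ('s, ('a \<times> 'b) list set) module" where
  "tensor_mod M N act = \<lparr>carrier = tclass M N ` lists (carrier M \<times> carrier N),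
     mult = undefined, one = undefined, zero = tclass M N [],
     add = (\<lambda>X Y. tclass M N (trep X @ trep Y)),
     smult = (\<lambda>s X. tclass M N (concat (map (\<lambda>(x, y). act s x y) (trep X))))\<rparr>"

definition tensor :: "('r, 'a) module \<Rightarrow> ('r, 'b) module \<Rightarrow> ('r, ('a \<times> 'b) list set) module" where
  "tensor M N = tensor_mod M N (\<lambda>r x y. [(r \<odot>\<^bsub>M\<^esub> x, y)])"


section \<open>The tensor product of two fields over the rationals\<close>

abbreviation qteq :: "('a::field_char_0 \<times> 'b::field_char_0) list \<Rightarrow> ('a \<times> 'b) list \<Rightarrow> bool" where
  "qteq \<equiv> teq (field_mod of_rat :: (rat, 'a) module) (field_mod of_rat)"

lemma field_mod_simps [simp]:
  "carrier (field_mod \<phi>) = UNIV" "zero (field_mod \<phi>) = 0" "add (field_mod \<phi>) = (+)"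
  "mult (field_mod \<phi>) = (*)" "one (field_mod \<phi>) = 1" "smult (field_mod \<phi>) = (\<lambda>r x. \<phi> r * x)"
  by (simp_all add: field_mod_def)

lemma qteq_refl: "qteq xs xs"
  by (rule teq.refl) simp

lemma equivp_qteq: "equivp qteq"
  by (intro equivpI reflpI sympI transpI) (blast intro: qteq_refl teq.sym teq.trans)+

quotient_type (overloaded) ('a, 'b) qtensor = "('a::field_char_0 \<times> 'b::field_char_0) list" / qteq
  by (rule equivp_qteq)

lemma qteq_mset: "mset xs = mset ys \<Longrightarrow> qteq xs ys"
proof (induction xs arbitrary: ys)
  case Nil
  then show ?case by (simp add: qteq_refl)
next
  case (Cons x xs)
  then have "x \<in> set ys" by (metis list.set_intros(1) mset_eq_setD)
  then obtain us vs where ys: "ys = us @ x # vs" by (meson split_list)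
  with Cons.prems have "mset xs = mset (us @ vs)" by simp
  then have "qteq xs (us @ vs)" by (rule Cons.IH)
  then have 1: "qteq ([x] @ xs) ([x] @ (us @ vs))" by (rule teq.append[OF qteq_refl])
  have "qteq (([x] @ us) @ vs) ((us @ [x]) @ vs)"
    by (rule teq.append[OF _ qteq_refl], rule teq.comm) simp
  with 1 show ?case using ys by (auto intro: teq.trans)
qed

definition lmult :: "('a::times \<times> 'b::times) list \<Rightarrow> ('a \<times> 'b) list \<Rightarrow> ('a \<times> 'b) list" where
  "lmult xs ys = concat (map (\<lambda>(a, b). map (\<lambda>(a', b'). (a * a', b * b')) ys) xs)"

lemma lmult_simps [simp]:
  "lmult [] ys = []"
  "lmult (x # xs) ys = map (\<lambda>y. (fst x * fst y, snd x * snd y)) ys @ lmult xs ys"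
  "lmult (xs @ xs') ys = lmult xs ys @ lmult xs' ys"
  by (auto simp: lmult_def case_prod_beta)

lemma mset_lmult:
  "mset (lmult xs ys) = (\<Sum>x\<in>#mset xs. \<Sum>y\<in>#mset ys. {#(fst x * fst y, snd x * snd y)#})"
proof (induction xs)
  case (Cons x xs)
  have "mset (map g ys) = (\<Sum>y\<in>#mset ys. {#g y#})" for g :: "'a \<times> 'b \<Rightarrow> 'a \<times> 'b"
    by (induction ys) auto
  then show ?case using Cons by simp
qed simp

lemma lmult_commute:
  fixes xs :: "('a::comm_ring_1 \<times> 'b::comm_ring_1) list"
  shows "mset (lmult xs ys) = mset (lmult ys xs)"
  unfolding mset_lmult by (subst sum_mset.swap) (simp add: mult.commute)

lemma lmult_assoc:
  fixes xs :: "('a::comm_ring_1 \<times> 'b::comm_ring_1) list"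
  shows "lmult (lmult xs ys) zs = lmult xs (lmult ys zs)"
proof (induction xs)
  case (Cons x xs)
  have "lmult (map (\<lambda>y. (fst x * fst y, snd x * snd y)) ys) zs =
        map (\<lambda>y. (fst x * fst y, snd x * snd y)) (lmult ys zs)"
    by (induction ys) (auto simp: mult.assoc)
  with Cons show ?case by simp
qed simp

lemma qteq_split_map:
  assumes "\<And>y. qteq [f y] [g y, h y]"
  shows "qteq (map f ys) (map g ys @ map h ys)"
proof (induction ys)
  case Nil
  show ?case by (simp add: qteq_refl)
next
  case (Cons y ys)
  have "qteq ([f y] @ map f ys) ([g y, h y] @ (map g ys @ map h ys))"
    by (rule teq.append[OF assms Cons.IH])
  moreover have "qteq ([g y, h y] @ (map g ys @ map h ys)) (map g (y # ys) @ map h (y # ys))"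
    by (rule qteq_mset) simp
  ultimately show ?case by (auto intro: teq.trans)
qed

lemma qteq_map_one:
  assumes "\<And>y. qteq [f y] [g y]"
  shows "qteq (map f ys) (map g ys)"
proof (induction ys)
  case Nil
  show ?case by (simp add: qteq_refl)
next
  case (Cons y ys)
  show ?case using teq.append[OF assms[of y] Cons.IH] by simp
qed

lemma qteq_map_zero:
  assumes "\<And>y. qteq [f y] []"
  shows "qteq (map f ys) []"
proof (induction ys)
  case Nil
  show ?case by (simp add: qteq_refl)
next
  case (Cons y ys)
  show ?case using teq.append[OF assms[of y] Cons.IH] by simp
qed

lemma qteq_add_left: "qteq [(a + a', b)] [(a, b), (a', b)]"
  using teq.add_left[of a "field_mod of_rat" a' b "field_mod of_rat"] by simp

lemma qteq_add_right: "qteq [(a, b + b')] [(a, b), (a, b')]"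
  using teq.add_right[of a "field_mod of_rat" b "field_mod of_rat" b'] by simp

lemma qteq_zero_left: "qteq [(0, b)] []"
  using teq.zero_left[of b "field_mod of_rat" "field_mod of_rat"] by simp

lemma qteq_zero_right: "qteq [(a, 0)] []"
  using teq.zero_right[of a "field_mod of_rat" "field_mod of_rat"] by simp

lemma qteq_balanced: "qteq [(of_rat r * a, b)] [(a, of_rat r * b)]"
  using teq.balanced[of a "field_mod of_rat" b "field_mod of_rat" r] by simp

lemma qteq_lmult_left: "qteq xs xs' \<Longrightarrow> qteq (lmult xs ys) (lmult xs' ys)"
proof (induction rule: teq.induct)
  case (refl xs)
  show ?case by (rule qteq_refl)
next
  case (sym xs ys)
  then show ?case by (blast intro: teq.sym)
next
  case (trans xs ys zs)
  then show ?case by (blast intro: teq.trans)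
next
  case (append xs ys xs' ys')
  then show ?case by (simp add: teq.append)
next
  case (comm xs ys)
  show ?case by (rule qteq_mset) simp
next
  case (add_left a a' b)
  show ?case by (simp add: distrib_right) (rule qteq_split_map, rule qteq_add_left)
next
  case (add_right a b b')
  show ?case by (simp add: distrib_right) (rule qteq_split_map, rule qteq_add_right)
next
  case (zero_left b)
  show ?case by simp (rule qteq_map_zero, rule qteq_zero_left)
next
  case (zero_right a)
  show ?case by simp (rule qteq_map_zero, rule qteq_zero_right)
next
  case (balanced a b r)
  show ?case by (simp add: mult.assoc) (rule qteq_map_one, rule qteq_balanced)
qed

lemma qteq_lmult:
  assumes "qteq xs xs'" "qteq ys ys'"
  shows "qteq (lmult xs ys) (lmult xs' ys')"
proof -
  have "qteq (lmult xs ys) (lmult xs' ys)" by (rule qteq_lmult_left[OF assms(1)])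
  also have "qteq (lmult xs' ys) (lmult ys xs')" by (rule qteq_mset[OF lmult_commute])
  also (teq.trans) have "qteq (lmult ys xs') (lmult ys' xs')" by (rule qteq_lmult_left[OF assms(2)])
  also (teq.trans) have "qteq (lmult ys' xs') (lmult xs' ys')" by (rule qteq_mset[OF lmult_commute])
  finally (teq.trans) show ?thesis .
qed

lemma teq_sum_list:
  fixes f :: "'a \<Rightarrow> 'b \<Rightarrow> 'c::cancel_comm_monoid_add"
  assumes "teq M N xs ys"
    and "\<And>a a' b. f (a \<oplus>\<^bsub>M\<^esub> a') b = f a b + f a' b"
    and "\<And>a b b'. f a (b \<oplus>\<^bsub>N\<^esub> b') = f a b + f a b'"
    and "\<And>r a b. f (r \<odot>\<^bsub>M\<^esub> a) b = f a (r \<odot>\<^bsub>N\<^esub> b)"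
    and "\<And>b. f \<zero>\<^bsub>M\<^esub> b = 0" and "\<And>a. f a \<zero>\<^bsub>N\<^esub> = 0"
  shows "(\<Sum>(a, b)\<leftarrow>xs. f a b) = (\<Sum>(a, b)\<leftarrow>ys. f a b)"
  using assms(1) by induction (auto simp: assms(2-) add.commute)

lemma rational_functional:
  obtains f :: "'a::field_char_0 \<Rightarrow> rat"
  where "\<And>x y. f (x + y) = f x + f y" "\<And>r x. f (of_rat r * x) = r * f x" "f 1 = 1"
proof -
  interpret vp: vector_space_pair "\<lambda>r (x::'a). of_rat r * x" "\<lambda>r (x::rat). r * x"
    by unfold_locales (auto simp: algebra_simps of_rat_add of_rat_mult)
  have "vp.vs1.independent {1::'a}" by simp
  from vp.linear_independent_extend[OF this, of "\<lambda>_. 1"]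
  obtain g where g: "Vector_Spaces.linear (\<lambda>r x::'a. of_rat r * x) (*) g" "g 1 = (1::rat)"
    by auto
  interpret g: Vector_Spaces.linear "\<lambda>r x::'a. of_rat r * x" "(*)" g by (rule g(1))
  show thesis by (rule that[of g]) (auto simp: g.add g.scale g(2))
qed

lemma not_qteq_one: "\<not> qteq [] [(1::'a::field_char_0, 1::'b::field_char_0)]"
proof
  assume *: "qteq [] [(1::'a, 1::'b)]"
  obtain f :: "'a \<Rightarrow> rat" where f: "\<And>x y. f (x + y) = f x + f y" "\<And>r x. f (of_rat r * x) = r * f x" "f 1 = 1"
    by (rule rational_functional) blast
  obtain g :: "'b \<Rightarrow> rat" where g: "\<And>x y. g (x + y) = g x + g y" "\<And>r x. g (of_rat r * x) = r * g x" "g 1 = 1"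
    by (rule rational_functional) blast
  have 0: "f 0 = 0" "g 0 = 0" using f(1)[of 0 0] g(1)[of 0 0] by auto
  have "(\<Sum>(a, b)\<leftarrow>[]. f a * g b) = (\<Sum>(a, b)\<leftarrow>[(1::'a, 1::'b)]. f a * g b)"
    by (rule teq_sum_list[OF *]) (auto simp: f g 0 distrib_left distrib_right)
  then show False by (simp add: f g)
qed

instantiation qtensor :: (field_char_0, field_char_0) comm_ring_1
begin

lift_definition zero_qtensor :: "('a, 'b) qtensor" is "[]" .

lift_definition one_qtensor :: "('a, 'b) qtensor" is "[(1, 1)]" .

lift_definition plus_qtensor :: "('a, 'b) qtensor \<Rightarrow> ('a, 'b) qtensor \<Rightarrow> ('a, 'b) qtensor" is "(@)"
  by (rule teq.append)

lift_definition times_qtensor :: "('a, 'b) qtensor \<Rightarrow> ('a, 'b) qtensor \<Rightarrow> ('a, 'b) qtensor" is lmult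
  by (rule qteq_lmult)

lift_definition uminus_qtensor :: "('a, 'b) qtensor \<Rightarrow> ('a, 'b) qtensor" is "lmult [(- 1, 1)]"
  by (rule qteq_lmult[OF qteq_refl])

definition minus_qtensor :: "('a, 'b) qtensor \<Rightarrow> ('a, 'b) qtensor \<Rightarrow> ('a, 'b) qtensor" where
  "minus_qtensor x y = x + - y"

instance
proof
  fix x y z :: "('a, 'b) qtensor"
  show "x + y + z = x + (y + z)" by transfer (simp add: qteq_refl)
  show "x + y = y + x" by transfer (rule qteq_mset, simp)
  show "0 + x = x" by transfer (simp add: qteq_refl)
  show "x * y * z = x * (y * z)" by transfer (simp add: lmult_assoc qteq_refl)
  show "x * y = y * x" by transfer (rule qteq_mset, rule lmult_commute)
  show "1 * x = x" by transfer (simp add: qteq_refl)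
  show "(x + y) * z = x * z + y * z" by transfer (simp add: qteq_refl)
  show "x - y = x + - y" by (simp add: minus_qtensor_def)
  show "(0::('a, 'b) qtensor) \<noteq> 1" by transfer (rule not_qteq_one)
  show "- x + x = 0"
  proof transfer
    fix xs :: "('a \<times> 'b) list"
    have "qteq [(-1 + 1 :: 'a, 1 :: 'b)] [(-1, 1), (1, 1)]" by (rule qteq_add_left)
    then have "qteq [(-1, 1), (1, 1)] [(0::'a, 1::'b)]" by (simp add: teq.sym)
    then have "qteq [(-1, 1), (1::'a, 1::'b)] []" by (rule teq.trans) (rule qteq_zero_left)
    from qteq_lmult[OF this qteq_refl[of xs]] show "qteq (lmult [(-1, 1)] xs @ xs) []" by simp
  qed
qed

end

lift_definition pure_tensor :: "'a::field_char_0 \<Rightarrow> 'b::field_char_0 \<Rightarrow> ('a, 'b) qtensor" (infix \<open>\<otimes>\<^sub>\<rat>\<close> 75)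
  is "\<lambda>a b. [(a, b)]" .

definition map_right :: "('b \<Rightarrow> 'c) \<Rightarrow> ('a::field_char_0, 'b::field_char_0) qtensor \<Rightarrow>
    ('a, 'c::field_char_0) qtensor" where
  "map_right g t = (\<Sum>(a, b)\<leftarrow>rep_qtensor t. a \<otimes>\<^sub>\<rat> g b)"

text \<open>The subring \<open>\<EE> \<otimes> K\<close> of \<open>\<EE> \<otimes> \<complex>\<close>, and the unit groups.\<close>

definition right_subring :: "'b set \<Rightarrow> ('a::field_char_0, 'b::field_char_0) qtensor ring" where
  "right_subring K = class_ring\<lparr>carrier := {(\<Sum>(a, b)\<leftarrow>xs. a \<otimes>\<^sub>\<rat> b) | xs. snd ` set xs \<subseteq> K}\<rparr>"

abbreviation unit_group :: "('e::field_char_0, complex) qtensor monoid" where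
  "unit_group \<equiv> units_of class_ring"

definition unit_cong :: "complex set \<Rightarrow> ('e::field_char_0, complex) qtensor \<Rightarrow>
    ('e, complex) qtensor \<Rightarrow> bool" where
  "unit_cong K x y \<longleftrightarrow> x \<in> carrier unit_group \<and> y \<in> carrier unit_group \<and>
     (\<exists>u\<in>Units (right_subring K). x = u \<otimes>\<^bsub>unit_group\<^esub> y)"


section \<open>Number fields\<close>

definition number_field :: "'a::field_char_0 itself \<Rightarrow> bool" where
  "number_field _ \<longleftrightarrow> (\<exists>B::'a set. finite B \<and> (\<forall>x. \<exists>c. x = (\<Sum>b\<in>B. of_rat (c b) * b)))"

definition real_embeddings :: "('f::field_char_0 \<Rightarrow> complex) set" where
  "real_embeddings = {\<sigma>. field_hom \<sigma> \<and> range \<sigma> \<subseteq> \<real>}"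

definition totally_real :: "'f::field_char_0 itself \<Rightarrow> bool" where
  "totally_real _ \<longleftrightarrow> (\<forall>\<sigma>::'f \<Rightarrow> complex. field_hom \<sigma> \<longrightarrow> range \<sigma> \<subseteq> \<real>)"


section \<open>Scalar extension of realizations\<close>

text \<open>\<open>V \<otimes>\<^sub>\<rat> \<complex>\<close> for an \<open>\<EE>\<close>-space \<open>V\<close>, as a module over \<open>\<EE> \<otimes> \<complex>\<close>.\<close>

abbreviation bclass :: "('e::field_char_0, 'b) module \<Rightarrow> ('b \<times> complex) list \<Rightarrow> ('b \<times> complex) list set" where
  "bclass V \<equiv> tclass (restrict_scalars (of_rat :: rat \<Rightarrow> 'e) V) (field_mod of_rat)"

definition betti_ext :: "('e::field_char_0, 'b) module \<Rightarrow>
    (('e, complex) qtensor, ('b \<times> complex) list set) module" where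
  "betti_ext V = tensor_mod (restrict_scalars (of_rat :: rat \<Rightarrow> 'e) V) (field_mod of_rat)
     (\<lambda>t v z. map (\<lambda>(e, w). (e \<odot>\<^bsub>V\<^esub> v, w * z)) (rep_qtensor t))"

text \<open>
  \<open>H \<otimes>\<^bsub>\<FF>,\<sigma>\<^esub> \<complex>\<close> for an \<open>\<EE> \<otimes> \<FF>\<close>-module \<open>H\<close>, as a module over \<open>\<EE> \<otimes> \<complex>\<close>.
\<close>

abbreviation dclass :: "('f \<Rightarrow> complex) \<Rightarrow> (('e::field_char_0, 'f::field_char_0) qtensor, 'd) module \<Rightarrow>
    ('d \<times> complex) list \<Rightarrow> ('d \<times> complex) list set" where
  "dclass \<sigma> H \<equiv> tclass (restrict_scalars (\<lambda>x. 1 \<otimes>\<^sub>\<rat> x) H) (field_mod \<sigma>)"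

definition derham_ext :: "('f \<Rightarrow> complex) \<Rightarrow> (('e::field_char_0, 'f::field_char_0) qtensor, 'd) module \<Rightarrow>
    (('e, complex) qtensor, ('d \<times> complex) list set) module" where
  "derham_ext \<sigma> H = tensor_mod (restrict_scalars (\<lambda>x. 1 \<otimes>\<^sub>\<rat> x) H) (field_mod \<sigma>)
     (\<lambda>t h z. map (\<lambda>(e, w). ((e \<otimes>\<^sub>\<rat> 1) \<odot>\<^bsub>H\<^esub> h, w * z)) (rep_qtensor t))"


section \<open>Motives\<close>

text \<open>
  A motive over \<open>\<FF>\<close> with coefficients in \<open>\<EE>\<close> is given through its system of realizations:
  the Betti spaces \<open>H\<^sub>B(\<sigma>,M)\<close> with complex conjugation \<open>\<rho>\<^sub>\<sigma>\<close>, the de Rham module with its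
  Hodge filtration, the comparison maps \<open>I\<^sub>\<sigma>\<close> and the Hodge types.
\<close>

record (overloaded) ('e::field_char_0, 'f::field_char_0, 'b, 'd) realizations =
  betti :: "('f \<Rightarrow> complex) \<Rightarrow> ('e, 'b) module"
  frob :: "('f \<Rightarrow> complex) \<Rightarrow> 'b \<Rightarrow> 'b"
  derham :: "(('e, 'f) qtensor, 'd) module"
  hodge_fil :: "int \<Rightarrow> 'd set"
  comparison :: "('f \<Rightarrow> complex) \<Rightarrow> ('b \<times> complex) list set \<Rightarrow> ('d \<times> complex) list set"
  hodge_type :: "('f \<Rightarrow> complex) \<Rightarrow> int \<Rightarrow> int \<Rightarrow> ('b \<times> complex) list set set"

abbreviation bettiC where "bettiC M \<sigma> \<equiv> betti_ext (betti M \<sigma>)"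

abbreviation derhamC where "derhamC M \<sigma> \<equiv> derham_ext \<sigma> (derham M)"

definition frobC :: "('e::field_char_0, 'f::field_char_0, 'b, 'd) realizations \<Rightarrow> ('f \<Rightarrow> complex) \<Rightarrow>
    ('b \<times> complex) list set \<Rightarrow> ('b \<times> complex) list set" where
  "frobC M \<sigma> X = bclass (betti M \<sigma>) (map (\<lambda>(v, z). (frob M \<sigma> v, z)) (trep X))"

definition motive_rank :: "('e::field_char_0, 'f::field_char_0, 'b, 'd) realizations \<Rightarrow> nat" where
  "motive_rank M = mrank (derham M)"

definition hodge_number :: "('e::field_char_0, 'f::field_char_0, 'b, 'd) realizations \<Rightarrow>
    int \<Rightarrow> int \<Rightarrow> nat" where
  "hodge_number M p q =
     (THE n. \<forall>\<sigma>\<in>real_embeddings. has_rank (submod (bettiC M \<sigma>) (hodge_type M \<sigma> p q)) n)"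

text \<open>
  Motives are pure of some weight \<open>w\<close>. That \<open>hodge_number\<close> is a rank of \<open>H\<^sup>p\<^sup>q\<^sub>\<sigma>\<close> for every \<open>\<sigma>\<close> is
  the independence of \<open>\<sigma>\<close>. Freeness of the quotients \<open>H\<^sub>D\<^sub>R / F\<^sup>p\<close> is no restriction, since
  \<open>\<EE> \<otimes> \<FF>\<close> is a product of fields and the Hodge numbers do not depend on \<open>\<sigma>\<close>.
\<close>

locale motive =
  fixes M :: "('e::field_char_0, 'f::field_char_0, 'b, 'd) realizations"
  assumes betti_module: "\<sigma> \<in> real_embeddings \<Longrightarrow> Module.module class_ring (betti M \<sigma>)"
    and betti_rank: "\<sigma> \<in> real_embeddings \<Longrightarrow> has_rank (betti M \<sigma>) (motive_rank M)"
    and frob_hom: "\<sigma> \<in> real_embeddings \<Longrightarrow>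
      frob M \<sigma> \<in> LinearCombinations.module_hom class_ring (betti M \<sigma>) (betti M \<sigma>)"
    and frob_involution: "\<sigma> \<in> real_embeddings \<Longrightarrow> v \<in> carrier (betti M \<sigma>) \<Longrightarrow>
      frob M \<sigma> (frob M \<sigma> v) = v"
    and derham_module: "Module.module class_ring (derham M)"
    and derham_rank: "has_rank (derham M) (motive_rank M)"
    and fil_submodule: "LinearCombinations.submodule class_ring (hodge_fil M p) (derham M)"
    and fil_decreasing: "p \<le> q \<Longrightarrow> hodge_fil M q \<subseteq> hodge_fil M p"
    and fil_quot_free: "\<exists>n. has_rank (quot_mod (derham M) (hodge_fil M p)) n"
    and comparison_hom: "\<sigma> \<in> real_embeddings \<Longrightarrow>
      comparison M \<sigma> \<in> LinearCombinations.module_hom class_ring (bettiC M \<sigma>) (derhamC M \<sigma>)"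
    and comparison_bij: "\<sigma> \<in> real_embeddings \<Longrightarrow>
      bij_betw (comparison M \<sigma>) (carrier (bettiC M \<sigma>)) (carrier (derhamC M \<sigma>))"
    and hodge_submodule: "\<sigma> \<in> real_embeddings \<Longrightarrow>
      submodule class_ring (hodge_type M \<sigma> p q) (bettiC M \<sigma>)"
    and hodge_decomposition: "\<sigma> \<in> real_embeddings \<Longrightarrow>
      direct_decomposition (bettiC M \<sigma>) (\<lambda>(p, q). hodge_type M \<sigma> p q)"
    and hodge_frob: "\<sigma> \<in> real_embeddings \<Longrightarrow>
      frobC M \<sigma> ` hodge_type M \<sigma> p q = hodge_type M \<sigma> q p"
    and hodge_rank: "\<sigma> \<in> real_embeddings \<Longrightarrow>
      has_rank (submod (bettiC M \<sigma>) (hodge_type M \<sigma> p q)) (hodge_number M p q)"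
    and hodge_pure: "\<exists>w. \<forall>\<sigma>\<in>real_embeddings. \<forall>p q. p + q \<noteq> w \<longrightarrow>
      hodge_type M \<sigma> p q = {\<zero>\<^bsub>bettiC M \<sigma>\<^esub>}"
    and fil_hodge: "\<sigma> \<in> real_embeddings \<Longrightarrow>
      comparison M \<sigma> ` LinearCombinations.module.span class_ring (bettiC M \<sigma>) (\<Union>r\<in>{p..}. \<Union>q. hodge_type M \<sigma> r q) =
      LinearCombinations.module.span class_ring (derhamC M \<sigma>) {dclass \<sigma> (derham M) [(h, 1)] | h. h \<in> hodge_fil M p}"


section \<open>Critical motives and periods\<close>

definition betti_eigen :: "('e::field_char_0, 'f::field_char_0, 'b, 'd) realizations \<Rightarrow>
    ('f \<Rightarrow> complex) \<Rightarrow> int \<Rightarrow> ('e, 'b) module" where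
  "betti_eigen M \<sigma> s =
     submod (betti M \<sigma>) {v \<in> carrier (betti M \<sigma>). frob M \<sigma> v = of_int s \<odot>\<^bsub>betti M \<sigma>\<^esub> v}"

abbreviation derham_quot where
  "derham_quot M p \<equiv> quot_mod (derham M) (hodge_fil M p)"

text \<open>
  For \<open>s = \<plusminus>1\<close> the filtration step \<open>F\<^sup>p\<close> is the one denoted by \<open>F\<^sup>\<mp>\<close>.
\<close>

definition critical :: "('e::field_char_0, 'f::field_char_0, 'b, 'd) realizations \<Rightarrow> bool" where
  "critical M \<longleftrightarrow> (\<forall>s\<in>{1, -1}. \<exists>p. \<forall>\<sigma>\<in>real_embeddings. \<exists>n.
     has_rank (betti_eigen M \<sigma> s) n \<and> has_rank (derham_quot M p) n)"

text \<open>
  \<open>H\<^sub>B(\<sigma>,M) \<otimes> \<complex> \<rightarrow> (H\<^sub>D\<^sub>R(M) / F\<^sup>p) \<otimes>\<^bsub>\<FF>,\<sigma>\<^esub> \<complex>\<close>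
\<close>

definition period_map :: "('e::field_char_0, 'f::field_char_0, 'b, 'd) realizations \<Rightarrow>
    ('f \<Rightarrow> complex) \<Rightarrow> int \<Rightarrow> ('b \<times> complex) list set \<Rightarrow> ('d set \<times> complex) list set" where
  "period_map M \<sigma> p X = dclass \<sigma> (derham_quot M p)
     (map (\<lambda>(h, z). (hodge_fil M p +>\<^bsub>derham M\<^esub> h, z)) (trep (comparison M \<sigma> X)))"

text \<open>
  The set of all values of the period \<open>c\<^sup>s(\<sigma>,M)\<close>, \<open>s = \<plusminus>1\<close>, for the various choices of an
  \<open>\<EE>\<close>-basis of \<open>H\<^sub>B\<^sup>s(\<sigma>,M)\<close> and an \<open>\<EE> \<otimes> \<FF>\<close>-basis of \<open>H\<^sub>D\<^sub>R(M) / F\<^sup>\<mp>\<close>. For \<open>\<FF> = \<rat>\<close> these are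
  the periods of Deligne.
\<close>

definition periods :: "('e::field_char_0, 'f::field_char_0, 'b, 'd) realizations \<Rightarrow>
    ('f \<Rightarrow> complex) \<Rightarrow> int \<Rightarrow> ('e, complex) qtensor set" where
  "periods M \<sigma> s = {det A | A n p bs ws.
     is_basis (betti_eigen M \<sigma> s) bs \<and> is_basis (derham_quot M p) ws \<and>
     length bs = n \<and> length ws = n \<and> A \<in> carrier_mat n n \<and>
     (\<forall>j<n. period_map M \<sigma> p (bclass (betti M \<sigma>) [(bs ! j, 1)]) =
        (\<Oplus>\<^bsub>derham_ext \<sigma> (derham_quot M p)\<^esub>i\<in>{..<n}.
           A $$ (i, j) \<odot>\<^bsub>derham_ext \<sigma> (derham_quot M p)\<^esub> dclass \<sigma> (derham_quot M p) [(ws ! i, 1)]))}"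

definition middle_sign :: "('e::field_char_0, 'f::field_char_0, 'b, 'd) realizations \<Rightarrow>
    ('f \<Rightarrow> complex) \<Rightarrow> int" where
  "middle_sign M \<sigma> = (THE k. \<exists>p. hodge_number M p p \<noteq> 0 \<and>
     (\<forall>x\<in>hodge_type M \<sigma> p p. frobC M \<sigma> x = of_int k \<odot>\<^bsub>bettiC M \<sigma>\<^esub> x))"


section \<open>Tensor product and restriction of scalars\<close>

definition tensor_motive :: "('e::field_char_0, 'f::field_char_0, 'b, 'd) realizations \<Rightarrow>
    ('e, 'f, 'b2, 'd2) realizations \<Rightarrow>
    ('e, 'f, ('b \<times> 'b2) list set, ('d \<times> 'd2) list set) realizations" where
  "tensor_motive M M' = (let
     B = (\<lambda>\<sigma>. tensor (betti M \<sigma>) (betti M' \<sigma>));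
     D = tensor (derham M) (derham M');
     bt = (\<lambda>\<sigma> v v'. tclass (betti M \<sigma>) (betti M' \<sigma>) [(v, v')]);
     dt = (\<lambda>h h'. tclass (derham M) (derham M') [(h, h')])
   in \<lparr>betti = B,
     frob = (\<lambda>\<sigma> X. tclass (betti M \<sigma>) (betti M' \<sigma>)
       (map (\<lambda>(v, v'). (frob M \<sigma> v, frob M' \<sigma> v')) (trep X))),
     derham = D,
     hodge_fil = (\<lambda>n. LinearCombinations.module.span class_ring D
       {dt h h' | h h' p q. p + q = n \<and> h \<in> hodge_fil M p \<and> h' \<in> hodge_fil M' q}),
     comparison = (\<lambda>\<sigma> X. dclass \<sigma> D
       [(dt h h', c * z * z').
          (Y, c) \<leftarrow> trep X, (v, v') \<leftarrow> trep Y,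
          (h, z) \<leftarrow> trep (comparison M \<sigma> (bclass (betti M \<sigma>) [(v, 1)])),
          (h', z') \<leftarrow> trep (comparison M' \<sigma> (bclass (betti M' \<sigma>) [(v', 1)]))]),
     hodge_type = (\<lambda>\<sigma> p q. LinearCombinations.module.span class_ring (betti_ext (B \<sigma>))
       {bclass (B \<sigma>) [(bt \<sigma> v v', z * z'). (v, z) \<leftarrow> trep x, (v', z') \<leftarrow> trep x'] | x x' a b a' b'.
          a + a' = p \<and> b + b' = q \<and> x \<in> hodge_type M \<sigma> a b \<and> x' \<in> hodge_type M' \<sigma> a' b'})\<rparr>)"

text \<open>
  \<open>R\<^bsub>\<FF>|\<rat>\<^esub>(M)\<close>, whose Betti realization is \<open>\<Oplus>\<^sub>\<sigma> H\<^sub>B(\<sigma>,M)\<close> and whose comparison map is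
  \<open>\<Oplus>\<^sub>\<sigma> I\<^sub>\<sigma>\<close> under \<open>H\<^sub>D\<^sub>R \<otimes>\<^sub>\<rat> \<complex> = \<Oplus>\<^sub>\<sigma> H\<^sub>D\<^sub>R \<otimes>\<^bsub>\<FF>,\<sigma>\<^esub> \<complex>\<close>: a class over \<open>\<rat>\<close> is sent to the classes over
  \<open>(\<FF>,\<sigma>)\<close> of the same formal sum. The argument \<open>\<tau>\<close> below can only be the embedding \<open>of_rat\<close>.
\<close>

definition betti_sum :: "('e::field_char_0, 'f::field_char_0, 'b, 'd) realizations \<Rightarrow>
    ('e, ('f \<Rightarrow> complex) \<Rightarrow> 'b) module" where
  "betti_sum M = \<lparr>carrier = (\<Pi>\<^sub>E \<sigma>\<in>real_embeddings. carrier (betti M \<sigma>)),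
     mult = undefined, one = undefined,
     zero = (\<lambda>\<sigma>\<in>real_embeddings. \<zero>\<^bsub>betti M \<sigma>\<^esub>),
     add = (\<lambda>x y. \<lambda>\<sigma>\<in>real_embeddings. x \<sigma> \<oplus>\<^bsub>betti M \<sigma>\<^esub> y \<sigma>),
     smult = (\<lambda>e x. \<lambda>\<sigma>\<in>real_embeddings. e \<odot>\<^bsub>betti M \<sigma>\<^esub> x \<sigma>)\<rparr>"

definition restriction :: "('e::field_char_0, 'f::field_char_0, 'b, 'd) realizations \<Rightarrow>
    ('e, rat, ('f \<Rightarrow> complex) \<Rightarrow> 'b, 'd) realizations" where
  "restriction M = (let
     D = restrict_scalars (map_right (of_rat :: rat \<Rightarrow> 'f)) (derham M);
     comp = (\<lambda>\<sigma> X. bclass (betti M \<sigma>) (map (\<lambda>(x, z). (x \<sigma>, z)) (trep X)))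
   in \<lparr>betti = (\<lambda>\<tau>. betti_sum M),
     frob = (\<lambda>\<tau> x. \<lambda>\<sigma>\<in>real_embeddings. frob M \<sigma> (x \<sigma>)),
     derham = D,
     hodge_fil = hodge_fil M,
     comparison = (\<lambda>\<tau> X. THE Y. Y \<in> carrier (derham_ext \<tau> D) \<and>
       (\<forall>\<sigma>\<in>real_embeddings. dclass \<sigma> (derham M) (trep Y) = comparison M \<sigma> (comp \<sigma> X))),
     hodge_type = (\<lambda>\<tau> p q. {X \<in> carrier (betti_ext (betti_sum M)).
       \<forall>\<sigma>\<in>real_embeddings. comp \<sigma> X \<in> hodge_type M \<sigma> p q})\<rparr>)"

end

theory Submission
  imports Defs "Jordan_Normal_Form.Char_Poly" "HOL-Computational_Algebra.Fundamental_Theorem_Algebra"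
    "HOL-Computational_Algebra.Field_as_Ring"
begin

text \<open>
  If the Hodge numbers of \<open>M\<close> are at most one and its rank is even, no Hodge type is fixed by complex
  conjugation, so the middle step of \<open>H\<^sub>D\<^sub>R(M) \<otimes> \<complex>\<close> is the graph of an isomorphism
  \<open>H\<^sub>B\<^sup>+ \<otimes> \<complex> \<rightarrow> H\<^sub>B\<^sup>- \<otimes> \<complex>\<close>, whose determinant in rational bases is \<open>c\<^sup>+/c\<^sup>-\<close>. Up to signs on the Hodge types,
  tensoring this isomorphism with a rational basis of \<open>H\<^sub>B(\<sigma>,M')\<close> consisting of eigenvectors of \<open>\<rho>\<^sub>\<sigma>\<close> gives the
  isomorphism that belongs to \<open>M \<otimes> M'\<close>: it is block diagonal, with one block for each eigenvector, inverted
  where \<open>\<rho>\<^sub>\<sigma>\<close> acts by \<open>-1\<close>. As the trace of \<open>\<rho>\<^sub>\<sigma>\<close> on \<open>H\<^sub>B(\<sigma>,M')\<close> is \<open>\<epsilon>(\<sigma>,M')\<close>, the determinant is the power in (i).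
  After restriction of scalars the isomorphism is the direct sum over \<open>\<sigma>\<close>, by means of the idempotents of \<open>\<FF> \<otimes> \<complex>\<close>.
\<close>


text \<open>The coefficients lie in \<EE> \<otimes> \<complex>, in general not a field, so ranks,
  inverses and independence are read off from determinants and from pairs of mutually inverse
  matrices. Two further points shape the proof. Comparison maps and tensor products are computed on
  chosen representatives of classes, and no isomorphism between the extension of a tensor product
  and the tensor product of the extensions is built: H_DR is seen only through functionals with
  values in \<EE> \<otimes> \<complex>, which turn each construction into a finite sum. And the step
  of the filtration of M \<otimes> M' that matters is not made of the upper types of M: a type (q,
  q') may lie in it although q lies below the middle, or outside it although q lies above. This is
  harmless, because an isomorphism that agrees with the graph only up to a sign on each Hodge type
  still has the right determinant up to a sign (\<open>adet_ratio\<close>); so the sign may be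
  prescribed by q alone, and the isomorphism of M can be reused for every basis vector of
  M'.\<close>

section \<open>Determinants of matrices indexed by finite sets\<close>

definition enum :: "'i set => nat => 'i" where
 "enum I = (SOME h. bij_betw h {..<card I} I)"

lemma bij_enum: "finite I ==> bij_betw (enum I) {..<card I} I"
 unfolding enum_def using ex_bij_betw_nat_finite[of I]
 by (metis lessThan_atLeast0 someI_ex)

lemma enum_in: "finite I ==> i < card I ==> enum I i \<in> I"
 using bij_enum[of I] by (auto simp: bij_betw_def)

text \<open>Rows and columns are numbered by the same enumeration, so the value does not depend on
  it (\<open>gdet_enum\<close>). This allows bases of tensor products and direct sums to keep their
  natural index sets.\<close>

definition gdet :: "'i set => ('i => 'i => 'r::comm_ring_1) => 'r" where
 "gdet I a = det (mat (card I) (card I) (%(i, j). a (enum I i) (enum I j)))"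

lemma mat_product:
 fixes a :: "'i => 'j => 'r::comm_ring_1"
 assumes "bij_betw h {..<l} J"
 shows "mat n l (%(i, j). a (f i) (h j)) * mat l m (%(i, j). b (h i) (g j)) =
  mat n m (%(i, j). \<Sum>k\<in>J. a (f i) k * b k (g j))"
proof (rule eq_matI)
 fix i j assume "i < dim_row (mat n m (%(i, j). \<Sum>k\<in>J. a (f i) k * b k (g j)))"
  "j < dim_col (mat n m (%(i, j). \<Sum>k\<in>J. a (f i) k * b k (g j)))"
 then have ij: "i < n" "j < m" by auto
 then show "(mat n l (%(i, j). a (f i) (h j)) * mat l m (%(i, j). b (h i) (g j))) $$ (i, j) =
  mat n m (%(i, j). \<Sum>k\<in>J. a (f i) k * b k (g j)) $$ (i, j)"
  using sum.reindex_bij_betw[OF assms, of "%k. a (f i) k * b k (g j)"]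
  by (simp add: scalar_prod_def lessThan_atLeast0)
qed auto

text \<open>Multiplicativity of \<open>det\<close> when the inner index runs through a set without
  an order. Every identity between periods below is an entrywise sum over basis vectors or Hodge
  types, turned into a product of determinants by this lemma.\<close>

lemma det_product_enum:
 fixes a b :: "nat => 'i => 'r::comm_ring_1"
 assumes "bij_betw h {..<n} J"
 shows "det (mat n n (%(i, j). \<Sum>k\<in>J. a i k * b j k)) =
  det (mat n n (%(i, j). a i (h j))) * det (mat n n (%(i, j). b j (h i)))"
proof -
 have "mat n n (%(i, j). a i (h j)) * mat n n (%(i, j). b j (h i)) =
   mat n n (%(i, j). \<Sum>k\<in>J. a i k * b j k)"
  using mat_product[OF assms, of n a id n "%k j. b j k" id] by simp
 from arg_cong[OF this, of det] show ?thesis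
  by (subst (asm) det_mult[OF mat_carrier mat_carrier]) simp
qed

text \<open>Comparison of ranks over any commutative ring. If \<open>J\<close> were smaller, padding
  both factors with zeros to square matrices would keep their product equal to 1 but give the second
  factor a zero row, hence determinant 0.\<close>

lemma left_inverse_card_le:
 fixes a :: "'i => 'j => 'r::comm_ring_1"
 assumes "finite I" "finite J"
  and 1: "!!i k. i \<in> I ==> k \<in> I ==> (\<Sum>j\<in>J. a i j * b j k) = (if i = k then 1 else 0)"
 shows "card I \<le> card J"
proof (rule ccontr)
 assume "\<not> card I \<le> card J"
 define n where "n = card I"
 define h where "h = enum I"
 define g where "g = enum J"
 define A where "A = mat n n (%(i, j). if j < card J then a (h i) (g j) else 0)"
 define B where "B = mat n n (%(j, k). if j < card J then b (g j) (h k) else 0)"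
 have lt: "card J < n" using \<open>\<not> card I \<le> card J\<close> by (simp add: n_def)
 have h: "bij_betw h {..<n} I" unfolding h_def n_def by (rule bij_enum) fact
 have g: "bij_betw g {..<card J} J" unfolding g_def by (rule bij_enum) fact
 have hI: "h i \<in> I" if "i < n" for i using h that by (auto simp: bij_betw_def)
 have inj: "h i = h j \<longleftrightarrow> i = j" if "i < n" "j < n" for i j
  using h that by (auto simp: bij_betw_def inj_on_def)
 have "A * B = 1\<^sub>m n"
 proof (rule eq_matI)
  fix i k assume ik: "i < dim_row (1\<^sub>m n :: 'r mat)" "k < dim_col (1\<^sub>m n :: 'r mat)"
  have "(A * B) $$ (i, k) = (\<Sum>j<n. (if j < card J then a (h i) (g j) * b (g j) (h k) else 0))"
   using ik by (simp add: A_def B_def scalar_prod_def lessThan_atLeast0) (rule sum.cong, auto)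
  also have "\<dots> = (\<Sum>j<card J. a (h i) (g j) * b (g j) (h k))"
   using lt by (intro sum.mono_neutral_cong_right) auto
  also have "\<dots> = (\<Sum>j\<in>J. a (h i) j * b j (h k))"
   by (rule sum.reindex_bij_betw[OF g, of "%j. a (h i) j * b j (h k)"])
  also have "\<dots> = (if h i = h k then 1 else 0)" using ik hI by (intro 1) auto
  also have "\<dots> = 1\<^sub>m n $$ (i, k)" using ik by (simp add: inj)
  finally show "(A * B) $$ (i, k) = 1\<^sub>m n $$ (i, k)" .
 qed (auto simp: A_def B_def)
 moreover have "det B = 0"
 proof -
  have "det B = (\<Sum>p | p permutes {0..<n}. signof p * (\<Prod>i = 0..<n. B $$ (i, p i)))"
   by (subst det_def') (auto simp: B_def)
  also have "\<dots> = 0"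
  proof (rule sum.neutral, safe)
   fix p assume p: "p permutes {0..<n}"
   \<comment> \<open>Row \<open>card J\<close> is the first row of padding, so every term of the
     Leibniz formula has a zero factor.\<close>
   have "B $$ (card J, p (card J)) = 0" using lt permutes_in_image[OF p, of "card J"] by (simp add: B_def)
   then have "(\<Prod>i = 0..<n. B $$ (i, p i)) = 0" using lt by (intro prod_zero) auto
   then show "signof p * (\<Prod>i = 0..<n. B $$ (i, p i)) = 0" by simp
  qed
  finally show ?thesis .
 qed
 moreover have "det (A * B) = det A * det B" by (rule det_mult) (auto simp: A_def B_def)
 ultimately show False by simp
qed

text \<open>The Kronecker matrices \<open>P\<close> and \<open>Q\<close> pass from one enumeration
  to the other and back, so the two matrices are conjugate.\<close>

lemma gdet_enum:
 fixes a :: "'i => 'i => 'r::comm_ring_1"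
 assumes h: "bij_betw h {..<n} I"
 shows "gdet I a = det (mat n n (%(i, j). a (h i) (h j)))"
proof -
 have fin: "finite I" and n: "card I = n" using h bij_betw_finite bij_betw_same_card by fastforce+
 define g where "g = enum I"
 have g: "bij_betw g {..<n} I" using bij_enum[OF fin] by (simp add: n g_def)
 define d :: "'i => 'i => 'r" where "d = (%i j. if i = j then 1 else 0)"
 define P where "P = mat n n (%(i, j). d (h i) (g j))"
 define Q where "Q = mat n n (%(i, j). d (g i) (h j))"
 define A where "A = mat n n (%(i, j). a (g i) (g j))"
 have c: "P \<in> carrier_mat n n" "Q \<in> carrier_mat n n" "A \<in> carrier_mat n n"
  by (auto simp: P_def Q_def A_def)
 have sd: "(\<Sum>k\<in>I. d i k * f k) = f i" "(\<Sum>k\<in>I. f k * d k i) = f i" if "i \<in> I" for f i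
  using fin that by (simp_all add: d_def if_distrib[of "%x. x * _"] if_distrib[of "%x. _ * x"] cong: if_cong)
 have inj: "h i = h j \<longleftrightarrow> i = j" if "i < n" "j < n" for i j
  using h that by (auto simp: bij_betw_def inj_on_def)
 have hI: "h i \<in> I" "g i \<in> I" if "i < n" for i using h g that by (auto simp: bij_betw_def)
 have "P * Q = 1\<^sub>m n"
 proof (rule eq_matI)
  fix i j assume "i < dim_row (1\<^sub>m n :: 'r mat)" "j < dim_col (1\<^sub>m n :: 'r mat)"
  then show "(P * Q) $$ (i, j) = 1\<^sub>m n $$ (i, j)"
   unfolding P_def Q_def mat_product[OF g]
   by (simp add: sd hI) (simp add: d_def inj)
 qed (auto simp: P_def Q_def)
 then have PQ: "det P * det Q = 1" using det_mult[OF c(1,2)] by simp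
 have "P * A * Q = mat n n (%(i, j). a (h i) (h j))"
  unfolding P_def Q_def A_def mat_product[OF g] mat_product[OF g, of n "%i j. \<Sum>k\<in>I. d i k * a k j" h n d h]
  by (auto simp: sd hI intro!: eq_matI)
 then have "det (mat n n (%(i, j). a (h i) (h j))) = det (P * A) * det Q"
  using det_mult[OF mult_carrier_mat[OF c(1,3)] c(2)] by simp
 also have "\<dots> = det A * (det P * det Q)" using det_mult[OF c(1,3)] by (simp add: ac_simps)
 finally show ?thesis using PQ by (simp add: gdet_def A_def g_def n)
qed

lemma gdet_cong:
 assumes "!!i j. i \<in> I ==> j \<in> I ==> a i j = b i j" "finite I"
 shows "gdet I a = gdet I b"
 unfolding gdet_def using assms enum_in by (intro arg_cong[where f = det] eq_matI) auto

lemma gdet_mult: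
 fixes a b :: "'i => 'i => 'r::comm_ring_1"
 assumes "finite I"
 shows "gdet I (%i j. \<Sum>k\<in>I. a i k * b k j) = gdet I a * gdet I b"
proof -
 have "mat (card I) (card I) (%(i, j). a (enum I i) (enum I j)) *
   mat (card I) (card I) (%(i, j). b (enum I i) (enum I j)) =
   mat (card I) (card I) (%(i, j). \<Sum>k\<in>I. a (enum I i) k * b k (enum I j))"
  by (rule mat_product[OF bij_enum[OF assms]])
 from arg_cong[OF this, of det] show ?thesis unfolding gdet_def
  by (subst (asm) det_mult[OF mat_carrier mat_carrier]) simp
qed

lemma gdet_one:
 assumes "finite I"
 shows "gdet I (%i j. if i = j then 1 else 0 :: 'r::comm_ring_1) = 1"
proof -
 have "mat (card I) (card I) (%(i, j). if enum I i = enum I j then 1 else 0 :: 'r) = 1\<^sub>m (card I)"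
  using bij_enum[OF assms] by (auto simp: bij_betw_def inj_on_def intro!: eq_matI)
 then show ?thesis by (simp add: gdet_def)
qed

lemma gdet_reindex:
 assumes "bij_betw f I J" "finite I"
 shows "gdet J a = gdet I (%i j. a (f i) (f j))"
 using gdet_enum[OF bij_betw_trans[OF bij_enum[OF assms(2)] assms(1)], of a]
 by (simp add: gdet_def)

lemma gdet_insert:
 fixes a :: "'i => 'i => 'r::comm_ring_1"
 assumes fin: "finite I" and x: "x \<notin> I" and xx: "a x x = 1"
  and 0: "!!i. i \<in> I ==> a i x = 0" "!!i. i \<in> I ==> a x i = 0"
 shows "gdet (insert x I) a = gdet I a"
proof -
 define n where "n = card I"
 define h where "h = (%i. if i < n then enum I i else x)"
 have "bij_betw h {..<n} I"
  using bij_enum[OF fin] bij_betw_cong[of "{..<n}" h "enum I" I] by (simp add: h_def n_def)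
 moreover have "h n = x" by (simp add: h_def)
 ultimately have h: "bij_betw h {..<Suc n} (insert x I)" and hI: "bij_betw h {..<n} I"
  using x by (auto simp: lessThan_Suc bij_betw_def)
 have hx: "h n = x" by (simp add: h_def)
 have I: "h i \<in> I" if "i < n" for i using hI that by (auto simp: bij_betw_def)
 have *: "mat (Suc n) (Suc n) (%(i, j). a (h i) (h j)) =
   four_block_mat (mat n n (%(i, j). a (h i) (h j))) (0\<^sub>m n 1) (0\<^sub>m 1 n) (1\<^sub>m 1)"
  by (rule eq_matI) (auto simp: less_Suc_eq hx xx 0 I)
 show ?thesis
  unfolding gdet_enum[OF h] gdet_enum[OF hI] *
  by (subst det_four_block_mat_upper_right_zero_col) auto
qed

lemma gdet_extend:
 fixes a :: "'i => 'i => 'r::comm_ring_1"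
 assumes "finite J" "finite I" "I \<inter> J = {}"
 shows "gdet (I \<union> J) (%i j. if i \<in> I \<and> j \<in> I then a i j else if i = j then 1 else 0) = gdet I a"
 using assms
proof (induction J)
 case empty
 then show ?case by (auto intro!: gdet_cong)
next
 case (insert x J)
 let ?b = "%i j. if i \<in> I \<and> j \<in> I then a i j else if i = j then 1 else 0"
 have "gdet (insert x (I \<union> J)) ?b = gdet (I \<union> J) ?b"
  by (rule gdet_insert) (use insert in auto)
 then show ?case using insert by simp
qed

text \<open>The matrix is the product of its two blocks, each completed by an identity on the other
  index set; \<open>gdet_mult\<close> and \<open>gdet_extend\<close> do the rest.\<close>

lemma gdet_block:
 fixes a :: "'i => 'i => 'r::comm_ring_1"
 assumes fin: "finite I" "finite J" and IJ: "I \<inter> J = {}"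
  and 0: "!!i j. i \<in> I ==> j \<in> J ==> a i j = 0" "!!i j. i \<in> I ==> j \<in> J ==> a j i = 0"
 shows "gdet (I \<union> J) a = gdet I a * gdet J a"
proof -
 define b where "b K = (%i j. if i \<in> K \<and> j \<in> K then a i j else if i = j then 1 else 0)" for K
 have "(\<Sum>k\<in>I \<union> J. b I i k * b J k j) = a i j" if "i \<in> I \<union> J" "j \<in> I \<union> J" for i j
 proof (cases "i \<in> I")
  case True
  then have "(\<Sum>k\<in>I \<union> J. b I i k * b J k j) = (\<Sum>k\<in>I \<union> J. if k = j then a i j else 0)"
   using IJ that 0 by (intro sum.cong) (auto simp: b_def)
  then show ?thesis using fin that by simp
 next
  case False
  then have "(\<Sum>k\<in>I \<union> J. b I i k * b J k j) = (\<Sum>k\<in>I \<union> J. if k = i then a i j else 0)"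
   using IJ that 0 by (intro sum.cong) (auto simp: b_def)
  then show ?thesis using fin that by simp
 qed
 then have "gdet (I \<union> J) a = gdet (I \<union> J) (%i j. \<Sum>k\<in>I \<union> J. b I i k * b J k j)"
  using fin by (intro gdet_cong) auto
 also have "\<dots> = gdet (I \<union> J) (b I) * gdet (I \<union> J) (b J)" using fin by (intro gdet_mult) auto
 also have "gdet (I \<union> J) (b I) = gdet I a" unfolding b_def using fin IJ by (intro gdet_extend)
 also have "gdet (I \<union> J) (b J) = gdet J a"
  unfolding b_def using fin IJ gdet_extend[of I J a] by (simp add: Un_commute Int_commute)
 finally show ?thesis .
qed

lemma gdet_Sigma:
 fixes a :: "'s \<times> 'i => 's \<times> 'i => 'r::comm_ring_1"
 assumes "finite S" "!!s. s \<in> S ==> finite (I s)"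
  and "!!s t i j. s \<in> S ==> t \<in> S ==> i \<in> I s ==> j \<in> I t ==> s \<noteq> t ==> a (s, i) (t, j) = 0"
 shows "gdet (Sigma S I) a = (\<Prod>s\<in>S. gdet (I s) (%i j. a (s, i) (s, j)))"
 using assms
proof (induction S)
 case empty
 show ?case using gdet_one[of "{}::('s \<times> 'i) set"] by (simp add: gdet_def)
next
 case (insert s S)
 have S: "Sigma (insert s S) I = ({s} \<times> I s) \<union> Sigma S I" by auto
 have "gdet (Sigma (insert s S) I) a = gdet ({s} \<times> I s) a * gdet (Sigma S I) a"
  unfolding S
 proof (rule gdet_block)
  fix i j assume "i \<in> {s} \<times> I s" "j \<in> Sigma S I"
  then obtain k t l where ij: "i = (s, k)" "j = (t, l)" "k \<in> I s" "t \<in> S" "l \<in> I t" by auto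
  then have "s \<noteq> t" using insert.hyps by auto
  with ij show "a i j = 0" "a j i = 0" by (auto intro!: insert.prems(2))
 qed (use insert in auto)
 also have "gdet ({s} \<times> I s) a = gdet (I s) (%i j. a (s, i) (s, j))"
  using insert.prems by (intro gdet_reindex) (auto simp: bij_betw_def inj_on_def)
 also have "gdet (Sigma S I) a = (\<Prod>s\<in>S. gdet (I s) (%i j. a (s, i) (s, j)))"
  using insert.prems by (intro insert.IH) auto
 finally show ?case using insert.hyps by simp
qed

section \<open>Modules over a commutative ring and semilinear functionals\<close>

abbreviation cmod :: "('r::comm_ring_1, 'a) module => bool" where
 "cmod M \<equiv> Module.module class_ring M"

lemma cmodI:
 fixes M :: "('r::comm_ring_1, 'a) module"
 assumes "!!x y. x \<in> carrier M ==> y \<in> carrier M ==> x \<oplus>\<^bsub>M\<^esub> y \<in> carrier M"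
  and "\<zero>\<^bsub>M\<^esub> \<in> carrier M"
  and "!!x y z. x \<in> carrier M ==> y \<in> carrier M ==> z \<in> carrier M ==>
   (x \<oplus>\<^bsub>M\<^esub> y) \<oplus>\<^bsub>M\<^esub> z = x \<oplus>\<^bsub>M\<^esub> (y \<oplus>\<^bsub>M\<^esub> z)"
  and "!!x y. x \<in> carrier M ==> y \<in> carrier M ==> x \<oplus>\<^bsub>M\<^esub> y = y \<oplus>\<^bsub>M\<^esub> x"
  and "!!x. x \<in> carrier M ==> \<zero>\<^bsub>M\<^esub> \<oplus>\<^bsub>M\<^esub> x = x"
  and "!!x. x \<in> carrier M ==> \<exists>y\<in>carrier M. y \<oplus>\<^bsub>M\<^esub> x = \<zero>\<^bsub>M\<^esub>"
  and "!!r x. x \<in> carrier M ==> r \<odot>\<^bsub>M\<^esub> x \<in> carrier M"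
  and "!!r s x. x \<in> carrier M ==> (r + s) \<odot>\<^bsub>M\<^esub> x = r \<odot>\<^bsub>M\<^esub> x \<oplus>\<^bsub>M\<^esub> s \<odot>\<^bsub>M\<^esub> x"
  and "!!r x y. x \<in> carrier M ==> y \<in> carrier M ==>
   r \<odot>\<^bsub>M\<^esub> (x \<oplus>\<^bsub>M\<^esub> y) = r \<odot>\<^bsub>M\<^esub> x \<oplus>\<^bsub>M\<^esub> r \<odot>\<^bsub>M\<^esub> y"
  and "!!r s x. x \<in> carrier M ==> (r * s) \<odot>\<^bsub>M\<^esub> x = r \<odot>\<^bsub>M\<^esub> (s \<odot>\<^bsub>M\<^esub> x)"
  and "!!x. x \<in> carrier M ==> 1 \<odot>\<^bsub>M\<^esub> x = x"
 shows "cmod M"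
 by (rule moduleI[OF class_cring.is_cring], rule abelian_groupI) (use assms in auto)

lemma cmodD:
 fixes M :: "('r::comm_ring_1, 'a) module"
 assumes "cmod M"
 shows cmod_smult_closed: "!!r x. x \<in> carrier M ==> r \<odot>\<^bsub>M\<^esub> x \<in> carrier M"
  and cmod_add_smult: "!!r s x. x \<in> carrier M ==> (r + s) \<odot>\<^bsub>M\<^esub> x = r \<odot>\<^bsub>M\<^esub> x \<oplus>\<^bsub>M\<^esub> s \<odot>\<^bsub>M\<^esub> x"
  and cmod_smult_add: "!!r x y. x \<in> carrier M ==> y \<in> carrier M ==>
   r \<odot>\<^bsub>M\<^esub> (x \<oplus>\<^bsub>M\<^esub> y) = r \<odot>\<^bsub>M\<^esub> x \<oplus>\<^bsub>M\<^esub> r \<odot>\<^bsub>M\<^esub> y"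
  and cmod_mult_smult: "!!r s x. x \<in> carrier M ==> (r * s) \<odot>\<^bsub>M\<^esub> x = r \<odot>\<^bsub>M\<^esub> (s \<odot>\<^bsub>M\<^esub> x)"
  and cmod_one_smult: "!!x. x \<in> carrier M ==> 1 \<odot>\<^bsub>M\<^esub> x = x"
  and cmod_zero_smult: "!!x. x \<in> carrier M ==> 0 \<odot>\<^bsub>M\<^esub> x = \<zero>\<^bsub>M\<^esub>"
  and cmod_smult_zero: "!!r. r \<odot>\<^bsub>M\<^esub> \<zero>\<^bsub>M\<^esub> = \<zero>\<^bsub>M\<^esub>"
  and cmod_add_closed: "!!x y. x \<in> carrier M ==> y \<in> carrier M ==> x \<oplus>\<^bsub>M\<^esub> y \<in> carrier M"
  and cmod_zero_closed: "\<zero>\<^bsub>M\<^esub> \<in> carrier M"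
  and cmod_abelian_group: "abelian_group M"
  and cmod_minus_smult: "!!x. x \<in> carrier M ==> (- 1) \<odot>\<^bsub>M\<^esub> x = \<ominus>\<^bsub>M\<^esub> x"
proof -
 interpret Module.module class_ring M by fact
 show "x \<in> carrier M ==> r \<odot>\<^bsub>M\<^esub> x \<in> carrier M"
  "x \<in> carrier M ==> (r + s) \<odot>\<^bsub>M\<^esub> x = r \<odot>\<^bsub>M\<^esub> x \<oplus>\<^bsub>M\<^esub> s \<odot>\<^bsub>M\<^esub> x"
  "x \<in> carrier M ==> y \<in> carrier M ==> r \<odot>\<^bsub>M\<^esub> (x \<oplus>\<^bsub>M\<^esub> y) = r \<odot>\<^bsub>M\<^esub> x \<oplus>\<^bsub>M\<^esub> r \<odot>\<^bsub>M\<^esub> y"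
  "x \<in> carrier M ==> (r * s) \<odot>\<^bsub>M\<^esub> x = r \<odot>\<^bsub>M\<^esub> (s \<odot>\<^bsub>M\<^esub> x)"
  "x \<in> carrier M ==> 1 \<odot>\<^bsub>M\<^esub> x = x"
  "x \<in> carrier M ==> 0 \<odot>\<^bsub>M\<^esub> x = \<zero>\<^bsub>M\<^esub>"
  "r \<odot>\<^bsub>M\<^esub> \<zero>\<^bsub>M\<^esub> = \<zero>\<^bsub>M\<^esub>"
  "x \<in> carrier M ==> y \<in> carrier M ==> x \<oplus>\<^bsub>M\<^esub> y \<in> carrier M"
  "\<zero>\<^bsub>M\<^esub> \<in> carrier M" for r s x y
  using smult_closed[of r x] smult_l_distr[of r s x] smult_r_distr[of r x y]
   smult_assoc1[of r s x] smult_one[of x] smult_l_null[of x] smult_r_null[of r]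
  by auto
 show "abelian_group M" ..
 show "x \<in> carrier M ==> (- 1) \<odot>\<^bsub>M\<^esub> x = \<ominus>\<^bsub>M\<^esub> x" for x
  using smult_l_minus[of 1 x] smult_one[of x] by (simp add: class_ring_simps)
qed

lemma cmod_field_mod:
 fixes \<sigma> :: "'r::comm_ring_1 => 'a::comm_ring_1"
 assumes "comm_ring_hom \<sigma>"
 shows "cmod (field_mod \<sigma>)"
proof -
 interpret comm_ring_hom \<sigma> by fact
 show ?thesis
  by (rule cmodI) (auto simp: hom_add hom_mult algebra_simps intro: exI[of _ "- _"])
qed

lemma cmod_restrict_scalars:
 fixes \<kappa> :: "'r::comm_ring_1 => 's::comm_ring_1"
 assumes "comm_ring_hom \<kappa>" "cmod M"
 shows "cmod (restrict_scalars \<kappa> M)"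
proof -
 interpret comm_ring_hom \<kappa> by fact
 interpret M: Module.module class_ring M by fact
 note D = cmodD[OF assms(2)]
 show ?thesis
  by (rule cmodI)
   (auto simp: restrict_scalars_def hom_add hom_mult D(1-9) M.a_ac intro: bexI[of _ "\<ominus>\<^bsub>M\<^esub> _"] M.l_neg)
qed

lemma restrict_scalars_simps [simp]:
 "carrier (restrict_scalars \<kappa> M) = carrier M" "zero (restrict_scalars \<kappa> M) = zero M"
 "add (restrict_scalars \<kappa> M) = add M" "Module.module.smult (restrict_scalars \<kappa> M) = (%r. Module.module.smult M (\<kappa> r))"
 by (simp_all add: restrict_scalars_def)

lemma submod_simps [simp]:
 "carrier (submod M N) = N" "zero (submod M N) = zero M"
 "add (submod M N) = add M" "Module.module.smult (submod M N) = Module.module.smult M"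
 by (simp_all add: submod_def)

lemma cmod_submod:
 fixes M :: "('r::comm_ring_1, 'a) module"
 assumes "cmod M" and sub: "N \<subseteq> carrier M" "\<zero>\<^bsub>M\<^esub> \<in> N"
  and add: "!!x y. x \<in> N ==> y \<in> N ==> x \<oplus>\<^bsub>M\<^esub> y \<in> N"
  and smult: "!!r x. x \<in> N ==> r \<odot>\<^bsub>M\<^esub> x \<in> N"
 shows "cmod (submod M N)"
proof -
 interpret M: Module.module class_ring M by fact
 note D = cmodD[OF assms(1)]
 have *: "x \<in> N ==> x \<in> carrier M" for x using sub by auto
 have "x \<in> N ==> \<ominus>\<^bsub>M\<^esub> x \<in> N" for x using smult[of x "- 1"] D(11)[OF *] by simp
 with * show ?thesis
  by (intro cmodI)
   (auto simp: D(1-9) M.a_ac add smult sub(2) intro!: bexI[of _ "\<ominus>\<^bsub>M\<^esub> _"] M.r_neg)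
qed

text \<open>With \<open>\<eta>\<close> the inclusion of the coefficients into \<EE> \<otimes>
  \<complex>, these are the restrictions to rational vectors of the linear functionals on a scalar
  extension.\<close>

definition semilin :: "('r => 's) => ('r, 'a) module => ('a => 's::comm_ring_1) => bool" where
 "semilin \<eta> M \<phi> \<longleftrightarrow> (\<forall>x\<in>carrier M. \<forall>y\<in>carrier M. \<phi> (x \<oplus>\<^bsub>M\<^esub> y) = \<phi> x + \<phi> y) \<and>
   (\<forall>r. \<forall>x\<in>carrier M. \<phi> (r \<odot>\<^bsub>M\<^esub> x) = \<eta> r * \<phi> x)"

lemma semilin_add: "semilin \<eta> M \<phi> ==> x \<in> carrier M ==> y \<in> carrier M ==> \<phi> (x \<oplus>\<^bsub>M\<^esub> y) = \<phi> x + \<phi> y"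
 and semilin_smult: "semilin \<eta> M \<phi> ==> x \<in> carrier M ==> \<phi> (r \<odot>\<^bsub>M\<^esub> x) = \<eta> r * \<phi> x"
 by (auto simp: semilin_def)

lemma semilin_zero:
 assumes "semilin \<eta> M \<phi>" "cmod M"
 shows "\<phi> \<zero>\<^bsub>M\<^esub> = 0"
proof -
 interpret Module.module class_ring M by fact
 have "\<phi> (\<zero>\<^bsub>M\<^esub> \<oplus>\<^bsub>M\<^esub> \<zero>\<^bsub>M\<^esub>) = \<phi> \<zero>\<^bsub>M\<^esub> + \<phi> \<zero>\<^bsub>M\<^esub>" by (rule semilin_add[OF assms(1)]) auto
 then show ?thesis by simp
qed

lemma semilin_finsum:
 assumes "semilin \<eta> M \<phi>" "cmod M" "!!i. i \<in> I ==> f i \<in> carrier M"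
 shows "\<phi> (\<Oplus>\<^bsub>M\<^esub>i\<in>I. f i) = (\<Sum>i\<in>I. \<phi> (f i))"
proof -
 interpret Module.module class_ring M by fact
 show ?thesis using assms(3)
 proof (induction I rule: infinite_finite_induct)
  case (insert i I)
  then show ?case by (simp add: finsum_insert Pi_def semilin_add[OF assms(1)] finsum_closed)
 qed (simp_all add: semilin_zero[OF assms(1,2)])
qed

section \<open>Formal sums\<close>

text \<open>The universal property of the tensor product in the form of sums over representatives: a
  biadditive balanced function of pairs does not see which formal sum was chosen.\<close>

lemma teq_sum:
 fixes f :: "'a => 'b => 'c::comm_monoid_add"
 assumes "teq M N xs ys"
  and "!!a a' b. a \<in> carrier M ==> a' \<in> carrier M ==> b \<in> carrier N ==> f (a \<oplus>\<^bsub>M\<^esub> a') b = f a b + f a' b"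
  and "!!a b b'. a \<in> carrier M ==> b \<in> carrier N ==> b' \<in> carrier N ==> f a (b \<oplus>\<^bsub>N\<^esub> b') = f a b + f a b'"
  and "!!r a b. a \<in> carrier M ==> b \<in> carrier N ==> f (r \<odot>\<^bsub>M\<^esub> a) b = f a (r \<odot>\<^bsub>N\<^esub> b)"
  and "!!b. b \<in> carrier N ==> f \<zero>\<^bsub>M\<^esub> b = 0" and "!!a. a \<in> carrier M ==> f a \<zero>\<^bsub>N\<^esub> = 0"
 shows "(\<Sum>(a, b)\<leftarrow>xs. f a b) = (\<Sum>(a, b)\<leftarrow>ys. f a b)"
 using assms(1) by induction (auto simp: assms(2-) add.commute)

lemma teq_mset:
 assumes "mset xs = mset ys" "set xs \<subseteq> carrier M \<times> carrier N"
 shows "teq M N xs ys"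
 using assms
proof (induction xs arbitrary: ys)
 case Nil
 then show ?case by (auto intro: teq.refl)
next
 case (Cons x xs)
 then have "x \<in> set ys" by (metis list.set_intros(1) mset_eq_setD)
 then obtain us vs where ys: "ys = us @ x # vs" by (meson split_list)
 from Cons.prems ys have "mset xs = mset (us @ vs)" by simp
 have sub: "set (us @ vs) \<subseteq> carrier M \<times> carrier N" "x \<in> carrier M \<times> carrier N"
  using Cons.prems(2) ys mset_eq_setD[OF \<open>mset xs = mset (us @ vs)\<close>] by auto
 from \<open>mset xs = mset (us @ vs)\<close> have "teq M N xs (us @ vs)" using Cons.prems(2) by (intro Cons.IH) auto
 then have 1: "teq M N ([x] @ xs) ([x] @ (us @ vs))" using sub by (intro teq.append teq.refl) auto
 have "teq M N (([x] @ us) @ vs) ((us @ [x]) @ vs)"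
  using sub by (intro teq.append teq.comm teq.refl) auto
 with 1 show ?case using ys by (auto intro: teq.trans)
qed

locale tensor_space =
 fixes M :: "('r::comm_ring_1, 'a) module" and N :: "('r, 'b) module"
 assumes cM: "cmod M" and cN: "cmod N"
begin

abbreviation "MN \<equiv> carrier M \<times> carrier N"

lemma teq_sub: "teq M N xs ys ==> set xs \<subseteq> MN \<and> set ys \<subseteq> MN"
 by (induction rule: teq.induct) (auto simp: cmodD[OF cM] cmodD[OF cN])

lemma tclass_eq: "set xs \<subseteq> MN ==> tclass M N xs = tclass M N ys \<longleftrightarrow> teq M N xs ys"
 unfolding tclass_def by (auto intro: teq.refl teq.sym teq.trans)

lemma trep_tclass: "set xs \<subseteq> MN ==> teq M N xs (trep (tclass M N xs))"
 unfolding trep_def tclass_def by (rule someI2[of _ xs]) (auto intro: teq.refl)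

lemma tclassI: "teq M N xs ys ==> tclass M N xs = tclass M N ys"
 using tclass_eq teq_sub by blast

lemma sub_trep: "X \<in> tclass M N ` lists MN ==> set (trep X) \<subseteq> MN"
 by (elim imageE) (metis in_listsD subsetI teq_sub trep_tclass)

lemma tclass_trep: "X \<in> tclass M N ` lists MN ==> tclass M N (trep X) = X"
 by (elim imageE) (auto simp: lists_eq_set intro!: tclassI[symmetric] trep_tclass)

text \<open>Classes of formal sums form a group, the inverse of a \<otimes> b being (-a) \<otimes>
  b, and an idempotent of a group is neutral. This turns additivity into the zero rules.\<close>

lemma teq_idem: 
 assumes "teq M N xs (xs @ xs)"
 shows "teq M N xs []"
proof -
 interpret M: Module.module class_ring M by (rule cM)
 define ng :: "('a \<times> 'b) list => ('a \<times> 'b) list" where "ng = map (%(x, y). (\<ominus>\<^bsub>M\<^esub> x, y))"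
 have inv: "teq M N (zs @ ng zs) []" if "set zs \<subseteq> MN" for zs
  using that
 proof (induction zs)
  case Nil
  show ?case by (simp add: ng_def teq.refl)
 next
  case (Cons z zs)
  obtain x y where z: "z = (x, y)" by force
  with Cons have xy: "x \<in> carrier M" "y \<in> carrier N" "teq M N (zs @ ng zs) []" "set zs \<subseteq> MN" by auto
  have "teq M N [(x \<oplus>\<^bsub>M\<^esub> \<ominus>\<^bsub>M\<^esub> x, y)] [(x, y), (\<ominus>\<^bsub>M\<^esub> x, y)]" using xy by (intro teq.add_left) auto
  moreover have "teq M N [(\<zero>\<^bsub>M\<^esub>, y)] []" using xy by (intro teq.zero_left)
  ultimately have "teq M N [(x, y), (\<ominus>\<^bsub>M\<^esub> x, y)] []" 
   using xy by (auto simp: M.r_neg intro: teq.trans[OF teq.sym])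
  from teq.append[OF this xy(3)]
  have 1: "teq M N ([(x, y), (\<ominus>\<^bsub>M\<^esub> x, y)] @ zs @ ng zs) []" by simp
  have "teq M N ((z # zs) @ ng (z # zs)) ([(x, y), (\<ominus>\<^bsub>M\<^esub> x, y)] @ zs @ ng zs)"
   using xy by (intro teq_mset) (auto simp: z ng_def)
  then show ?case using 1 by (rule teq.trans)
 qed
 have sub: "set xs \<subseteq> MN" "set (ng xs) \<subseteq> MN" using teq_sub[OF assms] by (auto simp: ng_def)
 have 1: "teq M N (xs @ ng xs) []" by (rule inv) fact
 have 2: "teq M N (xs @ ng xs) ((xs @ xs) @ ng xs)" using assms sub by (intro teq.append teq.refl)
 have 3: "teq M N (xs @ (xs @ ng xs)) (xs @ [])" using 1 sub by (intro teq.append teq.refl)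
 have 4: "teq M N [] (xs @ (xs @ ng xs))" using teq.trans[OF teq.sym[OF 1] 2] by simp
 show ?thesis using teq.sym[OF teq.trans[OF 4 3]] by simp
qed

text \<open>The universal property for maps into another tensor product. The zero rules follow from
  biadditivity, since \<open>F (\<zero>, b)\<close> is then idempotent.\<close>

lemma teq_concat:
 assumes "teq M N xs ys"
  and refl: "!!a b. a \<in> carrier M ==> b \<in> carrier N ==> set (F (a, b)) \<subseteq> carrier M' \<times> carrier N'"
  and "!!a a' b. a \<in> carrier M ==> a' \<in> carrier M ==> b \<in> carrier N ==>
   teq M' N' (F (a \<oplus>\<^bsub>M\<^esub> a', b)) (F (a, b) @ F (a', b))"
  and "!!a b b'. a \<in> carrier M ==> b \<in> carrier N ==> b' \<in> carrier N ==>
   teq M' N' (F (a, b \<oplus>\<^bsub>N\<^esub> b')) (F (a, b) @ F (a, b'))"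
  and "!!r a b. a \<in> carrier M ==> b \<in> carrier N ==> teq M' N' (F (r \<odot>\<^bsub>M\<^esub> a, b)) (F (a, r \<odot>\<^bsub>N\<^esub> b))"
  and MN': "tensor_space M' N'"
 shows "teq M' N' (concat (map F xs)) (concat (map F ys))"
proof -
 interpret M: Module.module class_ring M by (rule cM)
 interpret N: Module.module class_ring N by (rule cN)
 have *: "set (concat (map F xs)) \<subseteq> carrier M' \<times> carrier N'" if "set xs \<subseteq> MN" for xs
  using that
 proof (induction xs)
  case (Cons z zs)
  then show ?case using refl[of "fst z" "snd z"] by (auto simp: mem_Times_iff)
 qed simp
 show ?thesis using assms(1)
 proof induction
  case (refl xs)
  then show ?case by (intro teq.refl *)
 next
  case (comm xs ys)
  then have "set (concat (map F xs) @ concat (map F ys)) \<subseteq> carrier M' \<times> carrier N'"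
   using *[of "xs @ ys"] by (simp del: set_concat)
  from teq.comm[OF this] show ?case by simp
 next
  case (zero_left b)
  have "teq M' N' (F (\<zero>\<^bsub>M\<^esub> \<oplus>\<^bsub>M\<^esub> \<zero>\<^bsub>M\<^esub>, b)) (F (\<zero>\<^bsub>M\<^esub>, b) @ F (\<zero>\<^bsub>M\<^esub>, b))"
   using zero_left by (intro assms(3)) auto
  then show ?case by (simp add: tensor_space.teq_idem[OF MN'])
 next
  case (zero_right a)
  have "teq M' N' (F (a, \<zero>\<^bsub>N\<^esub> \<oplus>\<^bsub>N\<^esub> \<zero>\<^bsub>N\<^esub>)) (F (a, \<zero>\<^bsub>N\<^esub>) @ F (a, \<zero>\<^bsub>N\<^esub>))"
   using zero_right by (intro assms(4)) auto
  then show ?case by (simp add: tensor_space.teq_idem[OF MN'])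
 next
  case (sym xs ys)
  show ?case by (rule teq.sym) (rule sym.IH)
 next
  case (trans xs ys zs)
  show ?case by (rule teq.trans) (rule trans.IH)+
 next
  case (append xs ys xs' ys')
  show ?case by (simp only: map_append concat_append) (rule teq.append append.IH)+
 qed (simp_all add: assms(3-5))
qed

end

text \<open>Tensor products over the coefficients, Betti extensions and de Rham extensions differ
  only in the action of a scalar on a pair. The assumptions let this action pass to classes and give
  the module axioms there.\<close>

locale tensor_action = tensor_space M N
 for M :: "('r::comm_ring_1, 'a) module" and N :: "('r, 'b) module" +
 fixes act :: "'s::comm_ring_1 => 'a => 'b => ('a \<times> 'b) list"
 assumes act_closed: "!!s x y. x \<in> carrier M ==> y \<in> carrier N ==> set (act s x y) \<subseteq> carrier M \<times> carrier N"
  and act_add_left: "!!s x x' y. x \<in> carrier M ==> x' \<in> carrier M ==> y \<in> carrier N ==>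
   teq M N (act s (x \<oplus>\<^bsub>M\<^esub> x') y) (act s x y @ act s x' y)"
  and act_add_right: "!!s x y y'. x \<in> carrier M ==> y \<in> carrier N ==> y' \<in> carrier N ==>
   teq M N (act s x (y \<oplus>\<^bsub>N\<^esub> y')) (act s x y @ act s x y')"
  and act_balanced: "!!s r x y. x \<in> carrier M ==> y \<in> carrier N ==>
   teq M N (act s (r \<odot>\<^bsub>M\<^esub> x) y) (act s x (r \<odot>\<^bsub>N\<^esub> y))"
  and act_add: "!!s t x y. x \<in> carrier M ==> y \<in> carrier N ==>
   teq M N (act (s + t) x y) (act s x y @ act t x y)"
  and act_mult: "!!s t x y. x \<in> carrier M ==> y \<in> carrier N ==>
   teq M N (act (s * t) x y) (concat (map (%(x, y). act s x y) (act t x y)))"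
  and act_one: "!!x y. x \<in> carrier M ==> y \<in> carrier N ==> teq M N (act 1 x y) [(x, y)]"
begin

abbreviation "T \<equiv> tensor_mod M N act"
abbreviation "acts s xs \<equiv> concat (map (%(x, y). act s x y) xs)"

lemma T_simps [simp]:
 "carrier T = tclass M N ` lists MN" "zero T = tclass M N []"
 by (simp_all add: tensor_mod_def)

lemma acts_cong: "teq M N xs ys ==> teq M N (acts s xs) (acts s ys)"
 by (erule teq_concat)
  (simp_all add: tensor_space_axioms act_add_left act_add_right act_balanced act_closed)

lemma acts_closed: "set xs \<subseteq> MN ==> set (acts s xs) \<subseteq> MN"
proof (induction xs)
 case (Cons z zs)
 then show ?case using act_closed[of "fst z" "snd z" s] by (auto simp: mem_Times_iff split: prod.splits)
qed simp

lemma T_add: 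
 assumes "set xs \<subseteq> MN" "set ys \<subseteq> MN"
 shows "tclass M N xs \<oplus>\<^bsub>T\<^esub> tclass M N ys = tclass M N (xs @ ys)"
 using assms by (auto simp: tensor_mod_def intro!: tclassI[symmetric] teq.append trep_tclass)

lemma T_smult: 
 assumes "set xs \<subseteq> MN"
 shows "s \<odot>\<^bsub>T\<^esub> tclass M N xs = tclass M N (acts s xs)"
 using assms by (auto simp: tensor_mod_def intro!: tclassI[symmetric] acts_cong trep_tclass)

lemma acts_rules:
 assumes "set xs \<subseteq> MN"
 shows "teq M N (acts (s + t) xs) (acts s xs @ acts t xs)"
  and "teq M N (acts (s * t) xs) (acts s (acts t xs))" and "teq M N (acts 1 xs) xs"
 using assms
proof (induction xs)
 case Nil
 {
  case 1 show ?case by (simp add: teq.refl)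
 next
  case 2 show ?case by (simp add: teq.refl)
 next
  case 3 show ?case by (simp add: teq.refl)
 }
next
 case (Cons z zs)
 obtain x y where z: "z = (x, y)" by force
 {
  case 1
  with z have xy: "x \<in> carrier M" "y \<in> carrier N" "set zs \<subseteq> MN" by auto
  have "teq M N (act (s + t) x y @ acts (s + t) zs) ((act s x y @ act t x y) @ (acts s zs @ acts t zs))"
   using xy by (intro teq.append act_add Cons.IH)
  moreover have "teq M N ((act s x y @ act t x y) @ (acts s zs @ acts t zs)) 
    ((act s x y @ acts s zs) @ (act t x y @ acts t zs))"
   using act_closed[OF xy(1,2)] acts_closed[OF xy(3)]
   by (intro teq_mset) (simp_all del: set_concat)
  ultimately show ?case using z by (auto intro: teq.trans)
 next
  case 2
  with z have xy: "x \<in> carrier M" "y \<in> carrier N" "set zs \<subseteq> MN" by auto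
  have "teq M N (act (s * t) x y @ acts (s * t) zs) (acts s (act t x y) @ acts s (acts t zs))"
   using xy by (intro teq.append act_mult Cons.IH)
  then show ?case using z by simp
 next
  case 3
  with z have xy: "x \<in> carrier M" "y \<in> carrier N" "set zs \<subseteq> MN" by auto
  have "teq M N (act 1 x y @ acts 1 zs) ([(x, y)] @ zs)"
   using xy by (intro teq.append act_one Cons.IH)
  then show ?case using z by simp
 }
qed

lemma acts_zero: "set xs \<subseteq> MN ==> teq M N (acts 0 xs) []"
 using acts_rules(1)[of xs 0 0] by (intro teq_idem) auto

lemma T_elim:
 assumes "X \<in> carrier T"
 obtains xs where "X = tclass M N xs" "set xs \<subseteq> MN"
 using assms by (auto simp: lists_eq_set)

lemma tclass_in_T: "set xs \<subseteq> MN ==> tclass M N xs \<in> carrier T"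
 by (simp add: lists_eq_set)

declare T_simps(1) [simp del]

lemma cmod_T: "cmod T"
proof (rule cmodI, goal_cases)
 case (1 x y)
 then obtain xs ys where *: "x = tclass M N xs" "y = tclass M N ys"
  "set xs \<subseteq> MN" "set ys \<subseteq> MN" by (metis T_elim)
 then show ?case by (simp add: T_add tclass_in_T)
next
 case (3 x y z)
 then obtain xs ys zs where *: "x = tclass M N xs" "y = tclass M N ys" "z = tclass M N zs"
  "set xs \<subseteq> MN" "set ys \<subseteq> MN" "set zs \<subseteq> MN" by (metis T_elim)
 then show ?case by (simp add: T_add)
next
 case (4 x y)
 then obtain xs ys where *: "x = tclass M N xs" "y = tclass M N ys"
  "set xs \<subseteq> MN" "set ys \<subseteq> MN" by (metis T_elim)
 then show ?case by (simp add: T_add) (intro tclassI teq.comm, auto)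
next
 case (5 x)
 then obtain xs where *: "x = tclass M N xs" "set xs \<subseteq> MN" by (rule T_elim)
 then show ?case using T_add[of "[]" xs] by simp
next
 case (6 x)
 then obtain xs where *: "x = tclass M N xs" "set xs \<subseteq> MN" by (rule T_elim)
 show ?case
 proof (rule bexI)
  \<comment> \<open>The additive inverse is the action of -1, as the scalar 0 = -1 + 1 acts by
    zero.\<close>
  have "teq M N (acts (- 1 + 1) xs) (acts (- 1) xs @ acts 1 xs)" using * by (intro acts_rules)
  moreover have "teq M N (acts (- 1) xs @ acts 1 xs) (acts (- 1) xs @ xs)"
   using * acts_closed[of xs] by (intro teq.append acts_rules teq.refl)
  moreover have "teq M N (acts (- 1 + 1) xs) []" using acts_zero[OF *(2)] by simp
  ultimately have "teq M N (acts (- 1) xs @ xs) []" by (blast intro: teq.sym teq.trans)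
  then show "tclass M N (acts (- 1) xs) \<oplus>\<^bsub>T\<^esub> x = \<zero>\<^bsub>T\<^esub>"
   using * acts_closed[of xs] by (simp add: T_add tclassI del: set_concat)
  show "tclass M N (acts (- 1) xs) \<in> carrier T"
   using * acts_closed[of xs "- 1"] by (simp add: tclass_in_T)
 qed
next
 case (7 r x)
 then obtain xs where *: "x = tclass M N xs" "set xs \<subseteq> MN" by (rule T_elim)
 then show ?case
  using acts_closed[of xs r] by (simp add: T_smult tclass_in_T del: set_concat)
next
 case (8 r s x)
 then obtain xs where *: "x = tclass M N xs" "set xs \<subseteq> MN" by (rule T_elim)
 then show ?case using acts_closed[of xs]
  by (simp add: T_smult T_add tclassI acts_rules del: set_concat)
next
 case (9 r x y)
 then obtain xs ys where *: "x = tclass M N xs" "y = tclass M N ys"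
  "set xs \<subseteq> MN" "set ys \<subseteq> MN" by (metis T_elim)
 then show ?case using acts_closed[of xs] acts_closed[of ys]
  by (simp add: T_smult T_add del: set_concat)
next
 case (10 r s x)
 then obtain xs where *: "x = tclass M N xs" "set xs \<subseteq> MN" by (rule T_elim)
 then show ?case using acts_closed[of xs]
  by (simp add: T_smult tclassI acts_rules del: set_concat)
next
 case (11 x)
 then obtain xs where *: "x = tclass M N xs" "set xs \<subseteq> MN" by (rule T_elim)
 then show ?case by (simp add: T_smult tclassI acts_rules del: set_concat)
qed (simp add: tclass_in_T)

end

section \<open>The ring \<open>\<EE> \<otimes> \<complex>\<close>\<close>

lemma field_hom_of_rat:
 fixes h :: "'a::field_char_0 => 'b::field_char_0"
 assumes "field_hom h"
 shows "h (of_rat r) = of_rat r"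
proof -
 interpret field_hom h by fact
 obtain p q where "quotient_of r = (p, q)" by force
 then have r: "r = of_int p / of_int q" by (rule quotient_of_div)
 have "h (of_rat r) = h (of_int p / of_int q)" by (simp add: r of_rat_divide)
 also have "\<dots> = of_rat r" by (simp add: r of_rat_divide hom_distribs)
 finally show ?thesis .
qed

lemma comm_ring_hom_field_hom: "field_hom h ==> comm_ring_hom h"
 by (rule idom_hom.axioms(1)) (rule field_hom.axioms(1))

lemma field_hom_of_rat_hom: "field_hom (of_rat :: rat => 'a::field_char_0)"
 by unfold_locales (auto simp: of_rat_add of_rat_mult)

lemma comm_ring_hom_of_rat: "comm_ring_hom (of_rat :: rat => 'a::field_char_0)"
 by (rule comm_ring_hom_field_hom[OF field_hom_of_rat_hom])

lemma pure_add_left: "(a + a') \<otimes>\<^sub>\<rat> b = a \<otimes>\<^sub>\<rat> b + a' \<otimes>\<^sub>\<rat> b"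
 by transfer (simp add: qteq_add_left)

lemma pure_add_right: "a \<otimes>\<^sub>\<rat> (b + b') = a \<otimes>\<^sub>\<rat> b + a \<otimes>\<^sub>\<rat> b'"
 by transfer (simp add: qteq_add_right)

lemma pure_zero_left [simp]: "0 \<otimes>\<^sub>\<rat> b = 0"
 by transfer (rule qteq_zero_left)

lemma pure_zero_right [simp]: "a \<otimes>\<^sub>\<rat> 0 = 0"
 by transfer (rule qteq_zero_right)

lemma pure_balanced: "(of_rat r * a) \<otimes>\<^sub>\<rat> b = a \<otimes>\<^sub>\<rat> (of_rat r * b)"
 by transfer (rule qteq_balanced)

lemma pure_mult [simp]: "(a \<otimes>\<^sub>\<rat> b) * (a' \<otimes>\<^sub>\<rat> b') = (a * a') \<otimes>\<^sub>\<rat> (b * b')"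
 by transfer (simp add: qteq_refl)

lemma pure_one [simp]: "1 \<otimes>\<^sub>\<rat> 1 = 1"
 by transfer (rule qteq_refl)

lemma pure_of_rat: "of_rat r \<otimes>\<^sub>\<rat> b = 1 \<otimes>\<^sub>\<rat> (of_rat r * b)"
 using pure_balanced[of r 1 b] by simp

lemma pure_sum_right: "a \<otimes>\<^sub>\<rat> (\<Sum>x\<in>A. f x) = (\<Sum>x\<in>A. a \<otimes>\<^sub>\<rat> f x)"
 by (induction A rule: infinite_finite_induct) (simp_all add: pure_add_right)

lemma abs_qtensor_conv: "abs_qtensor xs = (\<Sum>(a, b)\<leftarrow>xs. a \<otimes>\<^sub>\<rat> b)"
proof (induction xs)
 case Nil
 show ?case by (simp add: zero_qtensor_def)
next
 case (Cons x xs)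
 have "abs_qtensor (x # xs) = abs_qtensor [x] + abs_qtensor xs"
  by (simp add: plus_qtensor.abs_eq)
 also have "abs_qtensor [x] = fst x \<otimes>\<^sub>\<rat> snd x" by (simp add: pure_tensor.abs_eq)
 finally show ?case using Cons by (simp add: case_prod_beta)
qed

lemma qtensor_rep: "t = (\<Sum>(a, b)\<leftarrow>rep_qtensor t. a \<otimes>\<^sub>\<rat> b)"
 unfolding abs_qtensor_conv[symmetric] by (metis Quotient_abs_rep Quotient_qtensor)

lemma qteq_iff: "qteq xs ys \<longleftrightarrow> (\<Sum>(a, b)\<leftarrow>xs. a \<otimes>\<^sub>\<rat> b) = (\<Sum>(a, b)\<leftarrow>ys. a \<otimes>\<^sub>\<rat> b)"
 unfolding abs_qtensor_conv[symmetric] by (simp add: qtensor.abs_eq_iff)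

lemma qtensor_induct [case_names zero add]:
 assumes "P 0" "!!a b t. P t ==> P (a \<otimes>\<^sub>\<rat> b + t)"
 shows "P t"
proof -
 have "P (\<Sum>(a, b)\<leftarrow>xs. a \<otimes>\<^sub>\<rat> b)" for xs
  by (induction xs) (auto simp: assms)
 then show ?thesis by (metis qtensor_rep)
qed

lemma comm_ring_hom_left: "comm_ring_hom (%a. a \<otimes>\<^sub>\<rat> (1::'b::field_char_0))"
 by unfold_locales (simp_all add: pure_add_left)

lemma comm_ring_hom_right: "comm_ring_hom (%b. (1::'a::field_char_0) \<otimes>\<^sub>\<rat> b)"
 by unfold_locales (simp_all add: pure_add_right)

lemma qteq_map_right:
 fixes g :: "'b::field_char_0 => 'c::field_char_0"
 assumes "field_hom g" "qteq xs ys"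
 shows "(\<Sum>(a, b)\<leftarrow>xs. a \<otimes>\<^sub>\<rat> g b) = (\<Sum>(a, b)\<leftarrow>ys. a \<otimes>\<^sub>\<rat> g b)"
proof -
 interpret field_hom g by fact
 show ?thesis
  by (rule teq_sum[OF assms(2)])
   (simp_all add: pure_add_left pure_add_right hom_distribs field_hom_of_rat[OF assms(1)] pure_balanced)
qed

lemma map_right_list:
 assumes "field_hom g"
 shows "map_right g (\<Sum>(a, b)\<leftarrow>xs. a \<otimes>\<^sub>\<rat> b) = (\<Sum>(a, b)\<leftarrow>xs. a \<otimes>\<^sub>\<rat> g b)"
 unfolding map_right_def
 by (rule qteq_map_right[OF assms]) (simp add: qteq_iff flip: qtensor_rep)

lemma map_right_pure: "field_hom g ==> map_right g (a \<otimes>\<^sub>\<rat> b) = a \<otimes>\<^sub>\<rat> g b"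
 using map_right_list[of g "[(a, b)]"] by simp

lemma map_right_add: 
 assumes "field_hom g"
 shows "map_right g (s + t) = map_right g s + map_right g t"
proof -
 have "s + t = (\<Sum>(a, b)\<leftarrow>rep_qtensor s @ rep_qtensor t. a \<otimes>\<^sub>\<rat> b)"
  using qtensor_rep[of s] qtensor_rep[of t] by simp
 then have "map_right g (s + t) = (\<Sum>(a, b)\<leftarrow>rep_qtensor s @ rep_qtensor t. a \<otimes>\<^sub>\<rat> g b)"
  by (simp only: map_right_list[OF assms])
 then show ?thesis by (simp add: map_right_def)
qed

lemma map_right_zero: "field_hom g ==> map_right g 0 = 0"
 using map_right_add[of g 0 0] by simp

lemma map_right_mult:
 assumes "field_hom g"
 shows "map_right g (s * t) = map_right g s * map_right g t"
proof -
 interpret field_hom g by fact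
 have 1: "map_right g (a \<otimes>\<^sub>\<rat> b * t) = a \<otimes>\<^sub>\<rat> g b * map_right g t" for a b
  by (induction t rule: qtensor_induct)
   (simp_all add: map_right_zero[OF assms] map_right_add[OF assms] map_right_pure[OF assms] distrib_left hom_mult)
 show ?thesis
  by (induction s rule: qtensor_induct)
   (simp_all add: map_right_zero[OF assms] map_right_add[OF assms] map_right_pure[OF assms] distrib_right 1)
qed

lemma comm_ring_hom_map_right:
 assumes "field_hom g"
 shows "comm_ring_hom (map_right g :: ('a::field_char_0, _) qtensor => _)"
proof -
 interpret field_hom g by fact
 have "map_right g (1 \<otimes>\<^sub>\<rat> 1) = (1 :: ('a, _) qtensor)" by (subst map_right_pure[OF assms]) simp
 then show ?thesis
  by unfold_locales (simp_all add: map_right_zero[OF assms] map_right_add[OF assms] map_right_mult[OF assms])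
qed

lemma pure_of_int: "of_int k \<otimes>\<^sub>\<rat> 1 = of_int k" "1 \<otimes>\<^sub>\<rat> of_int k = of_int k"
 using ring_hom.hom_of_int[OF comm_ring_hom.axioms(1)[OF comm_ring_hom_left]]
  ring_hom.hom_of_int[OF comm_ring_hom.axioms(1)[OF comm_ring_hom_right]] by auto

text \<open>A nonzero integer is invertible in the left factor, so it is a unit of the tensor
  product. Traces and signs found inside \<EE> \<otimes> \<complex> can therefore be compared as
  integers.\<close>

lemma qtensor_of_int_eq: "(of_int k :: ('a::field_char_0, 'b::field_char_0) qtensor) = of_int l \<longleftrightarrow> k = l"
proof
 assume eq: "(of_int k :: ('a, 'b) qtensor) = of_int l"
 show "k = l"
 proof (rule ccontr)
  assume "k \<noteq> l"
  have "(1::('a, 'b) qtensor) = (of_int (k - l) * (1 / of_int (k - l))) \<otimes>\<^sub>\<rat> (1 * 1)" using \<open>k \<noteq> l\<close> by simp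
  also have "\<dots> = of_int (k - l) * ((1 / of_int (k - l)) \<otimes>\<^sub>\<rat> 1)"
   unfolding pure_mult[symmetric] pure_of_int ..
  also have "(of_int (k - l) :: ('a, 'b) qtensor) = 0" using eq by simp
  finally show False by simp
 qed
qed auto

section \<open>Scalar extension to \<open>\<complex>\<close> and linear functionals\<close>

text \<open>The \<complex>-linear extension of a functional, taken on the chosen representative of a
  class; \<open>ev_cls\<close> shows that the choice does not matter when the functional is
  semilinear.\<close>

definition ev :: "('v => ('e::field_char_0, complex) qtensor) => ('v \<times> complex) list set => ('e, complex) qtensor" where
 "ev \<phi> X = (\<Sum>(v, z)\<leftarrow>trep X. 1 \<otimes>\<^sub>\<rat> z * \<phi> v)"

lemma (in tensor_space) teq_map_split:
 assumes "!!y. y \<in> set ys ==> teq M N [f y] [g y, h y]"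
 shows "teq M N (map f ys) (map g ys @ map h ys)"
 using assms
proof (induction ys)
 case Nil
 show ?case by (simp add: teq.refl)
next
 case (Cons y ys)
 have IH: "teq M N (map f ys) (map g ys @ map h ys)" using Cons by simp
 have "teq M N ([f y] @ map f ys) ([g y, h y] @ (map g ys @ map h ys))"
  using Cons.prems by (intro teq.append IH) auto
 moreover have "teq M N ([g y, h y] @ (map g ys @ map h ys)) (map g (y # ys) @ map h (y # ys))"
  using teq_sub[OF IH] teq_sub[OF Cons.prems[of y]] by (intro teq_mset) auto
 ultimately show ?case by (auto intro: teq.trans)
qed

lemma (in tensor_space) teq_map_one:
 assumes "!!y. y \<in> set ys ==> teq M N [f y] [g y]"
 shows "teq M N (map f ys) (map g ys)"
 using assms
proof (induction ys)
 case Nil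
 show ?case by (simp add: teq.refl)
next
 case (Cons y ys)
 have "teq M N ([f y] @ map f ys) ([g y] @ map g ys)"
  using Cons by (intro teq.append) auto
 then show ?case by simp
qed

lemma tensor_space_rat: 
 "tensor_space (field_mod of_rat :: (rat, 'a::field_char_0) module) (field_mod of_rat :: (rat, 'b::field_char_0) module)"
 by (intro tensor_space.intro cmod_field_mod comm_ring_hom_of_rat)

text \<open>
 \<open>V \<otimes>\<^bsub>\<FF>,\<sigma>\<^esub> \<complex>\<close> for a module \<open>V\<close> over an \<open>\<EE>\<close>-\<open>\<FF>\<close>-algebra \<open>A = \<EE>\<cdot>\<FF>\<close>; this covers Betti spaces
 (\<open>A = \<EE>\<close>, \<open>\<FF> = \<rat>\<close>) and de Rham modules (\<open>A = \<EE> \<otimes> \<FF>\<close>). The ring map \<open>\<eta>: A \<rightarrow> \<EE> \<otimes> \<complex>\<close> turns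
 functionals on the extension into \<open>\<eta>\<close>-semilinear functionals on \<open>V\<close>.
\<close>

locale scalar_ext =
 fixes V :: "('a::comm_ring_1, 'v) module" and \<iota> :: "'e::field_char_0 => 'a" and \<kappa> :: "'f::field_char_0 => 'a"
  and \<sigma> :: "'f => complex" and \<eta> :: "'a => ('e, complex) qtensor"
 assumes cV: "cmod V" and \<iota>: "comm_ring_hom \<iota>" and \<kappa>: "comm_ring_hom \<kappa>" and \<sigma>: "field_hom \<sigma>"
  and \<eta>: "comm_ring_hom \<eta>"
  and \<iota>_rat: "!!r. \<iota> (of_rat r) = \<kappa> (of_rat r)"
  and \<eta>_\<iota>: "!!e. \<eta> (\<iota> e) = e \<otimes>\<^sub>\<rat> 1" and \<eta>_\<kappa>: "!!f. \<eta> (\<kappa> f) = 1 \<otimes>\<^sub>\<rat> \<sigma> f"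
  and gen: "!!a. \<exists>xs. a = (\<Sum>(e, f)\<leftarrow>xs. \<iota> e * \<kappa> f)"
begin

definition actl :: "('e \<times> complex) list => 'v => complex => ('v \<times> complex) list" where
 "actl es v z = map (%(e, w). (\<iota> e \<odot>\<^bsub>V\<^esub> v, w * z)) es"

interpretation \<iota>: comm_ring_hom \<iota> by (rule \<iota>)
interpretation \<kappa>: comm_ring_hom \<kappa> by (rule \<kappa>)
interpretation \<sigma>: field_hom \<sigma> by (rule \<sigma>)
interpretation \<eta>: comm_ring_hom \<eta> by (rule \<eta>)

sublocale tensor_space "restrict_scalars \<kappa> V" "field_mod \<sigma>"
 by (intro tensor_space.intro cmod_restrict_scalars cmod_field_mod \<kappa> cV comm_ring_hom_field_hom \<sigma>)

abbreviation "teqv \<equiv> teq (restrict_scalars \<kappa> V) (field_mod \<sigma>)"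
abbreviation "cls \<equiv> tclass (restrict_scalars \<kappa> V) (field_mod \<sigma>)"

lemma eq_add_left: "x \<in> carrier V ==> y \<in> carrier V ==> teqv [(x \<oplus>\<^bsub>V\<^esub> y, z)] [(x, z), (y, z)]"
 using teq.add_left[of x "restrict_scalars \<kappa> V" y z "field_mod \<sigma>"] by simp

lemma eq_add_right: "x \<in> carrier V ==> teqv [(x, z + w)] [(x, z), (x, w)]"
 using teq.add_right[of x "restrict_scalars \<kappa> V" z "field_mod \<sigma>" w] by simp

lemma eq_balanced: "x \<in> carrier V ==> teqv [(\<kappa> f \<odot>\<^bsub>V\<^esub> x, z)] [(x, \<sigma> f * z)]"
 using teq.balanced[of x "restrict_scalars \<kappa> V" z "field_mod \<sigma>" f] by simp

lemma eq_zero: "teqv [(\<zero>\<^bsub>V\<^esub>, z)] []" "x \<in> carrier V ==> teqv [(x, 0)] []"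
 using teq.zero_left[of z "field_mod \<sigma>" "restrict_scalars \<kappa> V"]
  teq.zero_right[of x "restrict_scalars \<kappa> V" "field_mod \<sigma>"] by simp_all

lemma smult_closed: "x \<in> carrier V ==> a \<odot>\<^bsub>V\<^esub> x \<in> carrier V"
 by (rule cmod_smult_closed[OF cV])

lemma actl_closed: "v \<in> carrier V ==> set (actl es v z) \<subseteq> carrier V \<times> UNIV"
 by (auto simp: actl_def smult_closed)

text \<open>The scalar is itself a class of formal sums, so its action must be biadditive and
  balanced in the pairs \<open>(e, w)\<close>. Balancing moves a rational number through V to the
  complex factor, by \<open>\<iota>_rat\<close>.\<close>

lemma actl_cong:
 assumes "qteq es es'" "v \<in> carrier V"
 shows "teqv (actl es v z) (actl es' v z)"
proof -
 have *: "actl es v z = concat (map (%(e, w). [(\<iota> e \<odot>\<^bsub>V\<^esub> v, w * z)]) es)" for es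
  by (induction es) (auto simp: actl_def)
 have bal: "teqv [(\<iota> (of_rat r * a) \<odot>\<^bsub>V\<^esub> v, b * z)] [(\<iota> a \<odot>\<^bsub>V\<^esub> v, of_rat r * b * z)]" for r a b
  using eq_balanced[of "\<iota> a \<odot>\<^bsub>V\<^esub> v" "of_rat r" "b * z"] assms(2)
  by (simp add: \<iota>.hom_mult \<iota>_rat cmod_mult_smult[OF cV] smult_closed field_hom_of_rat[OF \<sigma>] mult.assoc)
 show ?thesis unfolding *
  by (rule tensor_space.teq_concat[OF tensor_space_rat assms(1)])
   (use assms(2) in \<open>simp_all add: smult_closed \<iota>.hom_add cmod_add_smult[OF cV] eq_add_left
    eq_add_right distrib_right bal tensor_space_axioms\<close>)
qed

lemma rep_qteq: "(\<Sum>(a, b)\<leftarrow>es. a \<otimes>\<^sub>\<rat> b) = t ==> qteq (rep_qtensor t) es"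
 by (simp add: qteq_iff flip: qtensor_rep)

abbreviation "act t \<equiv> actl (rep_qtensor t)"

lemma act_eq: "(\<Sum>(a, b)\<leftarrow>es. a \<otimes>\<^sub>\<rat> b) = t ==> v \<in> carrier V ==> teqv (act t v z) (actl es v z)"
 by (intro actl_cong rep_qteq)

lemma actl_append: "actl (es @ es') v z = actl es v z @ actl es' v z"
 by (simp add: actl_def)

lemma actl_lmult:
 assumes "v \<in> carrier V"
 shows "actl (lmult es' es) v z = concat (map (%(x, y). actl es x y) (actl es' v z))"
proof (induction es')
 case (Cons e es')
 then show ?case using assms
  by (auto simp: actl_def case_prod_beta \<iota>.hom_mult cmod_mult_smult[OF cV, symmetric] ac_simps)
qed (simp add: actl_def)

sublocale tensor_action "restrict_scalars \<kappa> V" "field_mod \<sigma>" "%t v z. act t v z"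
proof
 fix s t :: "('e, complex) qtensor" and x x' :: 'v and y y' :: complex and r :: 'f
 assume "x \<in> carrier (restrict_scalars \<kappa> V)"
 then have x: "x \<in> carrier V" by simp
 show "set (act s x y) \<subseteq> carrier (restrict_scalars \<kappa> V) \<times> carrier (field_mod \<sigma>)"
  using x actl_closed by simp
 show "teqv (act s x (y \<oplus>\<^bsub>field_mod \<sigma>\<^esub> y')) (act s x y @ act s x y')"
  unfolding actl_def using x
  by (intro teq_map_split) (auto simp: distrib_left smult_closed intro!: eq_add_right)
 show "teqv (act s (r \<odot>\<^bsub>restrict_scalars \<kappa> V\<^esub> x) y) (act s x (r \<odot>\<^bsub>field_mod \<sigma>\<^esub> y))"
  unfolding actl_def
 proof (intro teq_map_one, clarify)
  fix e w
  have "\<iota> e \<odot>\<^bsub>V\<^esub> (\<kappa> r \<odot>\<^bsub>V\<^esub> x) = \<kappa> r \<odot>\<^bsub>V\<^esub> (\<iota> e \<odot>\<^bsub>V\<^esub> x)"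
   using x by (simp add: cmod_mult_smult[OF cV, symmetric] mult.commute)
  then show "teqv [(\<iota> e \<odot>\<^bsub>V\<^esub> (r \<odot>\<^bsub>restrict_scalars \<kappa> V\<^esub> x), w * y)] [(\<iota> e \<odot>\<^bsub>V\<^esub> x, w * (r \<odot>\<^bsub>field_mod \<sigma>\<^esub> y))]"
   using eq_balanced[of "\<iota> e \<odot>\<^bsub>V\<^esub> x" r "w * y"] x by (simp add: smult_closed ac_simps)
 qed
 show "teqv (act (s + t) x y) (act s x y @ act t x y)"
  unfolding actl_append[symmetric] using x
  by (intro act_eq) (simp_all flip: qtensor_rep)
 \<comment> \<open>With t acting first the two formal sums agree term by term; the product of
   representatives then appears in the opposite order, which commutativity repairs.\<close>
 show "teqv (act (s * t) x y) (concat (map (%(x, y). act s x y) (act t x y)))"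
  unfolding actl_lmult[OF x, symmetric]
 proof (intro act_eq x)
  show "(\<Sum>(a, b)\<leftarrow>lmult (rep_qtensor t) (rep_qtensor s). a \<otimes>\<^sub>\<rat> b) = s * t"
   unfolding abs_qtensor_conv[symmetric] times_qtensor.abs_eq[symmetric]
   unfolding abs_qtensor_conv qtensor_rep[symmetric] by (rule mult.commute)
 qed
 have "actl [(1, 1)] x y = [(x, y)]" using x by (simp add: actl_def cmod_one_smult[OF cV])
 then show "teqv (act 1 x y) [(x, y)]" using act_eq[of "[(1, 1)]" 1 x y] x by simp
 assume "x' \<in> carrier (restrict_scalars \<kappa> V)"
 then show "teqv (act s (x \<oplus>\<^bsub>restrict_scalars \<kappa> V\<^esub> x') y) (act s x y @ act s x' y)"
  unfolding actl_def using x
  by (intro teq_map_split) (auto simp: cmod_smult_add[OF cV] smult_closed intro!: eq_add_left)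
qed

lemma cls_in_T: "set xs \<subseteq> carrier V \<times> UNIV ==> cls xs \<in> carrier T"
 by (rule tclass_in_T) simp

lemma ext_elim:
 assumes "X \<in> carrier T"
 obtains xs where "X = cls xs" "set xs \<subseteq> carrier V \<times> UNIV"
 using assms by (rule T_elim) simp

lemma cls_append: "set xs \<subseteq> carrier V \<times> UNIV ==> set ys \<subseteq> carrier V \<times> UNIV ==> cls (xs @ ys) = cls xs \<oplus>\<^bsub>T\<^esub> cls ys"
 by (rule T_add[symmetric]) auto

lemma smult_pure:
 assumes "v \<in> carrier V"
 shows "(e \<otimes>\<^sub>\<rat> w) \<odot>\<^bsub>T\<^esub> cls [(v, z)] = cls [(\<iota> e \<odot>\<^bsub>V\<^esub> v, w * z)]"
proof -
 have "teqv (act (e \<otimes>\<^sub>\<rat> w) v z) (actl [(e, w)] v z)" using assms by (intro act_eq) auto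
 then show ?thesis using assms by (simp add: T_smult) (rule tclassI, simp add: actl_def)
qed

lemma cls_smult_complex: "v \<in> carrier V ==> cls [(v, z)] = (1 \<otimes>\<^sub>\<rat> z) \<odot>\<^bsub>T\<^esub> cls [(v, 1)]"
 by (simp add: smult_pure cmod_one_smult[OF cV])

text \<open>By \<open>gen\<close> it is enough to treat \<open>\<iota> e * \<kappa> f\<close>: the
  factor \<open>\<kappa> f\<close> crosses the tensor sign as \<open>\<sigma> f\<close>, and
  \<open>\<iota> e\<close> is the action of \<open>e \<otimes>\<^sub>\<rat> 1\<close>.\<close>

lemma cls_smult:
 assumes v: "v \<in> carrier V"
 shows "cls [(a \<odot>\<^bsub>V\<^esub> v, 1)] = \<eta> a \<odot>\<^bsub>T\<^esub> cls [(v, 1)]"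
proof -
 obtain xs where a: "a = (\<Sum>(e, f)\<leftarrow>xs. \<iota> e * \<kappa> f)" using gen by blast
 have vT: "cls [(v, 1)] \<in> carrier T" using v by (intro cls_in_T) auto
 show ?thesis unfolding a
 proof (induction xs)
  case Nil
  show ?case using v vT eq_zero(1)
   by (simp add: cmod_zero_smult[OF cV] cmod_zero_smult[OF cmod_T]) (rule tclassI)
 next
  case (Cons ef xs)
  obtain e f where ef: "ef = (e, f)" by force
  define b where "b = (\<Sum>(e, f)\<leftarrow>xs. \<iota> e * \<kappa> f)"
  have 1: "cls [((\<iota> e * \<kappa> f) \<odot>\<^bsub>V\<^esub> v, 1)] = \<eta> (\<iota> e * \<kappa> f) \<odot>\<^bsub>T\<^esub> cls [(v, 1)]"
  proof -
   have "cls [((\<iota> e * \<kappa> f) \<odot>\<^bsub>V\<^esub> v, 1)] = cls [(\<kappa> f \<odot>\<^bsub>V\<^esub> (\<iota> e \<odot>\<^bsub>V\<^esub> v), 1)]"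
    using v by (simp add: mult.commute cmod_mult_smult[OF cV, symmetric])
   also have "\<dots> = cls [(\<iota> e \<odot>\<^bsub>V\<^esub> v, \<sigma> f * 1)]" using v by (intro tclassI eq_balanced smult_closed)
   also have "\<dots> = (e \<otimes>\<^sub>\<rat> \<sigma> f) \<odot>\<^bsub>T\<^esub> cls [(v, 1)]" using v by (simp add: smult_pure)
   also have "e \<otimes>\<^sub>\<rat> \<sigma> f = \<eta> (\<iota> e * \<kappa> f)" by (simp add: \<eta>.hom_mult \<eta>_\<iota> \<eta>_\<kappa>)
   finally show ?thesis .
  qed
  have "cls [((\<iota> e * \<kappa> f + b) \<odot>\<^bsub>V\<^esub> v, 1)] = cls ([((\<iota> e * \<kappa> f) \<odot>\<^bsub>V\<^esub> v, 1)] @ [(b \<odot>\<^bsub>V\<^esub> v, 1)])"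
   using v by (intro tclassI) (simp add: cmod_add_smult[OF cV] eq_add_left smult_closed)
  also have "\<dots> = \<eta> (\<iota> e * \<kappa> f) \<odot>\<^bsub>T\<^esub> cls [(v, 1)] \<oplus>\<^bsub>T\<^esub> \<eta> b \<odot>\<^bsub>T\<^esub> cls [(v, 1)]"
   using v 1 Cons by (subst cls_append) (auto simp: smult_closed b_def)
  also have "\<dots> = \<eta> (\<iota> e * \<kappa> f + b) \<odot>\<^bsub>T\<^esub> cls [(v, 1)]"
   using vT by (simp add: \<eta>.hom_add cmod_add_smult[OF cmod_T])
  finally show ?case by (simp add: ef b_def)
 qed
qed

lemma cls_add: "v \<in> carrier V ==> w \<in> carrier V ==> cls [(v \<oplus>\<^bsub>V\<^esub> w, z)] = cls [(v, z)] \<oplus>\<^bsub>T\<^esub> cls [(w, z)]"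
 by (subst cls_append[symmetric]) (auto intro!: tclassI eq_add_left)

lemma ev_cls:
 assumes \<phi>: "semilin \<eta> V \<phi>" and xs: "set xs \<subseteq> carrier V \<times> UNIV"
 shows "ev \<phi> (cls xs) = (\<Sum>(v, z)\<leftarrow>xs. 1 \<otimes>\<^sub>\<rat> z * \<phi> v)"
 unfolding ev_def
proof (rule teq_sum[of "restrict_scalars \<kappa> V" "field_mod \<sigma>"])
 show "teqv (trep (cls xs)) xs" using xs by (intro teq.sym[OF trep_tclass]) simp
 show "1 \<otimes>\<^sub>\<rat> b * \<phi> (r \<odot>\<^bsub>restrict_scalars \<kappa> V\<^esub> a) = 1 \<otimes>\<^sub>\<rat> (r \<odot>\<^bsub>field_mod \<sigma>\<^esub> b) * \<phi> a"
  if "a \<in> carrier (restrict_scalars \<kappa> V)" for a b r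
  using that by (simp add: semilin_smult[OF \<phi>] \<eta>_\<kappa> mult.assoc[symmetric] mult.commute[of b])
qed (simp_all add: semilin_add[OF \<phi>] semilin_zero[OF \<phi> cV] pure_add_right distrib_left distrib_right)

lemma ev_unit: "semilin \<eta> V \<phi> ==> v \<in> carrier V ==> ev \<phi> (cls [(v, 1)]) = \<phi> v"
 by (simp add: ev_cls)

lemma semilin_ev:
 assumes \<phi>: "semilin \<eta> V \<phi>"
 shows "semilin (%t. t) T (ev \<phi>)"
 unfolding semilin_def
proof (intro conjI ballI allI)
 fix x y assume "x \<in> carrier T" "y \<in> carrier T"
 then obtain xs ys where *: "x = cls xs" "y = cls ys" "set xs \<subseteq> carrier V \<times> UNIV" "set ys \<subseteq> carrier V \<times> UNIV"
  by (metis ext_elim)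
 then show "ev \<phi> (x \<oplus>\<^bsub>T\<^esub> y) = ev \<phi> x + ev \<phi> y"
  by (simp add: cls_append[symmetric] ev_cls[OF \<phi>])
next
 fix t x assume "x \<in> carrier T"
 then obtain xs where *: "x = cls xs" "set xs \<subseteq> carrier V \<times> UNIV"
  by (metis ext_elim)
 have 1: "(\<Sum>(v, z)\<leftarrow>actl es v z. 1 \<otimes>\<^sub>\<rat> z * \<phi> v) = (\<Sum>(a, b)\<leftarrow>es. a \<otimes>\<^sub>\<rat> b) * (1 \<otimes>\<^sub>\<rat> z * \<phi> v)"
  if "v \<in> carrier V" for es v z
  using that
  by (induction es) (auto simp: actl_def semilin_smult[OF \<phi>] \<eta>_\<iota> distrib_right mult.assoc[symmetric])
 have "ev \<phi> (t \<odot>\<^bsub>T\<^esub> x) = ev \<phi> (cls (acts t xs))" using * by (simp add: T_smult)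
 also have "\<dots> = (\<Sum>(v, z)\<leftarrow>acts t xs. 1 \<otimes>\<^sub>\<rat> z * \<phi> v)"
  using acts_closed[of xs t] * by (intro ev_cls \<phi>) simp
 also have "\<dots> = t * (\<Sum>(v, z)\<leftarrow>xs. 1 \<otimes>\<^sub>\<rat> z * \<phi> v)"
  using *(2) by (induction xs) (auto simp: 1 distrib_left simp flip: qtensor_rep)
 finally show "ev \<phi> (t \<odot>\<^bsub>T\<^esub> x) = t * ev \<phi> x" using * by (simp add: ev_cls[OF \<phi>])
qed

lemma semilin_unit:
 assumes \<Theta>: "semilin (%t. t) T \<Theta>"
 shows "semilin \<eta> V (%v. \<Theta> (cls [(v, 1)]))"
 unfolding semilin_def
 by (auto simp: cls_add cls_smult semilin_add[OF \<Theta>] semilin_smult[OF \<Theta>] cls_in_T)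

lemma ext_induct:
 assumes X: "X \<in> carrier T" and "P \<zero>\<^bsub>T\<^esub>"
  and "!!v t X. v \<in> carrier V ==> X \<in> carrier T ==> P X ==> P (t \<odot>\<^bsub>T\<^esub> cls [(v, 1)] \<oplus>\<^bsub>T\<^esub> X)"
 shows "P X"
proof -
 obtain xs where X: "X = cls xs" "set xs \<subseteq> carrier V \<times> UNIV" using X by (rule ext_elim)
 show ?thesis unfolding X(1) using X(2)
 proof (induction xs)
  case Nil
  then show ?case using assms(2) by simp
 next
  case (Cons x xs)
  obtain v z where x: "x = (v, z)" by force
  have "cls (x # xs) = cls [(v, z)] \<oplus>\<^bsub>T\<^esub> cls xs"
   using Cons.prems x by (subst cls_append[symmetric]) auto
  also have "cls [(v, z)] = (1 \<otimes>\<^sub>\<rat> z) \<odot>\<^bsub>T\<^esub> cls [(v, 1)]"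
   using Cons.prems x by (intro cls_smult_complex) auto
  finally show ?case using Cons x assms(3) by (auto simp: cls_in_T)
 qed
qed

text \<open>The classes v \<otimes> 1 generate the extension over \<EE> \<otimes> \<complex>, so a
  functional is known from its values on them.\<close>

lemma lin_eq:
 assumes \<Theta>: "semilin (%t. t) T \<Theta>" and \<Theta>': "semilin (%t. t) T \<Theta>'" and X: "X \<in> carrier T"
  and eq: "!!v. v \<in> carrier V ==> \<Theta> (cls [(v, 1)]) = \<Theta>' (cls [(v, 1)])"
 shows "\<Theta> X = \<Theta>' X"
 using X
proof (rule ext_induct)
 show "\<Theta> \<zero>\<^bsub>T\<^esub> = \<Theta>' \<zero>\<^bsub>T\<^esub>" using semilin_zero[OF \<Theta> cmod_T] semilin_zero[OF \<Theta>' cmod_T] by simp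
qed (simp add: semilin_add[OF \<Theta>] semilin_smult[OF \<Theta>] semilin_add[OF \<Theta>'] semilin_smult[OF \<Theta>'] eq
  cmod_smult_closed[OF cmod_T] cls_in_T del: T_simps)

end

lemma scalar_ext_betti:
 fixes V :: "('e::field_char_0, 'v) module"
 assumes "cmod V"
 shows "scalar_ext V (%e. e) of_rat of_rat (%e. e \<otimes>\<^sub>\<rat> 1)"
proof (intro scalar_ext.intro)
 show "\<exists>xs. a = (\<Sum>(e, f)\<leftarrow>xs. e * of_rat f)" for a :: 'e
  by (rule exI[of _ "[(a, 1)]"]) simp
 show "comm_ring_hom (%e::'e. e)" by unfold_locales simp_all
 show "of_rat r \<otimes>\<^sub>\<rat> 1 = 1 \<otimes>\<^sub>\<rat> of_rat r" for r using pure_of_rat[of r 1] by simp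
qed (simp_all add: assms comm_ring_hom_of_rat field_hom_of_rat_hom comm_ring_hom_left)

lemma scalar_ext_derham:
 fixes H :: "(('e::field_char_0, 'f::field_char_0) qtensor, 'd) module"
 assumes "cmod H" "field_hom \<sigma>"
 shows "scalar_ext H (%e. e \<otimes>\<^sub>\<rat> 1) (%x. 1 \<otimes>\<^sub>\<rat> x) \<sigma> (map_right \<sigma>)"
proof (intro scalar_ext.intro)
 show "\<exists>xs. a = (\<Sum>(e, f)\<leftarrow>xs. (e \<otimes>\<^sub>\<rat> 1) * (1 \<otimes>\<^sub>\<rat> f))" for a :: "('e, 'f) qtensor"
  by (rule exI[of _ "rep_qtensor a"]) (simp flip: qtensor_rep)
 interpret field_hom \<sigma> by fact
 show "map_right \<sigma> (e \<otimes>\<^sub>\<rat> 1) = e \<otimes>\<^sub>\<rat> 1" for e :: 'e by (simp add: map_right_pure assms)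
qed (auto simp: assms comm_ring_hom_left comm_ring_hom_right comm_ring_hom_map_right map_right_pure pure_of_rat)

lemma betti_ext_conv:
 assumes "cmod V"
 shows "betti_ext V = tensor_mod (restrict_scalars of_rat V) (field_mod of_rat)
  (%t. scalar_ext.actl V (%e. e) (rep_qtensor t))"
 unfolding betti_ext_def
 by (intro arg_cong[where f = "tensor_mod _ _"] ext) (simp add: scalar_ext.actl_def[OF scalar_ext_betti[OF assms]])

lemma derham_ext_conv:
 assumes "cmod H" "field_hom \<sigma>"
 shows "derham_ext \<sigma> H = tensor_mod (restrict_scalars (%x. 1 \<otimes>\<^sub>\<rat> x) H) (field_mod \<sigma>)
  (%t. scalar_ext.actl H (%e. e \<otimes>\<^sub>\<rat> 1) (rep_qtensor t))"
 unfolding derham_ext_def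
 by (intro arg_cong[where f = "tensor_mod _ _"] ext) (simp add: scalar_ext.actl_def[OF scalar_ext_derham[OF assms]])

section \<open>Coordinates with respect to a finite basis\<close>

definition lc :: "('r::comm_ring_1, 'a) module => 'i set => ('i => 'r) => ('i => 'a) => 'a" where
 "lc M I a b = (\<Oplus>\<^bsub>M\<^esub>i\<in>I. a i \<odot>\<^bsub>M\<^esub> b i)"

context
 fixes M :: "('r::comm_ring_1, 'a) module" and I :: "'i set" and b :: "'i => 'a"
 assumes M: "cmod M" and b: "!!i. i \<in> I ==> b i \<in> carrier M"
begin

interpretation M: Module.module class_ring M by (rule M)

lemma lc_closed: "lc M I a b \<in> carrier M"
 unfolding lc_def by (intro M.finsum_closed) (auto simp: b cmod_smult_closed[OF M])

lemma lc_add: "lc M I (%i. a i + a' i) b = lc M I a b \<oplus>\<^bsub>M\<^esub> lc M I a' b"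
proof -
 have "lc M I (%i. a i + a' i) b = (\<Oplus>\<^bsub>M\<^esub>i\<in>I. a i \<odot>\<^bsub>M\<^esub> b i \<oplus>\<^bsub>M\<^esub> a' i \<odot>\<^bsub>M\<^esub> b i)"
  unfolding lc_def by (intro M.finsum_cong') (auto simp: b cmodD[OF M])
 also have "\<dots> = lc M I a b \<oplus>\<^bsub>M\<^esub> lc M I a' b"
  unfolding lc_def by (intro M.finsum_addf) (auto simp: b cmodD[OF M])
 finally show ?thesis .
qed

lemma lc_smult:
 assumes "finite I"
 shows "lc M I (%i. r * a i) b = r \<odot>\<^bsub>M\<^esub> lc M I a b"
proof -
 have "lc M I (%i. r * a i) b = (\<Oplus>\<^bsub>M\<^esub>i\<in>I. r \<odot>\<^bsub>M\<^esub> (a i \<odot>\<^bsub>M\<^esub> b i))"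
  unfolding lc_def by (intro M.finsum_cong') (auto simp: b cmodD[OF M])
 also have "\<dots> = r \<odot>\<^bsub>M\<^esub> lc M I a b"
  unfolding lc_def using assms by (intro M.finsum_smult_ldistr[symmetric]) (auto simp: b cmodD[OF M])
 finally show ?thesis .
qed

lemma lc_cong: "(!!i. i \<in> I ==> a i = a' i) ==> lc M I a b = lc M I a' b"
 unfolding lc_def by (intro M.finsum_cong') (auto simp: b cmodD[OF M])

lemma lc_subset:
 assumes "finite I" "J \<subseteq> I" "!!i. i \<in> I - J ==> a i = 0"
 shows "lc M I a b = lc M J a b"
proof -
 have "comm_monoid (add_monoid M)"
  by (rule comm_group.axioms(1)[OF abelian_group.a_comm_group[OF cmod_abelian_group[OF M]]])
 from comm_monoid.finprod_mono_neutral_cong_left[OF this assms(1,2),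
   of "%i. a i \<odot>\<^bsub>M\<^esub> b i" "%i. a i \<odot>\<^bsub>M\<^esub> b i"]
 show ?thesis using assms(3) by (auto simp: lc_def finsum_def b cmodD[OF M])
qed

lemma lc_delta:
 assumes "finite I" "j \<in> I"
 shows "lc M I (%i. if i = j then 1 else 0) b = b j"
proof -
 have "lc M I (%i. if i = j then 1 else 0) b = lc M {j} (%i. if i = j then 1 else 0) b"
  using assms by (intro lc_subset) auto
 then show ?thesis using assms by (simp add: lc_def b cmodD[OF M])
qed

lemma lc_zero: "lc M I (%i. 0) b = \<zero>\<^bsub>M\<^esub>"
proof -
 have "lc M I (%i. 0) b = (\<Oplus>\<^bsub>M\<^esub>i\<in>I. \<zero>\<^bsub>M\<^esub>)"
  unfolding lc_def by (intro M.finsum_cong') (auto simp: b cmodD[OF M])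
 then show ?thesis by simp
qed

lemma semilin_lc: "semilin \<eta> M \<phi> ==> \<phi> (lc M I a b) = (\<Sum>i\<in>I. \<eta> (a i) * \<phi> (b i))"
 unfolding lc_def by (subst semilin_finsum[OF _ M]) (auto simp: b cmodD[OF M] semilin_smult)

end

lemma lc_reindex:
 assumes M: "cmod M" and h: "bij_betw h J I" and b: "!!i. i \<in> I ==> b i \<in> carrier M"
 shows "lc M I a b = lc M J (%j. a (h j)) (%j. b (h j))"
proof -
 interpret M: Module.module class_ring M by (rule M)
 show ?thesis using h b unfolding lc_def bij_betw_def
  by (auto simp: M.finsum_reindex cmodD[OF M] image_subset_iff Pi_def)
qed

text \<open>A finite basis with an arbitrary index set, carried together with its dual basis of
  coordinates, so that statements about bases become identities between matrices.\<close>

definition frame :: "('r::comm_ring_1, 'a) module => 'i set => ('i => 'a) => ('a => 'i => 'r) => bool" where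
 "frame M I b c \<longleftrightarrow> cmod M \<and> finite I \<and> (\<forall>i\<in>I. b i \<in> carrier M) \<and>
   (\<forall>i\<in>I. semilin (%r. r) M (%x. c x i)) \<and>
   (\<forall>i\<in>I. \<forall>j\<in>I. c (b j) i = (if i = j then 1 else 0)) \<and>
   (\<forall>x\<in>carrier M. x = lc M I (c x) b)"

lemma frameD:
 assumes "frame M I b c"
 shows frame_cmod: "cmod M" and frame_finite: "finite I"
  and frame_closed: "!!i. i \<in> I ==> b i \<in> carrier M"
  and frame_coord: "!!i. i \<in> I ==> semilin (%r. r) M (%x. c x i)"
  and frame_delta: "!!i j. i \<in> I ==> j \<in> I ==> c (b j) i = (if i = j then 1 else 0)"
  and frame_expand: "!!x. x \<in> carrier M ==> x = lc M I (c x) b"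
 using assms by (auto simp: frame_def)

lemma frame_semilin:
 assumes "frame M I b c" "semilin \<eta> M \<phi>" "x \<in> carrier M"
 shows "\<phi> x = (\<Sum>i\<in>I. \<eta> (c x i) * \<phi> (b i))"
 by (subst frame_expand[OF assms(1,3)])
  (rule semilin_lc[OF frame_cmod[OF assms(1)] frame_closed[OF assms(1)] assms(2)])

text \<open>Expanding one basis in the other and back gives two matrices with product 1.\<close>

lemma frame_card_le:
 assumes "frame M I b c" "frame M J b' c'"
 shows "card I \<le> card J"
proof (rule left_inverse_card_le)
 fix i k assume "i \<in> I" "k \<in> I"
 then have "(\<Sum>j\<in>J. c' (b k) j * c (b' j) i) = (if i = k then 1 else 0)"
  using frame_semilin[OF assms(2) frame_coord[OF assms(1)], of i "b k"] frame_closed[OF assms(1)]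
   frame_delta[OF assms(1)] by simp
 then show "(\<Sum>j\<in>J. c (b' j) i * c' (b k) j) = (if i = k then 1 else 0)" by (simp add: mult.commute)
qed (use assms in \<open>auto simp: frame_finite\<close>)

lemma frame_card: "frame M I b c ==> frame M J b' c' ==> card I = card J"
 by (intro antisym frame_card_le)

lemma frame_reindex:
 assumes f: "frame M I b c" and h: "bij_betw h J I"
 shows "frame M J (%j. b (h j)) (%x j. c x (h j))"
proof -
 have inj: "h i = h j \<longleftrightarrow> i = j" if "i \<in> J" "j \<in> J" for i j
  using h that by (auto simp: bij_betw_def inj_on_def)
 have hI: "h j \<in> I" if "j \<in> J" for j using h that by (auto simp: bij_betw_def)
 have "finite J" using bij_betw_finite[OF h] frame_finite[OF f] by simp
 moreover have "x = lc M J (%j. c x (h j)) (%j. b (h j))" if "x \<in> carrier M" for x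
  using frame_expand[OF f that] lc_reindex[OF frame_cmod[OF f] h frame_closed[OF f], where a = "c x"] by simp
 ultimately show ?thesis using frameD(1-5)[OF f] by (simp add: frame_def hI inj)
qed

text \<open>Existence of expansions selects coordinates; uniqueness makes them linear and dual to
  the basis.\<close>

lemma frameI_unique:
 assumes M: "cmod M" and fin: "finite I" and b: "!!i. i \<in> I ==> b i \<in> carrier M"
  and ex: "!!x. x \<in> carrier M ==> \<exists>a. x = lc M I a b"
  and uniq: "!!a a'. lc M I a b = lc M I a' b ==> \<forall>i\<in>I. a i = a' i"
 shows "\<exists>c. frame M I b c"
proof -
 obtain c where c: "!!x. x \<in> carrier M ==> x = lc M I (c x) b" using ex by metis
 note cl = lc_closed[OF M b]
 have cu: "c x i = a i" if "x = lc M I a b" "i \<in> I" for x a i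
  using uniq[of "c x" a] c[of x] cl[where a = a] that by auto
 have "frame M I b c" unfolding frame_def semilin_def
 proof (intro conjI ballI allI)
  fix i x y assume i: "i \<in> I" and xy: "x \<in> carrier M" "y \<in> carrier M"
  have "x \<oplus>\<^bsub>M\<^esub> y = lc M I (%i. c x i + c y i) b"
   using c[OF xy(1)] c[OF xy(2)] by (simp add: lc_add[OF M b])
  then show "c (x \<oplus>\<^bsub>M\<^esub> y) i = c x i + c y i" using cu[OF _ i] by simp
 next
  fix i x r assume i: "i \<in> I" and xy: "x \<in> carrier M"
  have "r \<odot>\<^bsub>M\<^esub> x = lc M I (%i. r * c x i) b"
   using c[OF xy(1)] by (simp add: lc_smult[OF M b fin])
  then show "c (r \<odot>\<^bsub>M\<^esub> x) i = r * c x i" using cu[OF _ i] by simp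
 next
  fix i j assume i: "i \<in> I" and j: "j \<in> I"
  have "b j = lc M I (%i. if i = j then 1 else 0) b" by (simp add: lc_delta[OF M b fin j])
  then show "c (b j) i = (if i = j then 1 else 0)" by (rule cu[OF _ i])
 qed (use M fin b c in auto)
 then show ?thesis by blast
qed

lemma frame_unique:
 assumes f: "frame M I b c" and eq: "lc M I a b = lc M I a' b"
 shows "\<forall>i\<in>I. a i = a' i"
proof
 fix i assume i: "i \<in> I"
 have "c (lc M I a b) i = a i" for a
  using semilin_lc[OF frame_cmod[OF f] frame_closed[OF f] frame_coord[OF f i], where a = a] i
  by (simp add: frame_delta[OF f] if_distrib[of "%x. _ * x"] frame_finite[OF f] cong: if_cong)
 then show "a i = a' i" using eq by metis
qed

lemma is_basis_frame:
 fixes M :: "('r::comm_ring_1, 'a) module"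
 assumes M: "cmod M" and bs: "is_basis M bs"
 shows "\<exists>c. frame M {..<length bs} ((!) bs) c"
proof (rule frameI_unique[OF M])
 define n where "n = length bs"
 have lst: "(\<Oplus>\<^bsub>M\<^esub>i\<in>{..<length bs}. c ! i \<odot>\<^bsub>M\<^esub> bs ! i) = lc M {..<length bs} ((!) c) ((!) bs)" for c
  by (simp add: lc_def)
 show b: "bs ! i \<in> carrier M" if "i \<in> {..<length bs}" for i
  using bs that by (auto simp: is_basis_def)
 show "\<exists>a. x = lc M {..<length bs} a ((!) bs)" if "x \<in> carrier M" for x
  using bs that by (auto simp: is_basis_def lst)
 show "\<forall>i\<in>{..<length bs}. a i = a' i"
  if eq: "lc M {..<length bs} a ((!) bs) = lc M {..<length bs} a' ((!) bs)" for a a'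
 proof -
  \<comment> \<open>\<open>is_basis\<close> speaks of lists of coefficients; a function on the
    indices is compared with it through the list of its values.\<close>
  define l where "l a = map a [0..<n]" for a :: "nat => 'r"
  have "lc M {..<length bs} ((!) (l a)) ((!) bs) = lc M {..<length bs} a ((!) bs)" for a
   by (intro lc_cong[OF M b]) (auto simp: l_def n_def)
  then have "lc M {..<length bs} ((!) (l a)) ((!) bs) = lc M {..<length bs} ((!) (l a')) ((!) bs)"
   using eq by simp
  moreover have "lc M {..<length bs} ((!) (l a)) ((!) bs) \<in> carrier M" by (rule lc_closed[OF M b])
  moreover have "length (l a) = length bs" "length (l a') = length bs" by (simp_all add: l_def n_def)
  ultimately have "l a = l a'" using bs unfolding is_basis_def lst by metis
  then have "l a ! i = l a' ! i" for i by simp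
  then have "a i = a' i" if "i < n" for i using that by (metis add_0 l_def nth_map_upt diff_zero)
  then show ?thesis by (simp add: n_def)
 qed
qed simp

lemma frame_is_basis:
 fixes M :: "('r::comm_ring_1, 'a) module"
 assumes f: "frame M {..<n} b c"
 shows "is_basis M (map b [0..<n])"
 unfolding is_basis_def
proof (intro conjI ballI)
 note M = frame_cmod[OF f] and b = frame_closed[OF f]
 show "set (map b [0..<n]) \<subseteq> carrier M" using b by auto
 fix x assume x: "x \<in> carrier M"
 have lst: "(\<Oplus>\<^bsub>M\<^esub>i\<in>{..<length (map b [0..<n])}. c ! i \<odot>\<^bsub>M\<^esub> map b [0..<n] ! i) = lc M {..<n} ((!) c) b" for c
 proof -
  interpret M: Module.module class_ring M by (rule M)
  show ?thesis unfolding lc_def by (intro M.finsum_cong') (auto simp: b cmodD[OF M])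
 qed
 show "\<exists>!a. length a = length (map b [0..<n]) \<and>
   x = (\<Oplus>\<^bsub>M\<^esub>i\<in>{..<length (map b [0..<n])}. a ! i \<odot>\<^bsub>M\<^esub> map b [0..<n] ! i)"
  unfolding lst
 proof (rule ex1I)
  have "x = lc M {..<n} (c x) b" by (rule frame_expand[OF f x])
  also have "\<dots> = lc M {..<n} ((!) (map (c x) [0..<n])) b" by (intro lc_cong[OF M b]) auto
  finally show "length (map (c x) [0..<n]) = length (map b [0..<n]) \<and>
    x = lc M {..<n} ((!) (map (c x) [0..<n])) b" by simp
  then show "a = map (c x) [0..<n]" if "length a = length (map b [0..<n]) \<and> x = lc M {..<n} ((!) a) b" for a
   using frame_unique[OF f, of "(!) a" "(!) (map (c x) [0..<n])"] that
   by (intro nth_equalityI) auto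
 qed
qed

lemma frame_enum_basis:
 assumes f: "frame M I b c"
 shows "is_basis M (map (%i. b (enum I i)) [0..<card I])"
 by (rule frame_is_basis[OF frame_reindex[OF f bij_enum[OF frame_finite[OF f]]]])

lemma frame_has_rank: "frame M I b c ==> has_rank M n \<longleftrightarrow> n = card I"
 using frame_enum_basis[of M I b c] is_basis_frame[OF frame_cmod[of M I b c]] frame_card[of M I b c]
 unfolding has_rank_def by fastforce

lemma has_rank_frame:
 assumes "cmod M" "has_rank M n"
 obtains b c where "frame M {..<n} b c"
 using assms is_basis_frame unfolding has_rank_def by blast

text \<open>Over a field a spanning subfamily with the fewest members is a basis. It supplies bases
  of the eigenspaces of complex conjugation and of \<FF> over the rationals.\<close>

lemma spanning_subframe:
 fixes M :: "('r::field, 'a) module"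
 assumes M: "cmod M" and K: "finite K" and u: "!!k. k \<in> K ==> u k \<in> carrier M"
  and span: "!!x. x \<in> carrier M ==> \<exists>a. x = lc M K a u"
 shows "\<exists>J c. J \<subseteq> K \<and> frame M J u c"
proof -
 interpret M: Module.module class_ring M by (rule M)
 define S where "S J \<longleftrightarrow> J \<subseteq> K \<and> (\<forall>x\<in>carrier M. \<exists>a. x = lc M J a u)" for J
 have "S K" using span by (simp add: S_def)
 then obtain J where J: "S J" "!!J'. S J' ==> card J \<le> card J'"
  using ex_has_least_nat[of S K card] by blast
 have JK: "J \<subseteq> K" and fJ: "finite J" and sp: "!!x. x \<in> carrier M ==> \<exists>a. x = lc M J a u"
  using J(1) K finite_subset by (auto simp: S_def)
 have uJ: "u k \<in> carrier M" if "k \<in> J" for k using that JK u by auto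
 have indep: "a j = 0" if 0: "lc M J a u = \<zero>\<^bsub>M\<^esub>" and j: "j \<in> J" for a j
 proof (rule ccontr)
  assume aj: "a j \<noteq> 0"
  have "S (J - {j})" unfolding S_def
  proof (intro conjI ballI)
   fix x assume "x \<in> carrier M"
   then obtain d where x: "x = lc M J d u" using sp by blast
   \<comment> \<open>The multiple of the relation that cancels the coefficient at \<open>j\<close>,
     so that \<open>j\<close> could be dropped.\<close>
   define e where "e = (%k. d k + (- d j / a j) * a k)"
   have "lc M J e u = lc M J d u \<oplus>\<^bsub>M\<^esub> (- d j / a j) \<odot>\<^bsub>M\<^esub> lc M J a u"
    using lc_add[of M J u d "%k. (- d j / a j) * a k"] lc_smult[of M J u "- d j / a j" a] M uJ fJ
    by (simp only: e_def)
   also have "\<dots> = x" using lc_closed[OF M uJ, where a = d] by (simp add: 0 cmodD[OF M] x)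
   finally have "x = lc M J e u" ..
   also have "\<dots> = lc M (J - {j}) e u" using aj j fJ
    by (intro lc_subset[OF M uJ]) (auto simp: e_def)
   finally show "\<exists>a. x = lc M (J - {j}) a u" by (rule exI[of _ e])
  qed (use JK in auto)
  from J(2)[OF this] card_Diff1_less[OF fJ j] show False by simp
 qed
 have "\<exists>c. frame M J u c"
 proof (rule frameI_unique[OF M fJ uJ sp])
  fix a a' assume eq: "lc M J a u = lc M J a' u"
  have "lc M J (%i. a i + (- 1) * a' i) u = lc M J a u \<oplus>\<^bsub>M\<^esub> (- 1) \<odot>\<^bsub>M\<^esub> lc M J a' u"
   using lc_add[of M J u a "%k. (- 1) * a' k"] lc_smult[of M J u "- 1" a'] M uJ fJ
   by (simp only:)
  also have "\<dots> = \<zero>\<^bsub>M\<^esub>"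
   using lc_closed[OF M uJ, where a = a'] by (simp add: eq cmod_minus_smult[OF M] M.r_neg)
  finally show "\<forall>i\<in>J. a i = a' i" using indep by fastforce
 qed auto
 then show ?thesis using JK by blast
qed

section \<open>Quotient modules\<close>

context
 fixes D :: "('r::comm_ring_1, 'd) module" and F
 assumes D: "cmod D" and F: "LinearCombinations.submodule class_ring F D"
begin

interpretation D: Module.module class_ring D by (rule D)

lemma sub_closed: "F \<subseteq> carrier D" "\<zero>\<^bsub>D\<^esub> \<in> F" "x \<in> F ==> y \<in> F ==> x \<oplus>\<^bsub>D\<^esub> y \<in> F" "x \<in> F ==> r \<odot>\<^bsub>D\<^esub> x \<in> F"
 using F by (auto simp: LinearCombinations.submodule_def)

lemma sub_uminus: "x \<in> F ==> \<ominus>\<^bsub>D\<^esub> x \<in> F"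
 using sub_closed(4)[of x "- 1"] sub_closed(1) by (simp add: cmod_minus_smult[OF D] subset_iff)

lemma abelian_subgroup_sub: "abelian_subgroup F D"
proof (rule abelian_subgroupI3)
 have "subgroup F (add_monoid D)"
  using sub_closed sub_uminus
  by (intro D.add.subgroupI) (auto simp: a_inv_def[symmetric])
 then show "additive_subgroup F D" by (rule additive_subgroup.intro)
qed (rule cmod_abelian_group[OF D])

interpretation F: abelian_subgroup F D by (rule abelian_subgroup_sub)

lemma quot_mod_simps: "zero (quot_mod D F) = F" "add (quot_mod D F) = set_add D"
 by (simp_all add: quot_mod_def)

lemma quot_carrier: "X \<in> carrier (quot_mod D F) \<longleftrightarrow> (\<exists>x\<in>carrier D. X = F +>\<^bsub>D\<^esub> x)"
 by (auto simp: quot_mod_def A_RCOSETS_def' )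

lemma coset_in_quot: "x \<in> carrier D ==> F +>\<^bsub>D\<^esub> x \<in> carrier (quot_mod D F)"
 by (auto simp: quot_carrier)

lemma quot_add: "x \<in> carrier D ==> y \<in> carrier D ==>
  (F +>\<^bsub>D\<^esub> x) \<oplus>\<^bsub>quot_mod D F\<^esub> (F +>\<^bsub>D\<^esub> y) = F +>\<^bsub>D\<^esub> (x \<oplus>\<^bsub>D\<^esub> y)"
 by (simp add: quot_mod_simps F.a_rcos_sum)

lemma coset_eqI:
 assumes "f \<in> F" "x \<in> carrier D"
 shows "F +>\<^bsub>D\<^esub> (f \<oplus>\<^bsub>D\<^esub> x) = F +>\<^bsub>D\<^esub> x"
proof -
 have "f \<oplus>\<^bsub>D\<^esub> x \<in> F +>\<^bsub>D\<^esub> x" using assms by (auto simp: a_r_coset_def')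
 from F.a_repr_independence'[OF this assms(2)] show ?thesis ..
qed

text \<open>All members of the union that defines the action on a coset are the same coset.\<close>

lemma quot_smult: 
 assumes "x \<in> carrier D"
 shows "r \<odot>\<^bsub>quot_mod D F\<^esub> (F +>\<^bsub>D\<^esub> x) = F +>\<^bsub>D\<^esub> (r \<odot>\<^bsub>D\<^esub> x)"
proof -
 have "F +>\<^bsub>D\<^esub> (r \<odot>\<^bsub>D\<^esub> y) = F +>\<^bsub>D\<^esub> (r \<odot>\<^bsub>D\<^esub> x)" if y: "y \<in> F +>\<^bsub>D\<^esub> x" for y
 proof -
  obtain f where f: "f \<in> F" "y = f \<oplus>\<^bsub>D\<^esub> x" using y by (auto simp: a_r_coset_def')
  then have "r \<odot>\<^bsub>D\<^esub> y = r \<odot>\<^bsub>D\<^esub> f \<oplus>\<^bsub>D\<^esub> r \<odot>\<^bsub>D\<^esub> x"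
   using assms sub_closed(1) by (simp add: cmodD[OF D] subset_iff)
  then show ?thesis using f assms by (simp add: coset_eqI sub_closed(4) cmod_smult_closed[OF D])
 qed
 then have "(\<Union>y\<in>F +>\<^bsub>D\<^esub> x. F +>\<^bsub>D\<^esub> (r \<odot>\<^bsub>D\<^esub> y)) = (\<Union>y\<in>F +>\<^bsub>D\<^esub> x. F +>\<^bsub>D\<^esub> (r \<odot>\<^bsub>D\<^esub> x))" by auto
 also have "\<dots> = F +>\<^bsub>D\<^esub> (r \<odot>\<^bsub>D\<^esub> x)" using F.a_rcos_self[OF assms] by auto
 finally show ?thesis by (simp add: quot_mod_def)
qed

lemma coset_zero: "f \<in> F ==> F +>\<^bsub>D\<^esub> f = F"
 by (rule F.a_rcos_const)

lemma cmod_quot: "cmod (quot_mod D F)"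
proof (rule cmodI, goal_cases)
 case (1 x y)
 then show ?case by (auto simp: quot_carrier quot_add intro!: bexI[of _ "_ \<oplus>\<^bsub>D\<^esub> _"])
next
 case 2
 show ?case using coset_zero[OF sub_closed(2)] by (auto simp: quot_carrier quot_mod_simps)
next
 case (3 x y z)
 then show ?case by (auto simp: quot_carrier quot_add D.a_assoc)
next
 case (4 x y)
 then show ?case by (auto simp: quot_carrier quot_add D.a_comm)
next
 case (5 x)
 then obtain y where "x = F +>\<^bsub>D\<^esub> y" "y \<in> carrier D" by (auto simp: quot_carrier)
 then show ?case using quot_add[of "\<zero>\<^bsub>D\<^esub>" y] coset_zero[OF sub_closed(2)]
  by (simp add: quot_mod_simps(1))
next
 case (6 x)
 then obtain y where y: "x = F +>\<^bsub>D\<^esub> y" "y \<in> carrier D" by (auto simp: quot_carrier)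
 then have "(F +>\<^bsub>D\<^esub> (\<ominus>\<^bsub>D\<^esub> y)) \<oplus>\<^bsub>quot_mod D F\<^esub> x = F" using quot_add[of "\<ominus>\<^bsub>D\<^esub> y" y] coset_zero[OF sub_closed(2)]
  by (simp add: D.l_neg)
 then show ?case using y by (intro bexI[of _ "F +>\<^bsub>D\<^esub> (\<ominus>\<^bsub>D\<^esub> y)"] coset_in_quot) (auto simp: quot_mod_simps(1))
qed (auto simp: quot_carrier quot_smult quot_add cmodD[OF D])

lemma semilin_quot:
 assumes "semilin \<eta> (quot_mod D F) \<psi>"
 shows "semilin \<eta> D (%h. \<psi> (F +>\<^bsub>D\<^esub> h))" "f \<in> F ==> \<psi> (F +>\<^bsub>D\<^esub> f) = 0"
 using semilin_add[OF assms] semilin_smult[OF assms] semilin_zero[OF assms cmod_quot]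
 by (auto simp: semilin_def coset_in_quot quot_add[symmetric] quot_smult[symmetric] coset_zero quot_mod_simps(1))

lemma semilin_quot_lift:
 assumes \<phi>: "semilin \<eta> D \<phi>" and 0: "!!f. f \<in> F ==> \<phi> f = 0"
 obtains \<psi> where "semilin \<eta> (quot_mod D F) \<psi>" "!!h. h \<in> carrier D ==> \<psi> (F +>\<^bsub>D\<^esub> h) = \<phi> h"
proof -
 define \<psi> where "\<psi> X = \<phi> (SOME h. h \<in> X)" for X
 have \<psi>: "\<psi> (F +>\<^bsub>D\<^esub> h) = \<phi> h" if h: "h \<in> carrier D" for h
 proof -
  have "(SOME y. y \<in> F +>\<^bsub>D\<^esub> h) \<in> F +>\<^bsub>D\<^esub> h" using F.a_rcos_self[OF h] by (rule someI)
  then obtain f where "f \<in> F" "(SOME y. y \<in> F +>\<^bsub>D\<^esub> h) = f \<oplus>\<^bsub>D\<^esub> h" by (auto simp: a_r_coset_def')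
  then show ?thesis using h sub_closed(1) by (simp add: \<psi>_def semilin_add[OF \<phi>] 0 subset_iff)
 qed
 moreover have "semilin \<eta> (quot_mod D F) \<psi>"
  unfolding semilin_def using semilin_add[OF \<phi>] semilin_smult[OF \<phi>]
  by (auto simp: quot_carrier quot_add quot_smult \<psi> cmodD[OF D])
 ultimately show thesis using that by blast
qed

end

section \<open>The idempotents of \<open>\<FF> \<otimes> \<complex>\<close>\<close>

text \<open>
 Multiplication by \<open>\<alpha> \<in> \<FF>\<close> on \<open>\<FF> \<otimes> \<complex>\<close> is annihilated by a polynomial with distinct complex roots, so
 \<open>1\<close> is a sum of simultaneous eigenvectors of \<open>\<FF>\<close>; the eigenvalue systems are the embeddings of \<open>\<FF>\<close>.
\<close>

lemma number_field_annihilator: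
 fixes \<alpha> :: "'f::field_char_0"
 assumes "number_field TYPE('f)"
 shows "\<exists>p::rat poly. p \<noteq> 0 \<and> poly (map_poly of_rat p) \<alpha> = 0"
proof -
 obtain B :: "'f set" where B: "finite B" "!!x. \<exists>c. x = (\<Sum>b\<in>B. of_rat (c b) * b)"
  using assms by (auto simp: number_field_def)
 interpret vs: vector_space "%r (x::'f). of_rat r * x"
  by unfold_locales (auto simp: algebra_simps of_rat_add of_rat_mult)
 define n where "n = card B"
 have ev: "poly (map_poly of_rat (\<Sum>i\<le>n. Polynomial.monom (a i) i)) \<alpha> = (\<Sum>i\<le>n. of_rat (a i) * \<alpha> ^ i)" for a
 proof -
  interpret map_poly_comm_ring_hom "of_rat :: rat => 'f"
   by (intro map_poly_comm_ring_hom.intro comm_ring_hom_of_rat)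
  show ?thesis by (simp add: hom_distribs poly_sum poly_monom)
 qed
 have nz: "(\<Sum>i\<le>n. Polynomial.monom (a i) i) \<noteq> 0" if "j \<le> n" "a j \<noteq> 0" for a :: "nat => rat" and j
 proof
  assume "(\<Sum>i\<le>n. Polynomial.monom (a i) i) = 0"
  then have "Polynomial.coeff (\<Sum>i\<le>n. Polynomial.monom (a i) i) j = 0" by simp
  then show False using that by (simp add: coeff_sum)
 qed
 show ?thesis
 \<comment> \<open>If two of the powers up to the exponent n coincide, their difference is a
   relation; otherwise n + 1 distinct elements of a space spanned by n elements are
   dependent.\<close>
 proof (cases "inj_on (%i. \<alpha> ^ i) {..n}")
  case False
  then obtain i j where ij: "i \<le> n" "j \<le> n" "i \<noteq> j" "\<alpha> ^ i = \<alpha> ^ j" by (auto simp: inj_on_def)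
  define a :: "nat => rat" where "a k = (if k = i then 1 else if k = j then - 1 else 0)" for k
  have "(\<Sum>k\<le>n. of_rat (a k) * \<alpha> ^ k) = (\<Sum>k\<in>{i, j}. of_rat (a k) * \<alpha> ^ k)"
   using ij by (intro sum.mono_neutral_right) (auto simp: a_def)
  also have "\<dots> = 0" using ij by (simp add: a_def)
  finally show ?thesis using ev[of a] nz[of i a] ij by (auto simp: a_def)
 next
  case True
  define S where "S = (%i. \<alpha> ^ i) ` {..n}"
  have "S \<subseteq> vs.span B"
  proof
   fix x
   obtain c where "x = (\<Sum>b\<in>B. of_rat (c b) * b)" using B(2) by blast
   then show "x \<in> vs.span B" by (auto intro: vs.span_sum vs.span_scale vs.span_base)
  qed
  moreover have "card S = Suc n" using True by (simp add: S_def card_image)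
  ultimately have "vs.dependent S" using vs.independent_span_bound[OF B(1), of S] by (auto simp: n_def)
  then obtain u v where u: "v \<in> S" "u v \<noteq> 0" "(\<Sum>v\<in>S. of_rat (u v) * v) = 0"
   using vs.dependent_finite[of S] by (auto simp: S_def)
  then obtain j where "j \<le> n" "v = \<alpha> ^ j" by (auto simp: S_def)
  moreover have "(\<Sum>i\<le>n. of_rat (u (\<alpha> ^ i)) * \<alpha> ^ i) = 0"
   using u(3) unfolding S_def sum.reindex[OF True] by simp
  ultimately show ?thesis using ev[of "%i. u (\<alpha> ^ i)"] nz[of j "%i. u (\<alpha> ^ i)"] u(2) by auto
 qed
qed

text \<open>An annihilator \<open>p\<close> of least degree is separable: its gcd with the
  derivative has smaller degree, so it does not kill \<alpha>, the cofactor does, and minimality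
  makes the gcd constant. The Bezout relation then excludes a common complex root of
  \<open>p\<close> and its derivative.\<close>

lemma squarefree_annihilator:
 fixes \<alpha> :: "'f::field_char_0"
 assumes "number_field TYPE('f)"
 shows "\<exists>p::rat poly. poly (map_poly of_rat p) \<alpha> = 0 \<and> rsquarefree (map_poly of_rat p :: complex poly)"
proof -
 interpret f: map_poly_comm_ring_hom "of_rat :: rat => 'f"
  by (intro map_poly_comm_ring_hom.intro comm_ring_hom_of_rat)
 interpret c: field_hom "of_rat :: rat => complex" by (rule field_hom_of_rat_hom)
 interpret fc: map_poly_comm_ring_hom "of_rat :: rat => complex" ..
 define A where "A p \<longleftrightarrow> p \<noteq> 0 \<and> poly (map_poly of_rat p) \<alpha> = 0" for p :: "rat poly"
 obtain p where p: "A p" "!!q. A q ==> degree p \<le> degree q"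
  using number_field_annihilator[OF assms, of \<alpha>] ex_has_least_nat[of A _ degree] by (auto simp: A_def)
 define g where "g = gcd p (pderiv p)"
 obtain k where k: "p = g * k" by (metis dvdE gcd_dvd1 g_def)
 have g0: "g \<noteq> 0" "k \<noteq> 0" "p \<noteq> 0" using p(1) k by (auto simp: A_def)
 have deg: "degree p = degree g + degree k" using g0 k by (simp add: degree_mult_eq)
 have "degree p \<noteq> 0"
 proof
  assume "degree p = 0"
  then obtain a where "p = [:a:]" by (rule degree_eq_zeroE)
  then show False using p(1) by (auto simp: A_def hom_distribs)
 qed
 then have "degree g < degree p"
  using dvd_imp_degree_le[of g "pderiv p"] g_def degree_pderiv[of p] pderiv_eq_0_iff[of p] by auto
 then have "\<not> A g" using p(2)[of g] by auto
 moreover have "A g \<or> A k" using p(1) k g0 by (auto simp: A_def f.hom_mult)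
 ultimately have "A k" by simp
 then have "degree g = 0" using p(2)[of k] deg by simp
 then obtain a where a: "g = [:a:]" "a \<noteq> 0" using g0 by (metis degree_eq_zeroE pCons_0_0)
 obtain u v where uv: "u * p + v * pderiv p = g"
  unfolding g_def by (metis bezout_coefficients_fst_snd)
 have "rsquarefree (map_poly of_rat p :: complex poly)"
  unfolding rsquarefree_roots
 proof (intro allI notI, elim conjE)
  fix z :: complex
  assume z: "poly (map_poly of_rat p) z = 0" "poly (pderiv (map_poly of_rat p)) z = 0"
  have "map_poly of_rat (u * p + v * pderiv p) = (map_poly of_rat g :: complex poly)" by (simp add: uv)
  then have "poly (map_poly of_rat u * map_poly of_rat p + map_poly of_rat v * pderiv (map_poly of_rat p)) z =
   (of_rat a :: complex)"
   unfolding fc.hom_add fc.hom_mult by (simp add: a hom_distribs)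
  then show False using z a by simp
 qed
 then show ?thesis using p(1) by (auto simp: A_def)
qed

text \<open>The homomorphism of \<complex>-algebras \<FF> \<otimes> \<complex> \<rightarrow>
  \<complex> that belongs to an embedding; it distinguishes the components of \<FF> \<otimes>
  \<complex>.\<close>

definition eval_emb :: "('f::field_char_0 => complex) => ('f, complex) qtensor => complex" where
 "eval_emb \<tau> t = (\<Sum>(a, b)\<leftarrow>rep_qtensor t. \<tau> a * b)"

lemma eval_emb_list:
 assumes "field_hom \<tau>"
 shows "eval_emb \<tau> (\<Sum>(a, b)\<leftarrow>xs. a \<otimes>\<^sub>\<rat> b) = (\<Sum>(a, b)\<leftarrow>xs. \<tau> a * b)"
proof -
 interpret field_hom \<tau> by fact
 have "qteq (rep_qtensor (\<Sum>(a, b)\<leftarrow>xs. a \<otimes>\<^sub>\<rat> b)) xs" by (simp add: qteq_iff flip: qtensor_rep)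
 then show ?thesis unfolding eval_emb_def
  by (rule teq_sum) (simp_all add: hom_distribs field_hom_of_rat[OF assms] algebra_simps)
qed

lemma eval_emb_add:
 assumes "field_hom \<tau>"
 shows "eval_emb \<tau> (s + t) = eval_emb \<tau> s + eval_emb \<tau> t"
proof -
 have "s + t = (\<Sum>(a, b)\<leftarrow>rep_qtensor s @ rep_qtensor t. a \<otimes>\<^sub>\<rat> b)"
  using qtensor_rep[of s] qtensor_rep[of t] by simp
 then have "eval_emb \<tau> (s + t) = (\<Sum>(a, b)\<leftarrow>rep_qtensor s @ rep_qtensor t. \<tau> a * b)"
  by (simp only: eval_emb_list[OF assms])
 then show ?thesis by (simp add: eval_emb_def)
qed

lemma eval_emb_zero: "field_hom \<tau> ==> eval_emb \<tau> 0 = 0"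
 using eval_emb_add[of \<tau> 0 0] by simp

lemma eval_emb_pure_mult:
 assumes "field_hom \<tau>"
 shows "eval_emb \<tau> (a \<otimes>\<^sub>\<rat> b * t) = \<tau> a * b * eval_emb \<tau> t"
proof -
 interpret field_hom \<tau> by fact
 have 1: "eval_emb \<tau> (a \<otimes>\<^sub>\<rat> b) = \<tau> a * b" for a b using eval_emb_list[OF assms, of "[(a, b)]"] by simp
 show ?thesis
  by (induction t rule: qtensor_induct)
   (simp_all add: eval_emb_zero[OF assms] eval_emb_add[OF assms] 1 distrib_left hom_mult)
qed

lemma eval_emb_one: "field_hom \<tau> ==> eval_emb \<tau> 1 = 1"
 using eval_emb_list[of \<tau> "[(1, 1)]"]
 by (simp add: field_hom_def idom_hom_def comm_ring_hom_def ring_hom_def semiring_hom_def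
   monoid_mult_hom_def one_hom_def)

lemma eval_emb_sum: "field_hom \<tau> ==> eval_emb \<tau> (sum f S) = (\<Sum>x\<in>S. eval_emb \<tau> (f x))"
 by (induction S rule: infinite_finite_induct) (simp_all add: eval_emb_zero eval_emb_add)

lemma eval_emb_sum_list: "field_hom \<tau> ==> eval_emb \<tau> (sum_list xs) = (\<Sum>x\<leftarrow>xs. eval_emb \<tau> x)"
 by (induction xs) (simp_all add: eval_emb_zero eval_emb_add)

context
 fixes emb :: "'f::field_char_0 => ('f, complex) qtensor" and sc :: "complex => ('f, complex) qtensor"
 defines "emb \<equiv> %a. a \<otimes>\<^sub>\<rat> 1" and "sc \<equiv> %z. 1 \<otimes>\<^sub>\<rat> z"
begin

interpretation emb: comm_ring_hom emb unfolding emb_def by (rule comm_ring_hom_left)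
interpretation sc: comm_ring_hom sc unfolding sc_def by (rule comm_ring_hom_right)
interpretation scp: map_poly_comm_ring_hom sc ..

text \<open>The separable annihilator of \<alpha> splits over \<complex>, and its leading
  coefficient becomes a unit that can be cancelled.\<close>

lemma root_product_annihilates:
 assumes "number_field TYPE('f)"
 shows "\<exists>Z. finite Z \<and> (\<Prod>r\<in>Z. emb \<alpha> - sc r) = 0"
proof -
 obtain p :: "rat poly" where p: "poly (map_poly of_rat p) \<alpha> = 0" "rsquarefree (map_poly of_rat p :: complex poly)"
  using squarefree_annihilator[OF assms] by blast
 define q where "q = (map_poly of_rat p :: complex poly)"
 define Z where "Z = {z. poly q z = 0}"
 have q0: "q \<noteq> 0" using p(2) by (auto simp: q_def rsquarefree_def)
 have fin: "finite Z" using poly_roots_finite[OF q0] by (simp add: Z_def)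
 have "poly (map_poly sc q) (emb \<alpha>) = emb (poly (map_poly of_rat p) \<alpha>)"
 proof -
  have sc_rat: "sc (of_rat r) = emb (of_rat r)" for r by (simp add: sc_def emb_def pure_of_rat)
  have "map_poly sc q = map_poly emb (map_poly of_rat p)"
   unfolding q_def by (subst map_poly_map_poly, simp, subst map_poly_map_poly, simp) (simp add: comp_def sc_rat)
  then show ?thesis by simp
 qed
 then have "0 = poly (map_poly sc q) (emb \<alpha>)" using p(1) by simp
 also have "q = [:lead_coeff q:] * (\<Prod>z\<in>Z. [:- z, 1:])"
  using complex_poly_decompose_rsquarefree[OF p(2)] by (simp add: q_def Z_def)
 also have "poly (map_poly sc \<dots>) (emb \<alpha>) = sc (lead_coeff q) * (\<Prod>r\<in>Z. emb \<alpha> - sc r)"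
  by (simp add: hom_distribs poly_prod)
 finally have "sc (1 / lead_coeff q) * (sc (lead_coeff q) * (\<Prod>r\<in>Z. emb \<alpha> - sc r)) = 0" by simp
 then have "sc (1 / lead_coeff q * lead_coeff q) * (\<Prod>r\<in>Z. emb \<alpha> - sc r) = 0"
  unfolding sc.hom_mult by (simp add: mult.assoc)
 then have "(\<Prod>r\<in>Z. emb \<alpha> - sc r) = 0" using q0 by simp
 then show ?thesis using fin by blast
qed

text \<open>Lagrange interpolation, one root at a time. That the components are multiples of
  \<open>x\<close> matters when the decomposition is repeated for another element: a multiple of an
  eigenvector keeps its eigenvalues.\<close>

lemma eigen_decomposition:
 assumes "finite Z" "(\<Prod>r\<in>Z. a - sc r) * x = 0"
 shows "\<exists>ys. sum_list ys = x \<and> (\<forall>y\<in>set ys. x dvd y \<and> (\<exists>c. a * y = sc c * y))"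
 using assms
proof (induction Z arbitrary: x)
 case empty
 then show ?case by (intro exI[of _ "[]"]) auto
next
 case (insert s Z)
 define y where "y = (\<Prod>r\<in>Z. a - sc r) * x"
 define c where "c = (\<Prod>r\<in>Z. s - r)"
 have "c \<noteq> 0" using insert.hyps by (auto simp: c_def)
 have ay: "a * y = sc s * y" using insert.prems insert.hyps by (simp add: y_def algebra_simps)
 have "(\<Prod>r\<in>Z. a - sc r) * y = sc c * y" unfolding c_def
  using insert.hyps(1)
 proof (induction Z)
  case (insert r Z)
  have "(\<Prod>r\<in>insert r Z. a - sc r) * y = (a - sc r) * ((\<Prod>r\<in>Z. a - sc r) * y)"
   using insert.hyps by (simp add: mult.assoc)
  also have "\<dots> = sc (\<Prod>r\<in>Z. s - r) * ((a - sc r) * y)" unfolding insert.IH by (rule mult.left_commute)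
  also have "(a - sc r) * y = sc (s - r) * y" using ay by (simp add: algebra_simps sc.hom_minus)
  finally show ?case using insert.hyps by (simp add: sc.hom_mult ac_simps)
 qed simp
 \<comment> \<open>The component of \<open>x\<close> with eigenvalue \<open>s\<close>: the product
   over the remaining roots acts on \<open>y\<close> by the nonzero scalar \<open>c\<close>, so it
   kills \<open>x - w\<close>.\<close>
 define w where "w = sc (1 / c) * y"
 have "(\<Prod>r\<in>Z. a - sc r) * w = sc (1 / c * c) * y"
  unfolding w_def sc.hom_mult mult.left_commute[of _ "sc (1 / c)"]
  using \<open>(\<Prod>r\<in>Z. a - sc r) * y = sc c * y\<close> by (simp add: mult.assoc)
 then have "(\<Prod>r\<in>Z. a - sc r) * (x - w) = 0" using \<open>c \<noteq> 0\<close> by (simp add: y_def algebra_simps)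
 from insert.IH[OF this] obtain ys where ys: "sum_list ys = x - w"
  "\<forall>y\<in>set ys. (x - w) dvd y \<and> (\<exists>c. a * y = sc c * y)" by blast
 have xw: "x dvd w" by (simp add: w_def y_def)
 have "x dvd y" if "y \<in> set ys" for y using ys(2) that xw by (metis dvd_diff dvd_refl dvd_trans)
 moreover have "a * w = sc s * w" unfolding w_def mult.left_commute[of _ "sc (1 / c)"] by (simp add: ay)
 ultimately show ?case using ys xw by (intro exI[of _ "w # ys"]) auto
qed

lemma simultaneous_eigen_decomposition:
 assumes "number_field TYPE('f)"
 shows "\<exists>ys. sum_list ys = 1 \<and> (\<forall>y\<in>set ys. \<forall>\<alpha>\<in>set as. \<exists>c. emb \<alpha> * y = sc c * y)"
proof (induction as)
 case Nil
 show ?case by (intro exI[of _ "[1]"]) simp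
next
 case (Cons \<alpha> as)
 then obtain ys where ys: "sum_list ys = 1" "\<forall>y\<in>set ys. \<forall>\<alpha>\<in>set as. \<exists>c. emb \<alpha> * y = sc c * y" by blast
 obtain Z where Z: "finite Z" "(\<Prod>r\<in>Z. emb \<alpha> - sc r) = 0" using root_product_annihilates[OF assms] by blast
 have "\<forall>x. \<exists>zs. sum_list zs = x \<and> (\<forall>y\<in>set zs. x dvd y \<and> (\<exists>c. emb \<alpha> * y = sc c * y))"
  using eigen_decomposition[OF Z(1), of "emb \<alpha>"] Z(2) by simp
 then obtain d where d: "!!x. sum_list (d x) = x" "!!x y. y \<in> set (d x) ==> x dvd y"
  "!!x y. y \<in> set (d x) ==> \<exists>c. emb \<alpha> * y = sc c * y" by metis
 have "sum_list (concat (map d ys)) = sum_list ys" by (induction ys) (auto simp: d(1))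
 moreover have "\<exists>c. emb \<beta> * y = sc c * y" if y: "y \<in> set (d x)" "x \<in> set ys" and \<beta>: "\<beta> \<in> set (\<alpha> # as)" for y x \<beta>
 proof (cases "\<beta> = \<alpha>")
  case False
  then obtain c where "emb \<beta> * x = sc c * x" using ys(2) y \<beta> by auto
  moreover obtain q where "y = x * q" using d(2)[OF y(1)] by (rule dvdE)
  ultimately have "emb \<beta> * y = sc c * y" by (simp add: mult.assoc[symmetric])
  then show ?thesis ..
 qed (use d(3)[OF y(1)] in simp)
 ultimately show ?case using ys(1) by (intro exI[of _ "concat (map d ys)"]) auto
qed

lemma sc_cancel:
 assumes "sc c * x = sc d * x" "x \<noteq> 0"
 shows "c = d"
proof (rule ccontr)
 assume "c \<noteq> d"
 have "x = sc (1 / (c - d) * (c - d)) * x" using \<open>c \<noteq> d\<close> by simp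
 also have "\<dots> = sc (1 / (c - d)) * (sc c * x - sc d * x)"
  unfolding sc.hom_mult sc.hom_minus by (simp add: mult.assoc left_diff_distrib)
 finally show False using assms by simp
qed

text \<open>Summands of 1 that are eigenvectors for a rational spanning set of \<FF> are
  eigenvectors for all of \<FF>, and collecting those with the same eigenvalue system gives the
  components. Finiteness of the set of embeddings is a by-product.\<close>

lemma number_field_idempotents:
 assumes nf: "number_field TYPE('f)"
 obtains \<epsilon> where "finite {\<tau>::'f => complex. field_hom \<tau>}"
  and "(\<Sum>\<tau>\<in>{\<tau>. field_hom \<tau>}. \<epsilon> \<tau>) = 1"
  and "!!\<tau> a. field_hom \<tau> ==> emb a * \<epsilon> \<tau> = sc (\<tau> a) * \<epsilon> \<tau>"
proof -
 obtain B :: "'f set" where B: "finite B" "!!x. \<exists>c. x = (\<Sum>b\<in>B. of_rat (c b) * b)"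
  using nf by (auto simp: number_field_def)
 obtain bs where bs: "set bs = B" using finite_list[OF B(1)] by blast
 obtain ys where ys: "sum_list ys = 1" "!!y \<alpha>. y \<in> set ys ==> \<alpha> \<in> B ==> \<exists>c. emb \<alpha> * y = sc c * y"
  using simultaneous_eigen_decomposition[OF nf, of bs] bs by blast
 have ex: "\<exists>c. emb \<alpha> * y = sc c * y" if y: "y \<in> set ys" for y \<alpha>
 proof -
  obtain c where c: "\<alpha> = (\<Sum>b\<in>B. of_rat (c b) * b)" using B(2) by blast
  obtain d where d: "!!b. b \<in> B ==> emb b * y = sc (d b) * y" using ys(2)[OF y] by metis
  have "emb \<alpha> * y = (\<Sum>b\<in>B. emb (of_rat (c b)) * (emb b * y))"
   unfolding c by (simp add: emb.hom_sum emb.hom_mult sum_distrib_right mult.assoc)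
  also have "\<dots> = (\<Sum>b\<in>B. sc (of_rat (c b) * d b) * y)"
   by (intro sum.cong) (simp_all add: d sc.hom_mult mult.assoc, simp add: emb_def sc_def pure_of_rat)
  also have "\<dots> = sc (\<Sum>b\<in>B. of_rat (c b) * d b) * y" by (simp add: sc.hom_sum sum_distrib_right)
  finally show ?thesis ..
 qed
 define \<chi> where "\<chi> y \<alpha> = (SOME c. emb \<alpha> * y = sc c * y)" for y \<alpha>
 have \<chi>: "emb \<alpha> * y = sc (\<chi> y \<alpha>) * y" if "y \<in> set ys" for y \<alpha>
  unfolding \<chi>_def using someI_ex[OF ex[OF that]] .
 have uniq: "\<chi> y \<alpha> = c" if "y \<in> set ys" "y \<noteq> 0" "emb \<alpha> * y = sc c * y" for y \<alpha> c
  using sc_cancel[of "\<chi> y \<alpha>" y c] that \<chi>[of y \<alpha>] by simp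
 have hom: "field_hom (\<chi> y)" if y: "y \<in> set ys" "y \<noteq> 0" for y
 proof
  fix a b
  show "\<chi> y (a + b) = \<chi> y a + \<chi> y b"
   by (rule uniq[OF y]) (simp add: emb.hom_add sc.hom_add distrib_right \<chi>[OF y(1)])
  have "emb (a * b) * y = emb a * (emb b * y)" by (simp add: emb.hom_mult mult.assoc)
  also have "\<dots> = sc (\<chi> y b) * (emb a * y)" unfolding \<chi>[OF y(1), of b] by (simp add: ac_simps)
  also have "\<dots> = sc (\<chi> y a * \<chi> y b) * y" unfolding \<chi>[OF y(1), of a] by (simp add: sc.hom_mult ac_simps)
  finally show "\<chi> y (a * b) = \<chi> y a * \<chi> y b" by (rule uniq[OF y])
 qed (rule uniq[OF y], simp)+
 define S where "S = \<chi> ` (set ys - {0})"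
 \<comment> \<open>No embedding is missed: evaluation at \<tau> sends 1 to 1, so some summand
   survives it, and the eigenvalues of this summand are then the values of \<tau>.\<close>
 have all: "\<tau> \<in> S" if \<tau>: "field_hom \<tau>" for \<tau>
 proof -
  have "(\<Sum>y\<leftarrow>ys. eval_emb \<tau> y) \<noteq> 0"
   using eval_emb_sum_list[OF \<tau>, of ys] eval_emb_one[OF \<tau>] ys(1) by simp
  then have "\<exists>y\<in>set ys. eval_emb \<tau> y \<noteq> 0" by (induction ys) auto
  then obtain y where y: "y \<in> set ys" "eval_emb \<tau> y \<noteq> 0" by blast
  then have y0: "y \<noteq> 0" using eval_emb_zero[OF \<tau>] by auto
  interpret field_hom \<tau> by fact
  have "\<chi> y a = \<tau> a" for a
  proof -
   have "eval_emb \<tau> (emb a * y) = eval_emb \<tau> (sc (\<chi> y a) * y)" by (simp add: \<chi>[OF y(1)])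
   then show ?thesis using y(2) by (simp add: emb_def sc_def eval_emb_pure_mult[OF \<tau>])
  qed
  then have "\<chi> y = \<tau>" by auto
  then show ?thesis using y y0 by (auto simp: S_def)
 qed
 have S: "{\<tau>. field_hom \<tau>} = S" using hom all by (auto simp: S_def)
 define \<epsilon> where "\<epsilon> \<tau> = sum_list (filter (%y. y \<noteq> 0 \<and> \<chi> y = \<tau>) ys)" for \<tau>
 show thesis
 proof (rule that[of \<epsilon>])
  show fin: "finite {\<tau>::'f => complex. field_hom \<tau>}" unfolding S S_def by simp
  show "(\<Sum>\<tau>\<in>{\<tau>. field_hom \<tau>}. \<epsilon> \<tau>) = 1"
  proof -
   have "(\<Sum>\<tau>\<in>S. sum_list (filter (%y. y \<noteq> 0 \<and> \<chi> y = \<tau>) zs)) = sum_list zs" if "set zs \<subseteq> set ys" for zs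
    using that
   proof (induction zs)
    case (Cons z zs)
    have "(\<Sum>\<tau>\<in>S. sum_list (filter (%y. y \<noteq> 0 \<and> \<chi> y = \<tau>) (z # zs))) =
     (\<Sum>\<tau>\<in>S. (if \<tau> = \<chi> z then z else 0) + sum_list (filter (%y. y \<noteq> 0 \<and> \<chi> y = \<tau>) zs))"
     by (intro sum.cong) auto
    also have "\<dots> = z + sum_list zs"
     using Cons fin[unfolded S] by (auto simp: sum.distrib S_def)
    finally show ?case by simp
   qed simp
   from this[of ys] show ?thesis unfolding S using ys(1) by (simp add: \<epsilon>_def)
  qed
  show "emb a * \<epsilon> \<tau> = sc (\<tau> a) * \<epsilon> \<tau>" for \<tau> a
  proof -
   have "emb a * sum_list (filter (%y. y \<noteq> 0 \<and> \<chi> y = \<tau>) zs) = sc (\<tau> a) * sum_list (filter (%y. y \<noteq> 0 \<and> \<chi> y = \<tau>) zs)"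
    if "set zs \<subseteq> set ys" for zs
    using that by (induction zs) (auto simp: distrib_left \<chi>)
   from this[of ys] show ?thesis by (simp add: \<epsilon>_def)
  qed
 qed
qed

text \<open>Evaluation at \<tau> kills an eigenvector with another eigenvalue system, and since the
  components add up to 1 it sends its own component to 1.\<close>

lemma eval_emb_idempotent:
 assumes fin: "finite {\<tau>::'f => complex. field_hom \<tau>}"
  and sum: "(\<Sum>\<tau>\<in>{\<tau>. field_hom \<tau>}. \<epsilon> \<tau>) = 1"
  and eig: "!!\<tau> a. field_hom \<tau> ==> emb a * \<epsilon> \<tau> = sc (\<tau> a) * \<epsilon> \<tau>"
  and hom: "field_hom \<sigma>" "field_hom \<tau>"
 shows "eval_emb \<tau> (\<epsilon> \<sigma>) = (if \<sigma> = \<tau> then 1 else 0)"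
proof -
 have 0: "eval_emb \<tau> (\<epsilon> \<rho>) = 0" if \<rho>: "field_hom \<rho>" "\<rho> \<noteq> \<tau>" for \<rho>
 proof -
  obtain a where a: "\<rho> a \<noteq> \<tau> a" using \<rho>(2) by (auto simp: fun_eq_iff)
  interpret field_hom \<tau> by (rule hom(2))
  have "eval_emb \<tau> (emb a * \<epsilon> \<rho>) = eval_emb \<tau> (sc (\<rho> a) * \<epsilon> \<rho>)" using eig[OF \<rho>(1)] by simp
  then show ?thesis using a by (auto simp: emb_def sc_def eval_emb_pure_mult[OF hom(2)])
 qed
 have "1 = (\<Sum>\<rho>\<in>{\<rho>. field_hom \<rho>}. eval_emb \<tau> (\<epsilon> \<rho>))"
  using eval_emb_one[OF hom(2)] sum eval_emb_sum[OF hom(2)] by metis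
 also have "\<dots> = (\<Sum>\<rho>\<in>{\<rho>. field_hom \<rho>}. if \<rho> = \<tau> then eval_emb \<tau> (\<epsilon> \<tau>) else 0)"
  using 0 by (intro sum.cong) auto
 also have "\<dots> = eval_emb \<tau> (\<epsilon> \<tau>)" using fin hom by simp
 finally show ?thesis using 0[OF hom(1)] by auto
qed

end

section \<open>Homomorphisms, extended bases and spans\<close>

lemma hom_lc:
 assumes M: "cmod M" and N: "cmod N" and b: "!!i. i \<in> I ==> b i \<in> carrier M"
  and g: "!!x. x \<in> carrier M ==> g x \<in> carrier N"
   "!!x y. x \<in> carrier M ==> y \<in> carrier M ==> g (x \<oplus>\<^bsub>M\<^esub> y) = g x \<oplus>\<^bsub>N\<^esub> g y"
   "!!r x. x \<in> carrier M ==> g (r \<odot>\<^bsub>M\<^esub> x) = \<eta> r \<odot>\<^bsub>N\<^esub> g x"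
  and fin: "finite I"
 shows "g (lc M I a b) = lc N I (%i. \<eta> (a i)) (%i. g (b i))"
proof -
 interpret M: Module.module class_ring M by (rule M)
 interpret N: Module.module class_ring N by (rule N)
 have "g \<zero>\<^bsub>M\<^esub> \<oplus>\<^bsub>N\<^esub> g \<zero>\<^bsub>M\<^esub> = g \<zero>\<^bsub>M\<^esub>" using g(2)[of "\<zero>\<^bsub>M\<^esub>" "\<zero>\<^bsub>M\<^esub>"] by simp
 then have 0: "g \<zero>\<^bsub>M\<^esub> = \<zero>\<^bsub>N\<^esub>" using g(1)[of "\<zero>\<^bsub>M\<^esub>"] by simp
 from fin b show ?thesis
 proof (induction I)
  case empty
  then show ?case by (simp add: lc_def 0)
 next
  case (insert i I)
  have "g (\<Oplus>\<^bsub>M\<^esub>i\<in>insert i I. a i \<odot>\<^bsub>M\<^esub> b i) = g (a i \<odot>\<^bsub>M\<^esub> b i \<oplus>\<^bsub>M\<^esub> lc M I a b)"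
   using insert.hyps insert.prems by (subst M.finsum_insert) (auto simp: lc_def cmodD[OF M])
  also have "\<dots> = \<eta> (a i) \<odot>\<^bsub>N\<^esub> g (b i) \<oplus>\<^bsub>N\<^esub> lc N I (%i. \<eta> (a i)) (%i. g (b i))"
   using insert lc_closed[OF M, of I b a] by (simp add: g cmodD[OF M])
  also have "\<dots> = (\<Oplus>\<^bsub>N\<^esub>i\<in>insert i I. \<eta> (a i) \<odot>\<^bsub>N\<^esub> g (b i))"
   using insert.hyps insert.prems by (subst N.finsum_insert) (auto simp: lc_def g cmodD[OF N])
  finally show ?case by (simp add: lc_def)
 qed
qed

lemma finsum_neutral_left:
 fixes M :: "('r::comm_ring_1, 'a) module"
 assumes "cmod M" "finite B" "A \<subseteq> B" "!!i. i \<in> B - A ==> f i = \<zero>\<^bsub>M\<^esub>" "!!i. i \<in> B ==> f i \<in> carrier M"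
 shows "(\<Oplus>\<^bsub>M\<^esub>i\<in>A. f i) = (\<Oplus>\<^bsub>M\<^esub>i\<in>B. f i)"
proof -
 have "comm_monoid (add_monoid M)"
  by (rule comm_group.axioms(1)[OF abelian_group.a_comm_group[OF cmod_abelian_group[OF assms(1)]]])
 from comm_monoid.finprod_mono_neutral_cong_left[OF this assms(2,3), of f f]
 show ?thesis using assms(4,5) by (auto simp: finsum_def)
qed

lemma ex1_eq: "\<exists>!x. Q x ==> Q a ==> Q b ==> a = b"
 by blast

lemma lc_singleton:
 assumes "cmod M" "b i \<in> carrier M"
 shows "lc M {i} a b = a i \<odot>\<^bsub>M\<^esub> b i"
proof -
 interpret Module.module class_ring M by (rule assms)
 show ?thesis using assms by (simp add: lc_def cmodD)
qed

lemma semilin_comp: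
 assumes "semilin \<eta> M \<phi>" "comm_ring_hom \<rho>"
 shows "semilin (%r. \<rho> (\<eta> r)) M (%x. \<rho> (\<phi> x))"
proof -
 interpret comm_ring_hom \<rho> by fact
 show ?thesis using assms(1) by (auto simp: semilin_def hom_add hom_mult)
qed

lemma semilin_lincomb:
 assumes "!!i. i \<in> I ==> semilin \<eta> M (\<phi> i)"
 shows "semilin \<eta> M (%x. \<Sum>i\<in>I. a i * \<phi> i x)"
 using assms by (auto simp: semilin_def sum.distrib distrib_left sum_distrib_left mult.left_commute)

text \<open>The extended coordinates reproduce each class v \<otimes> 1, because the expansion of v
  is carried over by \<open>cls_smult\<close>; these classes generate the extension.\<close>

lemma (in scalar_ext) frame_ext:
 assumes f: "frame V K b c"
 shows "frame T K (%k. cls [(b k, 1)]) (%X k. ev (%v. \<eta> (c v k)) X)"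
proof -
 interpret \<eta>: comm_ring_hom \<eta> by (rule \<eta>)
 have sl: "semilin \<eta> V (%v. \<eta> (c v k))" if "k \<in> K" for k
  using semilin_comp[OF frame_coord[OF f that] \<eta>] .
 have cl: "cls [(b k, 1)] \<in> carrier T" if "k \<in> K" for k
  using frame_closed[OF f that] by (intro cls_in_T) auto
 have "X = lc T K (%k. ev (%v. \<eta> (c v k)) X) (%k. cls [(b k, 1)])" (is "X = ?l X") if "X \<in> carrier T" for X
  using that
 proof (rule ext_induct)
  have "?l \<zero>\<^bsub>T\<^esub> = lc T K (%k. 0) (%k. cls [(b k, 1)])"
   using semilin_zero[OF semilin_ev[OF sl] cmod_T] by (intro lc_cong[OF cmod_T cl]) simp
  also have "\<dots> = \<zero>\<^bsub>T\<^esub>" by (rule lc_zero[OF cmod_T cl])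
  finally show "\<zero>\<^bsub>T\<^esub> = ?l \<zero>\<^bsub>T\<^esub>" ..
  fix v t X assume v: "v \<in> carrier V" and X: "X \<in> carrier T" and IH: "X = ?l X"
  have vT: "cls [(v, 1)] \<in> carrier T" using v by (intro cls_in_T) auto
  have "cls [(v, 1)] = cls [(lc V K (c v) b, 1)]" using frame_expand[OF f v] by simp
  also have "\<dots> = lc T K (%k. \<eta> (c v k)) (%k. cls [(b k, 1)])"
   by (rule hom_lc[OF cV cmod_T frame_closed[OF f], where g = "%v. cls [(v, 1)]"])
    (auto simp: cls_add cls_smult frame_finite[OF f] intro: cls_in_T)
  finally have v': "cls [(v, 1)] = lc T K (%k. \<eta> (c v k)) (%k. cls [(b k, 1)])" .
  have "?l (t \<odot>\<^bsub>T\<^esub> cls [(v, 1)] \<oplus>\<^bsub>T\<^esub> X) = lc T K (%k. t * \<eta> (c v k) + ev (%v. \<eta> (c v k)) X) (%k. cls [(b k, 1)])"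
   using v vT X
   by (intro lc_cong[OF cmod_T cl]) (simp_all add: semilin_add[OF semilin_ev[OF sl]] semilin_smult[OF semilin_ev[OF sl]]
     cmod_smult_closed[OF cmod_T] ev_unit[OF sl])
  also have "\<dots> = t \<odot>\<^bsub>T\<^esub> lc T K (%k. \<eta> (c v k)) (%k. cls [(b k, 1)]) \<oplus>\<^bsub>T\<^esub> ?l X"
   by (simp add: lc_add[OF cmod_T cl] lc_smult[OF cmod_T cl frame_finite[OF f]])
  finally show "t \<odot>\<^bsub>T\<^esub> cls [(v, 1)] \<oplus>\<^bsub>T\<^esub> X = ?l (t \<odot>\<^bsub>T\<^esub> cls [(v, 1)] \<oplus>\<^bsub>T\<^esub> X)"
   using v' IH by simp
 qed
 then show ?thesis unfolding frame_def
  using cmod_T frame_finite[OF f] cl semilin_ev[OF sl] frame_closed[OF f] frame_delta[OF f]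
  by (auto simp: ev_unit[OF sl])
qed

text \<open>The way in which spans are used: the Hodge filtrations enter only through the
  functionals that vanish on their generators.\<close>

lemma span_functional:
 assumes W: "cmod W" and S: "S \<subseteq> carrier W" and \<Theta>: "semilin \<eta> W \<Theta>"
  and 0: "!!s. s \<in> S ==> \<Theta> s = 0" and X: "X \<in> LinearCombinations.module.span class_ring W S"
 shows "\<Theta> X = 0"
proof -
 interpret Module.module class_ring W by (rule W)
 obtain a A where X: "X = lincomb a A" "finite A" "A \<subseteq> S" using X by (auto simp: span_def)
 have "\<Theta> X = (\<Sum>v\<in>A. \<Theta> (a v \<odot>\<^bsub>W\<^esub> v))" unfolding X(1) lincomb_def
  using X S by (intro semilin_finsum[OF \<Theta> W]) (auto intro!: cmod_smult_closed[OF W])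
 also have "\<dots> = 0" using X S 0 by (intro sum.neutral) (auto simp: semilin_smult[OF \<Theta>] subset_iff)
 finally show ?thesis .
qed

lemma in_span:
 assumes W: "cmod W" and S: "S \<subseteq> carrier W" and s: "s \<in> S"
 shows "s \<in> LinearCombinations.module.span class_ring W S"
proof -
 interpret Module.module class_ring W by (rule W)
 show ?thesis using in_own_span[of S] S s by auto
qed

lemma module_hom_add: "f \<in> LinearCombinations.module_hom class_ring M N ==> x \<in> carrier M ==> y \<in> carrier M ==>
  f (x \<oplus>\<^bsub>M\<^esub> y) = f x \<oplus>\<^bsub>N\<^esub> f y"
 and module_hom_smult: "f \<in> LinearCombinations.module_hom class_ring M N ==> x \<in> carrier M ==> f (r \<odot>\<^bsub>M\<^esub> x) = r \<odot>\<^bsub>N\<^esub> f x"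
 and module_hom_closed: "f \<in> LinearCombinations.module_hom class_ring M N ==> x \<in> carrier M ==> f x \<in> carrier N"
 unfolding LinearCombinations.module_hom_def by auto

lemma submodule_cmod:
 fixes W :: "('r::comm_ring_1, 'a) module"
 assumes "cmod W" "LinearCombinations.submodule class_ring H W"
 shows "cmod (submod W H)"
 using assms(2) by (intro cmod_submod assms) (auto simp: LinearCombinations.submodule_def)

section \<open>Motives with Hodge numbers at most one\<close>

text \<open>The Hodge decomposition at one embedding. In weight \<open>w\<close> a type is
  determined by its first index, so \<open>P\<close> is the set of types; the frame
  \<open>bC\<close> will be a rational Betti basis.\<close>

locale hodge_space =
 fixes W :: "('r::comm_ring_1, 'x) module" and H :: "int => int => 'x set" and hn :: "int => int => nat"
  and w :: int and P :: "int set" and K :: "'k set" and bC and cC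
 assumes cW: "cmod W" and hodge_sub: "!!p q. LinearCombinations.submodule class_ring (H p q) W"
  and hodge_rank: "!!p q. has_rank (submod W (H p q)) (hn p q)"
  and hodge_le: "!!p q. hn p q \<noteq> 0 ==> hn p q = 1"
  and w: "!!p q. p + q \<noteq> w ==> H p q = {\<zero>\<^bsub>W\<^esub>}"
  and decomposition: "direct_decomposition W (%(p, q). H p q)"
  and frC: "frame W K bC cC" and P_def: "P = {p. hn p (w - p) \<noteq> 0}"
begin

lemma hodge_subset: "x \<in> H p q ==> x \<in> carrier W"
 using hodge_sub[of p q] unfolding LinearCombinations.submodule_def by auto

lemma hodge_closed: "\<zero>\<^bsub>W\<^esub> \<in> H p q" "x \<in> H p q ==> t \<odot>\<^bsub>W\<^esub> x \<in> H p q"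
 using hodge_sub[of p q] unfolding LinearCombinations.submodule_def by auto

lemma hodge_trivial: 
 assumes "\<not> (p \<in> P \<and> q = w - p)"
 shows "H p q = {\<zero>\<^bsub>W\<^esub>}"
proof (cases "p + q = w")
 case True
 then have "hn p q = 0" using assms by (auto simp: P_def algebra_simps)
 then have rank: "has_rank (submod W (H p q)) 0"
  using hodge_rank[of p q] by simp
 have cS: "cmod (submod W (H p q))" by (rule submodule_cmod[OF cW hodge_sub])
 obtain b c where f: "frame (submod W (H p q)) {..<0::nat} b c"
  using has_rank_frame[OF cS rank] by blast
 have "x = \<zero>\<^bsub>W\<^esub>" if "x \<in> H p q" for x
 proof -
  have "lc (submod W (H p q)) {..<0} (c x) b = lc (submod W (H p q)) {..<0} (%_. 0) b"
   by (intro lc_cong[OF cS]) auto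
  also have "\<dots> = \<zero>\<^bsub>W\<^esub>" using lc_zero[OF cS, of "{..<0::nat}" b] by simp
  finally show ?thesis using frame_expand[OF f, of x] that by simp
 qed
 then show ?thesis using hodge_closed(1) by auto
next
 case False
 then show ?thesis using w by simp
qed

lemma hodge_generator:
 assumes "p \<in> P"
 shows "\<exists>f\<in>H p (w - p). (\<forall>x\<in>H p (w - p). \<exists>t. x = t \<odot>\<^bsub>W\<^esub> f) \<and>
  (\<forall>t t'. t \<odot>\<^bsub>W\<^esub> f = t' \<odot>\<^bsub>W\<^esub> f \<longrightarrow> t = t')"
proof -
 let ?H = "submod W (H p (w - p))"
 have H: "cmod ?H" by (rule submodule_cmod[OF cW hodge_sub])
 have "has_rank ?H 1"
  using hodge_rank[of p "w - p"] hodge_le assms by (simp add: P_def)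
 then obtain f c where f: "frame ?H {..<1::nat} f c"
  using has_rank_frame[OF H] by blast
 have one: "{..<1} = {0::nat}" by auto
 have f0: "f 0 \<in> H p (w - p)" using frame_closed[OF f, of 0] by simp
 have lc: "lc ?H {..<1} a f = a 0 \<odot>\<^bsub>W\<^esub> f 0" for a
  unfolding one using lc_singleton[OF H, of f 0 a] f0 by simp
 show ?thesis
 proof (intro bexI[OF _ f0] conjI ballI allI impI)
  fix x assume "x \<in> H p (w - p)"
  then show "\<exists>t. x = t \<odot>\<^bsub>W\<^esub> f 0" using frame_expand[OF f, of x] unfolding lc by auto
 next
  fix t t' assume "t \<odot>\<^bsub>W\<^esub> f 0 = t' \<odot>\<^bsub>W\<^esub> f 0"
  then show "t = t'" using frame_unique[OF f, of "%_. t" "%_. t'"] unfolding lc by auto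
 qed
qed

definition gen :: "int => 'x" where
 "gen p = (SOME f. f \<in> H p (w - p) \<and> (\<forall>x\<in>H p (w - p). \<exists>t. x = t \<odot>\<^bsub>W\<^esub> f) \<and>
  (\<forall>t t'. t \<odot>\<^bsub>W\<^esub> f = t' \<odot>\<^bsub>W\<^esub> f \<longrightarrow> t = t'))"

lemma gen:
 assumes "p \<in> P"
 shows gen_in: "gen p \<in> H p (w - p)"
  and gen_span: "!!x. x \<in> H p (w - p) ==> \<exists>t. x = t \<odot>\<^bsub>W\<^esub> gen p"
  and gen_cancel: "!!t t'. t \<odot>\<^bsub>W\<^esub> gen p = t' \<odot>\<^bsub>W\<^esub> gen p ==> t = t'"
proof -
 have "\<exists>f. f \<in> H p (w - p) \<and> (\<forall>x\<in>H p (w - p). \<exists>t. x = t \<odot>\<^bsub>W\<^esub> f) \<and>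
  (\<forall>t t'. t \<odot>\<^bsub>W\<^esub> f = t' \<odot>\<^bsub>W\<^esub> f \<longrightarrow> t = t')" using hodge_generator[OF assms] by blast
 from someI_ex[OF this, folded gen_def]
 show "gen p \<in> H p (w - p)" "x \<in> H p (w - p) ==> \<exists>t. x = t \<odot>\<^bsub>W\<^esub> gen p"
  "t \<odot>\<^bsub>W\<^esub> gen p = t' \<odot>\<^bsub>W\<^esub> gen p ==> t = t'" for x t t' by blast+
qed

lemma gen_W: "p \<in> P ==> gen p \<in> carrier W"
 by (rule hodge_subset[OF gen_in])

lemma hodge_expand:
 assumes X: "X \<in> carrier W"
 shows "\<exists>S a. finite S \<and> S \<subseteq> P \<and> X = lc W S a gen"
proof -
 interpret W: Module.module class_ring W by (rule cW)
 obtain d where d: "!!i. d i \<in> (case i of (p, q) => H p q)" "finite {i. d i \<noteq> \<zero>\<^bsub>W\<^esub>}"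
  "X = (\<Oplus>\<^bsub>W\<^esub>i\<in>{i. d i \<noteq> \<zero>\<^bsub>W\<^esub>}. d i)"
  using decomposition X unfolding direct_decomposition_def by blast
 define T where "T = {i. d i \<noteq> \<zero>\<^bsub>W\<^esub>}"
 have T: "fst i \<in> P" "snd i = w - fst i" if "i \<in> T" for i
  using d(1)[of i] hodge_trivial[of "fst i" "snd i"] that by (auto simp: T_def case_prod_beta)
 define a where "a p = (SOME t. d (p, w - p) = t \<odot>\<^bsub>W\<^esub> gen p)" for p
 have a: "d i = a (fst i) \<odot>\<^bsub>W\<^esub> gen (fst i)" if "i \<in> T" for i
 proof -
  have "d (fst i, w - fst i) \<in> H (fst i) (w - fst i)" using d(1)[of "(fst i, w - fst i)"] by simp
  from someI_ex[OF gen_span[OF T(1)[OF that] this], folded a_def] show ?thesis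
   using T(2)[OF that] by (cases i) simp
 qed
 have inj: "inj_on fst T" using T(2) by (auto simp: inj_on_def prod_eq_iff)
 have "X = (\<Oplus>\<^bsub>W\<^esub>i\<in>T. a (fst i) \<odot>\<^bsub>W\<^esub> gen (fst i))"
  unfolding d(3) T_def[symmetric] using T
  by (intro W.finsum_cong') (auto intro!: a cmod_smult_closed[OF cW] gen_W)
 also have "\<dots> = lc W (fst ` T) a gen"
  unfolding lc_def using T(1) by (subst W.finsum_reindex[OF _ inj])
   (auto intro!: cmod_smult_closed[OF cW] gen_W)
 finally show ?thesis using d(2) T(1) by (intro exI[of _ "fst ` T"] exI[of _ a]) (auto simp: T_def)
qed

lemma hodge_expand_unique:
 assumes S: "finite S" "S \<subseteq> P" and eq: "lc W S a gen = lc W S a' gen"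
 shows "\<forall>p\<in>S. a p = a' p"
proof -
 interpret W: Module.module class_ring W by (rule cW)
 have gS: "gen p \<in> carrier W" if "p \<in> S" for p using that S gen_W by blast
 \<comment> \<open>The combination written as a family over all pairs of indices, the form in which
   \<open>direct_decomposition\<close> asserts uniqueness.\<close>
 define d where "d a i = (if fst i \<in> S \<and> snd i = w - fst i then a (fst i) \<odot>\<^bsub>W\<^esub> gen (fst i) else \<zero>\<^bsub>W\<^esub>)"
  for a and i :: "int \<times> int"
 define T where "T = (%p. (p, w - p)) ` S"
 have dT: "d a i = \<zero>\<^bsub>W\<^esub>" if "i \<notin> T" for a i using that by (cases i) (auto simp: d_def T_def)
 have fT: "finite T" using S by (simp add: T_def)
 have dW: "d a i \<in> carrier W" for a i
  using gS by (auto simp: d_def intro!: cmod_smult_closed[OF cW])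
 have sum: "(\<Oplus>\<^bsub>W\<^esub>i\<in>{i. d a i \<noteq> \<zero>\<^bsub>W\<^esub>}. d a i) = lc W S a gen" for a
 proof -
  have "(\<Oplus>\<^bsub>W\<^esub>i\<in>{i. d a i \<noteq> \<zero>\<^bsub>W\<^esub>}. d a i) = (\<Oplus>\<^bsub>W\<^esub>i\<in>T. d a i)"
   using dT[of _ a] dW by (intro finsum_neutral_left[OF cW fT]) auto
  also have "\<dots> = (\<Oplus>\<^bsub>W\<^esub>p\<in>S. d a (p, w - p))"
   unfolding T_def by (rule W.finsum_reindex) (use dW in \<open>auto simp: inj_on_def\<close>)
  also have "\<dots> = lc W S a gen"
   unfolding lc_def using gS by (intro W.finsum_cong')
    (auto simp: d_def intro!: cmod_smult_closed[OF cW])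
  finally show ?thesis .
 qed
 have valid: "(\<forall>i. d a i \<in> (case i of (p, q) => H p q)) \<and> finite {i. d a i \<noteq> \<zero>\<^bsub>W\<^esub>}" for a
 proof (intro conjI allI)
  fix i show "d a i \<in> (case i of (p, q) => H p q)"
   using S gen_in by (auto simp: d_def hodge_closed case_prod_beta)
  show "finite {i. d a i \<noteq> \<zero>\<^bsub>W\<^esub>}" using dT by (intro finite_subset[OF _ fT]) auto
 qed
 have "lc W S a gen \<in> carrier W" by (rule lc_closed[OF cW gS])
 note dec = bspec[OF conjunct2[OF decomposition[unfolded direct_decomposition_def]] this]
 have "d a = d a'"
  by (rule ex1_eq[OF dec]) (use valid[of a] valid[of a'] sum[of a] sum[of a'] eq in simp_all)
 then show ?thesis
 proof (intro ballI gen_cancel)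
  fix p assume "p \<in> S" "d a = d a'"
  then have "d a (p, w - p) = d a' (p, w - p)" by simp
  then show "a p \<odot>\<^bsub>W\<^esub> gen p = a' p \<odot>\<^bsub>W\<^esub> gen p" using \<open>p \<in> S\<close> by (simp add: d_def)
 qed (use S in auto)
qed

text \<open>The finitely many vectors \<open>bC k\<close> involve finitely many generators. A
  further generator would be a combination of these vectors, hence of the other generators, against
  the uniqueness of expansions.\<close>

lemma finite_P: "finite P"
proof -
 define S where "S k = (SOME S. \<exists>a. finite S \<and> S \<subseteq> P \<and> bC k = lc W S a gen)" for k
 have "\<exists>a. finite (S k) \<and> S k \<subseteq> P \<and> bC k = lc W (S k) a gen" if "k \<in> K" for k
  unfolding S_def by (rule someI_ex) (rule hodge_expand[OF frame_closed[OF frC that]])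
 then obtain a where S: "!!k. k \<in> K ==> finite (S k)" "!!k. k \<in> K ==> S k \<subseteq> P"
  "!!k. k \<in> K ==> bC k = lc W (S k) (a k) gen" by metis
 define U where "U = (\<Union>k\<in>K. S k)"
 have U: "finite U" "U \<subseteq> P" using S frame_finite[OF frC] by (auto simp: U_def)
 have "p \<in> U" if p: "p \<in> P" for p
 proof (rule ccontr)
  assume pU: "p \<notin> U"
  have gU: "gen q \<in> carrier W" if "q \<in> insert p U" for q using that U p gen_W by blast
  note cl = lc_closed[OF cW gU]
  define a' where "a' k q = (if q \<in> S k then a k q else 0)" for k q
  have b: "bC k = lc W (insert p U) (a' k) gen" if k: "k \<in> K" for k
  proof -
   have gk: "gen q \<in> carrier W" if "q \<in> S k" for q using that S(2)[OF k] gen_W by blast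
   have "lc W (insert p U) (a' k) gen = lc W (S k) (a' k) gen"
    using U k by (intro lc_subset[OF cW gU]) (auto simp: U_def a'_def)
   also have "\<dots> = lc W (S k) (a k) gen" by (intro lc_cong[OF cW gk]) (auto simp: a'_def)
   finally show ?thesis using S(3)[OF k] by simp
  qed
  \<comment> \<open>Every combination of the \<open>bC k\<close> has an expansion with coefficient 0
    at \<open>p\<close>, and \<open>gen p\<close> is such a combination.\<close>
  have "\<exists>d. gen p = lc W (insert p U) d gen \<and> d p = 0"
  proof -
   have "\<exists>d. lc W J e bC = lc W (insert p U) d gen \<and> d p = 0" if "finite J" "J \<subseteq> K" for J e
    using that
   proof (induction J)
    case empty
    interpret W: Module.module class_ring W by (rule cW)
    have "lc W {} e bC = \<zero>\<^bsub>W\<^esub>" by (simp add: lc_def)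
    then show ?case using lc_zero[where b = gen and I = "insert p U", OF cW gU]
     by (intro exI[of _ "%_. 0"]) simp
   next
    case (insert k J)
    interpret W: Module.module class_ring W by (rule cW)
    obtain d where d: "lc W J e bC = lc W (insert p U) d gen" "d p = 0" using insert by auto
    have "lc W (insert k J) e bC = e k \<odot>\<^bsub>W\<^esub> bC k \<oplus>\<^bsub>W\<^esub> lc W J e bC"
     unfolding lc_def using insert frame_closed[OF frC]
     by (subst W.finsum_insert) (auto intro!: cmod_smult_closed[OF cW])
    also have "\<dots> = lc W (insert p U) (%q. e k * a' k q + d q) gen"
     using insert.prems U lc_add[of W "insert p U" gen "%q. e k * a' k q" d]
      lc_smult[of W "insert p U" gen "e k" "a' k"] cW gU by (simp add: d(1) b)
    finally show ?case using d pU insert.prems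
     by (intro exI[of _ "%q. e k * a' k q + d q"]) (auto simp: a'_def U_def)
   qed
   from this[OF frame_finite[OF frC], of "cC (gen p)"] show ?thesis
    using frame_expand[OF frC gen_W[OF p]] by auto
  qed
  then obtain d where d: "gen p = lc W (insert p U) d gen" "d p = 0" by blast
  have "lc W (insert p U) (%q. if q = p then 1 else 0) gen = gen p"
   using U by (intro lc_delta[OF cW gU]) auto
  with d(1) have "lc W (insert p U) (%q. if q = p then 1 else 0) gen = lc W (insert p U) d gen" by simp
  from hodge_expand_unique[OF _ _ this] U p have "(%q. if q = p then 1 else 0) p = d p" by blast
  with d(2) show False by simp
 qed
 then show ?thesis by (intro finite_subset[OF _ U(1)] subsetI)
qed

lemma hodge_frame_ex: "\<exists>\<theta>. frame W P gen \<theta>"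
proof (rule frameI_unique[OF cW finite_P gen_W])
 fix X assume "X \<in> carrier W"
 then obtain S a where S: "finite S" "S \<subseteq> P" "X = lc W S a gen" using hodge_expand by blast
 have gS: "gen q \<in> carrier W" if "q \<in> S" for q using that S(2) gen_W by blast
 have "lc W P (%q. if q \<in> S then a q else 0) gen = lc W S (%q. if q \<in> S then a q else 0) gen"
  using S finite_P by (intro lc_subset[OF cW gen_W]) auto
 also have "\<dots> = lc W S a gen" by (intro lc_cong[OF cW gS]) auto
 finally show "\<exists>a. X = lc W P a gen"
  by (intro exI[of _ "%q. if q \<in> S then a q else 0"]) (simp add: S(3))
qed (use hodge_expand_unique[OF finite_P] in auto)

definition \<theta> where "\<theta> = (SOME \<theta>. frame W P gen \<theta>)"

lemma fr\<theta>: "frame W P gen \<theta>"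
 unfolding \<theta>_def by (rule someI_ex[OF hodge_frame_ex])

lemma \<theta>_lin: "p \<in> P ==> semilin (%t. t) W (%X. \<theta> X p)"
 by (rule frame_coord[OF fr\<theta>])

lemma \<theta>_other:
 assumes x: "x \<in> H r q" and p: "p \<in> P" "p \<noteq> r"
 shows "\<theta> x p = 0"
proof (cases "r \<in> P \<and> q = w - r")
 case True
 then obtain t where "x = t \<odot>\<^bsub>W\<^esub> gen r" using gen_span x by blast
 then show ?thesis using True p by (simp add: semilin_smult[OF \<theta>_lin] gen_W frame_delta[OF fr\<theta>])
next
 case False
 then have "x = \<zero>\<^bsub>W\<^esub>" using hodge_trivial x by blast
 then show ?thesis using semilin_zero[OF \<theta>_lin[OF p(1)] cW] by simp
qed

text \<open>With \<open>cC_\<theta>\<close>: the transition matrices between the rational basis and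
  the Hodge generators are inverse to each other. They become \<open>z\<close> and \<open>y\<close>
  of \<open>dual_frame\<close>.\<close>

lemma \<theta>_cC: "k \<in> K ==> j \<in> K ==> (\<Sum>p\<in>P. \<theta> (bC k) p * cC (gen p) j) = (if k = j then 1 else 0)"
 using frame_semilin[OF fr\<theta> frame_coord[OF frC, of j], of "bC k"] frame_closed[OF frC, of k] frame_delta[OF frC, of j k]
 by auto

lemma cC_\<theta>: "p \<in> P ==> q \<in> P ==> (\<Sum>k\<in>K. cC (gen p) k * \<theta> (bC k) q) = (if p = q then 1 else 0)"
 using frame_semilin[OF frC \<theta>_lin[of q], of "gen p"] gen_W[of p] frame_delta[OF fr\<theta>, of q p]
 by auto

end

section \<open>Complex conjugation on the Hodge types\<close>

locale hodge_conjugation = hodge_space W H hn w P K bC cC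
 for W :: "('r::comm_ring_1, 'x) module" and H hn w P and K :: "'k set" and bC cC +
 fixes \<Phi> :: "'x => 'x" and \<epsilon> :: "'k => int"
 assumes \<Phi>: "!!p q. \<Phi> ` H p q = H q p" and \<Phi>_coord: "!!x k. x \<in> carrier W ==> k \<in> K ==> cC (\<Phi> x) k = of_int (\<epsilon> k) * cC x k"
begin

text \<open>Conjugation maps the type (w - p, p) onto (p, w - p), so a trivial type would force its
  conjugate to be a single element.\<close>

lemma star_P:
 assumes p: "p \<in> P"
 shows "w - p \<in> P"
proof (rule ccontr)
 assume "w - p \<notin> P"
 then have "H (w - p) p = {\<zero>\<^bsub>W\<^esub>}" by (intro hodge_trivial) simp
 then have 0: "H p (w - p) \<subseteq> {\<Phi> \<zero>\<^bsub>W\<^esub>}" using \<Phi>[of "w - p" p] by auto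
 have "\<zero>\<^bsub>W\<^esub> \<in> {\<Phi> \<zero>\<^bsub>W\<^esub>}" by (rule subsetD[OF 0 hodge_closed(1)])
 then have "gen p = \<zero>\<^bsub>W\<^esub>" using subsetD[OF 0 gen_in[OF p]] by auto
 then show False using frame_delta[OF fr\<theta> p p] semilin_zero[OF \<theta>_lin[OF p] cW] by simp
qed

definition u where "u p = (SOME t. \<Phi> (gen p) = t \<odot>\<^bsub>W\<^esub> gen (w - p))"

lemma \<Phi>_gen:
 assumes p: "p \<in> P"
 shows "\<Phi> (gen p) = u p \<odot>\<^bsub>W\<^esub> gen (w - p)"
proof -
 have "\<Phi> (gen p) \<in> H (w - p) (w - (w - p))" using \<Phi>[of p "w - p"] gen_in[OF p] by auto
 from someI_ex[OF gen_span[OF star_P[OF p] this]] show ?thesis unfolding u_def .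
qed

lemma \<epsilon>_coord:
 assumes p: "p \<in> P" and k: "k \<in> K"
 shows "of_int (\<epsilon> k) * cC (gen p) k = u p * cC (gen (w - p)) k"
 using \<Phi>_coord[OF gen_W[OF p] k] \<Phi>_gen[OF p] gen_W[OF star_P[OF p]]
 by (simp add: semilin_smult[OF frame_coord[OF frC k]])

text \<open>The trace of conjugation in two bases: its signs in the rational basis, and in the Hodge
  basis only the types fixed by conjugation.\<close>

lemma trace: "(\<Sum>k\<in>K. of_int (\<epsilon> k)) = (\<Sum>p\<in>{p\<in>P. 2 * p = w}. u p)"
proof -
 have "(\<Sum>k\<in>K. of_int (\<epsilon> k)) = (\<Sum>k\<in>K. of_int (\<epsilon> k) * (\<Sum>p\<in>P. \<theta> (bC k) p * cC (gen p) k))"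
  by (intro sum.cong) (simp_all add: \<theta>_cC)
 also have "\<dots> = (\<Sum>k\<in>K. \<Sum>p\<in>P. (of_int (\<epsilon> k) * cC (gen p) k) * \<theta> (bC k) p)"
  by (simp add: sum_distrib_left ac_simps)
 also have "\<dots> = (\<Sum>k\<in>K. \<Sum>p\<in>P. u p * (cC (gen (w - p)) k * \<theta> (bC k) p))"
  by (intro sum.cong) (simp_all add: \<epsilon>_coord mult.assoc)
 also have "\<dots> = (\<Sum>p\<in>P. u p * (\<Sum>k\<in>K. cC (gen (w - p)) k * \<theta> (bC k) p))"
  by (subst sum.swap) (simp add: sum_distrib_left)
 also have "\<dots> = (\<Sum>p\<in>P. if 2 * p = w then u p else 0)"
  by (intro sum.cong) (auto simp: cC_\<theta> star_P)
 also have "\<dots> = (\<Sum>p\<in>{p\<in>P. 2 * p = w}. u p)" by (simp add: sum.inter_filter finite_P)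
 finally show ?thesis .
qed

text \<open>Identifies the scalar on the middle type with the number that enters
  \<open>trace\<close>, and hence \<open>middle_sign\<close> with a difference of
  dimensions.\<close>

lemma middle:
 assumes p: "p \<in> P" "2 * p = w"
 shows "(\<forall>x\<in>H p p. \<Phi> x = t \<odot>\<^bsub>W\<^esub> x) \<longleftrightarrow> t = u p"
proof -
 have wp: "w - p = p" using p by simp
 have g: "gen p \<in> H p p" using gen_in[OF p(1)] wp by simp
 \<comment> \<open>Multiples of \<open>gen p\<close> are determined by their rational coordinates,
   since \<open>cC_\<theta>\<close> recovers the factor from them.\<close>
 have inj: "a = b" if "!!k. k \<in> K ==> a * cC (gen p) k = b * cC (gen p) k" for a b
 proof -
  have "a = (\<Sum>k\<in>K. a * cC (gen p) k * \<theta> (bC k) p)" for a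
   using cC_\<theta>[OF p(1) p(1)] by (simp add: sum_distrib_left[symmetric] mult.assoc)
  then show ?thesis using that by (metis (no_types, lifting) sum.cong)
 qed
 show ?thesis
 proof
  assume "\<forall>x\<in>H p p. \<Phi> x = t \<odot>\<^bsub>W\<^esub> x"
  then have "t \<odot>\<^bsub>W\<^esub> gen p = u p \<odot>\<^bsub>W\<^esub> gen p" using g \<Phi>_gen[OF p(1)] wp by simp
  then show "t = u p" by (rule gen_cancel[OF p(1)])
 next
  assume t: "t = u p"
  show "\<forall>x\<in>H p p. \<Phi> x = t \<odot>\<^bsub>W\<^esub> x"
  proof
   fix x assume x: "x \<in> H p p"
   then obtain r where r: "x = r \<odot>\<^bsub>W\<^esub> gen p" using gen_span[OF p(1)] wp by auto
   have "\<Phi> x \<in> H p p" using \<Phi> x by blast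
   then obtain r' where r': "\<Phi> x = r' \<odot>\<^bsub>W\<^esub> gen p" using gen_span[OF p(1)] wp by auto
   have "r' = u p * r"
   proof (rule inj)
    fix k assume k: "k \<in> K"
    note sm = semilin_smult[OF frame_coord[OF frC k] gen_W[OF p(1)]]
    have "r' * cC (gen p) k = of_int (\<epsilon> k) * (r * cC (gen p) k)"
     using \<Phi>_coord[OF hodge_subset[OF x] k] unfolding r' by (simp add: r sm)
    also have "\<dots> = r * (of_int (\<epsilon> k) * cC (gen p) k)" by (rule mult.left_commute)
    also have "\<dots> = u p * r * cC (gen p) k" unfolding \<epsilon>_coord[OF p(1) k] wp by (simp add: ac_simps)
    finally show "r' * cC (gen p) k = u p * r * cC (gen p) k" .
   qed
   then show "\<Phi> x = t \<odot>\<^bsub>W\<^esub> x"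
    unfolding r' t by (simp add: r cmod_mult_smult[OF cW] gen_W[OF p(1)])
  qed
 qed
qed

end

text \<open>
 \<open>G p \<phi>\<close> is the value of the functional \<open>\<phi>\<close> at the image in \<open>H\<^sub>D\<^sub>R \<otimes> \<complex>\<close> of a generator of the Hodge
 type indexed by \<open>p\<close>, \<open>\<gamma> p\<close> is the dual functional, and \<open>\<beta> k \<phi>\<close> is the value at a rational Betti class.
\<close>

locale dual_frame =
 fixes D :: "(('e::field_char_0, 'f::field_char_0) qtensor, 'd) module" and F :: "int => 'd set"
  and \<eta> :: "('e, 'f) qtensor => ('e, complex) qtensor" and P :: "'p set" and deg :: "'p => int" and K :: "'k set"
  and y :: "'p => 'k => ('e, complex) qtensor" and z :: "'k => 'p => ('e, complex) qtensor"
  and \<gamma> :: "'p => 'd => ('e, complex) qtensor"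
  and G :: "'p => ('d => ('e, complex) qtensor) => ('e, complex) qtensor"
  and \<beta> :: "'k => ('d => ('e, complex) qtensor) => ('e, complex) qtensor"
 assumes finP: "finite P" and finK: "finite K"
  and zy: "!!k j. k \<in> K ==> j \<in> K ==> (\<Sum>p\<in>P. z k p * y p j) = (if k = j then 1 else 0)"
  and yz: "!!p q. p \<in> P ==> q \<in> P ==> (\<Sum>k\<in>K. y p k * z k q) = (if p = q then 1 else 0)"
  and \<gamma>: "!!p. p \<in> P ==> semilin \<eta> D (\<gamma> p)"
  and expand: "!!\<phi> h. semilin \<eta> D \<phi> ==> h \<in> carrier D ==> \<phi> h = (\<Sum>p\<in>P. \<gamma> p h * G p \<phi>)"
  and \<gamma>_fil: "!!p n h. p \<in> P ==> deg p < n ==> h \<in> F n ==> \<gamma> p h = 0"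
  and G_fil: "!!\<phi> p n. semilin \<eta> D \<phi> ==> (!!h. h \<in> F n ==> \<phi> h = 0) ==> p \<in> P ==> n \<le> deg p ==>
   G p \<phi> = 0"
  and G_\<gamma>: "!!p q. p \<in> P ==> q \<in> P ==> G p (\<gamma> q) = (if p = q then 1 else 0)"
  and G_lin: "!!p a \<phi> \<psi> (I::nat set). p \<in> P ==> finite I ==> (!!i. i \<in> I ==> semilin \<eta> D (\<psi> i)) ==> semilin \<eta> D \<phi> ==>
   (!!h. h \<in> carrier D ==> \<phi> h = (\<Sum>i\<in>I. a i * \<psi> i h)) ==> G p \<phi> = (\<Sum>i\<in>I. a i * G p (\<psi> i))"
  and G_\<beta>: "!!\<phi> p. semilin \<eta> D \<phi> ==> p \<in> P ==> G p \<phi> = (\<Sum>k\<in>K. y p k * \<beta> k \<phi>)"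

text \<open>The comparison isomorphism at one embedding: \<open>unit\<close> stands for h \<mapsto>
  h \<otimes> 1 and \<open>evl\<close> for the extension of functionals from H_DR to H_DR \<otimes>
  \<complex>.\<close>

locale comparison_space = hodge_space W H hn w P K bC cC
 for W :: "(('e::field_char_0, complex) qtensor, 'x) module" and H hn w P and K :: "'k set" and bC cC +
 fixes DC :: "(('e, complex) qtensor, 'y) module" and I :: "'x => 'y"
  and D :: "(('e, 'f::field_char_0) qtensor, 'd) module" and F :: "int => 'd set"
  and \<eta> :: "('e, 'f) qtensor => ('e, complex) qtensor"
  and unit :: "'d => 'y" and evl :: "('d => ('e, complex) qtensor) => 'y => ('e, complex) qtensor"
 assumes cDC: "cmod DC" and I_hom: "I \<in> LinearCombinations.module_hom class_ring W DC"
  and I_bij: "bij_betw I (carrier W) (carrier DC)"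
  and unit_closed: "!!h. h \<in> carrier D ==> unit h \<in> carrier DC"
  and semilin_unit: "!!\<Theta>. semilin (%t. t) DC \<Theta> ==> semilin \<eta> D (%h. \<Theta> (unit h))"
  and semilin_evl: "!!\<phi>. semilin \<eta> D \<phi> ==> semilin (%t. t) DC (evl \<phi>)"
  and evl_unit: "!!\<phi> h. semilin \<eta> D \<phi> ==> h \<in> carrier D ==> evl \<phi> (unit h) = \<phi> h"
  and lin_eq: "!!\<Theta> \<Theta>' Y. semilin (%t. t) DC \<Theta> ==> semilin (%t. t) DC \<Theta>' ==> Y \<in> carrier DC ==>
   (!!h. h \<in> carrier D ==> \<Theta> (unit h) = \<Theta>' (unit h)) ==> \<Theta> Y = \<Theta>' Y"
  and F_sub: "!!n. F n \<subseteq> carrier D"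
  and fil: "!!n. I ` LinearCombinations.module.span class_ring W (\<Union>r\<in>{n..}. \<Union>q. H r q) =
   LinearCombinations.module.span class_ring DC {unit h | h. h \<in> F n}"
begin

lemmas I_add = module_hom_add[OF I_hom] and I_smult = module_hom_smult[OF I_hom]
 and I_closed = module_hom_closed[OF I_hom]

lemma semilin_I:
 assumes "semilin (%t. t) DC \<Theta>"
 shows "semilin (%t. t) W (%X. \<Theta> (I X))"
 unfolding semilin_def
 by (auto simp: I_add I_smult I_closed semilin_add[OF assms] semilin_smult[OF assms])

definition J where "J = inv_into (carrier W) I"

lemma J: "Y \<in> carrier DC ==> J Y \<in> carrier W" "Y \<in> carrier DC ==> I (J Y) = Y" "X \<in> carrier W ==> J (I X) = X"
 using I_bij unfolding J_def bij_betw_def by (auto intro: inv_into_into f_inv_into_f)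

lemma semilin_J:
 assumes "semilin (%t. t) W \<Theta>"
 shows "semilin (%t. t) DC (%Y. \<Theta> (J Y))"
proof -
 have "J (X \<oplus>\<^bsub>DC\<^esub> Y) = J X \<oplus>\<^bsub>W\<^esub> J Y" if "X \<in> carrier DC" "Y \<in> carrier DC" for X Y
  using that J(3)[of "J X \<oplus>\<^bsub>W\<^esub> J Y"] by (simp add: I_add J(1,2) cmod_add_closed[OF cW])
 moreover have "J (t \<odot>\<^bsub>DC\<^esub> X) = t \<odot>\<^bsub>W\<^esub> J X" if "X \<in> carrier DC" for t X
  using that J(3)[of "t \<odot>\<^bsub>W\<^esub> J X"] by (simp add: I_smult J(1,2) cmod_smult_closed[OF cW])
 ultimately show ?thesis
  unfolding semilin_def by (auto simp: J(1) semilin_add[OF assms] semilin_smult[OF assms])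
qed

definition \<gamma> where "\<gamma> p h = \<theta> (J (unit h)) p"

lemma evl_\<gamma>: "p \<in> P ==> Y \<in> carrier DC ==> evl (\<gamma> p) Y = \<theta> (J Y) p"
 unfolding \<gamma>_def
 by (rule lin_eq[OF semilin_evl[OF semilin_unit[OF semilin_J[OF \<theta>_lin]]] semilin_J[OF \<theta>_lin], of p p Y])
  (simp_all add: evl_unit[OF semilin_unit[OF semilin_J[OF \<theta>_lin]]])

lemma hodge_fil_W: "(\<Union>r\<in>{n..}. \<Union>q. H r q) \<subseteq> carrier W"
 using hodge_subset by blast

lemma unit_fil_DC: "{unit h | h. h \<in> F n} \<subseteq> carrier DC"
 using unit_closed F_sub by blast

text \<open>Both conditions on the filtration come from \<open>fil\<close>. For p < n the coordinate
  \<theta> at p kills the types that span F^n; for n \<le> p the image of \<open>gen p\<close> lies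
  in the span of F^n, so it is killed by every functional that vanishes there.\<close>

lemma dual_frame:
 "dual_frame D F \<eta> P (%p. p) K (%p k. cC (gen p) k) (%k p. \<theta> (bC k) p) \<gamma>
  (%p \<phi>. evl \<phi> (I (gen p))) (%k \<phi>. evl \<phi> (I (bC k)))"
proof
 show "finite P" by (rule finite_P)
 show "finite K" by (rule frame_finite[OF frC])
 show \<gamma>: "semilin \<eta> D (\<gamma> p)" if "p \<in> P" for p
  unfolding \<gamma>_def by (rule semilin_unit[OF semilin_J[OF \<theta>_lin[OF that]]])
 show "\<phi> h = (\<Sum>p\<in>P. \<gamma> p h * evl \<phi> (I (gen p)))" if \<phi>: "semilin \<eta> D \<phi>" and h: "h \<in> carrier D" for \<phi> h
  using frame_semilin[OF fr\<theta> semilin_I[OF semilin_evl[OF \<phi>]] J(1)[OF unit_closed[OF h]]]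
  by (simp add: J(2)[OF unit_closed[OF h]] evl_unit[OF \<phi> h] \<gamma>_def)
 show "\<gamma> p h = 0" if p: "p \<in> P" and n: "p < n" and h: "h \<in> F n" for p n h
 proof -
  have "unit h \<in> I ` LinearCombinations.module.span class_ring W (\<Union>r\<in>{n..}. \<Union>q. H r q)"
   unfolding fil using h by (intro in_span[OF cDC unit_fil_DC]) auto
  then obtain X where X: "X \<in> LinearCombinations.module.span class_ring W (\<Union>r\<in>{n..}. \<Union>q. H r q)" "unit h = I X"
   by blast
  have "X \<in> carrier W"
  proof -
   interpret W: Module.module class_ring W by (rule cW)
   show ?thesis using X(1) W.span_is_subset2[OF hodge_fil_W] by auto
  qed
  then have "\<gamma> p h = \<theta> X p" by (simp add: \<gamma>_def X(2) J(3))
  also have "\<dots> = 0"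
   by (rule span_functional[OF cW hodge_fil_W \<theta>_lin[OF p] _ X(1)]) (use n \<theta>_other[OF _ p] in auto)
  finally show ?thesis .
 qed
 show "evl \<phi> (I (gen p)) = 0"
  if \<phi>: "semilin \<eta> D \<phi>" "!!h. h \<in> F n ==> \<phi> h = 0" and p: "p \<in> P" "n \<le> p" for \<phi> p n
 proof (rule span_functional[OF cDC unit_fil_DC semilin_evl[OF \<phi>(1)]])
  have "gen p \<in> LinearCombinations.module.span class_ring W (\<Union>r\<in>{n..}. \<Union>q. H r q)"
   using gen_in[OF p(1)] p(2) by (intro in_span[OF cW hodge_fil_W]) auto
  then show "I (gen p) \<in> LinearCombinations.module.span class_ring DC {unit h | h. h \<in> F n}"
   unfolding fil[symmetric] by (rule imageI)
 qed (use \<phi>(2) subsetD[OF F_sub] evl_unit[OF \<phi>(1)] in auto)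
 show "evl (\<gamma> q) (I (gen p)) = (if p = q then 1 else 0)" if "p \<in> P" "q \<in> P" for p q
  using that by (simp add: evl_\<gamma> I_closed gen_W J(3) frame_delta[OF fr\<theta>] eq_commute)
 show "evl \<phi> (I (gen p)) = (\<Sum>i\<in>N. a i * evl (\<psi> i) (I (gen p)))"
  if p: "p \<in> P" and N: "finite N" and \<psi>: "!!i. i \<in> N ==> semilin \<eta> D (\<psi> i)" and \<phi>: "semilin \<eta> D \<phi>"
   and eq: "!!h. h \<in> carrier D ==> \<phi> h = (\<Sum>i\<in>N. a i * \<psi> i h)" for p a \<phi> \<psi> and N :: "nat set"
  by (rule lin_eq[OF semilin_evl[OF \<phi>] semilin_lincomb I_closed[OF gen_W[OF p]]])
   (simp_all add: semilin_evl \<psi> eq evl_unit \<phi>)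
 show "evl \<phi> (I (gen p)) = (\<Sum>k\<in>K. cC (gen p) k * evl \<phi> (I (bC k)))" if \<phi>: "semilin \<eta> D \<phi>" and p: "p \<in> P" for \<phi> p
  by (rule frame_semilin[OF frC semilin_I[OF semilin_evl[OF \<phi>]] gen_W[OF p]])
qed (simp_all add: \<theta>_cC cC_\<theta>)

end

section \<open>Units modulo a subfield\<close>

definition rsub :: "complex set => ('e::field_char_0, complex) qtensor set" where
 "rsub K = {(\<Sum>(a, b)\<leftarrow>xs. a \<otimes>\<^sub>\<rat> b) | xs. snd ` set xs \<subseteq> K}"

definition runits :: "complex set => ('e::field_char_0, complex) qtensor set" where
 "runits K = {x \<in> rsub K. \<exists>y\<in>rsub K. x * y = 1}"

lemma Units_right_subring: "Units (right_subring K) = runits K"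
 by (auto simp: Units_def right_subring_def runits_def rsub_def mult.commute)

lemma rsubI: "snd ` set xs \<subseteq> K ==> x = (\<Sum>(a, b)\<leftarrow>xs. a \<otimes>\<^sub>\<rat> b) ==> x \<in> rsub K"
 unfolding rsub_def by blast

lemma rsub_pure: "b \<in> K ==> a \<otimes>\<^sub>\<rat> b \<in> rsub K"
 by (rule rsubI[of "[(a, b)]"]) simp_all

lemma rsub_mult:
 assumes K: "!!a b. a \<in> K ==> b \<in> K ==> a * b \<in> K" and "x \<in> rsub K" "y \<in> rsub K"
 shows "x * y \<in> rsub K"
proof -
 obtain xs ys where xs: "x = (\<Sum>(a, b)\<leftarrow>xs. a \<otimes>\<^sub>\<rat> b)" "snd ` set xs \<subseteq> K"
  and ys: "y = (\<Sum>(a, b)\<leftarrow>ys. a \<otimes>\<^sub>\<rat> b)" "snd ` set ys \<subseteq> K"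
  using assms by (auto simp: rsub_def)
 show ?thesis
 proof (rule rsubI)
  show "x * y = (\<Sum>(a, b)\<leftarrow>lmult xs ys. a \<otimes>\<^sub>\<rat> b)"
   unfolding xs(1) ys(1) abs_qtensor_conv[symmetric] by (rule times_qtensor.abs_eq)
  have "snd ` set (lmult xs ys) \<subseteq> (%(b, b'). b * b') ` (snd ` set xs \<times> snd ` set ys)"
   by (force simp: lmult_def image_iff)
  also have "\<dots> \<subseteq> K" using xs(2) ys(2) K by (auto simp: subset_iff)
  finally show "snd ` set (lmult xs ys) \<subseteq> K" .
 qed
qed

lemma runits_mult:
 assumes K: "!!a b. a \<in> K ==> b \<in> K ==> a * b \<in> K" and "x \<in> runits K" "y \<in> runits K"
 shows "x * y \<in> runits K"
proof -
 obtain x' y' where xy: "x' \<in> rsub K" "x * x' = 1" "y' \<in> rsub K" "y * y' = 1" "x \<in> rsub K" "y \<in> rsub K"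
  using assms(2,3) by (auto simp: runits_def)
 have "(x * y) * (x' * y') = (x * x') * (y * y')" by (simp only: ac_simps)
 then have "(x * y) * (x' * y') = 1" by (simp add: xy)
 then show ?thesis using xy rsub_mult[OF K] unfolding runits_def by (intro CollectI conjI bexI[of _ "x' * y'"])
qed

lemma runits_inverse: "x \<in> runits K ==> x * y = 1 ==> y \<in> runits K"
proof -
 assume "x \<in> runits K" and xy: "x * y = 1"
 then obtain x' where x': "x' \<in> rsub K" "x * x' = 1" "x \<in> rsub K" by (auto simp: runits_def)
 have "y = (x * y) * x'" using x'(2) by (simp add: mult.commute[of x y] mult.assoc)
 then have "y = x'" using xy by simp
 then show ?thesis using x' by (auto simp: runits_def mult.commute)
qed

lemma runits_pure:
 assumes "1 \<in> K" "e * e' = 1"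
 shows "e \<otimes>\<^sub>\<rat> 1 \<in> runits K"
 unfolding runits_def using assms by (auto intro!: bexI[of _ "e' \<otimes>\<^sub>\<rat> 1"] rsub_pure)

lemma runits_sign:
 assumes "1 \<in> K" "d = 1 \<or> d = - 1"
 shows "of_int d \<in> runits K"
 using runits_pure[of K "of_int d" "of_int d"] assms by (auto simp: pure_of_int)

text \<open>A change of de Rham basis has as determinant a unit of \<EE> \<otimes> \<FF>; its image
  and that of its inverse lie in \<EE> \<otimes> \<sigma>(\<FF>).\<close>

lemma runits_map_right:
 fixes t s :: "('e::field_char_0, 'f::field_char_0) qtensor"
 assumes "field_hom \<sigma>" "t * s = 1"
 shows "map_right \<sigma> t \<in> runits (range \<sigma>)"
proof -
 interpret \<sigma>: field_hom \<sigma> by fact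
 interpret m: comm_ring_hom "map_right \<sigma> :: ('e, 'f) qtensor => _" by (rule comm_ring_hom_map_right[OF assms(1)])
 have "map_right \<sigma> t \<in> rsub (range \<sigma>)" for t :: "('e, 'f) qtensor"
  unfolding rsub_def map_right_def
  by (rule CollectI, rule exI[of _ "map (%(a, b). (a, \<sigma> b)) (rep_qtensor t)"]) (auto simp: case_prod_beta' comp_def)
 moreover have "map_right \<sigma> t * map_right \<sigma> s = 1" using assms(2) m.hom_mult[of t s] by simp
 ultimately show ?thesis by (auto simp: runits_def)
qed

lemma runits_mono: "K \<subseteq> L ==> runits K \<subseteq> runits L"
 unfolding runits_def rsub_def by blast

section \<open>Determinants of changes of bases\<close>

text \<open>The sign is the determinant of the diagonal integer matrix \<open>S\<close>, whose
  square is the identity.\<close>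

lemma det_signs:
 fixes a :: "nat => nat => 'r::comm_ring_1"
 assumes s: "!!j. s j = 1 \<or> s j = (- 1 :: int)"
 obtains d :: int where "d = 1 \<or> d = - 1"
  "det (mat n n (%(i, j). of_int (s j) * a i j)) = of_int d * det (mat n n (%(i, j). a i j))"
proof -
 define A where "A = mat n n (%(i, j). a i j)"
 define S where "S = mat n n (%(i, j). if i = j then s j else 0)"
 interpret comm_ring_hom "of_int :: int => 'r" by unfold_locales auto
 have c: "A \<in> carrier_mat n n" "S \<in> carrier_mat n n" by (auto simp: A_def S_def)
 have "s j * s j = 1" for j using s[of j] by auto
 then have "S * S = 1\<^sub>m n"
  by (auto simp: S_def scalar_prod_def if_distrib[of "%x. x * _"] cong: if_cong intro!: eq_matI)
 then have "det S * det S = 1" using det_mult[OF c(2) c(2)] by simp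
 then have d: "det S = 1 \<or> det S = - 1" by (metis zmult_eq_1_iff)
 have "A * map_mat of_int S = mat n n (%(i, j). of_int (s j) * a i j)"
  by (auto simp: A_def S_def scalar_prod_def mult.commute if_distrib[of "%x. _ * x"] if_distrib[of of_int]
    cong: if_cong intro!: eq_matI)
 then have "det (mat n n (%(i, j). of_int (s j) * a i j)) = det A * det (map_mat of_int S)"
  using det_mult[OF c(1), of "map_mat of_int S"] c(2) by simp
 then show thesis using that[OF d] using d by (simp add: A_def mult.commute)
qed

lemma frame_change_det:
 assumes f: "frame M {..<n} b c" and g: "frame M K b' c'" and e: "bij_betw e {..<n} K"
 shows "det (mat n n (%(i, j). c' (b j) (e i))) * det (mat n n (%(i, j). c (b' (e j)) i)) = 1"
proof -
 have 1: "(\<Sum>k\<in>K. c (b' k) i * c' (b j) k) = (if i = j then 1 else 0)" if "i < n" "j < n" for i j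
  using frame_semilin[OF g frame_coord[OF f], of i "b j"] frame_closed[OF f, of j] frame_delta[OF f, of i j] that
  by (simp add: mult.commute)
 have "det (mat n n (%(i, j). \<Sum>k\<in>K. c (b' k) i * c' (b j) k)) = det (1\<^sub>m n)"
  by (intro arg_cong[where f = det] eq_matI) (auto simp: 1)
 then show ?thesis using det_product_enum[OF e, of "%i k. c (b' k) i" "%j k. c' (b j) k"]
  by (simp add: mult.commute)
qed

section \<open>Periods in terms of functionals\<close>

definition betti_period :: "('e::field_char_0, 'f::field_char_0, 'b, 'd) realizations => ('f => complex) => 'b =>
  ('d => ('e, complex) qtensor) => ('e, complex) qtensor" where
 "betti_period M \<sigma> v \<phi> = ev \<phi> (comparison M \<sigma> (bclass (betti M \<sigma>) [(v, 1)]))"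

text \<open>A coordinate of H_DR / F^p, read as a functional on H_DR that vanishes on F^p. From here
  on a period is the determinant of the values of such functionals on Betti vectors.\<close>

definition eigen_period :: "('e::field_char_0, 'f::field_char_0, 'b, 'd) realizations => ('f => complex) => int =>
  ('d set => nat => ('e, 'f) qtensor) => nat => 'd => ('e, complex) qtensor" where
 "eigen_period M \<sigma> p \<kappa> i h = map_right \<sigma> (\<kappa> (hodge_fil M p +>\<^bsub>derham M\<^esub> h) i)"

text \<open>What the determinants of periods use of a motive. It is verified directly for the tensor
  product and for the restriction of scalars, so that neither has to be shown to satisfy all axioms
  of \<open>motive\<close>.\<close>

locale period_data =
 fixes N :: "('e::field_char_0, 'f::field_char_0, 'b, 'd) realizations" and \<sigma> :: "'f => complex"
 assumes \<sigma>: "field_hom \<sigma>" and cD: "cmod (derham N)"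
  and F: "!!n. LinearCombinations.submodule class_ring (hodge_fil N n) (derham N)"
  and F_dec: "!!m n. m \<le> n ==> hodge_fil N n \<subseteq> hodge_fil N m"
  and I_closed: "!!s v. s \<in> {1, - 1} ==> v \<in> carrier (betti_eigen N \<sigma> s) ==>
   comparison N \<sigma> (bclass (betti N \<sigma>) [(v, 1)]) \<in> carrier (derham_ext \<sigma> (derham N))"
begin

abbreviation "D \<equiv> derham N"
abbreviation "Fil \<equiv> hodge_fil N"

lemma cQ: "cmod (quot_mod D (Fil p))"
 by (rule cmod_quot[OF cD F])

lemma semilin_coord:
 assumes f: "frame (quot_mod D (Fil p)) {..<n::nat} ws \<kappa>" and i: "i < n"
 shows "semilin (map_right \<sigma>) (quot_mod D (Fil p)) (%X. map_right \<sigma> (\<kappa> X i))"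
 using semilin_comp[OF frame_coord[OF f] comm_ring_hom_map_right[OF \<sigma>], of i] i by simp

lemma semilin_eigen_period:
 assumes "frame (quot_mod D (Fil p)) {..<n::nat} ws \<kappa>" "i < n"
 shows "semilin (map_right \<sigma>) D (eigen_period N \<sigma> p \<kappa> i)"
  and "h \<in> Fil p ==> eigen_period N \<sigma> p \<kappa> i h = 0"
 unfolding eigen_period_def using semilin_quot[OF cD F semilin_coord[OF assms]] by auto

text \<open>The period map passes to cosets term by term on a representative, and so does the
  evaluation of a coordinate.\<close>

lemma ev_period_map:
 assumes f: "frame (quot_mod D (Fil p)) {..<n::nat} ws \<kappa>" and i: "i < n"
  and v: "s \<in> {1, - 1}" "v \<in> carrier (betti_eigen N \<sigma> s)"
 shows "ev (%X. map_right \<sigma> (\<kappa> X i)) (period_map N \<sigma> p (bclass (betti N \<sigma>) [(v, 1)])) =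
   betti_period N \<sigma> v (eigen_period N \<sigma> p \<kappa> i)"
  and "period_map N \<sigma> p (bclass (betti N \<sigma>) [(v, 1)]) \<in> carrier (derham_ext \<sigma> (quot_mod D (Fil p)))"
proof -
 interpret D: scalar_ext D "%e. e \<otimes>\<^sub>\<rat> 1" "%x. 1 \<otimes>\<^sub>\<rat> x" \<sigma> "map_right \<sigma>"
  by (rule scalar_ext_derham[OF cD \<sigma>])
 interpret Q: scalar_ext "quot_mod D (Fil p)" "%e. e \<otimes>\<^sub>\<rat> 1" "%x. 1 \<otimes>\<^sub>\<rat> x" \<sigma> "map_right \<sigma>"
  by (rule scalar_ext_derham[OF cQ \<sigma>])
 define Y where "Y = trep (comparison N \<sigma> (bclass (betti N \<sigma>) [(v, 1)]))"
 have "comparison N \<sigma> (bclass (betti N \<sigma>) [(v, 1)]) \<in> carrier D.T"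
  using I_closed[OF v] unfolding derham_ext_conv[OF cD \<sigma>] .
 then have Y: "set Y \<subseteq> carrier D \<times> UNIV" unfolding Y_def D.T_simps(1) using D.sub_trep by simp
 have Y': "set (map (%(h, z). (Fil p +>\<^bsub>D\<^esub> h, z)) Y) \<subseteq> carrier (quot_mod D (Fil p)) \<times> UNIV"
  using Y coset_in_quot[OF cD F] by auto
 show "ev (%X. map_right \<sigma> (\<kappa> X i)) (period_map N \<sigma> p (bclass (betti N \<sigma>) [(v, 1)])) =
   betti_period N \<sigma> v (eigen_period N \<sigma> p \<kappa> i)"
  unfolding period_map_def Y_def[symmetric] Q.ev_cls[OF semilin_coord[OF f i] Y']
  unfolding betti_period_def ev_def Y_def[symmetric] eigen_period_def
  by (simp add: comp_def case_prod_beta')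
 show "period_map N \<sigma> p (bclass (betti N \<sigma>) [(v, 1)]) \<in> carrier (derham_ext \<sigma> (quot_mod D (Fil p)))"
  unfolding derham_ext_conv[OF cQ \<sigma>] period_map_def Y_def[symmetric] by (rule Q.cls_in_T[OF Y'])
qed

text \<open>A basis of the quotient stays a basis after extension to \<complex>, so the matrix in
  the definition of \<open>periods\<close> is forced: its entries are the coordinates of the period
  map.\<close>

lemma periods_elim:
 assumes c: "c \<in> periods N \<sigma> s" and s: "s \<in> {1, - 1}" and E: "cmod (betti_eigen N \<sigma> s)"
 obtains n :: nat and p bs cb ws \<kappa> where "frame (betti_eigen N \<sigma> s) {..<n} bs cb"
  and "frame (quot_mod D (Fil p)) {..<n} ws \<kappa>"
  and "c = det (mat n n (%(i, j). betti_period N \<sigma> (bs j) (eigen_period N \<sigma> p \<kappa> i)))"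
proof -
 obtain A n p bs ws where A: "c = det A" "is_basis (betti_eigen N \<sigma> s) bs" "is_basis (quot_mod D (Fil p)) ws"
   "length bs = n" "length ws = n" "A \<in> carrier_mat n n"
   "!!j. j < n ==> period_map N \<sigma> p (bclass (betti N \<sigma>) [(bs ! j, 1)]) =
    (\<Oplus>\<^bsub>derham_ext \<sigma> (quot_mod D (Fil p))\<^esub>i\<in>{..<n}.
      A $$ (i, j) \<odot>\<^bsub>derham_ext \<sigma> (quot_mod D (Fil p))\<^esub> dclass \<sigma> (quot_mod D (Fil p)) [(ws ! i, 1)])"
  using c unfolding periods_def by auto
 obtain cb where cb: "frame (betti_eigen N \<sigma> s) {..<n} ((!) bs) cb" using is_basis_frame[OF E A(2)] A(4) by auto
 obtain \<kappa> where \<kappa>: "frame (quot_mod D (Fil p)) {..<n} ((!) ws) \<kappa>" using is_basis_frame[OF cQ A(3)] A(5) by auto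
 interpret Q: scalar_ext "quot_mod D (Fil p)" "%e. e \<otimes>\<^sub>\<rat> 1" "%x. 1 \<otimes>\<^sub>\<rat> x" \<sigma> "map_right \<sigma>"
  by (rule scalar_ext_derham[OF cQ \<sigma>])
 have "A $$ (i, j) = betti_period N \<sigma> (bs ! j) (eigen_period N \<sigma> p \<kappa> i)" if ij: "i < n" "j < n" for i j
 proof -
  note fr = Q.frame_ext[OF \<kappa>]
  have "betti_period N \<sigma> (bs ! j) (eigen_period N \<sigma> p \<kappa> i) =
    ev (%X. map_right \<sigma> (\<kappa> X i)) (period_map N \<sigma> p (bclass (betti N \<sigma>) [(bs ! j, 1)]))"
   using frame_closed[OF cb] ij by (intro ev_period_map(1)[OF \<kappa> ij(1) s, symmetric]) auto
  also have "\<dots> = ev (%X. map_right \<sigma> (\<kappa> X i))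
    (lc Q.T {..<n} (%i. A $$ (i, j)) (%i. dclass \<sigma> (quot_mod D (Fil p)) [(ws ! i, 1)]))"
   unfolding A(7)[OF ij(2)] lc_def derham_ext_conv[OF cQ \<sigma>] ..
  also have "\<dots> = (\<Sum>k<n. A $$ (k, j) * ev (%X. map_right \<sigma> (\<kappa> X i)) (dclass \<sigma> (quot_mod D (Fil p)) [(ws ! k, 1)]))"
   by (rule semilin_lc[OF Q.cmod_T frame_closed[OF fr] frame_coord[OF fr]]) (use ij in auto)
  also have "\<dots> = (\<Sum>k<n. A $$ (k, j) * (if i = k then 1 else 0))"
   using frame_delta[OF fr, of i] ij by (intro sum.cong) auto
  also have "\<dots> = A $$ (i, j)" using ij by (simp add: if_distrib[of "%x. _ * x"] cong: if_cong)
  finally show ?thesis ..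
 qed
 then have "A = mat n n (%(i, j). betti_period N \<sigma> (bs ! j) (eigen_period N \<sigma> p \<kappa> i))"
  using A(6) by (intro eq_matI) auto
 then show thesis using that[OF cb \<kappa>] A(1) by simp
qed

lemma periods_nonempty:
 assumes cb: "frame (betti_eigen N \<sigma> s) {..<n::nat} bs cb" and \<kappa>: "frame (quot_mod D (Fil p)) {..<n} ws \<kappa>"
  and s: "s \<in> {1, - 1}"
 shows "periods N \<sigma> s \<noteq> {}"
proof -
 interpret Q: scalar_ext "quot_mod D (Fil p)" "%e. e \<otimes>\<^sub>\<rat> 1" "%x. 1 \<otimes>\<^sub>\<rat> x" \<sigma> "map_right \<sigma>"
  by (rule scalar_ext_derham[OF cQ \<sigma>])
 define A where "A = mat n n (%(i, j). betti_period N \<sigma> (bs j) (eigen_period N \<sigma> p \<kappa> i))"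
 note fr = Q.frame_ext[OF \<kappa>]
 have "period_map N \<sigma> p (bclass (betti N \<sigma>) [(map bs [0..<n] ! j, 1)]) =
    (\<Oplus>\<^bsub>derham_ext \<sigma> (quot_mod D (Fil p))\<^esub>i\<in>{..<n}. A $$ (i, j) \<odot>\<^bsub>derham_ext \<sigma> (quot_mod D (Fil p))\<^esub>
      dclass \<sigma> (quot_mod D (Fil p)) [(map ws [0..<n] ! i, 1)])" if j: "j < n" for j
 proof -
  interpret QM: Module.module class_ring Q.T by (rule Q.cmod_T)
  let ?X = "period_map N \<sigma> p (bclass (betti N \<sigma>) [(bs j, 1)])"
  have v: "bs j \<in> carrier (betti_eigen N \<sigma> s)" using frame_closed[OF cb] j by auto
  have "?X = lc Q.T {..<n} (%i. ev (%X. map_right \<sigma> (\<kappa> X i)) ?X) (%i. dclass \<sigma> (quot_mod D (Fil p)) [(ws i, 1)])"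
   using ev_period_map(2)[OF \<kappa> _ s v, of j] j unfolding derham_ext_conv[OF cQ \<sigma>]
   by (intro frame_expand[OF fr]) auto
  also have "\<dots> = lc Q.T {..<n} (%i. A $$ (i, j)) (%i. dclass \<sigma> (quot_mod D (Fil p)) [(ws i, 1)])"
   using j by (intro lc_cong[OF Q.cmod_T frame_closed[OF fr]]) (auto simp: A_def ev_period_map(1)[OF \<kappa> _ s v])
  also have "\<dots> = (\<Oplus>\<^bsub>Q.T\<^esub>i\<in>{..<n}. A $$ (i, j) \<odot>\<^bsub>Q.T\<^esub> dclass \<sigma> (quot_mod D (Fil p)) [(map ws [0..<n] ! i, 1)])"
   unfolding lc_def
   by (intro QM.finsum_cong') (use frame_closed[OF fr] in \<open>auto intro!: cmod_smult_closed[OF Q.cmod_T]\<close>)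
  finally show ?thesis unfolding derham_ext_conv[OF cQ \<sigma>] using j by simp
 qed
 then have "det A \<in> periods N \<sigma> s"
  unfolding periods_def using frame_is_basis[OF cb] frame_is_basis[OF \<kappa>]
  by (intro CollectI exI[of _ A] exI[of _ n] exI[of _ p] exI[of _ "map bs [0..<n]"] exI[of _ "map ws [0..<n]"])
   (auto simp: A_def)
 then show ?thesis by blast
qed

lemma quot_lifts:
 assumes "frame (quot_mod D (Fil p)) I ws \<kappa>"
 obtains wt where "!!i. i \<in> I ==> wt i \<in> carrier D" "!!i. i \<in> I ==> ws i = Fil p +>\<^bsub>D\<^esub> wt i"
 using frame_closed[OF assms] unfolding quot_carrier[OF cD F] by metis

text \<open>A functional that vanishes on F^p factors through the quotient and is expanded there;
  lifts of the basis carry the coefficients.\<close>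

lemma functional_expand:
 fixes \<phi> :: "'d => 'r::comm_ring_1"
 assumes f: "frame (quot_mod D (Fil p)) I ws \<kappa>"
  and wt: "!!i. i \<in> I ==> wt i \<in> carrier D" "!!i. i \<in> I ==> ws i = Fil p +>\<^bsub>D\<^esub> wt i"
  and \<phi>: "semilin \<eta> D \<phi>" "!!h. h \<in> Fil p ==> \<phi> h = 0" and h: "h \<in> carrier D"
 shows "\<phi> h = (\<Sum>i\<in>I. \<eta> (\<kappa> (Fil p +>\<^bsub>D\<^esub> h) i) * \<phi> (wt i))"
proof -
 obtain \<psi> where \<psi>: "semilin \<eta> (quot_mod D (Fil p)) \<psi>" "!!h. h \<in> carrier D ==> \<psi> (Fil p +>\<^bsub>D\<^esub> h) = \<phi> h"
  using semilin_quot_lift[OF cD F \<phi>] by metis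
 show ?thesis
  using frame_semilin[OF f \<psi>(1) coset_in_quot[OF cD F h]] wt by (simp add: \<psi>(2) h)
qed

end

text \<open>Over a commutative ring a one-sided inverse of a square matrix is two-sided:
  \<open>det A\<close> is a unit, so a multiple of the adjugate is a left inverse of
  \<open>A\<close>, and it must be \<open>B\<close>.\<close>

lemma sum_inverse_swap:
 fixes a :: "'i => 'j => 'r::comm_ring_1"
 assumes h: "bij_betw h {..<n::nat} I" and g: "bij_betw g {..<n} J"
  and ab: "!!i k. i \<in> I ==> k \<in> I ==> (\<Sum>j\<in>J. a i j * b j k) = (if i = k then 1 else 0)"
  and jl: "j \<in> J" "l \<in> J"
 shows "(\<Sum>i\<in>I. b j i * a i l) = (if j = l then 1 else 0)"
proof -
 define A where "A = mat n n (%(i, j). a (h i) (g j))"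
 define B where "B = mat n n (%(i, j). b (g i) (h j))"
 have c: "A \<in> carrier_mat n n" "B \<in> carrier_mat n n" "adj_mat A \<in> carrier_mat n n"
  using adj_mat(1)[of A n] by (auto simp: A_def B_def)
 have hI: "h i \<in> I" and inj: "i < n ==> k < n ==> h i = h k \<longleftrightarrow> i = k" if "i < n" for i k
  using h that by (auto simp: bij_betw_def inj_on_def)
 have AB: "A * B = 1\<^sub>m n"
  unfolding A_def B_def mat_product[OF g] by (intro eq_matI) (auto simp: ab hI inj)
 define d where "d = det B"
 have dd: "d * det A = 1" using det_mult[OF c(1,2)] AB by (simp add: d_def mult.commute)
 have left: "(d \<cdot>\<^sub>m adj_mat A) * A = 1\<^sub>m n"
  using mult_smult_assoc_mat[OF c(3,1), of d] adj_mat(3)[OF c(1)] dd by (auto intro!: eq_matI)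
 have "B = ((d \<cdot>\<^sub>m adj_mat A) * A) * B" using left c by simp
 also have "\<dots> = d \<cdot>\<^sub>m adj_mat A" using c AB by (simp add: assoc_mult_mat[of _ n n _ n _ n])
 finally have "B * A = 1\<^sub>m n" using left by simp
 moreover have "B * A = mat n n (%(i, j). \<Sum>k\<in>I. b (g i) k * a k (g j))"
  unfolding A_def B_def by (rule mat_product[OF h])
 ultimately have BA: "mat n n (%(i, j). \<Sum>k\<in>I. b (g i) k * a k (g j)) = 1\<^sub>m n" by simp
 obtain i k where ik: "i < n" "k < n" "j = g i" "l = g k" using jl g by (auto simp: bij_betw_def)
 have "(\<Sum>i\<in>I. b j i * a i l) = 1\<^sub>m n $$ (i, k)" unfolding BA[symmetric] using ik by simp
 moreover have "j = l \<longleftrightarrow> i = k" using ik g by (auto simp: bij_betw_def inj_on_def)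
 ultimately show ?thesis using ik by simp
qed

text \<open>
 \<open>K\<close> indexes both a basis \<open>b 1\<close> of \<open>H\<^sub>B\<^sup>+\<close> and a basis \<open>b (- 1)\<close> of \<open>H\<^sub>B\<^sup>-\<close>, and \<open>star\<close> is the effect of
 complex conjugation on the Hodge types. If \<open>deg q \<ge> p\<close> picks one type out of each orbit of \<open>star\<close>,
 then \<open>F\<^sup>p \<otimes> \<complex>\<close> is the graph of an isomorphism \<open>H\<^sub>B\<^sup>+ \<otimes> \<complex> \<rightarrow> H\<^sub>B\<^sup>- \<otimes> \<complex>\<close>, whose determinant in rational bases is
 the ratio of the periods.
\<close>

locale period_frame = period_data N \<sigma> +
 dual_frame "derham N" "hodge_fil N" "map_right \<sigma>" P deg "{1, - 1} \<times> K" y z \<gamma> G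
  "%(s, k). betti_period N \<sigma> (b s k)"
 for N :: "('e::field_char_0, 'f::field_char_0, 'b, 'd) realizations" and \<sigma> and P :: "'p set" and deg
  and K :: "'k set" and y z \<gamma> G and b :: "int => 'k => 'b" +
 fixes cb and w :: int and star and v
 assumes frame_eigen: "!!s. s \<in> {1, - 1} ==> frame (betti_eigen N \<sigma> s) K (b s) (cb s)"
  and semilin_period: "!!s \<phi>. s \<in> {1, - 1} ==> semilin (map_right \<sigma>) (derham N) \<phi> ==>
   semilin (%e. e \<otimes>\<^sub>\<rat> 1) (betti_eigen N \<sigma> s) (%x. betti_period N \<sigma> x \<phi>)"
  and star: "!!p. p \<in> P ==> star p \<in> P" "!!p. p \<in> P ==> star (star p) = p"
   "!!p. p \<in> P ==> deg (star p) = w - deg p"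
  and y_star: "!!p s k. p \<in> P ==> s \<in> {1, - 1} ==> k \<in> K ==> y (star p) (s, k) = of_int s * v p * y p (s, k)"
begin

abbreviation "functional \<equiv> semilin (map_right \<sigma>) (derham N)"
abbreviation "\<beta> s k \<equiv> betti_period N \<sigma> (b s k)"
abbreviation "m \<equiv> card K"

lemma finK': "finite K"
 by (rule frame_finite[OF frame_eigen[of 1]]) simp

lemma sum_split:
 assumes "s \<in> {1, - 1 :: int}"
 shows "(\<Sum>t\<in>{1, - 1} \<times> K. f t) = (\<Sum>k\<in>K. f (s, k)) + (\<Sum>k\<in>K. f (- s, k))"
proof -
 have "(\<Sum>t\<in>{1, - 1} \<times> K. f t) = (\<Sum>t\<in>{1, - 1 :: int}. \<Sum>k\<in>K. f (t, k))"
  by (simp only: sum.cartesian_product) simp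
 then show ?thesis using assms by (auto simp: add.commute)
qed

lemma G_sum:
 assumes "functional \<phi>" "p \<in> P" "s \<in> {1, - 1}"
 shows "G p \<phi> = (\<Sum>k\<in>K. y p (s, k) * \<beta> s k \<phi>) + (\<Sum>k\<in>K. y p (- s, k) * \<beta> (- s) k \<phi>)"
 unfolding G_\<beta>[OF assms(1,2)] sum_split[OF assms(3)] by simp

lemma \<beta>_G:
 assumes \<phi>: "functional \<phi>" and k: "s \<in> {1, - 1}" "k \<in> K"
 shows "\<beta> s k \<phi> = (\<Sum>p\<in>P. z (s, k) p * G p \<phi>)"
proof -
 let ?\<beta> = "%t. (case t of (s, k) => \<beta> s k) \<phi>"
 have "(\<Sum>p\<in>P. z (s, k) p * G p \<phi>) = (\<Sum>p\<in>P. \<Sum>t\<in>{1, - 1} \<times> K. z (s, k) p * y p t * ?\<beta> t)"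
  by (intro sum.cong) (simp_all add: G_\<beta>[OF \<phi>] sum_distrib_left mult.assoc)
 also have "\<dots> = (\<Sum>t\<in>{1, - 1} \<times> K. (\<Sum>p\<in>P. z (s, k) p * y p t) * ?\<beta> t)"
  by (subst sum.swap) (simp add: sum_distrib_right)
 also have "\<dots> = (\<Sum>t\<in>{1, - 1} \<times> K. if t = (s, k) then ?\<beta> t else 0)"
  using k by (intro sum.cong) (auto simp: zy)
 also have "\<dots> = \<beta> s k \<phi>" using k finK by simp
 finally show ?thesis ..
qed

text \<open>Linearity is assumed of \<open>G\<close> only; the Betti values inherit it as
  combinations of the \<open>G p\<close>.\<close>

lemma \<beta>_lin:
 assumes "finite (I::nat set)" "!!i. i \<in> I ==> functional (\<psi> i)" "functional \<phi>"
  "!!h. h \<in> carrier (derham N) ==> \<phi> h = (\<Sum>i\<in>I. a i * \<psi> i h)" and k: "s \<in> {1, - 1}" "k \<in> K"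
 shows "\<beta> s k \<phi> = (\<Sum>i\<in>I. a i * \<beta> s k (\<psi> i))"
proof -
 have "\<beta> s k \<phi> = (\<Sum>p\<in>P. z (s, k) p * (\<Sum>i\<in>I. a i * G p (\<psi> i)))"
  unfolding \<beta>_G[OF assms(3) k] by (intro sum.cong) (simp_all add: G_lin[OF _ assms(1-4)])
 also have "\<dots> = (\<Sum>i\<in>I. a i * (\<Sum>p\<in>P. z (s, k) p * G p (\<psi> i)))"
  by (simp add: sum_distrib_left mult.left_commute) (rule sum.swap)
 also have "\<dots> = (\<Sum>i\<in>I. a i * \<beta> s k (\<psi> i))"
  by (intro sum.cong) (simp_all add: \<beta>_G[OF assms(2) k])
 finally show ?thesis .
qed

lemma card_P: "card P = 2 * m"
proof -
 have "card P \<le> card ({1, - 1 :: int} \<times> K)"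
  by (rule left_inverse_card_le[OF finP finK]) (rule yz)
 moreover have "card ({1, - 1 :: int} \<times> K) \<le> card P"
  by (rule left_inverse_card_le[OF finK finP]) (rule zy)
 ultimately show ?thesis by (simp add: card_cartesian_product)
qed

text \<open>The coordinates of H_DR / F^n and the \<gamma> p with deg p < n are two bases of the
  functionals that vanish on F^n. Each inequality is the expansion of one in terms of the
  other.\<close>

lemma quot_rank:
 assumes f: "frame (derham_quot N n) {..<l::nat} ws \<kappa>"
 shows "l = card {p\<in>P. deg p < n}"
proof -
 let ?Q = "{p\<in>P. deg p < n}"
 let ?\<phi> = "eigen_period N \<sigma> n \<kappa>"
 note sl = semilin_eigen_period[OF f]
 obtain wt where wt: "!!i. i \<in> {..<l} ==> wt i \<in> carrier D" "!!i. i \<in> {..<l} ==> ws i = Fil n +>\<^bsub>D\<^esub> wt i"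
  using quot_lifts[OF f] by metis
 have \<phi>wt: "?\<phi> i (wt j) = (if i = j then 1 else 0)" if "i < l" "j < l" for i j
 proof -
  interpret comm_ring_hom "map_right \<sigma> :: ('e, 'f) qtensor => _" by (rule comm_ring_hom_map_right[OF \<sigma>])
  show ?thesis using that wt(2)[of j] frame_delta[OF f, of i j] by (simp add: eigen_period_def)
 qed
 have "card {..<l} \<le> card ?Q"
 proof (rule left_inverse_card_le)
  fix i j assume ij: "i \<in> {..<l}" "j \<in> {..<l}"
  have "(\<Sum>p\<in>?Q. \<gamma> p (wt j) * G p (?\<phi> i)) = (\<Sum>p\<in>P. \<gamma> p (wt j) * G p (?\<phi> i))"
  proof (intro sum.mono_neutral_left ballI)
   fix q assume q: "q \<in> P - ?Q"
   have "G q (?\<phi> i) = 0" using sl[of i] ij q by (intro G_fil[of _ n]) auto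
   then show "\<gamma> q (wt j) * G q (?\<phi> i) = 0" by simp
  qed (use finP in auto)
  also have "\<dots> = ?\<phi> i (wt j)" using expand[OF sl(1), of i "wt j"] ij wt by simp
  finally show "(\<Sum>p\<in>?Q. G p (?\<phi> i) * \<gamma> p (wt j)) = (if i = j then 1 else 0)"
   using ij by (simp add: \<phi>wt mult.commute)
 qed (use finP in auto)
 moreover have "card ?Q \<le> card {..<l}"
 proof (rule left_inverse_card_le)
  fix p q assume pq: "p \<in> ?Q" "q \<in> ?Q"
  have "\<gamma> p h = (\<Sum>i<l. \<gamma> p (wt i) * ?\<phi> i h)" if h: "h \<in> carrier D" for h
   using functional_expand[OF f wt \<gamma> _ h, of p] \<gamma>_fil[of p n] pq
   by (simp add: eigen_period_def mult.commute)
  then have "G q (\<gamma> p) = (\<Sum>i<l. \<gamma> p (wt i) * G q (?\<phi> i))"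
   using pq sl \<gamma> by (intro G_lin) auto
  then show "(\<Sum>i\<in>{..<l}. \<gamma> p (wt i) * G q (?\<phi> i)) = (if p = q then 1 else 0)"
   using pq by (auto simp: G_\<gamma>)
 qed (use finP in auto)
 ultimately show ?thesis by simp
qed

section \<open>Determinants of periods at a step whose quotient has half the rank\<close>

definition "e = enum K"

lemma bij_e: "bij_betw e {..<m} K"
 unfolding e_def by (rule bij_enum[OF finK'])

lemma e_K: "i < m ==> e i \<in> K"
 using bij_e by (auto simp: bij_betw_def)

lemma e_inj: "i < m ==> j < m ==> e i = e j \<longleftrightarrow> i = j"
 using bij_e by (auto simp: bij_betw_def inj_on_def)

definition adet where
 "adet s \<phi> = det (mat m m (%(i, j). \<beta> s (e j) (\<phi> i)))"

context
 fixes p ws \<kappa>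
 assumes f: "frame (derham_quot N p) {..<m} ws \<kappa>"
begin

abbreviation "\<phi> \<equiv> eigen_period N \<sigma> p \<kappa>"
abbreviation "Q \<equiv> {q\<in>P. p \<le> deg q}"

lemmas \<phi>_lin = semilin_eigen_period(1)[OF f] and \<phi>_fil = semilin_eigen_period(2)[OF f]

lemma card_Q: "card Q = m" "card (P - Q) = m"
proof -
 have "card (P - Q) = m" using quot_rank[OF f] by (simp add: set_diff_eq not_le conj_commute cong: conj_cong)
 moreover have "card (P - Q) = card P - card Q" using finP by (intro card_Diff_subset) auto
 moreover have "card Q \<le> card P" using finP by (intro card_mono) auto
 ultimately show "card Q = m" "card (P - Q) = m" using card_P by auto
qed

text \<open>By counting it is enough that \<open>star\<close> maps \<open>Q\<close> outside
  \<open>Q\<close>. If q and \<open>star q\<close> both lay in \<open>Q\<close>, then 2 p \<le> w,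
  so \<open>star\<close> would map the complement into \<open>Q\<close>, onto it by counting; then q
  would be the conjugate of a type outside \<open>Q\<close>, which is \<open>star q\<close>.\<close>

lemma bij_star: "bij_betw star Q (P - Q)"
proof -
 have inj: "inj_on star P" using star(2) by (metis inj_onI)
 have fin: "finite Q" "finite (P - Q)" using finP by auto
 have "star q \<notin> Q" if q: "q \<in> Q" for q
 proof
  assume sq: "star q \<in> Q"
  then have pw: "2 * p \<le> w" using q star(3)[of q] by auto
  have "star ` (P - Q) \<subseteq> Q"
  proof
   fix r assume "r \<in> star ` (P - Q)"
   then obtain t where t: "t \<in> P - Q" "r = star t" by blast
   then have "t \<in> P" "deg t < p" by auto
   then show "r \<in> Q" using star(1,3)[of t] pw t(2) by simp
  qed
  moreover have "card (star ` (P - Q)) = card Q"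
   using card_Q inj by (subst card_image) (auto intro: inj_on_subset)
  ultimately have "star ` (P - Q) = Q" using fin by (intro card_subset_eq) auto
  then obtain t where "t \<in> P - Q" "q = star t" using q by auto
  then show False using sq star(2)[of t] by auto
 qed
 then have sub: "star ` Q \<subseteq> P - Q" using star(1) by auto
 moreover have inj': "inj_on star Q" using inj by (rule inj_on_subset) auto
 ultimately have "star ` Q = P - Q" using card_Q fin by (intro card_subset_eq) (auto simp: card_image)
 then show ?thesis using inj' by (simp add: bij_betw_def)
qed

definition "g = enum Q"

lemma bij_g: "bij_betw g {..<m} Q"
 using bij_enum[of Q] finP card_Q by (simp add: g_def)

lemma g_Q: "i < m ==> g i \<in> Q"
 using bij_g by (auto simp: bij_betw_def)

text \<open>The columns of \<open>z\<close> at q and at \<open>star q\<close> folded into one by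
  means of \<open>y_star\<close>. This makes the square matrix of \<open>y\<close> over
  \<open>Q\<close> invertible for each sign separately.\<close>

definition "zq s k q = z (s, k) q + of_int s * v q * z (s, k) (star q)"

text \<open>The sum over all types splits into \<open>Q\<close> and its conjugate half, and
  \<open>y_star\<close> brings the second half back to \<open>Q\<close>.\<close>

lemma zy_Q:
 assumes "s \<in> {1, - 1}" "k \<in> K" "j \<in> K"
 shows "(\<Sum>q\<in>Q. y q (s, j) * zq s k q) = (if k = j then 1 else 0)"
proof -
 have "(if k = j then 1 else 0) = (\<Sum>q\<in>P. z (s, k) q * y q (s, j))" using assms by (simp add: zy)
 also have "\<dots> = (\<Sum>q\<in>Q. z (s, k) q * y q (s, j)) + (\<Sum>q\<in>P - Q. z (s, k) q * y q (s, j))"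
  using finP by (subst sum.subset_diff[of Q P]) (auto simp: add.commute)
 also have "(\<Sum>q\<in>P - Q. z (s, k) q * y q (s, j)) = (\<Sum>q\<in>Q. z (s, k) (star q) * y (star q) (s, j))"
  by (rule sum.reindex_bij_betw[OF bij_star, symmetric])
 also have "\<dots> = (\<Sum>q\<in>Q. y q (s, j) * (of_int s * v q * z (s, k) (star q)))"
  using assms by (intro sum.cong) (simp_all add: y_star ac_simps)
 finally show ?thesis by (simp add: zq_def distrib_left sum.distrib mult.commute)
qed

definition "Ydet s = det (mat m m (%(i, j). y (g j) (s, e i)))"

lemma Ydet_unit:
 assumes s: "s \<in> {1, - 1}"
 shows "\<exists>t. Ydet s * t = 1"
proof -
 have "det (mat m m (%(i, j). \<Sum>q\<in>Q. y q (s, e i) * zq s (e j) q)) = det (1\<^sub>m m)"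
  using s by (intro arg_cong[where f = det] eq_matI) (auto simp: zy_Q e_K e_inj)
 then show ?thesis
  using det_product_enum[OF bij_g, of "%i q. y q (s, e i)" "%j q. zq s (e j) q"] by (auto simp: Ydet_def)
qed

lemma Ydet_cancel: "s \<in> {1, - 1} ==> x * Ydet s = x' * Ydet s ==> x = x'"
 using Ydet_unit[of s] by (metis mult.assoc mult_1_right)

text \<open>\<open>\<phi> i\<close> vanishes on F^p, hence on each Hodge type in \<open>Q\<close>;
  splitting this type into its two eigenparts gives the equation of the graph.\<close>

lemma Q_relation:
 assumes s: "s \<in> {1, - 1}" and i: "i < m" and q: "q \<in> Q"
 shows "(\<Sum>k\<in>K. \<beta> s k (\<phi> i) * y q (s, k)) = - (\<Sum>k\<in>K. \<beta> (- s) k (\<phi> i) * y q (- s, k))"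
proof -
 have "G q (\<phi> i) = 0" using q by (intro G_fil[OF \<phi>_lin[OF i] \<phi>_fil[OF i]]) auto
 then show ?thesis using G_sum[OF \<phi>_lin[OF i] _ s, of q] q by (simp add: mult.commute eq_neg_iff_add_eq_0)
qed

text \<open>\<open>Q_relation\<close> as an identity of matrices; the sign \<open>d\<close> comes
  from negating all m columns.\<close>

lemma adet_relation:
 obtains d :: int where "d = 1 \<or> d = - 1" "adet 1 \<phi> * Ydet 1 = of_int d * (adet (- 1) \<phi> * Ydet (- 1))"
proof -
 have pr: "adet s \<phi> * Ydet s = det (mat m m (%(i, j). \<Sum>k\<in>K. \<beta> s k (\<phi> i) * y (g j) (s, k)))" for s
  using det_product_enum[OF bij_e, of "%i k. \<beta> s k (\<phi> i)" "%j k. y (g j) (s, k)"] by (simp add: adet_def Ydet_def)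
 obtain d :: int where d: "d = 1 \<or> d = - 1"
  "det (mat m m (%(i, j). of_int (- 1) * (\<Sum>k\<in>K. \<beta> (- 1) k (\<phi> i) * y (g j) (- 1, k)))) =
   of_int d * det (mat m m (%(i, j). \<Sum>k\<in>K. \<beta> (- 1) k (\<phi> i) * y (g j) (- 1, k)))"
  by (rule det_signs[of "%_. - 1" m "%i j. \<Sum>k\<in>K. \<beta> (- 1) k (\<phi> i) * y (g j) (- 1, k)"]) auto
 have "adet 1 \<phi> * Ydet 1 = det (mat m m (%(i, j). of_int (- 1) * (\<Sum>k\<in>K. \<beta> (- 1) k (\<phi> i) * y (g j) (- 1, k))))"
  unfolding pr
 proof (intro arg_cong[where f = det] eq_matI, goal_cases)
  case (1 i j)
  then show ?case using Q_relation[of 1 i "g j"] g_Q[of j] by simp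
 qed auto
 then show thesis using that[OF d(1)] d(2) pr[of "- 1"] by simp
qed

text \<open>The functionals \<open>\<phi> i\<close> are dual to lifts of the basis of the quotient,
  and their values at the lifts expand in Betti periods of both signs. \<open>Q_relation\<close>
  rewrites those of sign \<open>- s\<close> in terms of those of sign \<open>s\<close>, which leaves
  a right inverse of the period matrix.\<close>

lemma adet_unit:
 assumes s: "s \<in> {1, - 1}"
 shows "\<exists>t. adet s \<phi> * t = 1"
proof -
 obtain wt where wt: "!!i. i \<in> {..<m} ==> wt i \<in> carrier D" "!!i. i \<in> {..<m} ==> ws i = Fil p +>\<^bsub>D\<^esub> wt i"
  using quot_lifts[OF f] by metis
 have s': "- s \<in> {1, - 1}" using s by auto
 define X where "X t k j = (\<Sum>q\<in>P. \<gamma> q (wt j) * y q (t, k))" for t k j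
 \<comment> \<open>The total coefficient of the Betti period at \<open>(s, k)\<close>: its own
   contribution and the one that returns through the sign \<open>- s\<close>.\<close>
 define Z where "Z k j = X s k j - (\<Sum>k'\<in>K. X (- s) k' j * (\<Sum>q\<in>Q. zq (- s) k' q * y q (s, k)))" for k j
 have eq: "(\<Sum>k\<in>K. \<beta> s k (\<phi> i) * Z k j) = (if i = j then 1 else 0)" if i: "i < m" and j: "j < m" for i j
 proof -
  interpret comm_ring_hom "map_right \<sigma> :: ('e, 'f) qtensor => _" by (rule comm_ring_hom_map_right[OF \<sigma>])
  have G: "G q (\<phi> i) = (\<Sum>k\<in>K. y q (s, k) * \<beta> s k (\<phi> i)) + (\<Sum>k\<in>K. y q (- s, k) * \<beta> (- s) k (\<phi> i))"
   if "q \<in> P" for q using G_sum[OF \<phi>_lin[OF i] that s] .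
  have bs: "\<beta> (- s) k (\<phi> i) = - (\<Sum>q\<in>Q. zq (- s) k q * (\<Sum>k'\<in>K. \<beta> s k' (\<phi> i) * y q (s, k')))" if k: "k \<in> K" for k
  proof -
   have "\<beta> (- s) k (\<phi> i) = (\<Sum>k'\<in>K. if k' = k then \<beta> (- s) k' (\<phi> i) else 0)" using k finK' by simp
   also have "\<dots> = (\<Sum>k'\<in>K. \<beta> (- s) k' (\<phi> i) * (\<Sum>q\<in>Q. y q (- s, k') * zq (- s) k q))"
    using zy_Q[OF s' k] by (intro sum.cong) auto
   also have "\<dots> = (\<Sum>q\<in>Q. zq (- s) k q * (\<Sum>k'\<in>K. \<beta> (- s) k' (\<phi> i) * y q (- s, k')))"
    unfolding sum_distrib_left by (subst sum.swap) (simp add: ac_simps)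
   also have "\<dots> = (\<Sum>q\<in>Q. zq (- s) k q * - (\<Sum>k'\<in>K. \<beta> s k' (\<phi> i) * y q (s, k')))"
    using Q_relation[OF s' i] by (intro sum.cong) auto
   finally show ?thesis by (simp add: sum_negf)
  qed
  have "(if i = j then 1 else 0) = \<phi> i (wt j)"
   using i j wt(2)[of j] frame_delta[OF f, of i j] by (simp add: eigen_period_def)
  also have "\<dots> = (\<Sum>q\<in>P. \<gamma> q (wt j) * G q (\<phi> i))" using expand[OF \<phi>_lin[OF i]] wt j by simp
  also have "\<dots> = (\<Sum>q\<in>P. \<Sum>k\<in>K. \<gamma> q (wt j) * y q (s, k) * \<beta> s k (\<phi> i)) +
    (\<Sum>q\<in>P. \<Sum>k\<in>K. \<gamma> q (wt j) * y q (- s, k) * \<beta> (- s) k (\<phi> i))"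
   by (simp add: G distrib_left sum.distrib sum_distrib_left mult.assoc)
  also have "\<dots> = (\<Sum>k\<in>K. X s k j * \<beta> s k (\<phi> i)) + (\<Sum>k\<in>K. X (- s) k j * \<beta> (- s) k (\<phi> i))"
   unfolding X_def sum_distrib_right by (intro arg_cong2[where f = "(+)"] sum.swap)
  also have "(\<Sum>k\<in>K. X (- s) k j * \<beta> (- s) k (\<phi> i)) =
    - (\<Sum>k\<in>K. \<Sum>q\<in>Q. \<Sum>k'\<in>K. X (- s) k j * (zq (- s) k q * (\<beta> s k' (\<phi> i) * y q (s, k'))))"
   by (simp add: bs sum_negf sum_distrib_left)
  also have "(\<Sum>k\<in>K. \<Sum>q\<in>Q. \<Sum>k'\<in>K. X (- s) k j * (zq (- s) k q * (\<beta> s k' (\<phi> i) * y q (s, k')))) =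
    (\<Sum>k'\<in>K. \<beta> s k' (\<phi> i) * (\<Sum>k\<in>K. X (- s) k j * (\<Sum>q\<in>Q. zq (- s) k q * y q (s, k'))))"
  proof -
   have "(\<Sum>k\<in>K. \<Sum>q\<in>Q. \<Sum>k'\<in>K. X (- s) k j * (zq (- s) k q * (\<beta> s k' (\<phi> i) * y q (s, k')))) =
     (\<Sum>k\<in>K. \<Sum>k'\<in>K. \<Sum>q\<in>Q. X (- s) k j * (zq (- s) k q * (\<beta> s k' (\<phi> i) * y q (s, k'))))"
    by (rule sum.cong[OF HOL.refl]) (rule sum.swap)
   also have "\<dots> = (\<Sum>k'\<in>K. \<Sum>k\<in>K. \<Sum>q\<in>Q. X (- s) k j * (zq (- s) k q * (\<beta> s k' (\<phi> i) * y q (s, k'))))"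
    by (rule sum.swap)
   finally show ?thesis by (simp add: sum_distrib_left ac_simps)
  qed
  finally show ?thesis by (simp add: Z_def right_diff_distrib sum_subtractf mult.commute)
 qed
 have "det (mat m m (%(i, j). \<Sum>k\<in>K. \<beta> s k (\<phi> i) * Z k j)) = det (1\<^sub>m m)"
  by (intro arg_cong[where f = det] eq_matI) (auto simp: eq)
 then show ?thesis
  using det_product_enum[OF bij_e, of "%i k. \<beta> s k (\<phi> i)" "%j k. Z k j"] by (auto simp: adet_def)
qed

text \<open>The signs \<open>s0\<close> multiply the columns of a square matrix, so they change its
  determinant only by a sign. Up to this freedom \<open>\<psi>\<close> is the isomorphism between
  the eigenparts, and the factor \<open>Ydet 1\<close> cancels because it is a unit.\<close>

lemma adet_ratio:
 assumes s0: "!!q. s0 q = 1 \<or> s0 q = (- 1 :: int)"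
  and \<psi>: "!!q k. q \<in> Q ==> k \<in> K ==> (\<Sum>j\<in>K. \<psi> k j * y q (1, j)) = of_int (s0 q) * y q (- 1, k)"
 obtains d :: int where "d = 1 \<or> d = - 1" "adet 1 \<phi> = of_int d * adet (- 1) \<phi> * gdet K \<psi>"
proof -
 obtain d1 :: int where d1: "d1 = 1 \<or> d1 = - 1" "adet 1 \<phi> * Ydet 1 = of_int d1 * (adet (- 1) \<phi> * Ydet (- 1))"
  by (rule adet_relation)
 obtain d2 :: int where d2: "d2 = 1 \<or> d2 = - 1"
  "det (mat m m (%(i, j). of_int (s0 (g j)) * y (g j) (- 1, e i))) = of_int d2 * Ydet (- 1)"
  unfolding Ydet_def
  by (rule det_signs[of "%j. s0 (g j)" m "%i j. y (g j) (- 1, e i)"]) (use s0 in auto)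
 have "gdet K \<psi> * Ydet 1 = det (mat m m (%(i, j). \<Sum>k\<in>K. \<psi> (e i) k * y (g j) (1, k)))"
  unfolding gdet_enum[OF bij_e] Ydet_def
  using det_product_enum[OF bij_e, of "%i k. \<psi> (e i) k" "%j k. y (g j) (1, k)"] by simp
 also have "\<dots> = det (mat m m (%(i, j). of_int (s0 (g j)) * y (g j) (- 1, e i)))"
  using \<psi> g_Q e_K by (intro arg_cong[where f = det] eq_matI) auto
 finally have *: "gdet K \<psi> * Ydet 1 = of_int d2 * Ydet (- 1)" using d2 by simp
 have "Ydet (- 1) = of_int d2 * (of_int d2 * Ydet (- 1))" using d2(1) by auto
 then have "adet 1 \<phi> * Ydet 1 = of_int (d1 * d2) * adet (- 1) \<phi> * gdet K \<psi> * Ydet 1"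
  unfolding d1(2) using * by (metis (no_types, lifting) mult.assoc mult.left_commute of_int_mult)
 then have "adet 1 \<phi> = of_int (d1 * d2) * adet (- 1) \<phi> * gdet K \<psi>" by (rule Ydet_cancel[rotated]) simp
 then show thesis using that[of "d1 * d2"] d1 d2 by auto
qed

end

text \<open>\<open>periods\<close> leaves the step of the filtration free. When both quotients have
  rank m, the coordinates modulo the larger step also vanish on the smaller one, so they are
  combinations of the other coordinates, with an invertible matrix over \<EE> \<otimes>
  \<FF>.\<close>

lemma adet_change:
 assumes f1: "frame (derham_quot N p1) {..<m} ws1 \<kappa>1" and f2: "frame (derham_quot N p2) {..<m} ws2 \<kappa>2"
  and le: "p1 \<le> p2" and s: "s \<in> {1, - 1}"
 obtains t where "t \<in> runits (range \<sigma>)"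
  "adet s (eigen_period N \<sigma> p1 \<kappa>1) = t * adet s (eigen_period N \<sigma> p2 \<kappa>2)"
proof -
 interpret mr: comm_ring_hom "map_right \<sigma> :: ('e, 'f) qtensor => _" by (rule comm_ring_hom_map_right[OF \<sigma>])
 obtain wt1 where wt1: "!!i. i \<in> {..<m} ==> wt1 i \<in> carrier D" "!!i. i \<in> {..<m} ==> ws1 i = Fil p1 +>\<^bsub>D\<^esub> wt1 i"
  using quot_lifts[OF f1] by metis
 obtain wt2 where wt2: "!!i. i \<in> {..<m} ==> wt2 i \<in> carrier D" "!!i. i \<in> {..<m} ==> ws2 i = Fil p2 +>\<^bsub>D\<^esub> wt2 i"
  using quot_lifts[OF f2] by metis
 define C where "C i j = \<kappa>1 (Fil p1 +>\<^bsub>D\<^esub> wt2 j) i" for i j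
 have ex: "\<kappa>1 (Fil p1 +>\<^bsub>D\<^esub> h) i = (\<Sum>j<m. \<kappa>2 (Fil p2 +>\<^bsub>D\<^esub> h) j * C i j)" if i: "i < m" and h: "h \<in> carrier D" for i h
 proof -
  have i': "i \<in> {..<m}" using i by simp
  note sq = semilin_quot[OF cD F frame_coord[OF f1 i']]
  show ?thesis unfolding C_def
   by (rule functional_expand[OF f2 wt2 sq(1) sq(2) h]) (use F_dec[OF le] in auto)
 qed
 have "(\<Sum>j<m. C i j * \<kappa>2 (Fil p2 +>\<^bsub>D\<^esub> wt1 l) j) = (if i = l then 1 else 0)" if "i < m" "l < m" for i l
  using ex[OF that(1), of "wt1 l"] wt1 that frame_delta[OF f1, of i l] by (simp add: mult.commute)
 then have "det (mat m m (%(i, l). \<Sum>j\<in>{..<m}. C i j * \<kappa>2 (Fil p2 +>\<^bsub>D\<^esub> wt1 l) j)) = det (1\<^sub>m m)"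
  by (intro arg_cong[where f = det] eq_matI) auto
 then have unit: "det (mat m m (%(i, j). C i j)) * det (mat m m (%(i, j). \<kappa>2 (Fil p2 +>\<^bsub>D\<^esub> wt1 j) i)) = 1"
  using det_product_enum[OF bij_betw_id, of m C "%l j. \<kappa>2 (Fil p2 +>\<^bsub>D\<^esub> wt1 l) j"] by simp
 have "\<beta> s k (eigen_period N \<sigma> p1 \<kappa>1 i) = (\<Sum>j<m. map_right \<sigma> (C i j) * \<beta> s k (eigen_period N \<sigma> p2 \<kappa>2 j))"
  if i: "i < m" and k: "k \<in> K" for i k
  using semilin_eigen_period(1)[OF f1] semilin_eigen_period(1)[OF f2] i k s
  by (intro \<beta>_lin) (auto simp: eigen_period_def ex mr.hom_sum mr.hom_mult mult.commute)
 then have "adet s (eigen_period N \<sigma> p1 \<kappa>1) =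
   det (mat m m (%(i, k). \<Sum>j\<in>{..<m}. map_right \<sigma> (C i j) * \<beta> s (e k) (eigen_period N \<sigma> p2 \<kappa>2 j)))"
  unfolding adet_def using e_K by (intro arg_cong[where f = det] eq_matI) auto
 also have "\<dots> = det (mat m m (%(i, j). map_right \<sigma> (C i j))) * adet s (eigen_period N \<sigma> p2 \<kappa>2)"
  using det_product_enum[OF bij_betw_id, of m "%i j. map_right \<sigma> (C i j)" "%k j. \<beta> s (e k) (eigen_period N \<sigma> p2 \<kappa>2 j)"]
  by (simp add: adet_def)
 also have "mat m m (%(i, j). map_right \<sigma> (C i j)) = map_mat (map_right \<sigma>) (mat m m (%(i, j). C i j))"
  by (intro eq_matI) auto
 finally show thesis using that runits_map_right[OF \<sigma> unit] by simp
qed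

lemma one_range: "1 \<in> range \<sigma>"
proof -
 interpret field_hom \<sigma> by (rule \<sigma>)
 show ?thesis by (metis hom_one rangeI)
qed

lemma mult_range: "c \<in> range \<sigma> ==> d \<in> range \<sigma> ==> c * d \<in> range \<sigma>"
proof -
 interpret field_hom \<sigma> by (rule \<sigma>)
 assume "c \<in> range \<sigma>" "d \<in> range \<sigma>"
 then obtain x x' where "c = \<sigma> x" "d = \<sigma> x'" by auto
 then have "c * d = \<sigma> (x * x')" by (simp add: hom_mult)
 then show ?thesis by simp
qed

lemmas runits_range_mult = runits_mult[OF mult_range]

text \<open>An arbitrary rational Betti basis is replaced by the fixed one; the determinant of the
  change lies in \<EE>.\<close>

lemma periods_adet:
 assumes c: "c \<in> periods N \<sigma> s" and s: "s \<in> {1, - 1}"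
 obtains p ws \<kappa> t where "frame (derham_quot N p) {..<m} ws \<kappa>" "t \<in> runits (range \<sigma>)"
  "c = t * adet s (eigen_period N \<sigma> p \<kappa>)"
proof -
 obtain n :: nat and p bs c' ws \<kappa> where *: "frame (betti_eigen N \<sigma> s) {..<n} bs c'"
  "frame (derham_quot N p) {..<n} ws \<kappa>"
  "c = det (mat n n (%(i, j). betti_period N \<sigma> (bs j) (eigen_period N \<sigma> p \<kappa> i)))"
  using periods_elim[OF c s frame_cmod[OF frame_eigen[OF s]]] by metis
 have n: "n = m" using frame_card[OF *(1) frame_eigen[OF s]] by simp
 interpret l: comm_ring_hom "%e. e \<otimes>\<^sub>\<rat> 1 :: ('e, complex) qtensor" by (rule comm_ring_hom_left)
 have "betti_period N \<sigma> (bs j) (eigen_period N \<sigma> p \<kappa> i) =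
   (\<Sum>k\<in>K. \<beta> s k (eigen_period N \<sigma> p \<kappa> i) * (cb s (bs j) k \<otimes>\<^sub>\<rat> 1))" if "i < m" "j < m" for i j
  using frame_semilin[OF frame_eigen[OF s] semilin_period[OF s semilin_eigen_period(1)[OF *(2)]], of i "bs j"]
   frame_closed[OF *(1), of j] that n by (simp add: mult.commute)
 then have "c = det (mat m m (%(i, j). \<Sum>k\<in>K. \<beta> s k (eigen_period N \<sigma> p \<kappa> i) * (cb s (bs j) k \<otimes>\<^sub>\<rat> 1)))"
  unfolding *(3) n by (intro arg_cong[where f = det] eq_matI) auto
 also have "\<dots> = adet s (eigen_period N \<sigma> p \<kappa>) * det (mat m m (%(i, j). cb s (bs j) (e i) \<otimes>\<^sub>\<rat> 1))"
  using det_product_enum[OF bij_e, of "%i k. \<beta> s k (eigen_period N \<sigma> p \<kappa> i)" "%j k. cb s (bs j) k \<otimes>\<^sub>\<rat> 1"]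
  by (simp add: adet_def)
 also have "mat m m (%(i, j). cb s (bs j) (e i) \<otimes>\<^sub>\<rat> 1) = map_mat (%e. e \<otimes>\<^sub>\<rat> 1) (mat m m (%(i, j). cb s (bs j) (e i)))"
  by (intro eq_matI) auto
 finally have "c = (det (mat m m (%(i, j). cb s (bs j) (e i))) \<otimes>\<^sub>\<rat> 1) * adet s (eigen_period N \<sigma> p \<kappa>)"
  by (simp add: mult.commute)
 moreover have "det (mat m m (%(i, j). cb s (bs j) (e i))) \<otimes>\<^sub>\<rat> 1 \<in> runits (range \<sigma>)"
  using frame_change_det[OF *(1)[unfolded n] frame_eigen[OF s] bij_e] by (intro runits_pure[OF one_range])
 ultimately show thesis using that *(2) n by blast
qed

lemma periods_unit:
 assumes c: "c \<in> periods N \<sigma> s" and s: "s \<in> {1, - 1}"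
 shows "\<exists>t. c * t = 1"
proof -
 obtain p ws \<kappa> t where *: "frame (derham_quot N p) {..<m} ws \<kappa>" "t \<in> runits (range \<sigma>)"
  "c = t * adet s (eigen_period N \<sigma> p \<kappa>)" by (rule periods_adet[OF c s])
 obtain t' where t': "t * t' = 1" using *(2) by (auto simp: runits_def)
 obtain a where a: "adet s (eigen_period N \<sigma> p \<kappa>) * a = 1" using adet_unit[OF *(1) s] by blast
 have "c * (t' * a) = (t * t') * (adet s (eigen_period N \<sigma> p \<kappa>) * a)" unfolding *(3) by (simp only: ac_simps)
 then show ?thesis using t' a by auto
qed

text \<open>The two periods come with unrelated bases and filtration steps. Both are reduced to the
  fixed Betti basis, and \<open>adet_change\<close> moves the second to the step of the first, in
  whichever direction the steps are nested.\<close>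

theorem period_ratio:
 assumes c1: "c1 \<in> periods N \<sigma> 1" and c2: "c2 \<in> periods N \<sigma> (- 1)"
  and s0: "!!q. s0 q = 1 \<or> s0 q = (- 1 :: int)"
  and \<psi>: "!!q k. q \<in> P ==> k \<in> K ==> (\<Sum>j\<in>K. \<psi> k j * y q (1, j)) = of_int (s0 q) * y q (- 1, k)"
 obtains t where "t \<in> runits (range \<sigma>)" "c1 = t * c2 * gdet K \<psi>"
proof -
 obtain p1 ws1 \<kappa>1 t1 where 1: "frame (derham_quot N p1) {..<m} ws1 \<kappa>1" "t1 \<in> runits (range \<sigma>)"
  "c1 = t1 * adet 1 (eigen_period N \<sigma> p1 \<kappa>1)" by (rule periods_adet[OF c1]) auto
 obtain p2 ws2 \<kappa>2 t2 where 2: "frame (derham_quot N p2) {..<m} ws2 \<kappa>2" "t2 \<in> runits (range \<sigma>)"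
  "c2 = t2 * adet (- 1) (eigen_period N \<sigma> p2 \<kappa>2)" by (rule periods_adet[OF c2]) auto
 obtain d :: int where d: "d = 1 \<or> d = - 1" "adet 1 (eigen_period N \<sigma> p1 \<kappa>1) =
   of_int d * adet (- 1) (eigen_period N \<sigma> p1 \<kappa>1) * gdet K \<psi>"
  by (rule adet_ratio[OF 1(1), of s0 \<psi>]) (use s0 \<psi> in auto)
 have "\<exists>t\<in>runits (range \<sigma>). adet (- 1) (eigen_period N \<sigma> p1 \<kappa>1) = t * adet (- 1) (eigen_period N \<sigma> p2 \<kappa>2)"
 proof (cases "p1 \<le> p2")
  case True
  show ?thesis by (rule adet_change[OF 1(1) 2(1) True, of "- 1"]) auto
 next
  case False
  then have le: "p2 \<le> p1" by simp
  obtain t where t: "t \<in> runits (range \<sigma>)" 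
   "adet (- 1) (eigen_period N \<sigma> p2 \<kappa>2) = t * adet (- 1) (eigen_period N \<sigma> p1 \<kappa>1)"
   by (rule adet_change[OF 2(1) 1(1) le, of "- 1"]) auto
  then obtain t' where t': "t * t' = 1" by (auto simp: runits_def)
  have "t' * adet (- 1) (eigen_period N \<sigma> p2 \<kappa>2) = (t * t') * adet (- 1) (eigen_period N \<sigma> p1 \<kappa>1)"
   unfolding t(2) by (simp only: ac_simps)
  then show ?thesis using runits_inverse[OF t(1) t'] t' by (intro bexI[of _ t']) simp_all
 qed
 then obtain t where t: "t \<in> runits (range \<sigma>)"
  "adet (- 1) (eigen_period N \<sigma> p1 \<kappa>1) = t * adet (- 1) (eigen_period N \<sigma> p2 \<kappa>2)" by blast
 obtain t2' where t2': "t2 * t2' = 1" using 2(2) by (auto simp: runits_def)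
 have "c1 = t1 * of_int d * t * (t2 * t2') * adet (- 1) (eigen_period N \<sigma> p2 \<kappa>2) * gdet K \<psi>"
  unfolding 1(3) d(2) t(2) t2' by (simp add: ac_simps)
 also have "\<dots> = (t1 * of_int d * t * t2') * c2 * gdet K \<psi>" unfolding 2(3) by (simp only: ac_simps)
 finally have "c1 = (t1 * of_int d * t * t2') * c2 * gdet K \<psi>" .
 moreover have "t1 * of_int d * t * t2' \<in> runits (range \<sigma>)"
  by (intro runits_range_mult 1(2) t(1) runits_sign[OF one_range d(1)] runits_inverse[OF 2(2) t2'])
 ultimately show thesis by (rule that[rotated])
qed

lemma periods_ex:
 assumes rank: "has_rank (derham_quot N p) n" and card: "card {q\<in>P. deg q < p} = m" and s: "s \<in> {1, - 1}"
 shows "periods N \<sigma> s \<noteq> {}"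
proof -
 obtain ws \<kappa> where f: "frame (derham_quot N p) {..<n} ws \<kappa>" using has_rank_frame[OF cQ rank] by blast
 have "n = m" using quot_rank[OF f] card by simp
 then show ?thesis
  using periods_nonempty[OF frame_reindex[OF frame_eigen[OF s] bij_e] _ s] f by blast
qed

text \<open>The isomorphism of which \<open>F\<^sup>p \<otimes> \<complex>\<close> is the graph, up to sign, and its inverse.\<close>

lemma graph_iso:
 assumes f: "frame (derham_quot N p) {..<m} ws \<kappa>"
 obtains \<psi> where "!!s q k. s \<in> {1, - 1} ==> q \<in> P ==> k \<in> K ==>
   (\<Sum>j\<in>K. \<psi> s k j * y q (s, j)) = of_int (if p \<le> deg q then - 1 else 1) * y q (- s, k)"
  and "gdet K (\<psi> 1) * gdet K (\<psi> (- 1)) = 1"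
proof -
 let ?Q = "{q\<in>P. p \<le> deg q}"
 \<comment> \<open>\<open>zq s\<close> inverts the matrix of \<open>y\<close> over \<open>?Q\<close>
   for the sign \<open>s\<close>, so this is the transition from the sign \<open>s\<close> to the
   sign \<open>- s\<close>, with the minus sign of \<open>Q_relation\<close>.\<close>
 define \<psi> where "\<psi> s k j = - (\<Sum>q\<in>?Q. y q (- s, k) * zq s j q)" for s k j
 \<comment> \<open>\<open>zy_Q\<close> is the product in the other order; both index sets have m
   elements.\<close>
 have swap: "(\<Sum>j\<in>K. zq s j q * y q' (s, j)) = (if q = q' then 1 else 0)"
  if s: "s \<in> {1, - 1}" and q: "q \<in> ?Q" "q' \<in> ?Q" for s q q'
  by (rule sum_inverse_swap[OF bij_e bij_g[OF f], where a = "%j q. y q (s, j)"])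
   (use s q zy_Q[OF f s] in auto)
 have \<psi>_Q: "(\<Sum>j\<in>K. \<psi> s k j * y q (s, j)) = - y q (- s, k)" if s: "s \<in> {1, - 1}" and q: "q \<in> ?Q" for s q k
 proof -
  have "(\<Sum>j\<in>K. \<psi> s k j * y q (s, j)) = - (\<Sum>j\<in>K. \<Sum>q'\<in>?Q. y q' (- s, k) * (zq s j q' * y q (s, j)))"
   by (simp add: \<psi>_def sum_negf sum_distrib_right mult.assoc)
  also have "\<dots> = - (\<Sum>q'\<in>?Q. y q' (- s, k) * (\<Sum>j\<in>K. zq s j q' * y q (s, j)))"
   by (subst sum.swap) (simp add: sum_distrib_left)
  also have "\<dots> = - (\<Sum>q'\<in>?Q. if q' = q then y q' (- s, k) else 0)"
   using swap[OF s _ q] by (intro arg_cong[where f = uminus] sum.cong) auto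
  also have "\<dots> = - y q (- s, k)" using finP q by simp
  finally show ?thesis .
 qed
 show thesis
 proof (rule that)
  fix s :: int and q k assume s: "s \<in> {1, - 1}" and q: "q \<in> P" and k: "k \<in> K"
  show "(\<Sum>j\<in>K. \<psi> s k j * y q (s, j)) = of_int (if p \<le> deg q then - 1 else 1) * y q (- s, k)"
  proof (cases "p \<le> deg q")
   case True
   then show ?thesis using \<psi>_Q[OF s] q by simp
  next
   case False
   then obtain q' where q': "q' \<in> ?Q" "q = star q'"
    using bij_star[OF f] q unfolding bij_betw_def by (metis (no_types, lifting) DiffI imageE mem_Collect_eq)
   \<comment> \<open>Passing to the conjugate type multiplies the part of sign \<open>s\<close> by
     \<open>s\<close> and that of sign \<open>- s\<close> by \<open>- s\<close>, apart from the
     common factor \<open>v q'\<close>; so the sign -1 becomes 1.\<close>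
   have "(\<Sum>j\<in>K. \<psi> s k j * y q (s, j)) = of_int s * v q' * (\<Sum>j\<in>K. \<psi> s k j * y q' (s, j))"
    unfolding sum_distrib_left using q' s by (intro sum.cong) (simp_all add: y_star mult.left_commute)
   also have "\<dots> = y q (- s, k)" using q' s k by (auto simp: \<psi>_Q y_star)
   finally show ?thesis using False by simp
  qed
 next
  have "(\<Sum>j\<in>K. \<psi> 1 k j * \<psi> (- 1) j l) = (if k = l then 1 else 0)" if kl: "k \<in> K" "l \<in> K" for k l
  proof -
   have "(\<Sum>j\<in>K. \<psi> 1 k j * \<psi> (- 1) j l) = - (\<Sum>j\<in>K. \<Sum>q\<in>?Q. \<psi> 1 k j * (y q (1, j) * zq (- 1) l q))"
    by (simp add: \<psi>_def[of "- 1"] sum_negf sum_distrib_left)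
   also have "\<dots> = - (\<Sum>q\<in>?Q. (\<Sum>j\<in>K. \<psi> 1 k j * y q (1, j)) * zq (- 1) l q)"
    by (subst sum.swap) (simp add: sum_distrib_right mult.assoc)
   also have "\<dots> = (\<Sum>q\<in>?Q. y q (- 1, k) * zq (- 1) l q)" by (simp add: \<psi>_Q sum_negf)
   also have "\<dots> = (if k = l then 1 else 0)" using zy_Q[OF f _ kl(2,1), of "- 1"] by auto
   finally show ?thesis .
  qed
  then have "gdet K (%k l. \<Sum>j\<in>K. \<psi> 1 k j * \<psi> (- 1) j l) = gdet K (%k l. if k = l then 1 else 0)"
   using finK' by (intro gdet_cong) auto
  then show "gdet K (\<psi> 1) * gdet K (\<psi> (- 1)) = 1"
   unfolding gdet_mult[OF finK'] gdet_one[OF finK'] .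
 qed
qed

end

section \<open>Rational bases adapted to complex conjugation\<close>

context
 fixes V :: "('e::field_char_0, 'v) module" and \<Phi> :: "'v => 'v"
 assumes V: "cmod V" and \<Phi>: "\<Phi> \<in> LinearCombinations.module_hom class_ring V V"
  and inv: "!!x. x \<in> carrier V ==> \<Phi> (\<Phi> x) = x"
begin

interpretation V: Module.module class_ring V by (rule V)

abbreviation "eig s \<equiv> {x \<in> carrier V. \<Phi> x = of_int s \<odot>\<^bsub>V\<^esub> x}"
definition "proj s x = (1 / 2) \<odot>\<^bsub>V\<^esub> x \<oplus>\<^bsub>V\<^esub> (of_int s / 2) \<odot>\<^bsub>V\<^esub> \<Phi> x"

lemmas \<Phi>_add = module_hom_add[OF \<Phi>] and \<Phi>_smult = module_hom_smult[OF \<Phi>] and \<Phi>_closed = module_hom_closed[OF \<Phi>]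
lemmas VD = cmodD[OF V]

lemma comb_add:
 assumes "x \<in> carrier V" "x' \<in> carrier V"
 shows "(a \<odot>\<^bsub>V\<^esub> x \<oplus>\<^bsub>V\<^esub> a' \<odot>\<^bsub>V\<^esub> x') \<oplus>\<^bsub>V\<^esub> (d \<odot>\<^bsub>V\<^esub> x \<oplus>\<^bsub>V\<^esub> d' \<odot>\<^bsub>V\<^esub> x') = (a + d) \<odot>\<^bsub>V\<^esub> x \<oplus>\<^bsub>V\<^esub> (a' + d') \<odot>\<^bsub>V\<^esub> x'"
 using assms by (simp add: VD V.a_ac)

lemma \<Phi>_proj:
 assumes "x \<in> carrier V" "s \<in> {1, - 1 :: int}"
 shows "\<Phi> (proj s x) = of_int s \<odot>\<^bsub>V\<^esub> proj s x"
proof -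
 have "of_int s * (of_int s / 2) = (1 / 2 :: 'e)" using assms(2) by auto
 then show ?thesis using assms(1)
  by (simp add: proj_def \<Phi>_add \<Phi>_smult \<Phi>_closed inv VD(1,3,8) VD(4)[symmetric] V.a_comm)
qed

lemma proj_closed: "x \<in> carrier V ==> proj s x \<in> carrier V"
 by (simp add: proj_def VD \<Phi>_closed)

lemma proj_eig: "x \<in> carrier V ==> s \<in> {1, - 1 :: int} ==> proj s x \<in> eig s"
 using \<Phi>_proj proj_closed by blast

lemma proj_sum: "x \<in> carrier V ==> proj 1 x \<oplus>\<^bsub>V\<^esub> proj (- 1) x = x"
 unfolding proj_def by (subst comb_add) (simp_all add: \<Phi>_closed VD)

lemma proj_on_eig:
 assumes "x \<in> eig t" "s \<in> {1, - 1 :: int}" "t \<in> {1, - 1}"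
 shows "proj s x = (if s = t then x else \<zero>\<^bsub>V\<^esub>)"
proof -
 have x: "x \<in> carrier V" using assms(1) by simp
 have "proj s x = (1 / 2 + of_int s / 2 * of_int t) \<odot>\<^bsub>V\<^esub> x"
  unfolding VD(2)[OF x] VD(4)[OF x] using assms(1) by (simp add: proj_def)
 then show ?thesis using assms by (auto simp: VD(5,6))
qed

lemma proj_add:
 assumes "x \<in> carrier V" "x' \<in> carrier V"
 shows "proj s (x \<oplus>\<^bsub>V\<^esub> x') = proj s x \<oplus>\<^bsub>V\<^esub> proj s x'"
 using assms by (simp add: proj_def \<Phi>_add \<Phi>_closed VD V.a_ac)

lemma proj_smult:
 assumes "x \<in> carrier V"
 shows "proj s (a \<odot>\<^bsub>V\<^esub> x) = a \<odot>\<^bsub>V\<^esub> proj s x"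
 using assms by (simp add: proj_def \<Phi>_smult \<Phi>_closed VD(1,3,8) VD(4)[symmetric] mult.commute)

lemma cmod_eig: "cmod (submod V (eig s))"
proof (rule cmod_submod[OF V])
 have "\<Phi> \<zero>\<^bsub>V\<^esub> = \<Phi> (0 \<odot>\<^bsub>V\<^esub> \<zero>\<^bsub>V\<^esub>)" by (simp add: VD)
 also have "\<dots> = \<zero>\<^bsub>V\<^esub>" by (subst \<Phi>_smult) (simp_all add: VD \<Phi>_closed)
 finally show "\<zero>\<^bsub>V\<^esub> \<in> eig s" by (simp add: VD)
qed (auto simp: \<Phi>_add \<Phi>_smult VD(1,3,8) VD(4)[symmetric] mult.commute)

text \<open>The projections of a basis span the eigenspace, and a basis is selected among
  them.\<close>

lemma eig_frame:
 assumes f: "frame V K b c" and s: "s \<in> {1, - 1 :: int}"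
 shows "\<exists>(n::nat) u d. frame (submod V (eig s)) {..<n} u d"
proof -
 have u: "proj s (b k) \<in> carrier (submod V (eig s))" if "k \<in> K" for k
  using proj_eig[OF frame_closed[OF f that] s] by simp
 have "\<exists>a. x = lc (submod V (eig s)) K a (%k. proj s (b k))" if x: "x \<in> carrier (submod V (eig s))" for x
 proof -
  have xV: "x \<in> carrier V" using x by simp
  have "x = proj s x" using proj_on_eig[of x s s] x s by simp
  also have "\<dots> = proj s (lc V K (c x) b)" using frame_expand[OF f xV] by simp
  also have "\<dots> = lc (submod V (eig s)) K (c x) (%k. proj s (b k))"
   by (rule hom_lc[OF V cmod_eig, where \<eta> = "%r. r"])
    (use s in \<open>auto simp: frame_closed[OF f] frame_finite[OF f] proj_add proj_smult proj_closed \<Phi>_proj\<close>)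
  finally show ?thesis by blast
 qed
 from spanning_subframe[OF cmod_eig frame_finite[OF f] u this]
 obtain J d where J: "frame (submod V (eig s)) J (%k. proj s (b k)) d" by blast
 from frame_reindex[OF J bij_enum[OF frame_finite[OF J]]] show ?thesis by blast
qed

lemma sum_frame:
 assumes f: "!!s. s \<in> {1, - 1 :: int} ==> frame (submod V (eig s)) {..<n s :: nat} (u s) (d s)"
 shows "frame V (Sigma {1, - 1} (%s. {..<n s})) (%(s, k). u s k) (%x (s, k). d s (proj s x) k)"
  (is "frame V ?K ?b ?c")
 unfolding frame_def
proof (intro conjI ballI)
 have u: "u s k \<in> eig s" if "s \<in> {1, - 1}" "k < n s" for s k
  using frame_closed[OF f[OF that(1)], of k] that by simp
 show b: "?b i \<in> carrier V" if "i \<in> ?K" for i using that u by auto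
 show "semilin (%r. r) V (%x. ?c x i)" if i: "i \<in> ?K" for i
 proof -
  obtain s k where sk: "i = (s, k)" "s \<in> {1, - 1}" "k < n s" using i by auto
  have "semilin (%r. r) (submod V (eig s)) (%x. d s x k)" using frame_coord[OF f] sk by auto
  then show ?thesis using sk proj_eig[OF _ sk(2)]
   by (simp add: semilin_def proj_add proj_smult)
 qed
 show "?c (?b j) i = (if i = j then 1 else 0)" if ij: "i \<in> ?K" "j \<in> ?K" for i j
 proof -
  obtain s k where sk: "i = (s, k)" "s \<in> {1, - 1}" "k < n s" using ij by auto
  obtain t l where tl: "j = (t, l)" "t \<in> {1, - 1}" "l < n t" using ij by auto
  have "semilin (%r. r) (submod V (eig s)) (%x. d s x k)" using frame_coord[OF f] sk by auto
  from semilin_zero[OF this cmod_eig] have "d s \<zero>\<^bsub>V\<^esub> k = 0" by simp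
  then show ?thesis using sk tl proj_on_eig[OF u[OF tl(2,3)] sk(2) tl(2)] frame_delta[OF f[OF sk(2)], of k l]
   by auto
 qed
 show "x = lc V ?K (?c x) ?b" if x: "x \<in> carrier V" for x
 proof -
  have K: "?K = {1} \<times> {..<n 1} \<union> {- 1} \<times> {..<n (- 1)}" by auto
  have part: "(\<Oplus>\<^bsub>V\<^esub>i\<in>{s} \<times> {..<n s}. ?c x i \<odot>\<^bsub>V\<^esub> ?b i) = proj s x" if s: "s \<in> {1, - 1}" for s
  proof -
   have "proj s x = lc (submod V (eig s)) {..<n s} (d s (proj s x)) (u s)"
    using proj_eig[OF x s] by (intro frame_expand[OF f[OF s]]) simp
   also have "\<dots> = lc V {..<n s} (d s (proj s x)) (u s)"
    by (rule hom_lc[OF cmod_eig V, where g = "%x. x" and \<eta> = "%r. r"]) (use u[OF s] in auto)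
   also have "\<dots> = lc V ({s} \<times> {..<n s}) (%i. d s (proj s x) (snd i)) (%i. u s (snd i))"
   proof (rule lc_reindex[OF V])
    show "bij_betw snd ({s} \<times> {..<n s}) {..<n s}" by (auto simp: bij_betw_def inj_on_def)
   qed (use u[OF s] in auto)
   also have "\<dots> = (\<Oplus>\<^bsub>V\<^esub>i\<in>{s} \<times> {..<n s}. ?c x i \<odot>\<^bsub>V\<^esub> ?b i)"
    unfolding lc_def
   proof (rule V.finsum_cong')
    show "(%i. ?c x i \<odot>\<^bsub>V\<^esub> ?b i) \<in> {s} \<times> {..<n s} \<rightarrow> carrier V"
     using u[OF s] by (intro Pi_I VD(1)) auto
   qed auto
   finally show ?thesis by simp
  qed
  have "lc V ?K (?c x) ?b = (\<Oplus>\<^bsub>V\<^esub>i\<in>{1} \<times> {..<n 1}. ?c x i \<odot>\<^bsub>V\<^esub> ?b i) \<oplus>\<^bsub>V\<^esub>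
    (\<Oplus>\<^bsub>V\<^esub>i\<in>{- 1} \<times> {..<n (- 1)}. ?c x i \<odot>\<^bsub>V\<^esub> ?b i)"
   unfolding lc_def K using b K by (intro V.finsum_Un_disjoint) (auto intro!: VD(1))
  then show ?thesis using part[of 1] part[of "- 1"] proj_sum[OF x] by simp
 qed
qed (use V in auto)

end

section \<open>Counting Hodge types; frames attached to a motive\<close>

definition sign_index :: "(int => nat) => (int \<times> nat) set" where
 "sign_index n = Sigma {1, - 1} (%s. {..<n s})"

lemma sum_sign_index: "(\<Sum>k\<in>sign_index n. of_int (fst k)) = (of_int (int (n 1) - int (n (- 1))) :: 'r::comm_ring_1)"
proof -
 have "(\<Sum>k\<in>sign_index n. of_int (fst k)) = (\<Sum>s\<in>{1, - 1}. \<Sum>k<n s. of_int s :: 'r)"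
  unfolding sign_index_def by (subst sum.Sigma) (auto simp: case_prod_beta')
 then show ?thesis by simp
qed

definition hodge_degrees :: "('e::field_char_0, 'f::field_char_0, 'b, 'd) realizations => int => int set" where
 "hodge_degrees M w = {p. hodge_number M p (w - p) \<noteq> 0}"

text \<open>The reflection exchanges the types below and above the middle. As at most one p
  satisfies 2 p = w, the parity of the rank decides whether a middle type exists.\<close>

lemma card_reflection:
 fixes P :: "int set"
 assumes "finite P" "!!p. p \<in> P ==> w - p \<in> P"
 shows "card P = 2 * card {p\<in>P. 2 * p < w} + card {p\<in>P. 2 * p = w}"
proof -
 let ?A = "{p\<in>P. 2 * p < w}" and ?B = "{p\<in>P. 2 * p = w}" and ?C = "{p\<in>P. 2 * p > w}"
 have "bij_betw (%p. w - p) ?A ?C"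
  using assms(2) by (intro bij_betwI[where g = "%p. w - p"]) auto
 then have "card ?C = card ?A" by (simp add: bij_betw_same_card)
 moreover have "P = ?A \<union> ?B \<union> ?C" by auto
 moreover have "card (?A \<union> ?B \<union> ?C) = card ?A + card ?B + card ?C"
  using assms(1) by (subst card_Un_disjoint, auto)+
 ultimately show ?thesis by simp
qed

lemma real_embeddings_field_hom: "\<sigma> \<in> real_embeddings ==> field_hom \<sigma>"
 by (simp add: real_embeddings_def)

context motive
begin

lemma sign_frame:
 assumes \<sigma>: "\<sigma> \<in> real_embeddings"
 obtains n b cb c where "!!s. s \<in> {1, - 1} ==> frame (betti_eigen M \<sigma> s) {..<n s} (b s) (cb s)"
  and "frame (betti M \<sigma>) (sign_index n) (%(s, k). b s k) c"
proof -
 note V = betti_module[OF \<sigma>] frob_hom[OF \<sigma>] frob_involution[OF \<sigma>]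
 obtain b0 c0 where f: "frame (betti M \<sigma>) {..<motive_rank M} b0 c0"
  using has_rank_frame[OF betti_module betti_rank] \<sigma> by blast
 have "\<exists>n u d. frame (betti_eigen M \<sigma> s) {..<n::nat} u d" if "s \<in> {1, - 1}" for s
  unfolding betti_eigen_def by (rule eig_frame[OF V f that])
 then obtain n u d where nud: "!!s. s \<in> {1, - 1} ==> frame (betti_eigen M \<sigma> s) {..<n s::nat} (u s) (d s)" by metis
 show thesis
  by (rule that[OF nud]) (use sum_frame[OF V nud[unfolded betti_eigen_def]] in \<open>auto simp: sign_index_def\<close>)
qed

text \<open>The passage from the axioms of \<open>motive\<close> to functionals: the conclusions
  package the Hodge decomposition, the conjugation and the comparison isomorphism at one embedding,
  for any rational basis of eigenvectors.\<close>

lemma motive_frame: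
 fixes b :: "'k => 'b" and \<epsilon> :: "'k => int"
 assumes \<sigma>: "\<sigma> \<in> real_embeddings" and fr: "frame (betti M \<sigma>) K b c"
  and frob_b: "!!k. k \<in> K ==> frob M \<sigma> (b k) = of_int (\<epsilon> k) \<odot>\<^bsub>betti M \<sigma>\<^esub> b k"
  and hodge_le: "!!p q. hodge_number M p q \<noteq> 0 ==> hodge_number M p q = 1"
  and w: "!!p q. p + q \<noteq> w ==> hodge_type M \<sigma> p q = {\<zero>\<^bsub>bettiC M \<sigma>\<^esub>}"
 obtains y z \<gamma> G u where
  "dual_frame (derham M) (hodge_fil M) (map_right \<sigma>) (hodge_degrees M w) (%p. p) K y z \<gamma> G
   (%k. betti_period M \<sigma> (b k))"
  and "!!p. p \<in> hodge_degrees M w ==> w - p \<in> hodge_degrees M w"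
  and "!!p k. p \<in> hodge_degrees M w ==> k \<in> K ==> of_int (\<epsilon> k) * y p k = u p * y (w - p) k"
  and "(\<Sum>k\<in>K. of_int (\<epsilon> k)) = (\<Sum>p\<in>{p\<in>hodge_degrees M w. 2 * p = w}. u p)"
  and "!!p t. p \<in> hodge_degrees M w ==> 2 * p = w ==>
   (\<forall>x\<in>hodge_type M \<sigma> p p. frobC M \<sigma> x = t \<odot>\<^bsub>bettiC M \<sigma>\<^esub> x) \<longleftrightarrow> t = u p"
  and "!!\<phi>. semilin (map_right \<sigma>) (derham M) \<phi> ==> semilin (%e. e \<otimes>\<^sub>\<rat> 1) (betti M \<sigma>) (%v. betti_period M \<sigma> v \<phi>)"
  and "!!v. v \<in> carrier (betti M \<sigma>) ==> comparison M \<sigma> (bclass (betti M \<sigma>) [(v, 1)]) \<in> carrier (derhamC M \<sigma>)"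
proof -
 note \<sigma>h = real_embeddings_field_hom[OF \<sigma>]
 interpret B: scalar_ext "betti M \<sigma>" "%e. e" of_rat of_rat "%e. e \<otimes>\<^sub>\<rat> 1"
  by (rule scalar_ext_betti[OF betti_module[OF \<sigma>]])
 interpret D: scalar_ext "derham M" "%e. e \<otimes>\<^sub>\<rat> 1" "%x. 1 \<otimes>\<^sub>\<rat> x" \<sigma> "map_right \<sigma>"
  by (rule scalar_ext_derham[OF derham_module \<sigma>h])
 note BT = betti_ext_conv[OF betti_module[OF \<sigma>], symmetric] and DT = derham_ext_conv[OF derham_module \<sigma>h, symmetric]
 note sub_unfold = LinearCombinations.submodule_def
 interpret h: hodge_space "bettiC M \<sigma>" "hodge_type M \<sigma>" "hodge_number M" w "hodge_degrees M w" K
  "%k. bclass (betti M \<sigma>) [(b k, 1)]" "%X k. ev (%v. c v k \<otimes>\<^sub>\<rat> 1) X"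
  using B.cmod_T[unfolded BT] hodge_submodule[OF \<sigma>] hodge_rank[OF \<sigma>] hodge_le w hodge_decomposition[OF \<sigma>]
   B.frame_ext[OF fr, unfolded BT]
  by (intro hodge_space.intro) (simp_all only: hodge_degrees_def)
 have frob_coord: "c (frob M \<sigma> v) k = of_int (\<epsilon> k) * c v k" if v: "v \<in> carrier (betti M \<sigma>)" and k: "k \<in> K" for v k
 proof -
  have "semilin (%r. r) (betti M \<sigma>) (%v. c (frob M \<sigma> v) k)"
   unfolding semilin_def
   by (intro conjI ballI allI)
    (simp_all only: module_hom_add[OF frob_hom[OF \<sigma>]] module_hom_smult[OF frob_hom[OF \<sigma>]]
     semilin_add[OF frame_coord[OF fr k]] semilin_smult[OF frame_coord[OF fr k]] module_hom_closed[OF frob_hom[OF \<sigma>]])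
  from frame_semilin[OF fr this v]
  have "c (frob M \<sigma> v) k = (\<Sum>j\<in>K. c v j * c (frob M \<sigma> (b j)) k)" .
  also have "\<dots> = (\<Sum>j\<in>K. if k = j then c v j * of_int (\<epsilon> j) else 0)"
   by (intro sum.cong)
    (auto simp: frob_b semilin_smult[OF frame_coord[OF fr k] frame_closed[OF fr]] frame_delta[OF fr k])
  also have "\<dots> = c v k * of_int (\<epsilon> k)" using k frame_finite[OF fr] by simp
  finally show ?thesis by (simp only: mult.commute)
 qed
 interpret C: hodge_conjugation "bettiC M \<sigma>" "hodge_type M \<sigma>" "hodge_number M" w "hodge_degrees M w" K
  "%k. bclass (betti M \<sigma>) [(b k, 1)]" "%X k. ev (%v. c v k \<otimes>\<^sub>\<rat> 1) X" "frobC M \<sigma>" \<epsilon>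
 proof
  show "frobC M \<sigma> ` hodge_type M \<sigma> p q = hodge_type M \<sigma> q p" for p q by (rule hodge_frob[OF \<sigma>])
  fix X k assume X: "X \<in> carrier (bettiC M \<sigma>)" and k: "k \<in> K"
  have sl: "semilin (%e. e \<otimes>\<^sub>\<rat> 1) (betti M \<sigma>) (%v. c v k \<otimes>\<^sub>\<rat> 1)"
   using semilin_comp[OF frame_coord[OF fr k] comm_ring_hom_left] .
  have X': "set (trep X) \<subseteq> carrier (betti M \<sigma>) \<times> UNIV" using B.sub_trep X unfolding BT[symmetric] B.T_simps(1) by simp
  then have X'': "set (map (%(v, z). (frob M \<sigma> v, z)) (trep X)) \<subseteq> carrier (betti M \<sigma>) \<times> UNIV"
   using module_hom_closed[OF frob_hom[OF \<sigma>]] by auto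
  have "ev (%v. c v k \<otimes>\<^sub>\<rat> 1) (frobC M \<sigma> X) = (\<Sum>(v, z)\<leftarrow>trep X. 1 \<otimes>\<^sub>\<rat> z * (c (frob M \<sigma> v) k \<otimes>\<^sub>\<rat> 1))"
   unfolding frobC_def B.ev_cls[OF sl X''] by (simp add: comp_def case_prod_beta')
  also have "\<dots> = (\<Sum>(v, z)\<leftarrow>trep X. of_int (\<epsilon> k) * (1 \<otimes>\<^sub>\<rat> z * (c v k \<otimes>\<^sub>\<rat> 1)))"
  proof (rule arg_cong[where f = sum_list], rule map_cong[OF HOL.refl], clarify)
   fix v z assume "(v, z) \<in> set (trep X)"
   then have "c (frob M \<sigma> v) k = of_int (\<epsilon> k) * c v k" using X' frob_coord[OF _ k] by auto
   then show "1 \<otimes>\<^sub>\<rat> z * (c (frob M \<sigma> v) k \<otimes>\<^sub>\<rat> 1) = of_int (\<epsilon> k) * (1 \<otimes>\<^sub>\<rat> z * (c v k \<otimes>\<^sub>\<rat> 1))"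
    by (simp only: pure_of_int(1)[symmetric] pure_mult) (simp add: mult.commute)
  qed
  also have "\<dots> = of_int (\<epsilon> k) * ev (%v. c v k \<otimes>\<^sub>\<rat> 1) X"
   unfolding ev_def by (simp add: case_prod_beta' sum_list_const_mult)
  finally show "ev (%v. c v k \<otimes>\<^sub>\<rat> 1) (frobC M \<sigma> X) = of_int (\<epsilon> k) * ev (%v. c v k \<otimes>\<^sub>\<rat> 1) X" .
 qed
 have u1: "cmod (derhamC M \<sigma>)" by (rule D.cmod_T[unfolded DT])
 have u2: "comparison M \<sigma> \<in> LinearCombinations.module_hom class_ring (bettiC M \<sigma>) (derhamC M \<sigma>)" by (rule comparison_hom[OF \<sigma>])
 have u3: "bij_betw (comparison M \<sigma>) (carrier (bettiC M \<sigma>)) (carrier (derhamC M \<sigma>))" by (rule comparison_bij[OF \<sigma>])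
 have u4: "dclass \<sigma> (derham M) [(h, 1)] \<in> carrier (derhamC M \<sigma>)" if "h \<in> carrier (derham M)" for h
   by (rule D.cls_in_T[unfolded DT]) (use that in simp)
 have u5: "semilin (map_right \<sigma>) (derham M) (%h. \<Theta> (dclass \<sigma> (derham M) [(h, 1)]))" if "semilin (%t. t) (derhamC M \<sigma>) \<Theta>" for \<Theta>
   by (rule D.semilin_unit[unfolded DT, OF that])
 have u6: "semilin (%t. t) (derhamC M \<sigma>) (ev \<phi>)" if "semilin (map_right \<sigma>) (derham M) \<phi>" for \<phi>
   by (rule D.semilin_ev[unfolded DT, OF that])
 have u7: "ev \<phi> (dclass \<sigma> (derham M) [(h, 1)]) = \<phi> h" if "semilin (map_right \<sigma>) (derham M) \<phi>" "h \<in> carrier (derham M)" for \<phi> h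
   by (rule D.ev_unit[OF that])
 have u8: "\<Theta> Y = \<Theta>' Y" if "semilin (%t. t) (derhamC M \<sigma>) \<Theta>" "semilin (%t. t) (derhamC M \<sigma>) \<Theta>'"
   "Y \<in> carrier (derhamC M \<sigma>)" "!!h. h \<in> carrier (derham M) ==> \<Theta> (dclass \<sigma> (derham M) [(h, 1)]) = \<Theta>' (dclass \<sigma> (derham M) [(h, 1)])"
   for \<Theta> \<Theta>' Y
   by (rule D.lin_eq[unfolded DT, OF that])
 have u9: "hodge_fil M n \<subseteq> carrier (derham M)" for n using fil_submodule[of n] by (simp add: sub_unfold)
 have u10: "comparison M \<sigma> ` LinearCombinations.module.span class_ring (bettiC M \<sigma>) (\<Union>r\<in>{n..}. \<Union>q. hodge_type M \<sigma> r q) =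
   LinearCombinations.module.span class_ring (derhamC M \<sigma>) {dclass \<sigma> (derham M) [(h, 1)] |h. h \<in> hodge_fil M n}" for n
   by (rule fil_hodge[OF \<sigma>])
 interpret I: comparison_space "bettiC M \<sigma>" "hodge_type M \<sigma>" "hodge_number M" w "hodge_degrees M w" K
  "%k. bclass (betti M \<sigma>) [(b k, 1)]" "%X k. ev (%v. c v k \<otimes>\<^sub>\<rat> 1) X" "derhamC M \<sigma>" "comparison M \<sigma>"
  "derham M" "hodge_fil M" "map_right \<sigma>" "%h. dclass \<sigma> (derham M) [(h, 1)]" ev
 apply (rule comparison_space.intro[OF h.hodge_space_axioms])
 apply (rule comparison_space_axioms.intro)
 apply (rule u1)
 apply (rule u2)
 apply (rule u3)
 apply (rule u4, assumption)
 apply (rule u5, assumption)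
 apply (rule u6, assumption)
 apply (rule u7, assumption, assumption)
 apply (rule u8)
 apply assumption+
 apply (rule u9)
 apply (rule u10)
 done
 have df: "dual_frame (derham M) (hodge_fil M) (map_right \<sigma>) (hodge_degrees M w) (%p. p) K
   (%p k. ev (%v. c v k \<otimes>\<^sub>\<rat> 1) (h.gen p)) (%k p. h.\<theta> (bclass (betti M \<sigma>) [(b k, 1)]) p) I.\<gamma>
   (%p \<phi>. ev \<phi> (comparison M \<sigma> (h.gen p))) (%k. betti_period M \<sigma> (b k))"
  using I.dual_frame unfolding betti_period_def[abs_def] .
 show thesis
 proof (rule that[OF df C.star_P C.\<epsilon>_coord C.trace C.middle])
  show "semilin (%e. e \<otimes>\<^sub>\<rat> 1) (betti M \<sigma>) (%v. betti_period M \<sigma> v \<phi>)" if "semilin (map_right \<sigma>) (derham M) \<phi>" for \<phi>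
   unfolding betti_period_def
   by (rule B.semilin_unit[unfolded BT, OF I.semilin_I[OF I.semilin_evl[OF that]]])
  show "comparison M \<sigma> (bclass (betti M \<sigma>) [(v, 1)]) \<in> carrier (derhamC M \<sigma>)" if "v \<in> carrier (betti M \<sigma>)" for v
   by (rule I.I_closed, rule B.cls_in_T[unfolded BT]) (use that in simp)
 qed
qed

end

section \<open>Tensor products of modules\<close>

lemma lc_Times:
 assumes M: "cmod M" and K: "finite K" "finite K'"
  and b: "!!k k'. k \<in> K ==> k' \<in> K' ==> b k k' \<in> carrier M"
 shows "lc M (K \<times> K') (%(k, k'). a k * a' k') (%(k, k'). b k k') = lc M K a (%k. lc M K' a' (b k))"
proof -
 interpret M: Module.module class_ring M by (rule M)
 from K(1) b show ?thesis
 proof (induction K)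
  case empty
  then show ?case by (simp add: lc_def)
 next
  case (insert k K)
  have cl: "lc M K' a' (b l) \<in> carrier M" if "l \<in> insert k K" for l
   using insert.prems that by (intro lc_closed[OF M]) auto
  have "lc M (insert k K \<times> K') (%(k, k'). a k * a' k') (%(k, k'). b k k') =
    lc M ({k} \<times> K') (%(k, k'). a k * a' k') (%(k, k'). b k k') \<oplus>\<^bsub>M\<^esub>
    lc M (K \<times> K') (%(k, k'). a k * a' k') (%(k, k'). b k k')"
  proof -
   have "insert k K \<times> K' = {k} \<times> K' \<union> K \<times> K'" by auto
   then show ?thesis unfolding lc_def using insert.prems insert.hyps K(2)
    by (simp only:) (rule M.finsum_Un_disjoint, auto intro!: cmod_smult_closed[OF M])
  qed
  also have "lc M ({k} \<times> K') (%(k, k'). a k * a' k') (%(k, k'). b k k') = lc M K' (%k'. a k * a' k') (b k)"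
  proof -
   have "lc M ({k} \<times> K') (%i. a k * a' (snd i)) (%i. b k (snd i)) = lc M K' (%k'. a k * a' k') (b k)"
    by (rule lc_reindex[OF M, symmetric]) (use insert.prems in \<open>auto simp: bij_betw_def inj_on_def\<close>)
   moreover have "lc M ({k} \<times> K') (%(k, k'). a k * a' k') (%(k, k'). b k k') =
     lc M ({k} \<times> K') (%i. a k * a' (snd i)) (%i. b k (snd i))"
    unfolding lc_def using insert.prems
    by (intro M.finsum_cong') (auto intro!: cmod_smult_closed[OF M])
   ultimately show ?thesis by simp
  qed
  also have "\<dots> = a k \<odot>\<^bsub>M\<^esub> lc M K' a' (b k)"
   by (rule lc_smult[OF M _ K(2)]) (use insert.prems in auto)
  also have "lc M (K \<times> K') (%(k, k'). a k * a' k') (%(k, k'). b k k') = lc M K a (%k. lc M K' a' (b k))"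
   using insert by simp
  also have "a k \<odot>\<^bsub>M\<^esub> lc M K' a' (b k) \<oplus>\<^bsub>M\<^esub> lc M K a (%k. lc M K' a' (b k)) =
    lc M (insert k K) a (%k. lc M K' a' (b k))"
   unfolding lc_def[of M K a] lc_def[of M "insert k K" a] using insert.hyps cl
   by (subst M.finsum_insert) (auto intro!: cmod_smult_closed[OF M])
  finally show ?case .
 qed
qed

locale tensor_pair =
 fixes M :: "('r::comm_ring_1, 'a) module" and N :: "('r, 'b) module"
 assumes cM: "cmod M" and cN: "cmod N"
begin

sublocale tensor_space M N
 by (intro tensor_space.intro cM cN)

abbreviation "tp x y \<equiv> tclass M N [(x, y)]"

sublocale tensor_action M N "%r x y. [(r \<odot>\<^bsub>M\<^esub> x, y)]"
proof
 fix r s x x' y y' assume x: "x \<in> carrier M" and y: "y \<in> carrier N"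
 note MD = cmodD[OF cM] and ND = cmodD[OF cN]
 show "set [(s \<odot>\<^bsub>M\<^esub> x, y)] \<subseteq> carrier M \<times> carrier N" using x y by (simp add: MD)
 show "teq M N [(s \<odot>\<^bsub>M\<^esub> (r \<odot>\<^bsub>M\<^esub> x), y)] [(s \<odot>\<^bsub>M\<^esub> x, r \<odot>\<^bsub>N\<^esub> y)]"
  using teq.balanced[of "s \<odot>\<^bsub>M\<^esub> x" M y N r] x y by (simp add: MD(1) MD(4)[symmetric] mult.commute)
 show "teq M N [((s + r) \<odot>\<^bsub>M\<^esub> x, y)] ([(s \<odot>\<^bsub>M\<^esub> x, y)] @ [(r \<odot>\<^bsub>M\<^esub> x, y)])"
  using teq.add_left[of "s \<odot>\<^bsub>M\<^esub> x" M "r \<odot>\<^bsub>M\<^esub> x" y N] x y by (simp add: MD)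
 show "teq M N [((s * r) \<odot>\<^bsub>M\<^esub> x, y)] (concat (map (%(x, y). [(s \<odot>\<^bsub>M\<^esub> x, y)]) [(r \<odot>\<^bsub>M\<^esub> x, y)]))"
  using x y by (simp add: MD teq.refl)
 show "teq M N [(1 \<odot>\<^bsub>M\<^esub> x, y)] [(x, y)]" using x y by (simp add: MD teq.refl)
 show "teq M N [(s \<odot>\<^bsub>M\<^esub> (x \<oplus>\<^bsub>M\<^esub> x'), y)] ([(s \<odot>\<^bsub>M\<^esub> x, y)] @ [(s \<odot>\<^bsub>M\<^esub> x', y)])" if "x' \<in> carrier M"
  using teq.add_left[of "s \<odot>\<^bsub>M\<^esub> x" M "s \<odot>\<^bsub>M\<^esub> x'" y N] x y that by (simp add: MD)
 show "teq M N [(s \<odot>\<^bsub>M\<^esub> x, y \<oplus>\<^bsub>N\<^esub> y')] ([(s \<odot>\<^bsub>M\<^esub> x, y)] @ [(s \<odot>\<^bsub>M\<^esub> x, y')])" if "y' \<in> carrier N"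
  using teq.add_right[of "s \<odot>\<^bsub>M\<^esub> x" M y N y'] x y that by (simp add: MD)
qed

lemma T_conv: "T = tensor M N"
 by (simp add: tensor_def)

lemmas cmod_tensor = cmod_T[unfolded T_conv]

lemma tp_closed: "x \<in> carrier M ==> y \<in> carrier N ==> tp x y \<in> carrier (tensor M N)"
 unfolding T_conv[symmetric] by (rule tclass_in_T) simp

lemma tp_add_left: "x \<in> carrier M ==> x' \<in> carrier M ==> y \<in> carrier N ==>
  tp (x \<oplus>\<^bsub>M\<^esub> x') y = tp x y \<oplus>\<^bsub>tensor M N\<^esub> tp x' y"
 unfolding T_conv[symmetric] by (subst T_add) (auto intro!: tclassI teq.add_left)

lemma tp_add_right: "x \<in> carrier M ==> y \<in> carrier N ==> y' \<in> carrier N ==>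
  tp x (y \<oplus>\<^bsub>N\<^esub> y') = tp x y \<oplus>\<^bsub>tensor M N\<^esub> tp x y'"
 unfolding T_conv[symmetric] by (subst T_add) (auto intro!: tclassI teq.add_right)

lemma tp_smult_left: "x \<in> carrier M ==> y \<in> carrier N ==> tp (r \<odot>\<^bsub>M\<^esub> x) y = r \<odot>\<^bsub>tensor M N\<^esub> tp x y"
 unfolding T_conv[symmetric] by (subst T_smult) auto

lemma tp_smult_right: "x \<in> carrier M ==> y \<in> carrier N ==> tp x (r \<odot>\<^bsub>N\<^esub> y) = r \<odot>\<^bsub>tensor M N\<^esub> tp x y"
 using tp_smult_left[of x y r] tclassI[OF teq.balanced[of x M y N r]] by simp

lemma tensor_induct:
 assumes X: "X \<in> carrier (tensor M N)" and "P \<zero>\<^bsub>tensor M N\<^esub>"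
  and "!!x y X. x \<in> carrier M ==> y \<in> carrier N ==> X \<in> carrier (tensor M N) ==> P X ==> P (tp x y \<oplus>\<^bsub>tensor M N\<^esub> X)"
 shows "P X"
proof -
 obtain xs where xs: "X = tclass M N xs" "set xs \<subseteq> MN" using X unfolding T_conv[symmetric] by (rule T_elim)
 show ?thesis unfolding xs(1) using xs(2)
 proof (induction xs)
  case Nil
  then show ?case using assms(2) by (simp add: T_conv[symmetric])
 next
  case (Cons z xs)
  obtain x y where z: "z = (x, y)" by force
  have "tclass M N (z # xs) = tp x y \<oplus>\<^bsub>tensor M N\<^esub> tclass M N xs"
   using Cons.prems z unfolding T_conv[symmetric] by (subst T_add) auto
  moreover have "tclass M N xs \<in> carrier (tensor M N)"
   using Cons.prems unfolding T_conv[symmetric] by (intro tclass_in_T) simp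
  ultimately show ?case using Cons z assms(3) by simp
 qed
qed

definition bilin :: "('r => 's) => ('a => 'b => 's::comm_ring_1) => bool" where
 "bilin \<eta> f \<longleftrightarrow> (\<forall>y\<in>carrier N. semilin \<eta> M (%x. f x y)) \<and> (\<forall>x\<in>carrier M. semilin \<eta> N (f x))"

definition tf :: "('a => 'b => 's::comm_ring_1) => ('a \<times> 'b) list set => 's" where
 "tf f X = (\<Sum>(x, y)\<leftarrow>trep X. f x y)"

lemma bilinD:
 assumes "bilin \<eta> f"
 shows "y \<in> carrier N ==> semilin \<eta> M (%x. f x y)" "x \<in> carrier M ==> semilin \<eta> N (f x)"
 using assms by (auto simp: bilin_def)

lemma tf_tclass:
 assumes f: "bilin \<eta> f" and xs: "set xs \<subseteq> MN"
 shows "tf f (tclass M N xs) = (\<Sum>(x, y)\<leftarrow>xs. f x y)"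
 unfolding tf_def
 by (rule teq_sum[OF teq.sym[OF trep_tclass[OF xs]]])
  (simp_all add: semilin_add[OF bilinD(1)[OF f]] semilin_add[OF bilinD(2)[OF f]]
   semilin_smult[OF bilinD(1)[OF f]] semilin_smult[OF bilinD(2)[OF f]]
   semilin_zero[OF bilinD(1)[OF f] cM] semilin_zero[OF bilinD(2)[OF f] cN])

lemma tf_tp: "bilin \<eta> f ==> x \<in> carrier M ==> y \<in> carrier N ==> tf f (tp x y) = f x y"
 by (simp add: tf_tclass)

lemma semilin_tf:
 assumes f: "bilin \<eta> f"
 shows "semilin \<eta> (tensor M N) (tf f)"
 unfolding semilin_def T_conv[symmetric]
proof (intro conjI ballI allI)
 fix X Y assume "X \<in> carrier T" "Y \<in> carrier T"
 then obtain xs ys where *: "X = tclass M N xs" "Y = tclass M N ys" "set xs \<subseteq> MN" "set ys \<subseteq> MN"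
  by (metis T_elim)
 then show "tf f (X \<oplus>\<^bsub>T\<^esub> Y) = tf f X + tf f Y" by (simp add: T_add tf_tclass[OF f])
next
 fix r X assume "X \<in> carrier T"
 then obtain xs where *: "X = tclass M N xs" "set xs \<subseteq> MN" by (rule T_elim)
 have "tf f (r \<odot>\<^bsub>T\<^esub> X) = (\<Sum>(x, y)\<leftarrow>acts r xs. f x y)"
  unfolding * T_smult[OF *(2)] by (rule tf_tclass[OF f acts_closed[OF *(2)]])
 also have "\<dots> = \<eta> r * (\<Sum>(x, y)\<leftarrow>xs. f x y)"
  using *(2) by (induction xs) (auto simp: semilin_smult[OF bilinD(1)[OF f]] distrib_left)
 finally show "tf f (r \<odot>\<^bsub>T\<^esub> X) = \<eta> r * tf f X" using * by (simp add: tf_tclass[OF f])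
qed

lemma bilin_tp:
 assumes "semilin \<eta> (tensor M N) \<phi>"
 shows "bilin \<eta> (%x y. \<phi> (tp x y))"
 unfolding bilin_def
proof (intro conjI ballI)
 show "semilin \<eta> M (%x. \<phi> (tp x y))" if "y \<in> carrier N" for y
  unfolding semilin_def using that
  by (auto simp: tp_add_left tp_smult_left tp_closed semilin_add[OF assms] semilin_smult[OF assms])
 show "semilin \<eta> N (%y. \<phi> (tp x y))" if "x \<in> carrier M" for x
  unfolding semilin_def using that
  by (auto simp: tp_add_right tp_smult_right tp_closed semilin_add[OF assms] semilin_smult[OF assms])
qed

lemma semilin_eqI:
 assumes \<phi>: "semilin \<eta> (tensor M N) \<phi>" and \<psi>: "semilin \<eta> (tensor M N) \<psi>" and X: "X \<in> carrier (tensor M N)"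
  and eq: "!!x y. x \<in> carrier M ==> y \<in> carrier N ==> \<phi> (tp x y) = \<psi> (tp x y)"
 shows "\<phi> X = \<psi> X"
 using X
proof (rule tensor_induct)
 show "\<phi> \<zero>\<^bsub>tensor M N\<^esub> = \<psi> \<zero>\<^bsub>tensor M N\<^esub>"
  using semilin_zero[OF \<phi> cmod_tensor] semilin_zero[OF \<psi> cmod_tensor] by simp
qed (simp add: semilin_add[OF \<phi>] semilin_add[OF \<psi>] tp_closed eq)

lemma frame_tensor:
 assumes f: "frame M K b c" and g: "frame N K' b' c'"
 shows "frame (tensor M N) (K \<times> K') (%(k, k'). tp (b k) (b' k')) (%X (k, k'). tf (%x y. c x k * c' y k') X)"
proof -
 have bl: "bilin (%r. r) (%x y. c x k * c' y k')" if "k \<in> K" "k' \<in> K'" for k k'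
  unfolding bilin_def semilin_def
  by (auto simp: semilin_add[OF frame_coord[OF f that(1)]] semilin_add[OF frame_coord[OF g that(2)]]
   semilin_smult[OF frame_coord[OF f that(1)]] semilin_smult[OF frame_coord[OF g that(2)]] algebra_simps)
 have cl: "tp (b k) (b' k') \<in> carrier (tensor M N)" if "k \<in> K" "k' \<in> K'" for k k'
  using that by (intro tp_closed frame_closed[OF f] frame_closed[OF g])
 let ?b = "%(k, k'). tp (b k) (b' k')"
 let ?c = "%X (k, k'). tf (%x y. c x k * c' y k') X"
 have cl': "?b i \<in> carrier (tensor M N)" if "i \<in> K \<times> K'" for i using that cl by auto
 have sl: "semilin (%r. r) (tensor M N) (%X. ?c X i)" if "i \<in> K \<times> K'" for i
  using semilin_tf[OF bl] that by auto
 have tp_exp: "tp x y = lc (tensor M N) (K \<times> K') (%(k, k'). c x k * c' y k') ?b"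
  if x: "x \<in> carrier M" and y: "y \<in> carrier N" for x y
 proof -
  have r: "tp (b k) y = lc (tensor M N) K' (c' y) (%k'. tp (b k) (b' k'))" if k: "k \<in> K" for k
  proof -
   have "tp (b k) (lc N K' (c' y) b') = lc (tensor M N) K' (c' y) (%k'. tp (b k) (b' k'))"
    by (rule hom_lc[OF cN cmod_tensor, where g = "tp (b k)" and \<eta> = "%r. r"])
     (simp_all add: frame_closed[OF g] frame_closed[OF f k] frame_finite[OF g] tp_closed tp_add_right tp_smult_right)
   then show ?thesis using frame_expand[OF g y] by simp
  qed
  have "tp (lc M K (c x) b) y = lc (tensor M N) K (c x) (%k. tp (b k) y)"
   by (rule hom_lc[OF cM cmod_tensor, where g = "%x. tp x y" and \<eta> = "%r. r"])
    (simp_all add: frame_closed[OF f] y frame_finite[OF f] tp_closed tp_add_left tp_smult_left)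
  also have "\<dots> = lc (tensor M N) K (c x) (%k. lc (tensor M N) K' (c' y) (%k'. tp (b k) (b' k')))"
  proof -
   interpret TM: Module.module class_ring "tensor M N" by (rule cmod_tensor)
   have "lc (tensor M N) K' (c' y) (%k'. tp (b k) (b' k')) \<in> carrier (tensor M N)" if "k \<in> K" for k
    using that cl by (intro lc_closed[OF cmod_tensor])
   then show ?thesis unfolding lc_def[of _ K]
    by (intro TM.finsum_cong') (auto simp: r intro!: cmod_smult_closed[OF cmod_tensor])
  qed
  also have "\<dots> = lc (tensor M N) (K \<times> K') (%(k, k'). c x k * c' y k') ?b"
   by (rule lc_Times[OF cmod_tensor frame_finite[OF f] frame_finite[OF g] cl, symmetric])
  finally show ?thesis using frame_expand[OF f x] by simp
 qed
 have "X = lc (tensor M N) (K \<times> K') (?c X) ?b" if "X \<in> carrier (tensor M N)" for X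
  using that
 proof (rule tensor_induct)
  have "lc (tensor M N) (K \<times> K') (?c \<zero>\<^bsub>tensor M N\<^esub>) ?b = lc (tensor M N) (K \<times> K') (%_. 0) ?b"
   by (rule lc_cong[OF cmod_tensor cl']) (auto simp: semilin_zero[OF semilin_tf[OF bl] cmod_tensor])
  then show "\<zero>\<^bsub>tensor M N\<^esub> = lc (tensor M N) (K \<times> K') (?c \<zero>\<^bsub>tensor M N\<^esub>) ?b"
   using lc_zero[of "tensor M N" "K \<times> K'" ?b, OF cmod_tensor cl'] by simp
  fix x y X assume x: "x \<in> carrier M" and y: "y \<in> carrier N" and X: "X \<in> carrier (tensor M N)"
   and IH: "X = lc (tensor M N) (K \<times> K') (?c X) ?b"
  have "lc (tensor M N) (K \<times> K') (?c (tp x y \<oplus>\<^bsub>tensor M N\<^esub> X)) ?b =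
    lc (tensor M N) (K \<times> K') (%i. (case i of (k, k') => c x k * c' y k') + ?c X i) ?b"
   by (rule lc_cong[OF cmod_tensor cl'])
    (auto simp: semilin_add[OF semilin_tf[OF bl]] tp_closed x y X tf_tp[OF bl])
  also have "\<dots> = lc (tensor M N) (K \<times> K') (%(k, k'). c x k * c' y k') ?b \<oplus>\<^bsub>tensor M N\<^esub>
    lc (tensor M N) (K \<times> K') (?c X) ?b"
   by (rule lc_add[OF cmod_tensor cl'])
  also have "lc (tensor M N) (K \<times> K') (?c X) ?b = X" by (rule IH[symmetric])
  also have "lc (tensor M N) (K \<times> K') (%(k, k'). c x k * c' y k') ?b = tp x y" by (rule tp_exp[OF x y, symmetric])
  finally show "tp x y \<oplus>\<^bsub>tensor M N\<^esub> X = lc (tensor M N) (K \<times> K') (?c (tp x y \<oplus>\<^bsub>tensor M N\<^esub> X)) ?b" by simp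
 qed
 then show ?thesis unfolding frame_def
  using cmod_tensor frame_finite[OF f] frame_finite[OF g] cl' sl frame_closed[OF f] frame_closed[OF g]
  by (auto simp: tf_tp[OF bl] frame_delta[OF f] frame_delta[OF g])
qed

end

section \<open>Tensor products of dual frames\<close>

context dual_frame
begin

lemma G_add:
 assumes "p \<in> P" "semilin \<eta> D \<phi>" "semilin \<eta> D \<psi>" "semilin \<eta> D \<chi>" "!!h. h \<in> carrier D ==> \<chi> h = \<phi> h + \<psi> h"
 shows "G p \<chi> = G p \<phi> + G p \<psi>"
 using G_lin[of p "{0, 1}" "%i. if i = 0 then \<phi> else \<psi>" \<chi> "%_. 1"] assms by auto

lemma G_smult:
 assumes "p \<in> P" "semilin \<eta> D \<phi>" "semilin \<eta> D \<chi>" "!!h. h \<in> carrier D ==> \<chi> h = a * \<phi> h"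
 shows "G p \<chi> = a * G p \<phi>"
 using G_lin[of p "{0}" "%_. \<phi>" \<chi> "%_. a"] assms by auto

lemma \<beta>_via_G:
 assumes \<phi>: "semilin \<eta> D \<phi>" and k: "k \<in> K"
 shows "\<beta> k \<phi> = (\<Sum>p\<in>P. z k p * G p \<phi>)"
proof -
 have "(\<Sum>p\<in>P. z k p * G p \<phi>) = (\<Sum>p\<in>P. \<Sum>j\<in>K. z k p * y p j * \<beta> j \<phi>)"
  by (intro sum.cong) (simp_all add: G_\<beta>[OF \<phi>] sum_distrib_left mult.assoc)
 also have "\<dots> = (\<Sum>j\<in>K. (\<Sum>p\<in>P. z k p * y p j) * \<beta> j \<phi>)"
  by (subst sum.swap) (simp add: sum_distrib_right)
 also have "\<dots> = (\<Sum>j\<in>K. if j = k then \<beta> j \<phi> else 0)" using k by (intro sum.cong) (auto simp: zy)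
 also have "\<dots> = \<beta> k \<phi>" using k finK by simp
 finally show ?thesis ..
qed

text \<open>The tensor product produces Betti indices that are pairs of eigenvectors, whereas
  \<open>period_frame\<close> wants the total sign in front.\<close>

lemma reindex:
 assumes h: "bij_betw h J K" and \<beta>': "!!j \<phi>. j \<in> J ==> semilin \<eta> D \<phi> ==> \<beta>' j \<phi> = \<beta> (h j) \<phi>"
 shows "dual_frame D F \<eta> P deg J (%p j. y p (h j)) (%j. z (h j)) \<gamma> G \<beta>'"
proof
 have hK: "h j \<in> K" if "j \<in> J" for j using h that by (auto simp: bij_betw_def)
 show "finite J" using bij_betw_finite[OF h] finK by simp
 show "(\<Sum>p\<in>P. z (h k) p * y p (h j)) = (if k = j then 1 else 0)" if "k \<in> J" "j \<in> J" for k j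
  using zy[OF hK hK, OF that] that h by (auto simp: bij_betw_def inj_on_def)
 show "(\<Sum>k\<in>J. y p (h k) * z (h k) q) = (if p = q then 1 else 0)" if "p \<in> P" "q \<in> P" for p q
  using yz[OF that] sum.reindex_bij_betw[OF h, of "%k. y p k * z k q"] by simp
 show "G p \<phi> = (\<Sum>k\<in>J. y p (h k) * \<beta>' k \<phi>)" if "semilin \<eta> D \<phi>" "p \<in> P" for p \<phi>
 proof -
  have "(\<Sum>k\<in>J. y p (h k) * \<beta>' k \<phi>) = (\<Sum>k\<in>J. y p (h k) * \<beta> (h k) \<phi>)" using \<beta>' that by (intro sum.cong) auto
  then show ?thesis unfolding G_\<beta>[OF that] using sum.reindex_bij_betw[OF h, of "%k. y p k * \<beta> k \<phi>"] by simp
 qed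
qed (fact finP \<gamma> expand \<gamma>_fil G_fil G_\<gamma> G_lin)+

end

locale tensor_frames =
 A: dual_frame DA FA \<eta> PA degA KA yA zA \<gamma>A GA \<beta>A + B: dual_frame DB FB \<eta> PB degB KB yB zB \<gamma>B GB \<beta>B +
 tensor_pair DA DB
 for DA :: "(('e::field_char_0, 'f::field_char_0) qtensor, 'd) module" and FA and \<eta> and PA :: "'p set"
  and degA and KA :: "'k set" and yA zA \<gamma>A GA \<beta>A
  and DB :: "(('e, 'f) qtensor, 'd2) module" and FB and PB :: "'p2 set"
  and degB and KB :: "'k2 set" and yB zB \<gamma>B GB \<beta>B +
 assumes FA: "!!n. FA n \<subseteq> carrier DA" and FB: "!!n. FB n \<subseteq> carrier DB"
begin

definition "FT n = LinearCombinations.module.span class_ring (tensor DA DB)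
  {tp h h' | h h' p q. p + q = n \<and> h \<in> FA p \<and> h' \<in> FB q}"

definition "\<gamma>T = (%(p, p'). tf (%h h'. \<gamma>A p h * \<gamma>B p' h'))"
text \<open>A Hodge generator of the tensor product is a product of generators, so its value on a
  functional is found by applying \<open>GA\<close> in the first variable and \<open>GB\<close> in
  the second.\<close>

definition "GT = (%(p, p') \<phi>. GB p' (%h'. GA p (%h. \<phi> (tp h h'))))"
definition "\<beta>T = (%(k, k') \<phi>. \<beta>B k' (%h'. \<beta>A k (%h. \<phi> (tp h h'))))"

lemma gens_closed: "{tp h h' | h h' p q. p + q = n \<and> h \<in> FA p \<and> h' \<in> FB q} \<subseteq> carrier (tensor DA DB)"
 using FA FB tp_closed by blast

lemma in_FT: "h \<in> FA p ==> h' \<in> FB q ==> tp h h' \<in> FT (p + q)"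
 unfolding FT_def by (rule in_span[OF cmod_tensor gens_closed]) blast

lemma FT_functional:
 assumes "semilin \<eta> (tensor DA DB) \<phi>" "!!h h' p q. p + q = n ==> h \<in> FA p ==> h' \<in> FB q ==> \<phi> (tp h h') = 0" "X \<in> FT n"
 shows "\<phi> X = 0"
 by (rule span_functional[OF cmod_tensor gens_closed assms(1) _ assms(3)[unfolded FT_def]]) (use assms(2) in auto)

lemma bilin_\<gamma>:
 assumes "p \<in> PA" "p' \<in> PB"
 shows "bilin \<eta> (%h h'. \<gamma>A p h * \<gamma>B p' h')"
 unfolding bilin_def semilin_def
 by (auto simp: semilin_add[OF A.\<gamma>[OF assms(1)]] semilin_add[OF B.\<gamma>[OF assms(2)]]
   semilin_smult[OF A.\<gamma>[OF assms(1)]] semilin_smult[OF B.\<gamma>[OF assms(2)]] algebra_simps)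

lemma semilin_GA:
 assumes \<phi>: "semilin \<eta> (tensor DA DB) \<phi>" and p: "p \<in> PA"
 shows "semilin \<eta> DB (%h'. GA p (%h. \<phi> (tp h h')))"
proof -
 note sl = bilinD(1)[OF bilin_tp[OF \<phi>]]
 have "GA p (%h. \<phi> (tp h (x \<oplus>\<^bsub>DB\<^esub> y))) = GA p (%h. \<phi> (tp h x)) + GA p (%h. \<phi> (tp h y))"
  if "x \<in> carrier DB" "y \<in> carrier DB" for x y
  using that by (intro A.G_add[OF p] sl) (auto simp: tp_add_right semilin_add[OF \<phi>] tp_closed cmod_add_closed[OF cN])
 moreover have "GA p (%h. \<phi> (tp h (r \<odot>\<^bsub>DB\<^esub> x))) = \<eta> r * GA p (%h. \<phi> (tp h x))" if "x \<in> carrier DB" for r x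
  using that by (intro A.G_smult[OF p] sl) (auto simp: tp_smult_right semilin_smult[OF \<phi>] tp_closed cmod_smult_closed[OF cN])
 ultimately show ?thesis by (auto simp: semilin_def)
qed

lemma semilin_\<beta>A:
 assumes \<phi>: "semilin \<eta> (tensor DA DB) \<phi>" and k: "k \<in> KA"
 shows "semilin \<eta> DB (%h'. \<beta>A k (%h. \<phi> (tp h h')))"
proof -
 have "semilin \<eta> DB (%h'. \<Sum>p\<in>PA. zA k p * GA p (%h. \<phi> (tp h h')))"
  by (rule semilin_lincomb[OF semilin_GA[OF \<phi>]])
 then show ?thesis unfolding semilin_def
  using bilinD(1)[OF bilin_tp[OF \<phi>]] by (auto simp: A.\<beta>_via_G[OF _ k] cmod_add_closed[OF cN] cmod_smult_closed[OF cN])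
qed

text \<open>Each condition is checked in one variable at a time. For the filtration: if i + j = n
  exceeds deg p + deg p', then i exceeds deg p or j exceeds deg p'; and if n \<le> deg p + deg p',
  it is split as deg p plus n - deg p.\<close>

lemma dual_frame_tensor:
 "dual_frame (tensor DA DB) FT \<eta> (PA \<times> PB) (%(p, p'). degA p + degB p') (KA \<times> KB)
  (%(p, p') (k, k'). yA p k * yB p' k') (%(k, k') (p, p'). zA k p * zB k' p') \<gamma>T GT \<beta>T"
proof
 show "finite (PA \<times> PB)" "finite (KA \<times> KB)" using A.finP B.finP A.finK B.finK by auto
 have prod: "(\<Sum>i\<in>X \<times> Y. (case i of (a, b) => f a * f' b)) = (\<Sum>a\<in>X. f a) * (\<Sum>b\<in>Y. f' b :: ('e, complex) qtensor)"
  for X Y f f' unfolding sum_product sum.cartesian_product ..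
 show "(\<Sum>p\<in>PA \<times> PB. (case k of (k, k') => %(p, p'). zA k p * zB k' p') p * (case p of (p, p') => %(k, k'). yA p k * yB p' k') j) =
   (if k = j then 1 else 0)" if "k \<in> KA \<times> KB" "j \<in> KA \<times> KB" for k j
 proof -
  obtain k1 k2 j1 j2 where kj: "k = (k1, k2)" "j = (j1, j2)" "k1 \<in> KA" "k2 \<in> KB" "j1 \<in> KA" "j2 \<in> KB"
   using \<open>k \<in> KA \<times> KB\<close> \<open>j \<in> KA \<times> KB\<close> by auto
  have "(\<Sum>p\<in>PA \<times> PB. (case k of (k, k') => %(p, p'). zA k p * zB k' p') p * (case p of (p, p') => %(k, k'). yA p k * yB p' k') j) =
   (\<Sum>p\<in>PA \<times> PB. (case p of (p, p') => (zA k1 p * yA p j1) * (zB k2 p' * yB p' j2)))"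
   unfolding kj by (intro sum.cong) (auto simp: ac_simps)
  then show ?thesis unfolding prod using kj by (simp add: A.zy B.zy)
 qed
 show "(\<Sum>k\<in>KA \<times> KB. (case p of (p, p') => %(k, k'). yA p k * yB p' k') k * (case k of (k, k') => %(p, p'). zA k p * zB k' p') q) =
   (if p = q then 1 else 0)" if "p \<in> PA \<times> PB" "q \<in> PA \<times> PB" for p q
 proof -
  obtain k1 k2 j1 j2 where kj: "p = (k1, k2)" "q = (j1, j2)" "k1 \<in> PA" "k2 \<in> PB" "j1 \<in> PA" "j2 \<in> PB"
   using \<open>p \<in> PA \<times> PB\<close> \<open>q \<in> PA \<times> PB\<close> by auto
  have "(\<Sum>k\<in>KA \<times> KB. (case p of (p, p') => %(k, k'). yA p k * yB p' k') k * (case k of (k, k') => %(p, p'). zA k p * zB k' p') q) =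
   (\<Sum>k\<in>KA \<times> KB. (case k of (k, k') => (yA k1 k * zA k j1) * (yB k2 k' * zB k' j2)))"
   unfolding kj by (intro sum.cong) (auto simp: ac_simps)
  then show ?thesis unfolding prod using kj by (simp add: A.yz B.yz)
 qed
 show "semilin \<eta> (tensor DA DB) (\<gamma>T p)" if "p \<in> PA \<times> PB" for p
  using that by (auto simp: \<gamma>T_def intro!: semilin_tf bilin_\<gamma>)
 show "\<phi> X = (\<Sum>p\<in>PA \<times> PB. \<gamma>T p X * GT p \<phi>)" if \<phi>: "semilin \<eta> (tensor DA DB) \<phi>" and X: "X \<in> carrier (tensor DA DB)" for \<phi> X
 proof -
  have "semilin \<eta> (tensor DA DB) (%X. \<Sum>p\<in>PA \<times> PB. GT p \<phi> * \<gamma>T p X)"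
   by (rule semilin_lincomb) (auto simp: \<gamma>T_def intro!: semilin_tf bilin_\<gamma>)
  from \<phi> this X have "\<phi> X = (\<Sum>p\<in>PA \<times> PB. GT p \<phi> * \<gamma>T p X)"
  proof (rule semilin_eqI)
   fix h h' assume h: "h \<in> carrier DA" "h' \<in> carrier DB"
   have "\<phi> (tp h h') = (\<Sum>p\<in>PA. \<gamma>A p h * GA p (%h. \<phi> (tp h h')))"
    using A.expand[OF bilinD(1)[OF bilin_tp[OF \<phi>] h(2)] h(1)] .
   also have "\<dots> = (\<Sum>p\<in>PA. \<gamma>A p h * (\<Sum>p'\<in>PB. \<gamma>B p' h' * GT (p, p') \<phi>))"
    using B.expand[OF semilin_GA[OF \<phi>] h(2)] by (intro sum.cong) (auto simp: GT_def)
   also have "\<dots> = (\<Sum>(p, p')\<in>PA \<times> PB. \<gamma>A p h * (\<gamma>B p' h' * GT (p, p') \<phi>))"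
    by (simp add: sum_distrib_left sum.cartesian_product)
   also have "\<dots> = (\<Sum>p\<in>PA \<times> PB. GT p \<phi> * \<gamma>T p (tp h h'))"
    by (intro sum.cong) (auto simp: \<gamma>T_def tf_tp[OF bilin_\<gamma>] h ac_simps)
   finally show "\<phi> (tp h h') = (\<Sum>p\<in>PA \<times> PB. GT p \<phi> * \<gamma>T p (tp h h'))" .
  qed
  then show ?thesis by (simp add: mult.commute)
 qed
 show "\<gamma>T p X = 0" if pq: "p \<in> PA \<times> PB" "(case p of (p, p') => degA p + degB p') < n" and X: "X \<in> FT n" for p n X
 proof -
  obtain p1 p2 where p: "p = (p1, p2)" "p1 \<in> PA" "p2 \<in> PB" "degA p1 + degB p2 < n" using pq by auto
  show ?thesis unfolding p(1) \<gamma>T_def prod.case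
  proof (rule FT_functional[OF semilin_tf[OF bilin_\<gamma>[OF p(2,3)]] _ X])
   fix h h' i j assume *: "i + j = n" "h \<in> FA i" "h' \<in> FB j"
   then have "degA p1 < i \<or> degB p2 < j" using p(4) by auto
   then have "\<gamma>A p1 h * \<gamma>B p2 h' = 0" using A.\<gamma>_fil[OF p(2) _ *(2)] B.\<gamma>_fil[OF p(3) _ *(3)] by auto
   then show "tf (%h h'. \<gamma>A p1 h * \<gamma>B p2 h') (tp h h') = 0"
    using * FA FB by (subst tf_tp[OF bilin_\<gamma>[OF p(2,3)]]) auto
  qed
 qed
 show "GT p \<phi> = 0" if \<phi>: "semilin \<eta> (tensor DA DB) \<phi>" "!!h. h \<in> FT n ==> \<phi> h = 0"
  and pq: "p \<in> PA \<times> PB" "n \<le> (case p of (p, p') => degA p + degB p')" for \<phi> p n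
 proof -
  obtain p1 p2 where p: "p = (p1, p2)" "p1 \<in> PA" "p2 \<in> PB" "n \<le> degA p1 + degB p2" using pq by auto
  show ?thesis unfolding p(1) GT_def prod.case
  proof (rule B.G_fil[OF semilin_GA[OF \<phi>(1) p(2)] _ p(3), of "n - degA p1"])
   fix h' assume h': "h' \<in> FB (n - degA p1)"
   show "GA p1 (%h. \<phi> (tp h h')) = 0"
   proof (rule A.G_fil[OF _ _ p(2) order.refl])
    show "semilin \<eta> DA (%h. \<phi> (tp h h'))" using bilinD(1)[OF bilin_tp[OF \<phi>(1)]] h' FB by blast
    show "\<phi> (tp h h') = 0" if "h \<in> FA (degA p1)" for h
     using \<phi>(2) in_FT[OF that h'] by simp
   qed
  qed (use p in simp)
 qed
 show "GT p (\<gamma>T q) = (if p = q then 1 else 0)" if pq: "p \<in> PA \<times> PB" "q \<in> PA \<times> PB" for p q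
 proof -
  obtain p1 p2 q1 q2 where p: "p = (p1, p2)" "p1 \<in> PA" "p2 \<in> PB" and q: "q = (q1, q2)" "q1 \<in> PA" "q2 \<in> PB" using pq by auto
  note bl = bilin_\<gamma>[OF q(2,3)]
  have "GA p1 (%h. \<gamma>T q (tp h h')) = (if p1 = q1 then 1 else 0) * \<gamma>B q2 h'" if "h' \<in> carrier DB" for h'
  proof -
   have "GA p1 (%h. \<gamma>T q (tp h h')) = \<gamma>B q2 h' * GA p1 (\<gamma>A q1)"
    using bilinD(1)[OF bilin_tp[OF semilin_tf[OF bl]] that] that
    by (intro A.G_smult[OF p(2)] A.\<gamma>[OF q(2)]) (auto simp: q(1) \<gamma>T_def tf_tp[OF bl])
   then show ?thesis using A.G_\<gamma>[OF p(2) q(2)] by (simp add: mult.commute)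
  qed
  then have "GT p (\<gamma>T q) = (if p1 = q1 then 1 else 0) * GB p2 (\<gamma>B q2)"
   unfolding p(1) GT_def prod.case
   by (intro B.G_smult[OF p(3)] semilin_GA[OF _ p(2)] B.\<gamma>[OF q(3)]) (auto simp: q(1) \<gamma>T_def intro!: semilin_tf bl)
  then show ?thesis using p q by (simp add: B.G_\<gamma>)
 qed
 show "GT p \<phi> = (\<Sum>i\<in>I. a i * GT p (\<psi> i))" if pP: "p \<in> PA \<times> PB" and I: "finite I" and \<psi>: "!!i. i \<in> I ==> semilin \<eta> (tensor DA DB) (\<psi> i)"
  and \<phi>: "semilin \<eta> (tensor DA DB) \<phi>" and eq: "!!h. h \<in> carrier (tensor DA DB) ==> \<phi> h = (\<Sum>i\<in>I. a i * \<psi> i h)"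
  for p a \<phi> \<psi> and I :: "nat set"
 proof -
  obtain p1 p2 where p: "p = (p1, p2)" "p1 \<in> PA" "p2 \<in> PB" using pP by auto
  have "GA p1 (%h. \<phi> (tp h h')) = (\<Sum>i\<in>I. a i * GA p1 (%h. \<psi> i (tp h h')))" if "h' \<in> carrier DB" for h'
   using that by (intro A.G_lin[OF p(2) I] bilinD(1)[OF bilin_tp[OF \<psi>]] bilinD(1)[OF bilin_tp[OF \<phi>]] eq tp_closed)
  then show ?thesis unfolding p(1) GT_def prod.case
   by (intro B.G_lin[OF p(3) I] semilin_GA[OF \<psi> p(2)] semilin_GA[OF \<phi> p(2)])
 qed
 show "GT p \<phi> = (\<Sum>k\<in>KA \<times> KB. (case p of (p, p') => %(k, k'). yA p k * yB p' k') k * \<beta>T k \<phi>)"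
  if \<phi>: "semilin \<eta> (tensor DA DB) \<phi>" and pP: "p \<in> PA \<times> PB" for p \<phi>
 proof -
  obtain p1 p2 where p: "p = (p1, p2)" "p1 \<in> PA" "p2 \<in> PB" using pP by auto
  define \<Phi> where "\<Phi> k = (%h'. \<beta>A k (%h. \<phi> (tp h h')))" for k
  have sl: "semilin \<eta> DB (\<Phi> k)" if "k \<in> KA" for k unfolding \<Phi>_def by (rule semilin_\<beta>A[OF \<phi> that])
  \<comment> \<open>\<open>G_lin\<close> is stated for index sets of natural numbers, so
    \<open>KA\<close> is enumerated before linearity of \<open>GB\<close> is applied.\<close>
  obtain e :: "nat => 'k" where e: "bij_betw e {..<card KA} KA" using bij_enum[OF A.finK] by blast
  have eK: "e i \<in> KA" if "i < card KA" for i using e that by (auto simp: bij_betw_def)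
  have "GT p \<phi> = (\<Sum>i\<in>{..<card KA}. yA p1 (e i) * GB p2 (\<Phi> (e i)))"
   unfolding p(1) GT_def prod.case
  proof (rule B.G_lin[OF p(3)])
   fix h' assume "h' \<in> carrier DB"
   then have "GA p1 (%h. \<phi> (tp h h')) = (\<Sum>k\<in>KA. yA p1 k * \<Phi> k h')"
    unfolding \<Phi>_def using A.G_\<beta>[OF bilinD(1)[OF bilin_tp[OF \<phi>]] p(2)] by simp
   then show "GA p1 (%h. \<phi> (tp h h')) = (\<Sum>i<card KA. yA p1 (e i) * \<Phi> (e i) h')"
    using sum.reindex_bij_betw[OF e, of "%k. yA p1 k * \<Phi> k h'"] by simp
  qed (use sl eK semilin_GA[OF \<phi> p(2)] in auto)
  also have "\<dots> = (\<Sum>k\<in>KA. yA p1 k * GB p2 (\<Phi> k))"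
   by (rule sum.reindex_bij_betw[OF e, of "%k. yA p1 k * GB p2 (\<Phi> k)"])
  also have "\<dots> = (\<Sum>k\<in>KA. \<Sum>k'\<in>KB. yA p1 k * (yB p2 k' * \<beta>B k' (\<Phi> k)))"
   by (intro sum.cong) (simp_all add: B.G_\<beta>[OF sl p(3)] sum_distrib_left)
  also have "\<dots> = (\<Sum>k\<in>KA \<times> KB. (case p of (p, p') => %(k, k'). yA p k * yB p' k') k * \<beta>T k \<phi>)"
   unfolding sum.cartesian_product by (intro sum.cong) (auto simp: p(1) \<beta>T_def \<Phi>_def mult.assoc)
  finally show ?thesis .
 qed
qed

end

section \<open>Realizations of tensor products\<close>

lemma sum_list_swap:
 "(\<Sum>x\<leftarrow>xs. \<Sum>y\<leftarrow>ys. f x y) = (\<Sum>y\<leftarrow>ys. \<Sum>x\<leftarrow>xs. f x y :: 'c::comm_monoid_add)"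
 by (induction xs) (simp_all add: sum_list_addf)

lemma sum_list_concat: "sum_list (concat xss) = (\<Sum>xs\<leftarrow>xss. sum_list xs :: 'c::comm_monoid_add)"
 by (induction xss) simp_all

lemma pure_right_mult: "1 \<otimes>\<^sub>\<rat> a * (1 \<otimes>\<^sub>\<rat> b * x) = 1 \<otimes>\<^sub>\<rat> (a * b) * x"
 by (simp add: mult.assoc[symmetric])

lemma semilin_sum_list:
 assumes "!!x. x \<in> set xs ==> semilin \<eta> M (\<phi> x)"
 shows "semilin \<eta> M (%h. \<Sum>x\<leftarrow>xs. a x * \<phi> x h)"
 using assms by (induction xs) (auto simp: semilin_def algebra_simps)

text \<open>A coordinate of the opposite sign on an eigenvector equals its own negative, so it is
  zero in characteristic 0.\<close>

lemma eigen_frame: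
 fixes V :: "('e::field_char_0, 'v) module"
 assumes V: "cmod V" and \<Phi>: "\<Phi> \<in> LinearCombinations.module_hom class_ring V V"
  and inv: "!!x. x \<in> carrier V ==> \<Phi> (\<Phi> x) = x"
  and f: "frame V ({1, - 1} \<times> K) \<beta> C"
  and \<Phi>\<beta>: "!!s k. s \<in> {1, - 1} ==> k \<in> K ==> \<Phi> (\<beta> (s, k)) = of_int s \<odot>\<^bsub>V\<^esub> \<beta> (s, k)"
  and s: "s \<in> {1, - 1 :: int}"
 shows "frame (submod V {x \<in> carrier V. \<Phi> x = of_int s \<odot>\<^bsub>V\<^esub> x}) K (%k. \<beta> (s, k)) (%x k. C x (s, k))"
proof -
 let ?E = "submod V {x \<in> carrier V. \<Phi> x = of_int s \<odot>\<^bsub>V\<^esub> x}"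
 have E: "cmod ?E" by (rule cmod_eig[OF V \<Phi> inv])
 have finK: "finite K" using finite_cartesian_productD2[OF frame_finite[OF f]] by simp
 have \<beta>: "\<beta> (s, k) \<in> carrier ?E" if "k \<in> K" for k using frame_closed[OF f, of "(s, k)"] \<Phi>\<beta>[OF s that] s that by simp
 have coord: "C (\<Phi> x) i = of_int (fst i) * C x i" if x: "x \<in> carrier V" and i: "i \<in> {1, - 1} \<times> K" for x i
 proof -
  have "semilin (%r. r) V (%v. C (\<Phi> v) i)"
   unfolding semilin_def
   by (intro conjI ballI allI)
    (simp_all only: module_hom_add[OF \<Phi>] module_hom_smult[OF \<Phi>]
     semilin_add[OF frame_coord[OF f i]] semilin_smult[OF frame_coord[OF f i]] module_hom_closed[OF \<Phi>])
  from frame_semilin[OF f this x]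
  have "C (\<Phi> x) i = (\<Sum>j\<in>{1, - 1} \<times> K. C x j * C (\<Phi> (\<beta> j)) i)" .
  also have "\<dots> = (\<Sum>j\<in>{1, - 1} \<times> K. if i = j then C x j * of_int (fst j) else 0)"
  proof (rule sum.cong[OF HOL.refl])
   fix j assume j: "j \<in> {1, - 1 :: int} \<times> K"
   then have "C (\<Phi> (\<beta> j)) i = C (of_int (fst j) \<odot>\<^bsub>V\<^esub> \<beta> j) i" using \<Phi>\<beta> by auto
   then show "C x j * C (\<Phi> (\<beta> j)) i = (if i = j then C x j * of_int (fst j) else 0)"
    using semilin_smult[OF frame_coord[OF f i] frame_closed[OF f j]] frame_delta[OF f i j] by simp
  qed
  also have "\<dots> = C x i * of_int (fst i)" using i frame_finite[OF f] by simp
  finally show ?thesis by (simp only: mult.commute)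
 qed
 have "x = lc ?E K (%k. C x (s, k)) (%k. \<beta> (s, k))" if "x \<in> carrier ?E" for x
 proof -
  have x: "x \<in> carrier V" "\<Phi> x = of_int s \<odot>\<^bsub>V\<^esub> x" using that by auto
  have 0: "C x i = 0" if i: "i \<in> {1, - 1} \<times> K - {s} \<times> K" for i
  proof -
   have i': "i \<in> {1, - 1} \<times> K" "fst i = - s" using i s by auto
   have "- of_int s * C x i = of_int s * C x i"
    using coord[OF x(1) i'(1)] semilin_smult[OF frame_coord[OF f i'(1)] x(1), of "of_int s"] x(2) i'(2) by simp
   then show ?thesis using s by auto
  qed
  have "x = lc V ({1, - 1} \<times> K) (C x) \<beta>" by (rule frame_expand[OF f x(1)])
  also have "\<dots> = lc V ({s} \<times> K) (C x) \<beta>"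
   using s by (intro lc_subset[OF V frame_closed[OF f] frame_finite[OF f] _ 0]) auto
  also have "\<dots> = lc V K (%k. C x (s, k)) (%k. \<beta> (s, k))"
   by (rule lc_reindex[OF V]) (use s frame_closed[OF f] in \<open>auto simp: bij_betw_def inj_on_def\<close>)
  also have "\<dots> = lc ?E K (%k. C x (s, k)) (%k. \<beta> (s, k))"
   by (rule hom_lc[OF E V, where g = "%x. x" and \<eta> = "%r. r", symmetric]) (use \<beta> finK in auto)
  finally show ?thesis .
 qed
 moreover have "semilin (%r. r) ?E (%x. C x (s, k))" if "k \<in> K" for k
  using frame_coord[OF f, of "(s, k)"] s that by (simp add: semilin_def)
 moreover have "C (\<beta> (s, j)) (s, k) = (if k = j then 1 else 0)" if "k \<in> K" "j \<in> K" for k j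
  using frame_delta[OF f, of "(s, k)" "(s, j)"] s that by simp
 ultimately show ?thesis using E finK \<beta> unfolding frame_def by blast
qed

locale motive_pair = M: motive M + M': motive M'
 for M :: "('e::field_char_0, 'f::field_char_0, 'b, 'd) realizations"
  and M' :: "('e, 'f, 'b2, 'd2) realizations" +
 fixes \<sigma> :: "'f => complex"
 assumes \<sigma>: "\<sigma> \<in> real_embeddings"
  and sl: "!!\<phi>. semilin (map_right \<sigma>) (derham M) \<phi> ==> semilin (%e. e \<otimes>\<^sub>\<rat> 1) (betti M \<sigma>) (%v. betti_period M \<sigma> v \<phi>)"
  and sl': "!!\<phi>. semilin (map_right \<sigma>) (derham M') \<phi> ==> semilin (%e. e \<otimes>\<^sub>\<rat> 1) (betti M' \<sigma>) (%v. betti_period M' \<sigma> v \<phi>)"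
  and I: "!!v. v \<in> carrier (betti M \<sigma>) ==> comparison M \<sigma> (bclass (betti M \<sigma>) [(v, 1)]) \<in> carrier (derhamC M \<sigma>)"
  and I': "!!v. v \<in> carrier (betti M' \<sigma>) ==> comparison M' \<sigma> (bclass (betti M' \<sigma>) [(v, 1)]) \<in> carrier (derhamC M' \<sigma>)"
begin

abbreviation "T \<equiv> tensor_motive M M'"
abbreviation "V \<equiv> betti M \<sigma>"
abbreviation "V' \<equiv> betti M' \<sigma>"
abbreviation "D \<equiv> derham M"
abbreviation "D' \<equiv> derham M'"

lemmas \<sigma>h = real_embeddings_field_hom[OF \<sigma>]

sublocale B: tensor_pair V V'
 by (intro tensor_pair.intro M.betti_module M'.betti_module \<sigma>)

sublocale D: tensor_pair D D'
 by (intro tensor_pair.intro M.derham_module M'.derham_module)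

lemma tensor_motive_simps:
 "betti T \<sigma> = tensor V V'" "derham T = tensor D D'"
 "hodge_fil T n = LinearCombinations.module.span class_ring (tensor D D')
  {D.tp h h' | h h' p q. p + q = n \<and> h \<in> hodge_fil M p \<and> h' \<in> hodge_fil M' q}"
 "frob T \<sigma> X = tclass V V' (map (%(v, v'). (frob M \<sigma> v, frob M' \<sigma> v')) (trep X))"
 "comparison T \<sigma> X' = dclass \<sigma> (tensor D D')
    [(D.tp h h', c * z * z').
     (Y, c) \<leftarrow> trep X', (v, v') \<leftarrow> trep Y,
     (h, z) \<leftarrow> trep (comparison M \<sigma> (bclass V [(v, 1)])),
     (h', z') \<leftarrow> trep (comparison M' \<sigma> (bclass V' [(v', 1)]))]"
 by (simp_all add: tensor_motive_def Let_def)

lemma trep_tensor: "X \<in> carrier (tensor V V') ==> set (trep X) \<subseteq> carrier V \<times> carrier V'"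
 unfolding B.T_conv[symmetric] B.T_simps(1) by (rule B.sub_trep)

lemma trep_I: "v \<in> carrier V ==> set (trep (comparison M \<sigma> (bclass V [(v, 1)]))) \<subseteq> carrier D \<times> UNIV"
proof -
 interpret S: scalar_ext D "%e. e \<otimes>\<^sub>\<rat> 1" "%x. 1 \<otimes>\<^sub>\<rat> x" \<sigma> "map_right \<sigma>"
  by (rule scalar_ext_derham[OF M.derham_module \<sigma>h])
 show "v \<in> carrier V ==> ?thesis" using I S.sub_trep 
  unfolding derham_ext_conv[OF M.derham_module \<sigma>h] S.T_simps(1) by simp
qed

lemma trep_I': "v \<in> carrier V' ==> set (trep (comparison M' \<sigma> (bclass V' [(v, 1)]))) \<subseteq> carrier D' \<times> UNIV"
proof -
 interpret S: scalar_ext D' "%e. e \<otimes>\<^sub>\<rat> 1" "%x. 1 \<otimes>\<^sub>\<rat> x" \<sigma> "map_right \<sigma>"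
  by (rule scalar_ext_derham[OF M'.derham_module \<sigma>h])
 show "v \<in> carrier V' ==> ?thesis" using I' S.sub_trep 
  unfolding derham_ext_conv[OF M'.derham_module \<sigma>h] S.T_simps(1) by simp
qed

lemma frob_closed: "v \<in> carrier V ==> frob M \<sigma> v \<in> carrier V" "v' \<in> carrier V' ==> frob M' \<sigma> v' \<in> carrier V'"
 using module_hom_closed[OF M.frob_hom[OF \<sigma>]] module_hom_closed[OF M'.frob_hom[OF \<sigma>]] by auto

abbreviation "frobl \<equiv> map (%(v, v'). (frob M \<sigma> v, frob M' \<sigma> v'))"

lemma frob_tclass:
 assumes xs: "set xs \<subseteq> carrier V \<times> carrier V'"
 shows "frob T \<sigma> (tclass V V' xs) = tclass V V' (frobl xs)"
proof -
 have "teq V V' (concat (map (%(v, v'). [(frob M \<sigma> v, frob M' \<sigma> v')]) xs))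
   (concat (map (%(v, v'). [(frob M \<sigma> v, frob M' \<sigma> v')]) (trep (tclass V V' xs))))"
  by (rule B.teq_concat[OF B.trep_tclass[OF xs]])
   (simp_all add: frob_closed B.tensor_space_axioms module_hom_add[OF M.frob_hom[OF \<sigma>]] module_hom_add[OF M'.frob_hom[OF \<sigma>]]
    module_hom_smult[OF M.frob_hom[OF \<sigma>]] module_hom_smult[OF M'.frob_hom[OF \<sigma>]]
    teq.add_left teq.add_right teq.balanced)
 moreover have "concat (map (%(v, v'). [(frob M \<sigma> v, frob M' \<sigma> v')]) zs) = frobl zs" for zs
  by (induction zs) auto
 ultimately show ?thesis unfolding tensor_motive_simps using B.tclassI by simp
qed

lemma frobl_closed: "set xs \<subseteq> carrier V \<times> carrier V' ==> set (frobl xs) \<subseteq> carrier V \<times> carrier V'"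
 using frob_closed by auto

lemma tensor_elim:
 assumes "X \<in> carrier (tensor V V')"
 obtains xs where "X = tclass V V' xs" "set xs \<subseteq> carrier V \<times> carrier V'"
 by (rule B.T_elim[unfolded B.T_conv, OF assms that])

lemma frob_tensor_hom: "frob T \<sigma> \<in> LinearCombinations.module_hom class_ring (betti T \<sigma>) (betti T \<sigma>)"
proof -
 have 1: "frob T \<sigma> X \<in> carrier (tensor V V')" if X: "X \<in> carrier (tensor V V')" for X
 proof -
  obtain xs where xs: "X = tclass V V' xs" "set xs \<subseteq> carrier V \<times> carrier V'" using X by (rule tensor_elim)
  show ?thesis unfolding xs(1) frob_tclass[OF xs(2)] B.T_conv[symmetric] by (rule B.tclass_in_T[OF frobl_closed[OF xs(2)]])
 qed
 have 2: "frob T \<sigma> (X \<oplus>\<^bsub>tensor V V'\<^esub> Y) = frob T \<sigma> X \<oplus>\<^bsub>tensor V V'\<^esub> frob T \<sigma> Y"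
  if X: "X \<in> carrier (tensor V V')" and Y: "Y \<in> carrier (tensor V V')" for X Y
 proof -
  obtain xs where xs: "X = tclass V V' xs" "set xs \<subseteq> carrier V \<times> carrier V'" using X by (rule tensor_elim)
  obtain ys where ys: "Y = tclass V V' ys" "set ys \<subseteq> carrier V \<times> carrier V'" using Y by (rule tensor_elim)
  have s: "set (xs @ ys) \<subseteq> carrier V \<times> carrier V'" using xs ys by simp
  show ?thesis unfolding xs(1) ys(1) frob_tclass[OF xs(2)] frob_tclass[OF ys(2)] B.T_conv[symmetric]
    B.T_add[OF xs(2) ys(2)] B.T_add[OF frobl_closed[OF xs(2)] frobl_closed[OF ys(2)]] frob_tclass[OF s] by simp
 qed
 have 3: "frob T \<sigma> (r \<odot>\<^bsub>tensor V V'\<^esub> X) = r \<odot>\<^bsub>tensor V V'\<^esub> frob T \<sigma> X" if X: "X \<in> carrier (tensor V V')" for r X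
 proof -
  obtain xs where xs: "X = tclass V V' xs" "set xs \<subseteq> carrier V \<times> carrier V'" using X by (rule tensor_elim)
  have "frobl (B.acts r xs) = B.acts r (frobl xs)"
   using xs(2) by (induction xs) (auto simp: module_hom_smult[OF M.frob_hom[OF \<sigma>]])
  then show ?thesis unfolding xs(1) frob_tclass[OF xs(2)] B.T_conv[symmetric]
    B.T_smult[OF xs(2)] B.T_smult[OF frobl_closed[OF xs(2)]] frob_tclass[OF B.acts_closed[OF xs(2)]] by simp
 qed
 show ?thesis unfolding LinearCombinations.module_hom_def tensor_motive_simps(1) using 1 2 3 by simp
qed

lemma frob_tensor_involution:
 assumes "X \<in> carrier (betti T \<sigma>)"
 shows "frob T \<sigma> (frob T \<sigma> X) = X"
proof -
 obtain xs where xs: "X = tclass V V' xs" "set xs \<subseteq> carrier V \<times> carrier V'"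
  using assms unfolding tensor_motive_simps(1) by (rule tensor_elim)
 have "frobl (frobl xs) = xs"
  using xs(2) by (induction xs) (auto simp: M.frob_involution[OF \<sigma>] M'.frob_involution[OF \<sigma>])
 then show ?thesis unfolding xs(1) frob_tclass[OF xs(2)] frob_tclass[OF frobl_closed[OF xs(2)]] by simp
qed

lemma frob_tp: "v \<in> carrier V ==> v' \<in> carrier V' ==> frob T \<sigma> (B.tp v v') = B.tp (frob M \<sigma> v) (frob M' \<sigma> v')"
 by (subst frob_tclass) simp_all

definition "pf \<phi> v v' = betti_period M' \<sigma> v' (%h'. betti_period M \<sigma> v (%h. \<phi> (D.tp h h')))"

text \<open>Interchange of two finite sums. \<open>pf_def\<close> shows linearity in the second
  vector, this form linearity in the first.\<close>

lemma pf_swap: "pf \<phi> v v' = betti_period M \<sigma> v (%h. betti_period M' \<sigma> v' (%h'. \<phi> (D.tp h h')))"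
 unfolding pf_def betti_period_def ev_def
 by (simp add: case_prod_beta' sum_list_const_mult[symmetric])
  (subst sum_list_swap, simp add: pure_right_mult mult.commute)

lemma bilin_pf:
 assumes \<phi>: "semilin (map_right \<sigma>) (derham T) \<phi>"
 shows "B.bilin (%e. e \<otimes>\<^sub>\<rat> 1) (pf \<phi>)"
 unfolding B.bilin_def
proof (intro conjI ballI)
 note bl = D.bilin_tp[OF \<phi>[unfolded tensor_motive_simps]]
 show "semilin (%e. e \<otimes>\<^sub>\<rat> 1) V (%v. pf \<phi> v v')" if v': "v' \<in> carrier V'" for v'
  unfolding pf_swap
 proof (rule sl)
  show "semilin (map_right \<sigma>) D (%h. betti_period M' \<sigma> v' (%h'. \<phi> (D.tp h h')))"
   unfolding betti_period_def ev_def case_prod_beta'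
   by (rule semilin_sum_list, rule D.bilinD(1)[OF bl]) (use trep_I'[OF v'] in auto)
 qed
 show "semilin (%e. e \<otimes>\<^sub>\<rat> 1) V' (pf \<phi> v)" if v: "v \<in> carrier V" for v
  unfolding pf_def[abs_def]
 proof (rule sl')
  show "semilin (map_right \<sigma>) D' (%h'. betti_period M \<sigma> v (%h. \<phi> (D.tp h h')))"
   unfolding betti_period_def ev_def case_prod_beta'
   by (rule semilin_sum_list, rule D.bilinD(2)[OF bl]) (use trep_I[OF v] in auto)
 qed
qed

text \<open>The comparison map of the tensor product is given by nested choices of representatives.
  Evaluating a functional turns them into an iterated sum, which depends on the classes alone
  because \<open>pf\<close> is bilinear.\<close>

lemma tensor_period:
 assumes X: "X \<in> carrier (betti T \<sigma>)"
 shows "comparison T \<sigma> (bclass (betti T \<sigma>) [(X, 1)]) \<in> carrier (derhamC T \<sigma>)"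
  and "semilin (map_right \<sigma>) (derham T) \<phi> ==> betti_period T \<sigma> X \<phi> = B.tf (pf \<phi>) X"
proof -
 interpret DT: scalar_ext "tensor D D'" "%e. e \<otimes>\<^sub>\<rat> 1" "%x. 1 \<otimes>\<^sub>\<rat> x" \<sigma> "map_right \<sigma>"
  by (rule scalar_ext_derham[OF D.cmod_tensor \<sigma>h])
 interpret BT: scalar_ext "tensor V V'" "%e. e" of_rat of_rat "%e. e \<otimes>\<^sub>\<rat> 1"
  by (rule scalar_ext_betti[OF B.cmod_tensor])
 have X': "X \<in> carrier (tensor V V')" using X unfolding tensor_motive_simps .
 define XX where "XX = bclass (betti T \<sigma>) [(X, 1)]"
 have XX: "XX = bclass (tensor V V') [(X, 1)]" unfolding XX_def tensor_motive_simps ..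
 have trXX: "set (trep XX) \<subseteq> carrier (tensor V V') \<times> UNIV"
  using BT.sub_trep[of XX] BT.cls_in_T[of "[(X, 1)]"] X' unfolding XX[symmetric] BT.T_simps(1) by simp
 let ?L = "[(D.tp h h', c * z * z').
     (Y, c) \<leftarrow> trep XX, (v, v') \<leftarrow> trep Y,
     (h, z) \<leftarrow> trep (comparison M \<sigma> (bclass V [(v, 1)])),
     (h', z') \<leftarrow> trep (comparison M' \<sigma> (bclass V' [(v', 1)]))]"
 have L: "set ?L \<subseteq> carrier (tensor D D') \<times> UNIV"
 proof
  fix x assume "x \<in> set ?L"
  then obtain Y c v v' h z h' z' where *: "(Y, c) \<in> set (trep XX)" "(v, v') \<in> set (trep Y)"
   "(h, z) \<in> set (trep (comparison M \<sigma> (bclass V [(v, 1)])))"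
   "(h', z') \<in> set (trep (comparison M' \<sigma> (bclass V' [(v', 1)])))" "x = (D.tp h h', c * z * z')"
   by auto
  have "v \<in> carrier V" "v' \<in> carrier V'" using *(1,2) trXX trep_tensor by blast+
  then have "h \<in> carrier D" "h' \<in> carrier D'" using *(3,4) trep_I trep_I' by blast+
  then show "x \<in> carrier (tensor D D') \<times> UNIV" unfolding *(5) by (simp add: D.tp_closed)
 qed
 have comp: "comparison T \<sigma> XX = dclass \<sigma> (tensor D D') ?L" by (rule tensor_motive_simps(5))
 show "comparison T \<sigma> (bclass (betti T \<sigma>) [(X, 1)]) \<in> carrier (derhamC T \<sigma>)"
  unfolding XX_def[symmetric] comp tensor_motive_simps(2) derham_ext_conv[OF D.cmod_tensor \<sigma>h]
  by (rule DT.cls_in_T[OF L])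
 assume \<phi>: "semilin (map_right \<sigma>) (derham T) \<phi>"
 have "betti_period T \<sigma> X \<phi> = (\<Sum>(v, z)\<leftarrow>?L. 1 \<otimes>\<^sub>\<rat> z * \<phi> v)"
  unfolding betti_period_def XX_def[symmetric] comp
  by (rule DT.ev_cls[OF \<phi>[unfolded tensor_motive_simps] L])
 also have "\<dots> = ev (B.tf (pf \<phi>)) XX"
  unfolding ev_def[of "B.tf (pf \<phi>)"] B.tf_def pf_swap unfolding betti_period_def ev_def
  by (simp add: map_concat sum_list_concat comp_def case_prod_beta' sum_list_const_mult[symmetric] pure_right_mult mult.assoc)
 also have "\<dots> = B.tf (pf \<phi>) X"
  unfolding XX by (rule BT.ev_unit[OF B.semilin_tf[OF bilin_pf[OF \<phi>]] X'])
 finally show "betti_period T \<sigma> X \<phi> = B.tf (pf \<phi>) X" .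
qed

lemma semilin_tensor_period:
 assumes \<phi>: "semilin (map_right \<sigma>) (derham T) \<phi>"
 shows "semilin (%e. e \<otimes>\<^sub>\<rat> 1) (betti T \<sigma>) (%X. betti_period T \<sigma> X \<phi>)"
proof -
 note s = B.semilin_tf[OF bilin_pf[OF \<phi>], folded tensor_motive_simps]
 have "cmod (betti T \<sigma>)" unfolding tensor_motive_simps by (rule B.cmod_tensor)
 then show ?thesis using s unfolding semilin_def by (simp add: tensor_period(2)[OF _ \<phi>] cmodD)
qed

lemma period_data_tensor: "period_data T \<sigma>"
proof (rule period_data.intro)
 show "field_hom \<sigma>" by (rule \<sigma>h)
 show "cmod (derham T)" unfolding tensor_motive_simps by (rule D.cmod_tensor)
 have F: "hodge_fil M p \<subseteq> carrier D" "hodge_fil M' p \<subseteq> carrier D'" for p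
  using M.fil_submodule[of p] M'.fil_submodule[of p] by (auto simp: LinearCombinations.submodule_def)
 interpret DT: Module.module class_ring "tensor D D'" by (rule D.cmod_tensor)
 have gens: "{D.tp h h' | h h' p q. p + q = n \<and> h \<in> hodge_fil M p \<and> h' \<in> hodge_fil M' q} \<subseteq> carrier (tensor D D')" for n
  using F D.tp_closed by blast
 show "LinearCombinations.submodule class_ring (hodge_fil T n) (derham T)" for n
  unfolding tensor_motive_simps by (rule DT.span_is_submodule[OF gens])
 show "hodge_fil T n \<subseteq> hodge_fil T m" if "m \<le> n" for m n
  unfolding tensor_motive_simps
 proof (rule DT.span_is_monotone, safe)
  fix h h' p q assume *: "h \<in> hodge_fil M p" "h' \<in> hodge_fil M' q" "n = p + q"
  \<comment> \<open>The whole drop from n to m is taken in the first factor.\<close>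
  then have "h \<in> hodge_fil M (m - q)" using M.fil_decreasing[of "m - q" p] that by auto
  then show "\<exists>k k' p' q'. D.tp h h' = D.tp k k' \<and> p' + q' = m \<and> k \<in> hodge_fil M p' \<and> k' \<in> hodge_fil M' q'"
   using * by (intro exI[of _ h] exI[of _ h'] exI[of _ "m - q"] exI[of _ q]) auto
 qed
 show "comparison T \<sigma> (bclass (betti T \<sigma>) [(v, 1)]) \<in> carrier (derhamC T \<sigma>)"
  if "v \<in> carrier (betti_eigen T \<sigma> s)" for s v
  using that by (intro tensor_period) (simp add: betti_eigen_def)
qed

end

section \<open>Period frames of motives of even and of odd rank\<close>

abbreviation period_functional :: "('e::field_char_0, 'f::field_char_0, 'b, 'd) realizations => ('f => complex) =>
  ('d => ('e, complex) qtensor) => bool" where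
 "period_functional M \<sigma> \<equiv> semilin (map_right \<sigma>) (derham M)"

context motive
begin

lemma hodge_number_pure:
 assumes \<sigma>: "\<sigma> \<in> real_embeddings" and "hodge_type M \<sigma> p q = {\<zero>\<^bsub>bettiC M \<sigma>\<^esub>}"
 shows "hodge_number M p q = 0"
proof -
 interpret B: scalar_ext "betti M \<sigma>" "%e. e" of_rat of_rat "%e. e \<otimes>\<^sub>\<rat> 1"
  by (rule scalar_ext_betti[OF betti_module[OF \<sigma>]])
 have cW: "cmod (bettiC M \<sigma>)" unfolding betti_ext_conv[OF betti_module[OF \<sigma>]] by (rule B.cmod_T)
 have "cmod (submod (bettiC M \<sigma>) {\<zero>\<^bsub>bettiC M \<sigma>\<^esub>})"
  using cmodD[OF cW] by (intro cmod_submod[OF cW]) (auto simp: abelian_monoid.l_zero[OF abelian_group.axioms(1)])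
 then have "frame (submod (bettiC M \<sigma>) {\<zero>\<^bsub>bettiC M \<sigma>\<^esub>}) {} (%_::nat. \<zero>\<^bsub>bettiC M \<sigma>\<^esub>) (%_ _. 0)"
  by (auto simp: frame_def lc_def finsum_def finprod_def submod_def)
 from frame_has_rank[OF this] show ?thesis using hodge_rank[OF \<sigma>, of p q] assms(2) by simp
qed

text \<open>\<open>motive_frame\<close> for a basis made of the two eigenspaces: the sign of a
  vector is the first component of its index, and the trace is the difference of their
  dimensions.\<close>

lemma sign_period_frame:
 assumes \<sigma>: "\<sigma> \<in> real_embeddings"
  and hodge_le: "!!p q. hodge_number M p q \<noteq> 0 ==> hodge_number M p q = 1"
  and w: "!!p q. p + q \<noteq> w ==> hodge_type M \<sigma> p q = {\<zero>\<^bsub>bettiC M \<sigma>\<^esub>}"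
 obtains n b cb c y z \<gamma> G u where
  "!!s. s \<in> {1, - 1} ==> frame (betti_eigen M \<sigma> s) {..<n s} (b s) (cb s)"
  and "frame (betti M \<sigma>) (sign_index n) (%(s, k). b s k) c"
  and "dual_frame (derham M) (hodge_fil M) (map_right \<sigma>) (hodge_degrees M w) (%p. p) (sign_index n) y z \<gamma> G
   (%(s, k). betti_period M \<sigma> (b s k))"
  and "!!p. p \<in> hodge_degrees M w ==> w - p \<in> hodge_degrees M w"
  and "!!p s k. p \<in> hodge_degrees M w ==> (s, k) \<in> sign_index n ==>
   y (w - p) (s, k) = of_int s * u (w - p) * y p (s, k)"
  and "(of_int (int (n 1) - int (n (- 1))) :: ('e, complex) qtensor) = (\<Sum>p\<in>{p\<in>hodge_degrees M w. 2 * p = w}. u p)"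
  and "!!p t. p \<in> hodge_degrees M w ==> 2 * p = w ==>
   (\<forall>x\<in>hodge_type M \<sigma> p p. frobC M \<sigma> x = t \<odot>\<^bsub>bettiC M \<sigma>\<^esub> x) \<longleftrightarrow> t = u p"
  and "!!\<phi>. period_functional M \<sigma> \<phi> ==> semilin (%e. e \<otimes>\<^sub>\<rat> 1) (betti M \<sigma>) (%v. betti_period M \<sigma> v \<phi>)"
  and "!!v. v \<in> carrier (betti M \<sigma>) ==> comparison M \<sigma> (bclass (betti M \<sigma>) [(v, 1)]) \<in> carrier (derhamC M \<sigma>)"
  and "card (hodge_degrees M w) = motive_rank M" "card (sign_index n) = motive_rank M" "finite (hodge_degrees M w)"
proof -
 obtain n b cb c where f: "!!s. s \<in> {1, - 1} ==> frame (betti_eigen M \<sigma> s) {..<n s} (b s) (cb s)"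
  and fr: "frame (betti M \<sigma>) (sign_index n) (%(s, k). b s k) c" by (rule sign_frame[OF \<sigma>]; ((rule that; assumption) | assumption))
 have frob_b: "frob M \<sigma> ((%(s, k). b s k) i) = of_int (fst i) \<odot>\<^bsub>betti M \<sigma>\<^esub> (%(s, k). b s k) i" if i: "i \<in> sign_index n" for i
 proof -
  obtain s k where sk: "i = (s, k)" "s \<in> {1, - 1}" "k < n s" using i by (auto simp: sign_index_def)
  show ?thesis using frame_closed[OF f[OF sk(2)], of k] sk(1,3) by (simp add: betti_eigen_def)
 qed
 obtain y z \<gamma> G u where 1:
  "dual_frame (derham M) (hodge_fil M) (map_right \<sigma>) (hodge_degrees M w) (%p. p) (sign_index n) y z \<gamma> G
   (%k. betti_period M \<sigma> ((%(s, k). b s k) k))"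
  and 2: "!!p. p \<in> hodge_degrees M w ==> w - p \<in> hodge_degrees M w"
  and 3: "!!p k. p \<in> hodge_degrees M w ==> k \<in> sign_index n ==> of_int (fst k) * y p k = u p * y (w - p) k"
  and 4: "(\<Sum>k\<in>sign_index n. of_int (fst k)) = (\<Sum>p\<in>{p\<in>hodge_degrees M w. 2 * p = w}. u p)"
  and 5: "!!p t. p \<in> hodge_degrees M w ==> 2 * p = w ==>
   (\<forall>x\<in>hodge_type M \<sigma> p p. frobC M \<sigma> x = t \<odot>\<^bsub>bettiC M \<sigma>\<^esub> x) \<longleftrightarrow> t = u p"
  and 6: "!!\<phi>. period_functional M \<sigma> \<phi> ==> semilin (%e. e \<otimes>\<^sub>\<rat> 1) (betti M \<sigma>) (%v. betti_period M \<sigma> v \<phi>)"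
  and 7: "!!v. v \<in> carrier (betti M \<sigma>) ==> comparison M \<sigma> (bclass (betti M \<sigma>) [(v, 1)]) \<in> carrier (derhamC M \<sigma>)"
  by (rule motive_frame[OF \<sigma> fr frob_b hodge_le w]; ((rule that; assumption) | assumption))
 interpret dual_frame "derham M" "hodge_fil M" "map_right \<sigma>" "hodge_degrees M w" "%p. p" "sign_index n" y z \<gamma> G
   "%k. betti_period M \<sigma> ((%(s, k). b s k) k)" by (rule 1)
 have eq: "(%k. betti_period M \<sigma> ((%(s, k). b s k) k)) = (%(s, k). betti_period M \<sigma> (b s k))" by auto
 have c1: "card (sign_index n) = motive_rank M" using frame_has_rank[OF fr] betti_rank[OF \<sigma>] by simp
 moreover have "card (hodge_degrees M w) = card (sign_index n)"
  by (intro antisym left_inverse_card_le[OF finP finK yz] left_inverse_card_le[OF finK finP zy])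
 ultimately have c2: "card (hodge_degrees M w) = motive_rank M" by simp
 \<comment> \<open>The coordinate relation at the type w - p, multiplied by the sign
   \<open>s\<close>, whose square is 1.\<close>
 have y: "y (w - p) (s, k) = of_int s * u (w - p) * y p (s, k)" if p: "p \<in> hodge_degrees M w" and sk: "(s, k) \<in> sign_index n" for p s k
 proof -
  have "s * s = 1" using sk by (auto simp: sign_index_def)
  then have ss: "of_int s * of_int s = (1 :: ('e, complex) qtensor)" by (simp only: of_int_mult[symmetric] of_int_1)
  have "y (w - p) (s, k) = of_int s * (of_int s * y (w - p) (s, k))" by (simp add: mult.assoc[symmetric] ss)
  also have "of_int s * y (w - p) (s, k) = u (w - p) * y p (s, k)" using 3[OF 2[OF p] sk] by simp
  finally show ?thesis by (simp only: mult.assoc)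
 qed
 show thesis
  by (rule that[OF f fr 1[unfolded eq] 2 y 4[unfolded sum_sign_index] 5 6 7 c2 c1 finP])
qed

lemma period_data: 
 assumes "\<sigma> \<in> real_embeddings" "!!v. v \<in> carrier (betti M \<sigma>) ==>
  comparison M \<sigma> (bclass (betti M \<sigma>) [(v, 1)]) \<in> carrier (derhamC M \<sigma>)"
 shows "period_data M \<sigma>"
 by (rule period_data.intro[OF real_embeddings_field_hom[OF assms(1)] derham_module fil_submodule fil_decreasing assms(2)])
  (auto simp: betti_eigen_def)

text \<open>Even rank excludes a middle type, so the trace of conjugation is 0 and both eigenspaces
  have the same dimension \<open>m\<close>. The step just above the middle then has a quotient of
  rank \<open>m\<close>, which makes the periods exist and yields the isomorphism of the
  graph.\<close>

lemma even_period_frame: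
 assumes \<sigma>: "\<sigma> \<in> real_embeddings"
  and hodge_le: "!!p q. hodge_number M p q \<noteq> 0 ==> hodge_number M p q = 1"
  and w: "!!p q. p + q \<noteq> w ==> hodge_type M \<sigma> p q = {\<zero>\<^bsub>bettiC M \<sigma>\<^esub>}"
  and ev: "even (motive_rank M)"
 obtains m :: nat and b cb c y z \<gamma> G u \<psi> where
  "!!s. s \<in> {1, - 1} ==> frame (betti_eigen M \<sigma> s) {..<m} (b s) (cb s)"
  and "frame (betti M \<sigma>) ({1, - 1} \<times> {..<m}) (%(s, k). b s k) c"
  and "dual_frame (derham M) (hodge_fil M) (map_right \<sigma>) (hodge_degrees M w) (%p. p) ({1, - 1} \<times> {..<m}) y z \<gamma> G
   (%(s, k). betti_period M \<sigma> (b s k))"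
  and "!!p. p \<in> hodge_degrees M w ==> w - p \<in> hodge_degrees M w"
  and "!!p s k. p \<in> hodge_degrees M w ==> s \<in> {1, - 1} ==> k < m ==>
   y (w - p) (s, k) = of_int s * u (w - p) * y p (s, k)"
  and "!!\<phi>. period_functional M \<sigma> \<phi> ==> semilin (%e. e \<otimes>\<^sub>\<rat> 1) (betti M \<sigma>) (%v. betti_period M \<sigma> v \<phi>)"
  and "!!v. v \<in> carrier (betti M \<sigma>) ==> comparison M \<sigma> (bclass (betti M \<sigma>) [(v, 1)]) \<in> carrier (derhamC M \<sigma>)"
  and "!!s q k. s \<in> {1, - 1} ==> q \<in> hodge_degrees M w ==> k < m ==>
   (\<Sum>j<m. \<psi> s k j * y q (s, j)) = of_int (if w div 2 + 1 \<le> q then - 1 else 1) * y q (- s, k)"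
  and "gdet {..<m} (\<psi> 1) * gdet {..<m} (\<psi> (- 1)) = 1"
  and "!!s. s \<in> {1, - 1} ==> periods M \<sigma> s \<noteq> {}"
  and "!!s c. s \<in> {1, - 1} ==> c \<in> periods M \<sigma> s ==> \<exists>t. c * t = 1"
  and "!!a b. a \<in> periods M \<sigma> 1 ==> b \<in> periods M \<sigma> (- 1) ==> \<exists>t\<in>runits (range \<sigma>). a = t * b * gdet {..<m} (\<psi> 1)"
proof -
 obtain n b cb c y z \<gamma> G u where
  1: "!!s. s \<in> {1, - 1} ==> frame (betti_eigen M \<sigma> s) {..<n s} (b s) (cb s)"
  and 2: "frame (betti M \<sigma>) (sign_index n) (%(s, k). b s k) c"
  and 3: "dual_frame (derham M) (hodge_fil M) (map_right \<sigma>) (hodge_degrees M w) (%p. p) (sign_index n) y z \<gamma> G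
   (%(s, k). betti_period M \<sigma> (b s k))"
  and 4: "!!p. p \<in> hodge_degrees M w ==> w - p \<in> hodge_degrees M w"
  and 5: "!!p s k. p \<in> hodge_degrees M w ==> (s, k) \<in> sign_index n ==>
   y (w - p) (s, k) = of_int s * u (w - p) * y p (s, k)"
  and 6: "(of_int (int (n 1) - int (n (- 1))) :: ('e, complex) qtensor) = (\<Sum>p\<in>{p\<in>hodge_degrees M w. 2 * p = w}. u p)"
  and 7: "!!\<phi>. period_functional M \<sigma> \<phi> ==> semilin (%e. e \<otimes>\<^sub>\<rat> 1) (betti M \<sigma>) (%v. betti_period M \<sigma> v \<phi>)"
  and 8: "!!v. v \<in> carrier (betti M \<sigma>) ==> comparison M \<sigma> (bclass (betti M \<sigma>) [(v, 1)]) \<in> carrier (derhamC M \<sigma>)"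
  and 9: "card (hodge_degrees M w) = motive_rank M" "card (sign_index n) = motive_rank M" and fin: "finite (hodge_degrees M w)"
  by (rule sign_period_frame[OF \<sigma> hodge_le w]; ((rule that; assumption) | assumption))
 let ?P = "hodge_degrees M w"
 note refl = card_reflection[OF fin 4]
 have mid: "{p\<in>?P. 2 * p = w} = {}"
 proof (rule ccontr)
  assume "{p\<in>?P. 2 * p = w} \<noteq> {}"
  then obtain p where "p \<in> ?P" "2 * p = w" by blast
  then have "{p\<in>?P. 2 * p = w} = {p}" by auto
  then show False using refl ev 9 by simp
 qed
 have "(of_int (int (n 1) - int (n (- 1))) :: ('e, complex) qtensor) = of_int 0" unfolding 6 mid by simp
 then have n: "n (- 1) = n 1" unfolding qtensor_of_int_eq by simp
 define m where "m = n 1"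
 have nm: "n s = m" if "s \<in> {1, - 1}" for s using that n by (auto simp: m_def)
 then have si: "sign_index n = {1, - 1} \<times> {..<m}" unfolding sign_index_def by auto
 have f: "frame (betti_eigen M \<sigma> s) {..<m} (b s) (cb s)" if "s \<in> {1, - 1}" for s using 1[OF that] nm[OF that] by simp
 have y: "y (w - p) (s, k) = of_int s * u (w - p) * y p (s, k)" if "p \<in> ?P" "s \<in> {1, - 1}" "k < m" for p s k
  using 5[of p s k] that si by simp
 interpret df: dual_frame "derham M" "hodge_fil M" "map_right \<sigma>" ?P "%p. p" "{1, - 1} \<times> {..<m}" y z \<gamma> G
   "%(s, k). betti_period M \<sigma> (b s k)" using 3 unfolding si .
 interpret pd: period_data M \<sigma> by (rule period_data[OF \<sigma> 8])
 have pf: "period_frame M \<sigma> ?P (%p. p) {..<m} y z \<gamma> G b cb w (%p. w - p) (%p. u (w - p))"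
 proof (rule period_frame.intro[OF pd.period_data_axioms df.dual_frame_axioms], rule period_frame_axioms.intro)
  show "semilin (%e. e \<otimes>\<^sub>\<rat> 1) (betti_eigen M \<sigma> s) (%x. betti_period M \<sigma> x \<phi>)" if "period_functional M \<sigma> \<phi>" for s \<phi>
   using 7[OF that] by (simp add: semilin_def betti_eigen_def)
 qed (use f 4 y in auto)
 interpret period_frame M \<sigma> ?P "%p. p" "{..<m}" y z \<gamma> G b cb w "%p. w - p" "%p. u (w - p)" by (rule pf)
 \<comment> \<open>\<open>w div 2 + 1\<close> is the first degree strictly above w / 2; as no type
   sits at w / 2, the types below it are those with 2 p < w.\<close>
 have "{p\<in>?P. p < w div 2 + 1} = {p\<in>?P. 2 * p < w}"
 proof -
  have "p < w div 2 + 1 \<longleftrightarrow> 2 * p < w" if "p \<in> ?P" for p using mid that by (cases "2 * p = w") auto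
  then show ?thesis by blast
 qed
 then have cQ: "card {p\<in>?P. p < w div 2 + 1} = m" using card_P refl mid by simp
 obtain r where r: "has_rank (derham_quot M (w div 2 + 1)) r" using fil_quot_free by blast
 obtain ws \<kappa> where q: "frame (derham_quot M (w div 2 + 1)) {..<r} ws \<kappa>" using has_rank_frame[OF pd.cQ r] by blast
 have "r = m" using quot_rank[OF q] cQ by simp
 then have q': "frame (derham_quot M (w div 2 + 1)) {..<card {..<m}} ws \<kappa>" using q by simp
 obtain \<psi> where \<psi>: "!!s q k. s \<in> {1, - 1} ==> q \<in> ?P ==> k \<in> {..<m} ==>
   (\<Sum>j\<in>{..<m}. \<psi> s k j * y q (s, j)) = of_int (if w div 2 + 1 \<le> q then - 1 else 1) * y q (- s, k)"
  and g: "gdet {..<m} (\<psi> 1) * gdet {..<m} (\<psi> (- 1)) = 1"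
  by (rule graph_iso[OF q']; ((rule that; assumption) | assumption))
 have ne: "periods M \<sigma> s \<noteq> {}" if "s \<in> {1, - 1}" for s
  using cQ by (intro periods_ex[OF r _ that]) simp
 have ratio: "\<exists>t\<in>runits (range \<sigma>). a = t * b * gdet {..<m} (\<psi> 1)" if ab: "a \<in> periods M \<sigma> 1" "b \<in> periods M \<sigma> (- 1)" for a b
 proof -
  obtain t where "t \<in> runits (range \<sigma>)" "a = t * b * gdet {..<m} (\<psi> 1)"
   by (rule period_ratio[OF ab, of "%q. if w div 2 + 1 \<le> q then - 1 else 1" "\<psi> 1"]) (use \<psi>[of 1] in auto)
  then show ?thesis by blast
 qed
 show thesis
  by (rule that[OF f 2[unfolded si] df.dual_frame_axioms 4 y 7 8 _ g ne _ ratio]) (use \<psi> periods_unit in auto)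
qed

text \<open>Odd rank leaves exactly one fixed type, which alone contributes to the trace:
  \<open>middle_sign\<close> is therefore the difference of the dimensions of the eigenspaces. It is
  1 or -1 since conjugation is an involution.\<close>

lemma odd_period_frame:
 assumes \<sigma>: "\<sigma> \<in> real_embeddings"
  and hodge_le: "!!p q. hodge_number M p q \<noteq> 0 ==> hodge_number M p q = 1"
  and w: "!!p q. p + q \<noteq> w ==> hodge_type M \<sigma> p q = {\<zero>\<^bsub>bettiC M \<sigma>\<^esub>}"
  and od: "odd (motive_rank M)"
 obtains n b cb c y z \<gamma> G u where
  "!!s. s \<in> {1, - 1} ==> frame (betti_eigen M \<sigma> s) {..<n s} (b s) (cb s)"
  and "frame (betti M \<sigma>) (sign_index n) (%(s, k). b s k) c"
  and "dual_frame (derham M) (hodge_fil M) (map_right \<sigma>) (hodge_degrees M w) (%p. p) (sign_index n) y z \<gamma> G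
   (%(s, k). betti_period M \<sigma> (b s k))"
  and "!!p. p \<in> hodge_degrees M w ==> w - p \<in> hodge_degrees M w"
  and "!!p s k. p \<in> hodge_degrees M w ==> (s, k) \<in> sign_index n ==>
   y (w - p) (s, k) = of_int s * u (w - p) * y p (s, k)"
  and "!!\<phi>. period_functional M \<sigma> \<phi> ==> semilin (%e. e \<otimes>\<^sub>\<rat> 1) (betti M \<sigma>) (%v. betti_period M \<sigma> v \<phi>)"
  and "!!v. v \<in> carrier (betti M \<sigma>) ==> comparison M \<sigma> (bclass (betti M \<sigma>) [(v, 1)]) \<in> carrier (derhamC M \<sigma>)"
  and "middle_sign M \<sigma> = int (n 1) - int (n (- 1))" "middle_sign M \<sigma> = 1 \<or> middle_sign M \<sigma> = - 1"
proof -
 obtain n b cb c y z \<gamma> G u where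
  1: "!!s. s \<in> {1, - 1} ==> frame (betti_eigen M \<sigma> s) {..<n s} (b s) (cb s)"
  and 2: "frame (betti M \<sigma>) (sign_index n) (%(s, k). b s k) c"
  and 3: "dual_frame (derham M) (hodge_fil M) (map_right \<sigma>) (hodge_degrees M w) (%p. p) (sign_index n) y z \<gamma> G
   (%(s, k). betti_period M \<sigma> (b s k))"
  and 4: "!!p. p \<in> hodge_degrees M w ==> w - p \<in> hodge_degrees M w"
  and 5: "!!p s k. p \<in> hodge_degrees M w ==> (s, k) \<in> sign_index n ==>
   y (w - p) (s, k) = of_int s * u (w - p) * y p (s, k)"
  and 6: "(of_int (int (n 1) - int (n (- 1))) :: ('e, complex) qtensor) = (\<Sum>p\<in>{p\<in>hodge_degrees M w. 2 * p = w}. u p)"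
  and mid: "!!p t. p \<in> hodge_degrees M w ==> 2 * p = w ==>
   (\<forall>x\<in>hodge_type M \<sigma> p p. frobC M \<sigma> x = t \<odot>\<^bsub>bettiC M \<sigma>\<^esub> x) \<longleftrightarrow> t = u p"
  and 7: "!!\<phi>. period_functional M \<sigma> \<phi> ==> semilin (%e. e \<otimes>\<^sub>\<rat> 1) (betti M \<sigma>) (%v. betti_period M \<sigma> v \<phi>)"
  and 8: "!!v. v \<in> carrier (betti M \<sigma>) ==> comparison M \<sigma> (bclass (betti M \<sigma>) [(v, 1)]) \<in> carrier (derhamC M \<sigma>)"
  and 9: "card (hodge_degrees M w) = motive_rank M" "card (sign_index n) = motive_rank M" and fin: "finite (hodge_degrees M w)"
  by (rule sign_period_frame[OF \<sigma> hodge_le w]; ((rule that; assumption) | assumption))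
 let ?P = "hodge_degrees M w"
 define k where "k = int (n 1) - int (n (- 1))"
 have "{p\<in>?P. 2 * p = w} \<noteq> {}"
 proof
  assume e: "{p\<in>?P. 2 * p = w} = {}"
  show False using card_reflection[OF fin 4] od 9 unfolding e by simp
 qed
 then obtain p0 where p0: "p0 \<in> ?P" "2 * p0 = w" by blast
 then have P0: "{p\<in>?P. 2 * p = w} = {p0}" by auto
 have uk: "of_int k = u p0" using 6 unfolding P0 k_def by simp
 interpret df: dual_frame "derham M" "hodge_fil M" "map_right \<sigma>" ?P "%p. p" "sign_index n" y z \<gamma> G
   "%(s, k). betti_period M \<sigma> (b s k)" by (rule 3)
 have wp: "w - p0 = p0" using p0 by simp
 \<comment> \<open>The relation of the fixed type with itself, applied twice; summed against
   \<open>z\<close> it gives \<open>u p0 * u p0 = 1\<close>.\<close>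
 have yy: "u p0 * u p0 * y p0 i = y p0 i" if i: "i \<in> sign_index n" for i
 proof -
  obtain s l where sl: "i = (s, l)" by force
  have y: "y p0 i = of_int s * u p0 * y p0 i" using 5[OF p0(1), of s l] i wp sl by simp
  have "s * s = 1" using i sl by (auto simp: sign_index_def)
  then have ss: "of_int s * of_int s = (1 :: ('e, complex) qtensor)" by (simp only: of_int_mult[symmetric] of_int_1)
  have "y p0 i = of_int s * u p0 * (of_int s * u p0 * y p0 i)" using y by simp
  also have "\<dots> = (of_int s * of_int s) * (u p0 * u p0 * y p0 i)" by (simp only: ac_simps)
  finally show ?thesis unfolding ss by simp
 qed
 have "1 = (\<Sum>i\<in>sign_index n. y p0 i * z i p0)" using df.yz[OF p0(1) p0(1)] by simp
 also have "\<dots> = (\<Sum>i\<in>sign_index n. u p0 * u p0 * (y p0 i * z i p0))"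
  by (rule sum.cong[OF HOL.refl]) (simp add: yy mult.assoc[symmetric])
 also have "\<dots> = u p0 * u p0" using df.yz[OF p0(1) p0(1)] by (simp add: sum_distrib_left[symmetric])
 finally have "(of_int (k * k) :: ('e, complex) qtensor) = of_int 1" using uk by simp
 then have "k * k = 1" unfolding qtensor_of_int_eq .
 then have k1: "k = 1 \<or> k = - 1" using zmult_eq_1_iff by auto
 have "middle_sign M \<sigma> = k"
  unfolding middle_sign_def
 proof (rule the_equality)
  have "hodge_number M p0 p0 \<noteq> 0" using p0(1) wp by (simp add: hodge_degrees_def)
  then show "\<exists>p. hodge_number M p p \<noteq> 0 \<and> (\<forall>x\<in>hodge_type M \<sigma> p p. frobC M \<sigma> x = of_int k \<odot>\<^bsub>bettiC M \<sigma>\<^esub> x)"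
   using mid[OF p0, of "of_int k"] uk by (intro exI[of _ p0]) simp
  fix l assume "\<exists>p. hodge_number M p p \<noteq> 0 \<and> (\<forall>x\<in>hodge_type M \<sigma> p p. frobC M \<sigma> x = of_int l \<odot>\<^bsub>bettiC M \<sigma>\<^esub> x)"
  then obtain p where p: "hodge_number M p p \<noteq> 0" "\<forall>x\<in>hodge_type M \<sigma> p p. frobC M \<sigma> x = of_int l \<odot>\<^bsub>bettiC M \<sigma>\<^esub> x" by blast
  have "p + p = w" using hodge_number_pure[OF \<sigma> w, of p p] p(1) by (cases "p + p = w") auto
  then have "p = p0" using p0 by simp
  then have "of_int l = u p0" using p(2) mid[OF p0, of "of_int l"] by simp
  then have "(of_int l :: ('e, complex) qtensor) = of_int k" using uk by simp
  then show "l = k" unfolding qtensor_of_int_eq .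
 qed
 then show thesis
  by (intro that[OF 1 2 3 4 5 7 8]) (use k1 in \<open>auto simp: k_def\<close>)
qed

end

section \<open>The period frame of a tensor product\<close>

text \<open>
 The last conjuncts record the ratio of the periods: \<open>\<psi>\<close> is block diagonal with one block, of
 determinant \<open>\<delta>\<close> or \<open>\<delta>' = \<delta>\<^sup>-\<^sup>1\<close>, for each basis vector of \<open>H\<^sub>B(\<sigma>,M')\<close> on which complex conjugation acts
 by \<open>1\<close> or by \<open>-1\<close>.
\<close>

definition tensor_frame where
 "tensor_frame M M' w w' \<sigma> K b cb c y z \<gamma> G v \<psi> \<delta> \<delta>' \<longleftrightarrow>
  motive_pair M M' \<sigma> \<and>
  period_frame (tensor_motive M M') \<sigma> (hodge_degrees M w \<times> hodge_degrees M' w') (%(p, p'). p + p') K y z \<gamma> G b cb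
   (w + w') (%(p, p'). (w - p, w' - p')) v \<and>
  frame (betti (tensor_motive M M') \<sigma>) ({1, - 1} \<times> K) (%(s, k). b s k) c \<and>
  (\<forall>s\<in>{1, - 1}. \<forall>k\<in>K. frob (tensor_motive M M') \<sigma> (b s k) = of_int s \<odot>\<^bsub>betti (tensor_motive M M') \<sigma>\<^esub> b s k) \<and>
  (\<forall>q\<in>hodge_degrees M w \<times> hodge_degrees M' w'. \<forall>k\<in>K. (\<Sum>j\<in>K. \<psi> k j * y q (1, j)) =
   of_int (if w div 2 + 1 \<le> fst q then - 1 else 1) * y q (- 1, k)) \<and>
  \<delta> * \<delta>' = 1 \<and> gdet K \<psi> = (if middle_sign M' \<sigma> = 1 then \<delta> else \<delta>') \<and>
  (middle_sign M' \<sigma> = 1 \<or> middle_sign M' \<sigma> = - 1) \<and>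
  (\<forall>a\<in>periods M \<sigma> 1. \<forall>b\<in>periods M \<sigma> (- 1). \<exists>t\<in>runits (range \<sigma>). a = t * b * \<delta>) \<and>
  (\<forall>s\<in>{1, - 1}. periods M \<sigma> s \<noteq> {} \<and> (\<forall>c\<in>periods M \<sigma> s. \<exists>t. c * t = 1))"

lemma sign_square: "s \<in> {1, - 1 :: int} ==> of_int s * of_int s = (1 :: 'r::comm_ring_1)"
 by auto

lemma prod_sign_index:
 "(\<Prod>k\<in>sign_index n. f (fst k)) = f 1 ^ n 1 * f (- 1) ^ n (- 1)"
proof -
 have "(\<Prod>k\<in>sign_index n. f (fst k)) = (\<Prod>s\<in>{1, - 1}. \<Prod>k<n s. f s)"
  unfolding sign_index_def by (subst prod.Sigma) (auto simp: case_prod_beta')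
 then show ?thesis by simp
qed

text \<open>Signs multiply under the tensor product: for a vector of M' with sign t, the sign s of
  the product is obtained from the vectors of M with sign s t. Both eigenspaces of the product are
  thus indexed by pairs of a vector of M' and a position below \<open>m\<close>.\<close>

lemma tensor_period_frame:
 fixes M :: "('e::field_char_0, 'f::field_char_0, 'b, 'd) realizations" and M' :: "('e, 'f, 'b2, 'd2) realizations"
 assumes M: "motive M" and M': "motive M'" and \<sigma>: "\<sigma> \<in> real_embeddings"
  and hodge_le: "!!p q. hodge_number M p q \<noteq> 0 ==> hodge_number M p q = 1"
  and hodge_le': "!!p q. hodge_number M' p q \<noteq> 0 ==> hodge_number M' p q = 1"
  and w: "!!p q. p + q \<noteq> w ==> hodge_type M \<sigma> p q = {\<zero>\<^bsub>bettiC M \<sigma>\<^esub>}"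
  and w': "!!p q. p + q \<noteq> w' ==> hodge_type M' \<sigma> p q = {\<zero>\<^bsub>bettiC M' \<sigma>\<^esub>}"
  and ev: "even (motive_rank M)" and od: "odd (motive_rank M')"
 shows "\<exists>(K :: ((int \<times> nat) \<times> nat) set) b cb c y z \<gamma> G v \<psi> \<delta> \<delta>'. tensor_frame M M' w w' \<sigma> K b cb c y z \<gamma> G v \<psi> \<delta> \<delta>'"
proof -
 let ?P = "hodge_degrees M w" and ?P' = "hodge_degrees M' w'"
 obtain m b cb c y z \<gamma> G u \<psi> where
  a1: "!!s. s \<in> {1, - 1} ==> frame (betti_eigen M \<sigma> s) {..<m::nat} (b s) (cb s)"
  and a2: "frame (betti M \<sigma>) ({1, - 1} \<times> {..<m}) (%(s, k). b s k) c"
  and a3: "dual_frame (derham M) (hodge_fil M) (map_right \<sigma>) ?P (%p. p) ({1, - 1} \<times> {..<m}) y z \<gamma> G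
   (%(s, k). betti_period M \<sigma> (b s k))"
  and a4: "!!p. p \<in> ?P ==> w - p \<in> ?P"
  and a5: "!!p s k. p \<in> ?P ==> s \<in> {1, - 1} ==> k < m ==> y (w - p) (s, k) = of_int s * u (w - p) * y p (s, k)"
  and a6: "!!\<phi>. period_functional M \<sigma> \<phi> ==> semilin (%e. e \<otimes>\<^sub>\<rat> 1) (betti M \<sigma>) (%v. betti_period M \<sigma> v \<phi>)"
  and a7: "!!v. v \<in> carrier (betti M \<sigma>) ==> comparison M \<sigma> (bclass (betti M \<sigma>) [(v, 1)]) \<in> carrier (derhamC M \<sigma>)"
  and a8: "!!s q k. s \<in> {1, - 1} ==> q \<in> ?P ==> k < m ==>
   (\<Sum>j<m. \<psi> s k j * y q (s, j)) = of_int (if w div 2 + 1 \<le> q then - 1 else 1) * y q (- s, k)"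
  and a9: "gdet {..<m} (\<psi> 1) * gdet {..<m} (\<psi> (- 1)) = 1"
  and a10: "!!s. s \<in> {1, - 1} ==> periods M \<sigma> s \<noteq> {}"
  and a11: "!!s c. s \<in> {1, - 1} ==> c \<in> periods M \<sigma> s ==> \<exists>t. c * t = 1"
  and a12: "!!a b. a \<in> periods M \<sigma> 1 ==> b \<in> periods M \<sigma> (- 1) ==> \<exists>t\<in>runits (range \<sigma>). a = t * b * gdet {..<m} (\<psi> 1)"
  by (rule motive.even_period_frame[OF M \<sigma> hodge_le w ev]; ((rule that; assumption) | assumption))
 obtain n' b' cb' c' y' z' \<gamma>' G' u' where
  b1: "!!s. s \<in> {1, - 1} ==> frame (betti_eigen M' \<sigma> s) {..<n' s} (b' s) (cb' s)"
  and b2: "frame (betti M' \<sigma>) (sign_index n') (%(s, k). b' s k) c'"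
  and b3: "dual_frame (derham M') (hodge_fil M') (map_right \<sigma>) ?P' (%p. p) (sign_index n') y' z' \<gamma>' G'
   (%(s, k). betti_period M' \<sigma> (b' s k))"
  and b4: "!!p. p \<in> ?P' ==> w' - p \<in> ?P'"
  and b5: "!!p s k. p \<in> ?P' ==> (s, k) \<in> sign_index n' ==> y' (w' - p) (s, k) = of_int s * u' (w' - p) * y' p (s, k)"
  and b6: "!!\<phi>. period_functional M' \<sigma> \<phi> ==> semilin (%e. e \<otimes>\<^sub>\<rat> 1) (betti M' \<sigma>) (%v. betti_period M' \<sigma> v \<phi>)"
  and b7: "!!v. v \<in> carrier (betti M' \<sigma>) ==> comparison M' \<sigma> (bclass (betti M' \<sigma>) [(v, 1)]) \<in> carrier (derhamC M' \<sigma>)"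
  and b8: "middle_sign M' \<sigma> = int (n' 1) - int (n' (- 1))" "middle_sign M' \<sigma> = 1 \<or> middle_sign M' \<sigma> = - 1"
  by (rule motive.odd_period_frame[OF M' \<sigma> hodge_le' w' od]; ((rule that; assumption) | assumption))
 have mp: "motive_pair M M' \<sigma>"
  apply (rule motive_pair.intro[OF M M'])
  apply (rule motive_pair_axioms.intro)
  apply (rule \<sigma>)
  apply (erule a6)
  apply (erule b6)
  apply (erule a7)
  apply (erule b7)
  done
 interpret motive_pair M M' \<sigma> by (rule mp)
 have FA: "hodge_fil M n \<subseteq> carrier (derham M)" and FB: "hodge_fil M' n \<subseteq> carrier (derham M')" for n
  using M.fil_submodule[of n] M'.fil_submodule[of n] by (auto simp: LinearCombinations.submodule_def)
 interpret TF: tensor_frames "derham M" "hodge_fil M" "map_right \<sigma>" ?P "%p. p" "{1, - 1} \<times> {..<m}" y z \<gamma> G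
   "%(s, k). betti_period M \<sigma> (b s k)" "derham M'" "hodge_fil M'" ?P' "%p. p" "sign_index n'" y' z' \<gamma>' G'
   "%(s, k). betti_period M' \<sigma> (b' s k)"
  by (rule tensor_frames.intro[OF a3 b3 D.tensor_pair_axioms], rule tensor_frames_axioms.intro) (rule FA, rule FB)
 define K where "K = sign_index n' \<times> {..<m}"
 \<comment> \<open>From the total sign and the common index to a pair of basis vectors; the sign in
   M is s times the sign of \<open>k'\<close>, which is its own inverse.\<close>
 define h where "h = (%(s :: int, (k' :: int \<times> nat, k :: nat)). ((s * fst k', k), k'))"
 define bT where "bT s = (%(k', k). B.tp (b (s * fst k') k) (b' (fst k') (snd k')))" for s
 have K': "fst k' \<in> {1, - 1}" "snd k' < n' (fst k')" "(fst k', snd k') \<in> sign_index n'" if "k' \<in> sign_index n'" for k'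
  using that by (auto simp: sign_index_def)
 have sg: "s * t \<in> {1, - 1 :: int}" if "s \<in> {1, - 1}" "t \<in> {1, - 1}" for s t using that by auto
 have sq: "s * s = 1" if "s \<in> {1, - 1 :: int}" for s using that by auto
 have h: "bij_betw h ({1, - 1} \<times> K) (({1, - 1} \<times> {..<m}) \<times> sign_index n')"
 proof (rule bij_betwI[where g = "%((t, k), k'). (t * fst k', (k', k))"])
  show "h \<in> {1, - 1} \<times> K \<rightarrow> ({1, - 1} \<times> {..<m}) \<times> sign_index n'"
   using sg K' by (auto simp: h_def K_def)
  show "(%((t, k), k'). (t * fst k', (k', k))) \<in> ({1, - 1} \<times> {..<m}) \<times> sign_index n' \<rightarrow> {1, - 1} \<times> K"
   using sg K' by (auto simp: K_def)
  show "(%((t, k), k'). (t * fst k', (k', k))) (h x) = x" if "x \<in> {1, - 1} \<times> K" for x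
   using that sq K'(1) by (auto simp: h_def K_def mult.assoc)
  show "h ((%((t, k), k'). (t * fst k', (k', k))) x) = x" if "x \<in> ({1, - 1} \<times> {..<m}) \<times> sign_index n'" for x
   using that sq K'(1) by (auto simp: h_def mult.assoc)
 qed
 have bcl: "b s k \<in> carrier (betti M \<sigma>)" "frob M \<sigma> (b s k) = of_int s \<odot>\<^bsub>betti M \<sigma>\<^esub> b s k" if "s \<in> {1, - 1}" "k < m" for s k
  using frame_closed[OF a1[OF that(1)], of k] that(2) by (simp_all add: betti_eigen_def)
 have b'cl: "b' (fst k') (snd k') \<in> carrier (betti M' \<sigma>)" 
  "frob M' \<sigma> (b' (fst k') (snd k')) = of_int (fst k') \<odot>\<^bsub>betti M' \<sigma>\<^esub> b' (fst k') (snd k')" if "k' \<in> sign_index n'" for k'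
  using frame_closed[OF b1[OF K'(1)[OF that]], of "snd k'"] K'(2)[OF that] by (simp_all add: betti_eigen_def)
 have bT_h: "bT s \<kappa> = (%(k, k'). B.tp ((%(s, k). b s k) k) ((%(s, k). b' s k) k')) (h (s, \<kappa>))" for s \<kappa>
  by (cases \<kappa>) (auto simp: bT_def h_def case_prod_beta')
 have bTcl: "bT s \<kappa> \<in> carrier (betti T \<sigma>)" if s: "s \<in> {1, - 1}" and \<kappa>: "\<kappa> \<in> K" for s \<kappa>
 proof -
  obtain k' k where kk: "\<kappa> = (k', k)" "k' \<in> sign_index n'" "k < m" using \<kappa> by (auto simp: K_def)
  show ?thesis unfolding tensor_motive_simps bT_def kk(1) prod.case
   by (rule B.tp_closed[OF bcl(1)[OF sg[OF s K'(1)[OF kk(2)]] kk(3)] b'cl(1)[OF kk(2)]])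
 qed
 obtain cT where frT: "frame (betti T \<sigma>) ({1, - 1} \<times> K) (%(s, k). bT s k) cT"
 proof -
  have "(%(s, k). bT s k) = (%j. (%(k, k'). B.tp ((%(s, k). b s k) k) ((%(s, k). b' s k) k')) (h j))"
   by (rule ext) (auto simp: bT_h)
  then show thesis using that frame_reindex[OF B.frame_tensor[OF a2 b2] h] unfolding tensor_motive_simps by simp
 qed
 have frobT: "frob T \<sigma> (bT s \<kappa>) = of_int s \<odot>\<^bsub>betti T \<sigma>\<^esub> bT s \<kappa>" if s: "s \<in> {1, - 1}" and \<kappa>: "\<kappa> \<in> K" for s \<kappa>
 proof -
  obtain k' k where kk: "\<kappa> = (k', k)" "k' \<in> sign_index n'" "k < m" using \<kappa> by (auto simp: K_def)
  let ?t = "s * fst k'"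
  have t: "?t \<in> {1, - 1}" by (rule sg[OF s K'(1)[OF kk(2)]])
  have cl: "B.tp (b ?t k) (b' (fst k') (snd k')) \<in> carrier (tensor (betti M \<sigma>) (betti M' \<sigma>))"
   by (rule B.tp_closed[OF bcl(1)[OF t kk(3)] b'cl(1)[OF kk(2)]])
  have "frob T \<sigma> (bT s \<kappa>) = B.tp (of_int ?t \<odot>\<^bsub>betti M \<sigma>\<^esub> b ?t k) (of_int (fst k') \<odot>\<^bsub>betti M' \<sigma>\<^esub> b' (fst k') (snd k'))"
   unfolding kk(1) bT_def prod.case frob_tp[OF bcl(1)[OF t kk(3)] b'cl(1)[OF kk(2)]] bcl(2)[OF t kk(3)] b'cl(2)[OF kk(2)] ..
  also have "\<dots> = (of_int ?t * of_int (fst k')) \<odot>\<^bsub>tensor (betti M \<sigma>) (betti M' \<sigma>)\<^esub> B.tp (b ?t k) (b' (fst k') (snd k'))"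
   using bcl(1)[OF t kk(3)] b'cl(1)[OF kk(2)] cl
   by (simp only: B.tp_smult_left B.tp_smult_right cmod_smult_closed[OF B.cM] cmod_smult_closed[OF B.cN] cmod_mult_smult[OF B.cmod_tensor]
     mult.commute[of "of_int ?t"])
  also have "of_int ?t * of_int (fst k') = (of_int s :: 'e)"
   using sq[OF K'(1)[OF kk(2)]] by (simp only: of_int_mult[symmetric] mult.assoc) simp
  finally show ?thesis unfolding kk(1) bT_def prod.case tensor_motive_simps(1) .
 qed
 have FT: "TF.FT = hodge_fil T" by (rule ext) (simp only: TF.FT_def tensor_motive_simps)
 define yT where "yT = (%(p, p') (s, (k', k)). y p (s * fst k', k) * y' p' k')"
 define zT where "zT = (%(s, (k', k)) (p, p'). z (s * fst k', k) p * z' k' p')"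
 have df: "dual_frame (derham T) (hodge_fil T) (map_right \<sigma>) (?P \<times> ?P') (%(p, p'). p + p') ({1, - 1} \<times> K) yT zT
   TF.\<gamma>T TF.GT (%(s, k). betti_period T \<sigma> (bT s k))"
 proof -
  interpret R: dual_frame "derham T" "hodge_fil T" "map_right \<sigma>" "?P \<times> ?P'" "%(p, p'). p + p'"
   "({1, - 1} \<times> {..<m}) \<times> sign_index n'" "%(p, p') (k, k'). y p k * y' p' k'" "%(k, k') (p, p'). z k p * z' k' p'"
   TF.\<gamma>T TF.GT TF.\<beta>T
   using TF.dual_frame_tensor unfolding FT tensor_motive_simps(2) .
  have "dual_frame (derham T) (hodge_fil T) (map_right \<sigma>) (?P \<times> ?P') (%(p, p'). p + p') ({1, - 1} \<times> K)
   (%p j. (%(p, p') (k, k'). y p k * y' p' k') p (h j)) (%j. (%(k, k') (p, p'). z k p * z' k' p') (h j))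
   TF.\<gamma>T TF.GT (%(s, k). betti_period T \<sigma> (bT s k))"
  proof (rule R.reindex[OF h])
   fix j :: "int \<times> ((int \<times> nat) \<times> nat)" and \<phi> :: "('d \<times> 'd2) list set => ('e, complex) qtensor" 
   assume j: "j \<in> {1, - 1} \<times> K" and \<phi>: "semilin (map_right \<sigma>) (derham T) \<phi>"
   obtain s k' k where jj: "j = (s, (k', k))" "s \<in> {1, - 1}" "k' \<in> sign_index n'" "k < m" using j by (auto simp: K_def)
   note cl = bcl(1)[OF sg[OF jj(2) K'(1)[OF jj(3)]] jj(4)] b'cl(1)[OF jj(3)]
   have "betti_period T \<sigma> (bT s (k', k)) \<phi> = B.tf (pf \<phi>) (bT s (k', k))"
    using bTcl[OF jj(2), of "(k', k)"] jj by (intro tensor_period(2)[OF _ \<phi>]) (simp add: K_def)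
   also have "\<dots> = pf \<phi> (b (s * fst k') k) (b' (fst k') (snd k'))"
    unfolding bT_def prod.case by (rule B.tf_tp[OF bilin_pf[OF \<phi>] cl])
   also have "\<dots> = TF.\<beta>T (h j) \<phi>"
    unfolding jj(1) h_def TF.\<beta>T_def pf_def prod.case by (simp add: case_prod_beta')
   finally show "(%(s, k). betti_period T \<sigma> (bT s k)) j \<phi> = TF.\<beta>T (h j) \<phi>" by (simp add: jj(1))
  qed
  moreover have "(%p j. (%(p, p') (k, k'). y p k * y' p' k') p (h j)) = yT"
   by (intro ext) (auto simp: yT_def h_def split: prod.splits)
  moreover have "(%j. (%(k, k') (p, p'). z k p * z' k' p') (h j)) = zT"
   by (intro ext) (auto simp: zT_def h_def split: prod.splits)
  ultimately show ?thesis by simp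
 qed
 define vT where "vT = (%(p, p'). u (w - p) * u' (w' - p'))"
 have cbT: "cmod (betti T \<sigma>)" by (rule frame_cmod[OF frT])
 have "period_frame T \<sigma> (?P \<times> ?P') (%(p, p'). p + p') K yT zT TF.\<gamma>T TF.GT bT (%s x k. cT x (s, k))
   (w + w') (%(p, p'). (w - p, w' - p')) vT"
 proof (rule period_frame.intro[OF period_data_tensor df], rule period_frame_axioms.intro)
  show "frame (betti_eigen T \<sigma> s) K (bT s) (%x k. cT x (s, k))" if s: "s \<in> {1, - 1}" for s
   using eigen_frame[OF cbT frob_tensor_hom frob_tensor_involution frT _ s] frobT unfolding betti_eigen_def by simp
  show "semilin (%e. e \<otimes>\<^sub>\<rat> 1) (betti_eigen T \<sigma> s) (%x. betti_period T \<sigma> x \<phi>)" if "period_functional T \<sigma> \<phi>" for s \<phi>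
   using semilin_tensor_period[OF that] by (simp add: semilin_def betti_eigen_def)
  show "yT ((%(p, p'). (w - p, w' - p')) q) (s, \<kappa>) = of_int s * vT q * yT q (s, \<kappa>)"
   if q: "q \<in> ?P \<times> ?P'" and s: "s \<in> {1, - 1}" and \<kappa>: "\<kappa> \<in> K" for q s \<kappa>
  proof -
   obtain p p' where pp: "q = (p, p')" "p \<in> ?P" "p' \<in> ?P'" using q by auto
   obtain k' k where kk: "\<kappa> = (k', k)" "k' \<in> sign_index n'" "k < m" using \<kappa> by (auto simp: K_def)
   have 1: "y (w - p) (s * fst k', k) = of_int (s * fst k') * u (w - p) * y p (s * fst k', k)"
    by (rule a5[OF pp(2) sg[OF s K'(1)[OF kk(2)]] kk(3)])
   have 2: "y' (w' - p') k' = of_int (fst k') * u' (w' - p') * y' p' k'"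
    using b5[OF pp(3) K'(3)[OF kk(2)]] by simp
   have "y (w - p) (s * fst k', k) * y' (w' - p') k' =
     (of_int (fst k') * of_int (fst k')) * (of_int s * (u (w - p) * u' (w' - p')) * (y p (s * fst k', k) * y' p' k'))"
    unfolding 1 2 of_int_mult by (simp only: ac_simps)
   then show ?thesis unfolding sign_square[OF K'(1)[OF kk(2)]] by (simp add: pp(1) kk(1) yT_def vT_def)
  qed
 qed (use a4 b4 in \<open>auto\<close>)
 \<comment> \<open>At total sign 1 the factor from M has the sign of \<open>k'\<close>, so the block
   of \<open>k'\<close> is the isomorphism of M that starts from that sign. The coordinate
   \<open>y' p' k'\<close> is a common factor on both sides, so the sign depends on the type of M
   only.\<close>
 moreover define \<psi>T where "\<psi>T = (%(k' :: int \<times> nat, k) (j', j). if k' = j' then \<psi> (fst k') k j else 0)"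
 have "(\<Sum>j\<in>K. \<psi>T \<kappa> j * yT q (1, j)) = of_int (if w div 2 + 1 \<le> fst q then - 1 else 1) * yT q (- 1, \<kappa>)"
  if q: "q \<in> ?P \<times> ?P'" and \<kappa>: "\<kappa> \<in> K" for q \<kappa>
 proof -
  obtain p p' where pp: "q = (p, p')" "p \<in> ?P" "p' \<in> ?P'" using q by auto
  obtain k' k where kk: "\<kappa> = (k', k)" "k' \<in> sign_index n'" "k < m" using \<kappa> by (auto simp: K_def)
  have fin: "finite (sign_index n')" by (rule frame_finite[OF b2])
  have "(\<Sum>j\<in>K. \<psi>T \<kappa> j * yT q (1, j)) = (\<Sum>j'\<in>sign_index n'. \<Sum>j<m. \<psi>T \<kappa> (j', j) * yT q (1, (j', j)))"
   unfolding K_def sum.cartesian_product by (simp add: case_prod_beta')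
  also have "\<dots> = (\<Sum>j'\<in>sign_index n'. if j' = k' then (\<Sum>j<m. \<psi> (fst k') k j * y p (fst k', j)) * y' p' k' else 0)"
   by (rule sum.cong[OF HOL.refl]) (auto simp: \<psi>T_def yT_def pp(1) kk(1) sum_distrib_right mult.assoc)
  also have "\<dots> = (\<Sum>j<m. \<psi> (fst k') k j * y p (fst k', j)) * y' p' k'" using fin kk(2) by simp
  also have "\<dots> = of_int (if w div 2 + 1 \<le> fst q then - 1 else 1) * yT q (- 1, \<kappa>)"
   unfolding a8[OF K'(1)[OF kk(2)] pp(2) kk(3)] by (simp add: pp(1) kk(1) yT_def)
  finally show ?thesis .
 qed
 moreover have "gdet K \<psi>T = (if middle_sign M' \<sigma> = 1 then gdet {..<m} (\<psi> 1) else gdet {..<m} (\<psi> (- 1)))"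
 proof -
  have "gdet K \<psi>T = (\<Prod>k'\<in>sign_index n'. gdet {..<m} (%k j. \<psi>T (k', k) (k', j)))"
   unfolding K_def by (rule gdet_Sigma) (use frame_finite[OF b2] in \<open>auto simp: \<psi>T_def\<close>)
  also have "\<dots> = (\<Prod>k'\<in>sign_index n'. gdet {..<m} (\<psi> (fst k')))" by (simp add: \<psi>T_def)
  also have "\<dots> = gdet {..<m} (\<psi> 1) ^ n' 1 * gdet {..<m} (\<psi> (- 1)) ^ n' (- 1)"
   by (rule prod_sign_index[where f = "%s. gdet {..<m} (\<psi> s)"])
  finally have g: "gdet K \<psi>T = gdet {..<m} (\<psi> 1) ^ n' 1 * gdet {..<m} (\<psi> (- 1)) ^ n' (- 1)" .
  \<comment> \<open>Blocks of opposite signs cancel in pairs; the numbers of blocks of the two signs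
    differ by \<open>middle_sign\<close>, so one block remains.\<close>
  have pw: "gdet {..<m} (\<psi> 1) ^ r * gdet {..<m} (\<psi> (- 1)) ^ r = 1" for r
   unfolding power_mult_distrib[symmetric] a9 by simp
  show ?thesis
  proof (cases "middle_sign M' \<sigma> = 1")
   case True
   then have "n' 1 = Suc (n' (- 1))" using b8(1) by simp
   then show ?thesis using True g pw[of "n' (- 1)"] by (simp add: mult.assoc)
  next
   case False
   then have "n' (- 1) = Suc (n' 1)" using b8 by simp
   then show ?thesis using False g pw[of "n' 1"] by (simp add: mult.left_commute)
  qed
 qed
 ultimately have "tensor_frame M M' w w' \<sigma> K bT (%s x k. cT x (s, k)) cT yT zT TF.\<gamma>T TF.GT vT \<psi>T
   (gdet {..<m} (\<psi> 1)) (gdet {..<m} (\<psi> (- 1)))"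
  unfolding tensor_frame_def using mp frT frobT a9 b8(2) a10 a11 a12 by (intro conjI ballI) simp_all
 then show ?thesis by blast
qed

section \<open>Restriction of scalars\<close>

lemma map_right_of_rat:
 assumes "field_hom \<tau>"
 shows "map_right \<tau> (map_right (of_rat :: rat => 'f::field_char_0) r) = map_right of_rat r"
proof (induction r rule: qtensor_induct)
 case zero
 show ?case by (simp add: map_right_zero assms field_hom_of_rat_hom)
next
 case (add a b t)
 then show ?case
  by (simp add: map_right_add map_right_pure assms field_hom_of_rat_hom field_hom_of_rat)
qed

text \<open>The requirements on \<open>T\<close> are those verified for the tensor product;
  \<epsilon> consists of the components of 1 in \<FF> \<otimes> \<complex>.\<close>

locale restriction_data =
 fixes T :: "('e::field_char_0, 'f::field_char_0, 'b, 'd) realizations"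
  and \<epsilon> :: "('f => complex) => ('f, complex) qtensor"
 assumes cV: "!!\<sigma>. \<sigma> \<in> real_embeddings ==> cmod (betti T \<sigma>)"
  and frob_hom: "!!\<sigma>. \<sigma> \<in> real_embeddings ==>
   frob T \<sigma> \<in> LinearCombinations.module_hom class_ring (betti T \<sigma>) (betti T \<sigma>)"
  and frob_inv: "!!\<sigma> v. \<sigma> \<in> real_embeddings ==> v \<in> carrier (betti T \<sigma>) ==> frob T \<sigma> (frob T \<sigma> v) = v"
  and cD: "cmod (derham T)"
  and F_sub: "!!n. LinearCombinations.submodule class_ring (hodge_fil T n) (derham T)"
  and F_dec: "!!m n. m \<le> n ==> hodge_fil T n \<subseteq> hodge_fil T m"
  and I_closed: "!!\<sigma> v. \<sigma> \<in> real_embeddings ==> v \<in> carrier (betti T \<sigma>) ==>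
   comparison T \<sigma> (bclass (betti T \<sigma>) [(v, 1)]) \<in> carrier (derhamC T \<sigma>)"
  and sl: "!!\<sigma> \<phi>. \<sigma> \<in> real_embeddings ==> period_functional T \<sigma> \<phi> ==>
   semilin (%e. e \<otimes>\<^sub>\<rat> 1) (betti T \<sigma>) (%v. betti_period T \<sigma> v \<phi>)"
  and fin: "finite (real_embeddings :: ('f => complex) set)"
  and \<epsilon>_sum: "(\<Sum>\<tau>\<in>real_embeddings. \<epsilon> \<tau>) = 1"
  and \<epsilon>_eig: "!!\<sigma> a. \<sigma> \<in> real_embeddings ==> (a \<otimes>\<^sub>\<rat> 1) * \<epsilon> \<sigma> = (1 \<otimes>\<^sub>\<rat> \<sigma> a) * \<epsilon> \<sigma>"
  and \<epsilon>_eval: "!!\<sigma> \<tau>. \<sigma> \<in> real_embeddings ==> \<tau> \<in> real_embeddings ==> eval_emb \<tau> (\<epsilon> \<sigma>) = (if \<sigma> = \<tau> then 1 else 0)"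
begin

abbreviation Emb :: "('f => complex) set" where "Emb \<equiv> real_embeddings"
abbreviation "D \<equiv> derham T"
abbreviation "N \<equiv> restriction T"
abbreviation DN :: "(('e, rat) qtensor, 'd) module" where "DN \<equiv> restrict_scalars (map_right (of_rat :: rat => 'f)) D"
abbreviation \<omega> :: "rat => complex" where "\<omega> \<equiv> of_rat"

definition DF :: "('f, 'd) module" where "DF = restrict_scalars (%f. 1 \<otimes>\<^sub>\<rat> f) D"

lemma DF_simps [simp]:
 "carrier DF = carrier D" "zero DF = zero D" "add DF = add D" "f \<odot>\<^bsub>DF\<^esub> x = (1 \<otimes>\<^sub>\<rat> f) \<odot>\<^bsub>D\<^esub> x"
 by (simp_all add: DF_def)

lemma restriction_simps:
 "derham N = DN" "hodge_fil N = hodge_fil T" "betti N \<omega> = betti_sum T"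
 "frob N \<omega> = (%x. \<lambda>\<sigma>\<in>Emb. frob T \<sigma> (x \<sigma>))"
 "comparison N \<omega> X = (THE Y. Y \<in> carrier (derham_ext \<omega> DN) \<and>
    (\<forall>\<sigma>\<in>Emb. dclass \<sigma> D (trep Y) =
     comparison T \<sigma> (bclass (betti T \<sigma>) (map (%(x, z). (x \<sigma>, z)) (trep X)))))"
 by (simp_all add: restriction_def Let_def)

lemmas EmbD = real_embeddings_field_hom

lemma cDN: "cmod DN"
 by (rule cmod_restrict_scalars[OF comm_ring_hom_map_right[OF field_hom_of_rat_hom] cD])

text \<open>\<open>H\<^sub>D\<^sub>R \<otimes>\<^sub>\<rat> \<complex>\<close> is a module over \<open>\<FF> \<otimes> \<complex>\<close> as well as over \<open>\<EE> \<otimes> \<complex>\<close>.\<close>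

sublocale Fm: scalar_ext DF "%e. e" of_rat of_rat "%e. e \<otimes>\<^sub>\<rat> 1"
 unfolding DF_def by (rule scalar_ext_betti[OF cmod_restrict_scalars[OF comm_ring_hom_right cD]])

sublocale Sm: scalar_ext DN "%e. e \<otimes>\<^sub>\<rat> 1" "%x. 1 \<otimes>\<^sub>\<rat> x" \<omega> "map_right of_rat"
 by (rule scalar_ext_derham[OF cDN field_hom_of_rat_hom])

text \<open>Both are H_DR as a rational vector space. Hence \<open>Fm.cls\<close> and
  \<open>Sm.cls\<close> are the same classes, on which \<FF> \<otimes> \<complex> and \<EE>
  \<otimes> \<complex> both act.\<close>

lemma DQ: "restrict_scalars (%x. 1 \<otimes>\<^sub>\<rat> x) DN = restrict_scalars of_rat DF"
 by (simp add: restrict_scalars_def DF_def map_right_pure field_hom_of_rat_hom)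

abbreviation "Nfunctional \<equiv> semilin (map_right of_rat :: _ => ('e, complex) qtensor) DN"

lemma smult_D: "h \<in> carrier D ==> s \<odot>\<^bsub>D\<^esub> h \<in> carrier D"
 by (rule cmod_smult_closed[OF cD])

lemma scalar_ext_emb: "\<sigma> \<in> Emb ==> scalar_ext D (%e. e \<otimes>\<^sub>\<rat> 1) (%x. 1 \<otimes>\<^sub>\<rat> x) \<sigma> (map_right \<sigma>)"
 by (rule scalar_ext_derham[OF cD EmbD])

abbreviation "teqE \<sigma> \<equiv> teq (restrict_scalars (%x. 1 \<otimes>\<^sub>\<rat> x) D) (field_mod \<sigma>)"

text \<open>On the component of \<sigma> the field \<FF> acts through \<sigma>, so balancing over
  \<FF> already holds there for classes over the rationals.\<close>

lemma \<epsilon>_cls: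
 assumes \<sigma>: "\<sigma> \<in> Emb" and h: "h \<in> carrier D"
 shows "\<epsilon> \<sigma> \<odot>\<^bsub>Fm.T\<^esub> Fm.cls [((1 \<otimes>\<^sub>\<rat> a) \<odot>\<^bsub>D\<^esub> h, z)] = \<epsilon> \<sigma> \<odot>\<^bsub>Fm.T\<^esub> Fm.cls [(h, \<sigma> a * z)]"
proof -
 have cl: "Fm.cls [(h, z)] \<in> carrier Fm.T" using h by (intro Fm.cls_in_T) simp
 have 1: "Fm.cls [((1 \<otimes>\<^sub>\<rat> a) \<odot>\<^bsub>D\<^esub> h, z)] = (a \<otimes>\<^sub>\<rat> 1) \<odot>\<^bsub>Fm.T\<^esub> Fm.cls [(h, z)]"
  using Fm.smult_pure[of h a 1 z] h by simp
 have 2: "Fm.cls [(h, \<sigma> a * z)] = (1 \<otimes>\<^sub>\<rat> \<sigma> a) \<odot>\<^bsub>Fm.T\<^esub> Fm.cls [(h, z)]"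
  using Fm.smult_pure[of h 1 "\<sigma> a" z] h by (simp add: cmod_one_smult[OF cD])
 show ?thesis unfolding 1 2 cmod_mult_smult[OF Fm.cmod_T cl, symmetric]
  using \<epsilon>_eig[OF \<sigma>, of a] by (simp add: mult.commute)
qed

text \<open>By \<open>\<epsilon>_cls\<close> each generating relation of the tensor product over
  \<FF> becomes an equality of rational classes after multiplication by
  \<open>\<epsilon> \<sigma>\<close>.\<close>

lemma \<epsilon>_teq:
 assumes \<sigma>: "\<sigma> \<in> Emb" and "teqE \<sigma> xs ys"
 shows "\<epsilon> \<sigma> \<odot>\<^bsub>Fm.T\<^esub> Fm.cls xs = \<epsilon> \<sigma> \<odot>\<^bsub>Fm.T\<^esub> Fm.cls ys"
proof -
 interpret S: scalar_ext D "%e. e \<otimes>\<^sub>\<rat> 1" "%x. 1 \<otimes>\<^sub>\<rat> x" \<sigma> "map_right \<sigma>" by (rule scalar_ext_emb[OF \<sigma>])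
 from assms(2) show ?thesis
 proof (induction rule: teq.induct)
  case (append xs ys xs' ys')
  have s: "set xs \<subseteq> carrier DF \<times> UNIV" "set ys \<subseteq> carrier DF \<times> UNIV"
   "set xs' \<subseteq> carrier DF \<times> UNIV" "set ys' \<subseteq> carrier DF \<times> UNIV"
   using S.teq_sub[OF append.hyps(1)] S.teq_sub[OF append.hyps(2)] by auto
  show ?case unfolding Fm.cls_append[OF s(1,3)] Fm.cls_append[OF s(2,4)]
   using append.IH s by (simp add: cmod_smult_add[OF Fm.cmod_T] Fm.cls_in_T del: Fm.T_simps)
 next
  case (comm xs ys)
  then have "Fm.cls (xs @ ys) = Fm.cls (ys @ xs)" by (intro Fm.tclassI teq.comm) simp
  then show ?case by simp
 next
  case (add_left a a' b)
  then have "Fm.cls [(a \<oplus>\<^bsub>D\<^esub> a', b)] = Fm.cls [(a, b), (a', b)]"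
   using Fm.eq_add_left[of a a' b] by (intro Fm.tclassI) simp
  then show ?case by simp
 next
  case (add_right a b b')
  then have "Fm.cls [(a, b + b')] = Fm.cls [(a, b), (a, b')]" by (intro Fm.tclassI Fm.eq_add_right) simp
  then show ?case by simp
 next
  case (zero_left b)
  have "Fm.cls [(\<zero>\<^bsub>D\<^esub>, b)] = Fm.cls []" using Fm.eq_zero(1)[of b] by (intro Fm.tclassI) simp
  then show ?case by simp
 next
  case (zero_right a)
  then have "Fm.cls [(a, 0)] = Fm.cls []" by (intro Fm.tclassI Fm.eq_zero) simp
  then show ?case by simp
 next
  case (balanced a b r)
  then show ?case using \<epsilon>_cls[OF \<sigma>, of a r b] by simp
 qed simp_all
qed

text \<open>\<sigma> fixes the rationals, so balancing over the rationals is a special case of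
  balancing over \<FF>.\<close>

lemma teq_rat_emb:
 assumes \<sigma>: "\<sigma> \<in> Emb" and "Fm.teqv xs ys"
 shows "teqE \<sigma> xs ys"
proof -
 interpret S: scalar_ext D "%e. e \<otimes>\<^sub>\<rat> 1" "%x. 1 \<otimes>\<^sub>\<rat> x" \<sigma> "map_right \<sigma>" by (rule scalar_ext_emb[OF \<sigma>])
 from assms(2) show ?thesis
 proof (induction rule: teq.induct)
  case (refl xs)
  then show ?case by (intro teq.refl) simp
 next
  case (comm xs ys)
  then show ?case by (intro teq.comm) simp
 next
  case (trans xs ys zs)
  show ?case by (rule teq.trans[OF trans.IH])
 next
  case (add_left a a' b)
  then show ?case using S.eq_add_left[of a a' b] by simp
 next
  case (add_right a b b')
  then show ?case using S.eq_add_right[of a b b'] by simp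
 next
  case (zero_left b)
  then show ?case using S.eq_zero(1)[of b] by simp
 next
  case (zero_right a)
  then show ?case using S.eq_zero(2)[of a] by simp
 next
  case (balanced a b r)
  then show ?case using S.eq_balanced[of a "of_rat r" b] by (simp add: field_hom_of_rat[OF EmbD[OF \<sigma>]])
 qed (auto intro: teq.sym teq.append)
qed

text \<open>Injectivity of H_DR \<otimes>_\<rat> \<complex> \<rightarrow> \<Oplus> H_DR
  \<otimes>_{\<FF>,\<sigma>} \<complex>: the components \<open>\<epsilon> \<sigma>\<close> of the
  two classes agree, and they add up to the classes.\<close>

lemma rat_class_unique:
 assumes xs: "set xs \<subseteq> carrier D \<times> UNIV" and ys: "set ys \<subseteq> carrier D \<times> UNIV"
  and eq: "!!\<sigma>. \<sigma> \<in> Emb ==> teqE \<sigma> xs ys"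
 shows "Fm.cls xs = Fm.cls ys"
proof -
 have cl: "Fm.cls xs \<in> carrier Fm.T" "Fm.cls ys \<in> carrier Fm.T" using xs ys by (auto intro!: Fm.cls_in_T)
 have "(\<Sum>\<sigma>\<in>A. \<epsilon> \<sigma>) \<odot>\<^bsub>Fm.T\<^esub> Fm.cls xs = (\<Sum>\<sigma>\<in>A. \<epsilon> \<sigma>) \<odot>\<^bsub>Fm.T\<^esub> Fm.cls ys" if "finite A" "A \<subseteq> Emb" for A
  using that
 proof (induction A)
  case empty
  then show ?case using cl by (simp add: cmod_zero_smult[OF Fm.cmod_T] del: Fm.T_simps)
 next
  case (insert \<sigma> A)
  then show ?case using cl \<epsilon>_teq[OF _ eq, of \<sigma>] by (simp add: cmod_add_smult[OF Fm.cmod_T])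
 qed
 from this[OF fin order.refl] show ?thesis using cl unfolding \<epsilon>_sum by (simp add: cmod_one_smult[OF Fm.cmod_T])
qed

text \<open>\<FF> \<otimes> \<complex> acts on the extension along \<tau> through evaluation at
  \<tau>.\<close>

lemma actl_emb:
 assumes \<tau>: "\<tau> \<in> Emb" and h: "h \<in> carrier D"
 shows "teqE \<tau> (Fm.actl es h z) [(h, (\<Sum>(a, b)\<leftarrow>es. \<tau> a * b) * z)]"
proof -
 interpret S: scalar_ext D "%e. e \<otimes>\<^sub>\<rat> 1" "%x. 1 \<otimes>\<^sub>\<rat> x" \<tau> "map_right \<tau>" by (rule scalar_ext_emb[OF \<tau>])
 show ?thesis
 proof (induction es)
  case Nil
  show ?case using teq.sym[OF S.eq_zero(2)[OF h]] by (simp add: Fm.actl_def)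
 next
  case (Cons x es)
  obtain a b where x: "x = (a, b)" by force
  let ?s = "(\<Sum>(a, b)\<leftarrow>es. \<tau> a * b)"
  have "teqE \<tau> [((1 \<otimes>\<^sub>\<rat> a) \<odot>\<^bsub>D\<^esub> h, b * z)] [(h, \<tau> a * (b * z))]" by (rule S.eq_balanced[OF h])
  from teq.append[OF this Cons.IH]
  have "teqE \<tau> (Fm.actl (x # es) h z) [(h, \<tau> a * (b * z)), (h, ?s * z)]" by (simp add: Fm.actl_def x)
  moreover have "teqE \<tau> [(h, \<tau> a * (b * z)), (h, ?s * z)] [(h, \<tau> a * (b * z) + ?s * z)]"
   by (rule teq.sym[OF S.eq_add_right[OF h]])
  ultimately show ?case using teq.trans by (fastforce simp: x distrib_right mult.assoc)
 qed
qed

text \<open>The functional composed with the action of t \<in> \<FF> \<otimes> \<complex>; for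
  \<open>\<epsilon> \<sigma>\<close> this is its component at \<sigma>.\<close>

definition part where
 "part t \<phi> h = (\<Sum>(a, b)\<leftarrow>rep_qtensor t. 1 \<otimes>\<^sub>\<rat> b * \<phi> ((1 \<otimes>\<^sub>\<rat> a) \<odot>\<^bsub>D\<^esub> h) :: ('e, complex) qtensor)"

lemma Nfunctional_add: "Nfunctional \<phi> ==> x \<in> carrier D ==> y \<in> carrier D ==> \<phi> (x \<oplus>\<^bsub>D\<^esub> y) = \<phi> x + \<phi> y"
 using semilin_add[of _ DN] by simp

lemma Nfunctional_left: "Nfunctional \<phi> ==> x \<in> carrier D ==> \<phi> ((e \<otimes>\<^sub>\<rat> 1) \<odot>\<^bsub>D\<^esub> x) = e \<otimes>\<^sub>\<rat> 1 * \<phi> x"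
 using semilin_smult[of "map_right of_rat" DN \<phi> x "e \<otimes>\<^sub>\<rat> 1"] by (simp add: map_right_pure field_hom_of_rat_hom)

lemma Nfunctional_zero: "Nfunctional \<phi> ==> \<phi> \<zero>\<^bsub>D\<^esub> = 0"
 using semilin_zero[OF _ cDN] by simp

lemma Nfunctional_rat: "Nfunctional \<phi> ==> x \<in> carrier D ==> \<phi> ((1 \<otimes>\<^sub>\<rat> of_rat r) \<odot>\<^bsub>D\<^esub> x) = 1 \<otimes>\<^sub>\<rat> of_rat r * \<phi> x"
 using semilin_smult[of "map_right of_rat" DN \<phi> x "1 \<otimes>\<^sub>\<rat> r"] by (simp add: map_right_pure field_hom_of_rat_hom)

lemma part_list:
 assumes \<phi>: "Nfunctional \<phi>" and h: "h \<in> carrier D"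
 shows "part (\<Sum>(a, b)\<leftarrow>xs. a \<otimes>\<^sub>\<rat> b) \<phi> h = (\<Sum>(a, b)\<leftarrow>xs. 1 \<otimes>\<^sub>\<rat> b * \<phi> ((1 \<otimes>\<^sub>\<rat> a) \<odot>\<^bsub>D\<^esub> h))"
 unfolding part_def
proof (rule teq_sum)
 show "qteq (rep_qtensor (\<Sum>(a, b)\<leftarrow>xs. a \<otimes>\<^sub>\<rat> b)) xs" by (simp add: qteq_iff flip: qtensor_rep)
 show "1 \<otimes>\<^sub>\<rat> b * \<phi> ((1 \<otimes>\<^sub>\<rat> (r \<odot>\<^bsub>field_mod of_rat\<^esub> a)) \<odot>\<^bsub>D\<^esub> h) = 1 \<otimes>\<^sub>\<rat> (r \<odot>\<^bsub>field_mod of_rat\<^esub> b) * \<phi> ((1 \<otimes>\<^sub>\<rat> a) \<odot>\<^bsub>D\<^esub> h)" for r a b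
 proof -
  have "(1 \<otimes>\<^sub>\<rat> (of_rat r * a)) \<odot>\<^bsub>D\<^esub> h = (1 \<otimes>\<^sub>\<rat> of_rat r) \<odot>\<^bsub>D\<^esub> ((1 \<otimes>\<^sub>\<rat> a) \<odot>\<^bsub>D\<^esub> h)"
   by (simp add: cmod_mult_smult[OF cD h, symmetric])
  then show ?thesis
   by (simp add: Nfunctional_rat[OF \<phi> smult_D[OF h]] mult.assoc[symmetric] mult.commute[of "of_rat r"])
 qed
qed (simp_all add: pure_add_right cmod_add_smult[OF cD h] Nfunctional_add[OF \<phi>] smult_D h distrib_left distrib_right
  cmod_zero_smult[OF cD h] Nfunctional_zero[OF \<phi>])

lemma part_add:
 assumes \<phi>: "Nfunctional \<phi>" and h: "h \<in> carrier D"
 shows "part (s + t) \<phi> h = part s \<phi> h + part t \<phi> h"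
proof -
 have "s + t = (\<Sum>(a, b)\<leftarrow>rep_qtensor s @ rep_qtensor t. a \<otimes>\<^sub>\<rat> b)"
  using qtensor_rep[of s] qtensor_rep[of t] by simp
 then have "part (s + t) \<phi> h = (\<Sum>(a, b)\<leftarrow>rep_qtensor s @ rep_qtensor t. 1 \<otimes>\<^sub>\<rat> b * \<phi> ((1 \<otimes>\<^sub>\<rat> a) \<odot>\<^bsub>D\<^esub> h))"
  by (simp only: part_list[OF assms])
 then show ?thesis by (simp add: part_def)
qed

lemma part_sum:
 assumes \<phi>: "Nfunctional \<phi>" and h: "h \<in> carrier D"
 shows "(\<Sum>\<sigma>\<in>Emb. part (\<epsilon> \<sigma>) \<phi> h) = \<phi> h"
proof -
 have 0: "part 0 \<phi> h = 0" using part_add[OF assms, of 0 0] by simp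
 have "(\<Sum>\<sigma>\<in>A. part (\<epsilon> \<sigma>) \<phi> h) = part (\<Sum>\<sigma>\<in>A. \<epsilon> \<sigma>) \<phi> h" for A
  by (induction A rule: infinite_finite_induct) (simp_all add: 0 part_add[OF assms])
 then have "(\<Sum>\<sigma>\<in>Emb. part (\<epsilon> \<sigma>) \<phi> h) = part (\<Sum>\<sigma>\<in>Emb. \<epsilon> \<sigma>) \<phi> h" .
 also have "\<dots> = \<phi> h"
  using part_list[OF assms, of "[(1, 1)]"] unfolding \<epsilon>_sum by (simp add: cmod_one_smult[OF cD h])
 finally show ?thesis .
qed

lemma ev_part:
 assumes \<phi>: "Nfunctional \<phi>" and h: "h \<in> carrier D"
 shows "ev \<phi> (t \<odot>\<^bsub>Fm.T\<^esub> Fm.cls [(h, z)]) = 1 \<otimes>\<^sub>\<rat> z * part t \<phi> h"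
proof -
 have s: "set (Fm.act t h z) \<subseteq> carrier DN \<times> UNIV" using Fm.actl_closed[of h "rep_qtensor t" z] h by simp
 have "t \<odot>\<^bsub>Fm.T\<^esub> Fm.cls [(h, z)] = Fm.cls (Fm.act t h z)" using Fm.T_smult[of "[(h, z)]" t] h by simp
 then have "ev \<phi> (t \<odot>\<^bsub>Fm.T\<^esub> Fm.cls [(h, z)]) = (\<Sum>(v, z)\<leftarrow>Fm.act t h z. 1 \<otimes>\<^sub>\<rat> z * \<phi> v)"
  using Sm.ev_cls[OF \<phi> s] unfolding DQ by simp
 also have "\<dots> = 1 \<otimes>\<^sub>\<rat> z * part t \<phi> h"
  by (simp add: Fm.actl_def part_def comp_def case_prod_beta' sum_list_const_mult[symmetric] pure_right_mult mult.commute)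
 finally show ?thesis .
qed

text \<open>Linearity over \<EE> is inherited from \<open>\<phi>\<close>; that \<FF> acts through
  \<sigma> is \<open>\<epsilon>_cls\<close> evaluated by \<open>\<phi>\<close>.\<close>

lemma part_semilin:
 assumes \<phi>: "Nfunctional \<phi>" and \<sigma>: "\<sigma> \<in> Emb"
 shows "period_functional T \<sigma> (part (\<epsilon> \<sigma>) \<phi>)"
proof -
 interpret m: comm_ring_hom "map_right \<sigma> :: ('e, 'f) qtensor => _" by (rule comm_ring_hom_map_right[OF EmbD[OF \<sigma>]])
 have add: "part t \<phi> (x \<oplus>\<^bsub>D\<^esub> y) = part t \<phi> x + part t \<phi> y" if "x \<in> carrier D" "y \<in> carrier D" for t x y
  unfolding part_def case_prod_beta'
  by (simp add: that cmod_smult_add[OF cD] Nfunctional_add[OF \<phi>] smult_D distrib_left sum_list_addf)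
 have left: "part t \<phi> ((e \<otimes>\<^sub>\<rat> 1) \<odot>\<^bsub>D\<^esub> x) = e \<otimes>\<^sub>\<rat> 1 * part t \<phi> x" if x: "x \<in> carrier D" for t e x
 proof -
  have "(1 \<otimes>\<^sub>\<rat> a) \<odot>\<^bsub>D\<^esub> ((e \<otimes>\<^sub>\<rat> 1) \<odot>\<^bsub>D\<^esub> x) = (e \<otimes>\<^sub>\<rat> 1) \<odot>\<^bsub>D\<^esub> ((1 \<otimes>\<^sub>\<rat> a) \<odot>\<^bsub>D\<^esub> x)" for a
   by (simp add: cmod_mult_smult[OF cD x, symmetric])
  then have "\<phi> ((1 \<otimes>\<^sub>\<rat> a) \<odot>\<^bsub>D\<^esub> ((e \<otimes>\<^sub>\<rat> 1) \<odot>\<^bsub>D\<^esub> x)) = e \<otimes>\<^sub>\<rat> 1 * \<phi> ((1 \<otimes>\<^sub>\<rat> a) \<odot>\<^bsub>D\<^esub> x)" for a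
   by (simp add: Nfunctional_left[OF \<phi> smult_D[OF x]])
  then show ?thesis unfolding part_def case_prod_beta'
   by (simp add: sum_list_const_mult[symmetric] mult.left_commute del: pure_mult)
 qed
 have right: "part (\<epsilon> \<sigma>) \<phi> ((1 \<otimes>\<^sub>\<rat> f) \<odot>\<^bsub>D\<^esub> x) = 1 \<otimes>\<^sub>\<rat> \<sigma> f * part (\<epsilon> \<sigma>) \<phi> x" if x: "x \<in> carrier D" for f x
  using ev_part[OF \<phi> smult_D[OF x], of "\<epsilon> \<sigma>" "1 \<otimes>\<^sub>\<rat> f" 1] ev_part[OF \<phi> x, of "\<epsilon> \<sigma>" "\<sigma> f * 1"] \<epsilon>_cls[OF \<sigma> x, of f 1] by simp
 have "part (\<epsilon> \<sigma>) \<phi> (s \<odot>\<^bsub>D\<^esub> x) = map_right \<sigma> s * part (\<epsilon> \<sigma>) \<phi> x" if x: "x \<in> carrier D" for s x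
 proof (induction s rule: qtensor_induct)
  case zero
  have "part (\<epsilon> \<sigma>) \<phi> \<zero>\<^bsub>D\<^esub> = 0"
   using left[OF cmod_zero_closed[OF cD], of "\<epsilon> \<sigma>" 0] by (simp add: cmod_smult_zero[OF cD])
  then show ?case by (simp add: cmod_zero_smult[OF cD x])
 next
  case (add e f t)
  have "(e \<otimes>\<^sub>\<rat> f) \<odot>\<^bsub>D\<^esub> x = (1 \<otimes>\<^sub>\<rat> f) \<odot>\<^bsub>D\<^esub> ((e \<otimes>\<^sub>\<rat> 1) \<odot>\<^bsub>D\<^esub> x)"
   by (simp add: cmod_mult_smult[OF cD x, symmetric])
  then have "part (\<epsilon> \<sigma>) \<phi> ((e \<otimes>\<^sub>\<rat> f) \<odot>\<^bsub>D\<^esub> x) = (e \<otimes>\<^sub>\<rat> \<sigma> f) * part (\<epsilon> \<sigma>) \<phi> x"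
   by (simp add: right[OF smult_D[OF x]] left[OF x] mult.assoc[symmetric])
  then show ?case
   using add by (simp add: cmod_add_smult[OF cD x] \<open>!!y x t. x \<in> carrier D ==> y \<in> carrier D ==> part t \<phi> (x \<oplus>\<^bsub>D\<^esub> y) = part t \<phi> x + part t \<phi> y\<close>
    smult_D[OF x] m.hom_add map_right_pure[OF EmbD[OF \<sigma>]] distrib_right)
 qed
 then show ?thesis using add by (simp add: semilin_def)
qed

lemma functional_restrict:
 assumes \<tau>: "\<tau> \<in> Emb" and \<phi>: "period_functional T \<tau> \<phi>"
 shows "Nfunctional \<phi>"
 using \<phi> by (simp add: semilin_def map_right_of_rat[OF EmbD[OF \<tau>]])

text \<open>On a functional along \<tau> the element \<open>\<epsilon> \<sigma>\<close> acts through
  its evaluation at \<tau>, which is 1 or 0.\<close>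

lemma part_own:
 assumes \<tau>: "\<tau> \<in> Emb" and \<sigma>: "\<sigma> \<in> Emb" and \<phi>: "period_functional T \<tau> \<phi>" and h: "h \<in> carrier D"
 shows "part (\<epsilon> \<sigma>) \<phi> h = (if \<sigma> = \<tau> then \<phi> h else 0)"
proof -
 have "part (\<epsilon> \<sigma>) \<phi> h = (\<Sum>(a, b)\<leftarrow>rep_qtensor (\<epsilon> \<sigma>). 1 \<otimes>\<^sub>\<rat> (b * \<tau> a)) * \<phi> h"
  unfolding part_def case_prod_beta'
  by (simp add: semilin_smult[OF \<phi> h] map_right_pure[OF EmbD[OF \<tau>]] pure_right_mult sum_list_mult_const[symmetric])
 also have "(\<Sum>(a, b)\<leftarrow>es. 1 \<otimes>\<^sub>\<rat> (b * \<tau> a)) = (1 \<otimes>\<^sub>\<rat> (\<Sum>(a, b)\<leftarrow>es. \<tau> a * b) :: ('e, complex) qtensor)" for es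
  by (induction es) (auto simp: pure_add_right mult.commute)
 also have "(\<Sum>(a, b)\<leftarrow>rep_qtensor (\<epsilon> \<sigma>). \<tau> a * b) = (if \<sigma> = \<tau> then 1 else 0)"
  using \<epsilon>_eval[OF \<sigma> \<tau>] by (simp add: eval_emb_def)
 finally show ?thesis by simp
qed

end

section \<open>Comparison map and frames of the restriction of scalars\<close>

context restriction_data
begin

lemma act_sum: "(\<Sum>(v, z)\<leftarrow>Fm.actl (rep_qtensor t) h z. 1 \<otimes>\<^sub>\<rat> z * \<phi> v) = 1 \<otimes>\<^sub>\<rat> z * part t \<phi> h"
 by (simp add: Fm.actl_def part_def comp_def case_prod_beta' sum_list_const_mult[symmetric] pure_right_mult mult.commute)

text \<open>Surjectivity of H_DR \<otimes>_\<rat> \<complex> \<rightarrow> \<Oplus> H_DR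
  \<otimes>_{\<FF>,\<sigma>} \<complex>: the sum of the \<open>\<epsilon> \<sigma>\<close> times the
  given lists, as \<open>\<epsilon> \<sigma>\<close> acts by 1 at \<sigma> and by 0 at the other
  embeddings. The formula for functionals is read off from this sum.\<close>

lemma glue_lists:
 assumes l: "!!\<sigma>. \<sigma> \<in> Emb ==> set (l \<sigma>) \<subseteq> carrier D \<times> UNIV"
 obtains ys where "set ys \<subseteq> carrier D \<times> UNIV" "!!\<tau>. \<tau> \<in> Emb ==> teqE \<tau> ys (l \<tau>)"
  "!!\<phi>. (\<Sum>(h, z)\<leftarrow>ys. 1 \<otimes>\<^sub>\<rat> z * \<phi> h) = (\<Sum>\<sigma>\<in>Emb. \<Sum>(h, z)\<leftarrow>l \<sigma>. 1 \<otimes>\<^sub>\<rat> z * part (\<epsilon> \<sigma>) \<phi> h)"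
proof -
 obtain \<sigma>s where \<sigma>s: "set \<sigma>s = Emb" "distinct \<sigma>s" using finite_distinct_list[OF fin] by blast
 have A: "teqE \<tau> (Fm.acts (\<epsilon> \<sigma>) xs) (if \<sigma> = \<tau> then xs else [])"
  if \<sigma>: "\<sigma> \<in> Emb" and \<tau>: "\<tau> \<in> Emb" and xs: "set xs \<subseteq> carrier D \<times> UNIV" for \<sigma> \<tau> xs
  using xs
 proof (induction xs)
  case Nil
  show ?case by (simp add: teq.refl)
 next
  case (Cons x xs)
  interpret S: scalar_ext D "%e. e \<otimes>\<^sub>\<rat> 1" "%x. 1 \<otimes>\<^sub>\<rat> x" \<tau> "map_right \<tau>" by (rule scalar_ext_emb[OF \<tau>])
  obtain h z where x: "x = (h, z)" by force
  have h: "h \<in> carrier D" using Cons.prems x by simp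
  have "teqE \<tau> (Fm.act (\<epsilon> \<sigma>) h z) [(h, eval_emb \<tau> (\<epsilon> \<sigma>) * z)]" unfolding eval_emb_def by (rule actl_emb[OF \<tau> h])
  moreover have "teqE \<tau> [(h, eval_emb \<tau> (\<epsilon> \<sigma>) * z)] (if \<sigma> = \<tau> then [(h, z)] else [])"
   unfolding \<epsilon>_eval[OF \<sigma> \<tau>] using h S.eq_zero(2)[OF h] by (simp add: teq.refl)
  ultimately have "teqE \<tau> (Fm.act (\<epsilon> \<sigma>) h z) (if \<sigma> = \<tau> then [(h, z)] else [])" by (rule teq.trans)
  from teq.append[OF this Cons.IH] Cons.prems show ?case by (auto simp: x split: if_splits)
 qed
 define ys where "ys = concat (map (%\<sigma>. Fm.acts (\<epsilon> \<sigma>) (l \<sigma>)) \<sigma>s)"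
 have acl: "set (Fm.acts (\<epsilon> \<sigma>) (l \<sigma>)) \<subseteq> carrier D \<times> UNIV" if "\<sigma> \<in> Emb" for \<sigma>
  using Fm.acts_closed[of "l \<sigma>" "\<epsilon> \<sigma>"] l[OF that] by simp
 have setc: "set (concat (map f ts)) = (\<Union>t\<in>set ts. set (f t))" for f :: "('f => complex) => ('d \<times> complex) list" and ts
  by (induction ts) auto
 have "set ys = (\<Union>\<sigma>\<in>Emb. set (Fm.acts (\<epsilon> \<sigma>) (l \<sigma>)))"
  using setc[of "%\<sigma>. Fm.acts (\<epsilon> \<sigma>) (l \<sigma>)" \<sigma>s] unfolding ys_def \<sigma>s(1) .
 then have sub: "set ys \<subseteq> carrier D \<times> UNIV" using acl by blast
 have "teqE \<tau> (concat (map (%\<sigma>. Fm.acts (\<epsilon> \<sigma>) (l \<sigma>)) ts)) (if \<tau> \<in> set ts then l \<tau> else [])"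
  if \<tau>: "\<tau> \<in> Emb" and "set ts \<subseteq> Emb" "distinct ts" for \<tau> ts
  using that(2,3)
 proof (induction ts)
  case Nil
  show ?case by (simp add: teq.refl)
 next
  case (Cons \<sigma> ts)
  then have \<sigma>: "\<sigma> \<in> Emb" by simp
  have "teqE \<tau> (Fm.acts (\<epsilon> \<sigma>) (l \<sigma>)) (if \<sigma> = \<tau> then l \<sigma> else [])" by (rule A[OF \<sigma> \<tau> l[OF \<sigma>]])
  from teq.append[OF this Cons.IH] Cons.prems show ?case by (auto split: if_splits)
 qed
 from this[of _ \<sigma>s] have teq: "teqE \<tau> ys (l \<tau>)" if "\<tau> \<in> Emb" for \<tau>
  using that \<sigma>s by (simp add: ys_def)
 have acts: "(\<Sum>(h, z)\<leftarrow>Fm.acts t xs. 1 \<otimes>\<^sub>\<rat> z * \<phi> h) = (\<Sum>(h, z)\<leftarrow>xs. 1 \<otimes>\<^sub>\<rat> z * part t \<phi> h)" for t xs \<phi>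
  by (induction xs) (auto simp: act_sum)
 have "(\<Sum>(h, z)\<leftarrow>concat (map (%\<sigma>. Fm.acts (\<epsilon> \<sigma>) (l \<sigma>)) ts). 1 \<otimes>\<^sub>\<rat> z * \<phi> h) =
   (\<Sum>\<sigma>\<leftarrow>ts. \<Sum>(h, z)\<leftarrow>l \<sigma>. 1 \<otimes>\<^sub>\<rat> z * part (\<epsilon> \<sigma>) \<phi> h)" for \<phi> ts
  by (induction ts) (simp_all add: acts del: map_concat)
 then have "(\<Sum>(h, z)\<leftarrow>ys. 1 \<otimes>\<^sub>\<rat> z * \<phi> h) = (\<Sum>\<sigma>\<in>Emb. \<Sum>(h, z)\<leftarrow>l \<sigma>. 1 \<otimes>\<^sub>\<rat> z * part (\<epsilon> \<sigma>) \<phi> h)" for \<phi>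
  using \<sigma>s by (simp add: ys_def sum_list_distinct_conv_sum_set)
 then show thesis using that[OF sub teq] by blast
qed

lemma betti_sum_simps:
 "carrier (betti_sum T) = (\<Pi>\<^sub>E \<sigma>\<in>Emb. carrier (betti T \<sigma>))" "\<zero>\<^bsub>betti_sum T\<^esub> = (\<lambda>\<sigma>\<in>Emb. \<zero>\<^bsub>betti T \<sigma>\<^esub>)"
 "x \<oplus>\<^bsub>betti_sum T\<^esub> y = (\<lambda>\<sigma>\<in>Emb. x \<sigma> \<oplus>\<^bsub>betti T \<sigma>\<^esub> y \<sigma>)" "e \<odot>\<^bsub>betti_sum T\<^esub> x = (\<lambda>\<sigma>\<in>Emb. e \<odot>\<^bsub>betti T \<sigma>\<^esub> x \<sigma>)"
 by (simp_all add: betti_sum_def)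

lemma betti_sum_at: "x \<in> carrier (betti_sum T) ==> \<sigma> \<in> Emb ==> x \<sigma> \<in> carrier (betti T \<sigma>)"
 using PiE_mem[of x Emb "%\<sigma>. carrier (betti T \<sigma>)" \<sigma>] by (simp add: betti_sum_simps)

lemma betti_sum_ext:
 "x \<in> carrier (betti_sum T) ==> y \<in> carrier (betti_sum T) ==> (!!\<sigma>. \<sigma> \<in> Emb ==> x \<sigma> = y \<sigma>) ==> x = y"
 unfolding betti_sum_simps by (rule PiE_ext)

lemma betti_sum_closedI: "(!!\<sigma>. \<sigma> \<in> Emb ==> f \<sigma> \<in> carrier (betti T \<sigma>)) ==> restrict f Emb \<in> carrier (betti_sum T)"
 unfolding betti_sum_simps by (auto simp: restrict_def)

lemma cmod_betti_sum: "cmod (betti_sum T)"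
proof -
 have g: "abelian_group (betti T \<sigma>)" if "\<sigma> \<in> Emb" for \<sigma> by (rule cmod_abelian_group[OF cV[OF that]])
 note am = abelian_group.axioms(1)[OF g]
 have cl: "x \<oplus>\<^bsub>betti_sum T\<^esub> y \<in> carrier (betti_sum T)" if "x \<in> carrier (betti_sum T)" "y \<in> carrier (betti_sum T)" for x y
  unfolding betti_sum_simps(3) by (rule betti_sum_closedI) (simp add: cmod_add_closed[OF cV] betti_sum_at that)
 have sc: "r \<odot>\<^bsub>betti_sum T\<^esub> x \<in> carrier (betti_sum T)" if "x \<in> carrier (betti_sum T)" for r x
  unfolding betti_sum_simps(4) by (rule betti_sum_closedI) (simp add: cmod_smult_closed[OF cV] betti_sum_at that)
 have zc: "\<zero>\<^bsub>betti_sum T\<^esub> \<in> carrier (betti_sum T)"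
  unfolding betti_sum_simps(2) by (rule betti_sum_closedI) (simp add: cmod_zero_closed[OF cV])
 note at = betti_sum_simps(2-4) restrict_apply'
 note cls = cl sc zc
 show ?thesis
 proof (rule cmodI)
  show "\<exists>y\<in>carrier (betti_sum T). y \<oplus>\<^bsub>betti_sum T\<^esub> x = \<zero>\<^bsub>betti_sum T\<^esub>" if x: "x \<in> carrier (betti_sum T)" for x
  proof (rule bexI)
   show y: "(\<lambda>\<sigma>\<in>Emb. \<ominus>\<^bsub>betti T \<sigma>\<^esub> x \<sigma>) \<in> carrier (betti_sum T)"
    by (rule betti_sum_closedI) (simp add: abelian_group.a_inv_closed[OF g] betti_sum_at x)
   show "(\<lambda>\<sigma>\<in>Emb. \<ominus>\<^bsub>betti T \<sigma>\<^esub> x \<sigma>) \<oplus>\<^bsub>betti_sum T\<^esub> x = \<zero>\<^bsub>betti_sum T\<^esub>"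
    by (rule betti_sum_ext[OF cl[OF y x] zc]) (simp add: at abelian_group.l_neg[OF g] betti_sum_at x)
  qed
  show "x \<oplus>\<^bsub>betti_sum T\<^esub> y \<oplus>\<^bsub>betti_sum T\<^esub> z = x \<oplus>\<^bsub>betti_sum T\<^esub> (y \<oplus>\<^bsub>betti_sum T\<^esub> z)"
   if "x \<in> carrier (betti_sum T)" "y \<in> carrier (betti_sum T)" "z \<in> carrier (betti_sum T)" for x y z
   by (rule betti_sum_ext[OF cl[OF cl[OF that(1,2)] that(3)] cl[OF that(1) cl[OF that(2,3)]]])
    (simp add: at abelian_monoid.a_assoc[OF am] betti_sum_at that)
  show "x \<oplus>\<^bsub>betti_sum T\<^esub> y = y \<oplus>\<^bsub>betti_sum T\<^esub> x"
   if "x \<in> carrier (betti_sum T)" "y \<in> carrier (betti_sum T)" for x y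
   by (rule betti_sum_ext[OF cl[OF that] cl[OF that(2,1)]]) (simp add: at abelian_monoid.a_comm[OF am] betti_sum_at that)
  show "\<zero>\<^bsub>betti_sum T\<^esub> \<oplus>\<^bsub>betti_sum T\<^esub> x = x" if "x \<in> carrier (betti_sum T)" for x
   by (rule betti_sum_ext[OF cl[OF zc that] that]) (simp add: at abelian_monoid.l_zero[OF am] betti_sum_at that)
  show "(r + s) \<odot>\<^bsub>betti_sum T\<^esub> x = r \<odot>\<^bsub>betti_sum T\<^esub> x \<oplus>\<^bsub>betti_sum T\<^esub> s \<odot>\<^bsub>betti_sum T\<^esub> x" if "x \<in> carrier (betti_sum T)" for r s x
   by (rule betti_sum_ext[OF sc[OF that] cl[OF sc[OF that] sc[OF that]]]) (simp add: at cmod_add_smult[OF cV] betti_sum_at that)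
  show "r \<odot>\<^bsub>betti_sum T\<^esub> (x \<oplus>\<^bsub>betti_sum T\<^esub> y) = r \<odot>\<^bsub>betti_sum T\<^esub> x \<oplus>\<^bsub>betti_sum T\<^esub> r \<odot>\<^bsub>betti_sum T\<^esub> y"
   if "x \<in> carrier (betti_sum T)" "y \<in> carrier (betti_sum T)" for r x y
   by (rule betti_sum_ext[OF sc[OF cl[OF that]] cl[OF sc[OF that(1)] sc[OF that(2)]]]) (simp add: at cmod_smult_add[OF cV] betti_sum_at that)
  show "(r * s) \<odot>\<^bsub>betti_sum T\<^esub> x = r \<odot>\<^bsub>betti_sum T\<^esub> (s \<odot>\<^bsub>betti_sum T\<^esub> x)" if "x \<in> carrier (betti_sum T)" for r s x
   by (rule betti_sum_ext[OF sc[OF that] sc[OF sc[OF that]]]) (simp add: at cmod_mult_smult[OF cV] betti_sum_at that)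
  show "1 \<odot>\<^bsub>betti_sum T\<^esub> x = x" if "x \<in> carrier (betti_sum T)" for x
   by (rule betti_sum_ext[OF sc[OF that] that]) (simp add: at cmod_one_smult[OF cV] betti_sum_at that)
 qed (fact cls)+
qed

text \<open>The period is the sum over \<sigma> of the periods of the components, because the
  comparison image is glued from the images at the embeddings.\<close>

lemma restriction_period:
 assumes x: "x \<in> carrier (betti_sum T)"
 shows "comparison N \<omega> (bclass (betti N \<omega>) [(x, 1)]) \<in> carrier (derham_ext \<omega> (derham N))"
  and "Nfunctional \<phi> ==> betti_period N \<omega> x \<phi> = (\<Sum>\<sigma>\<in>Emb. betti_period T \<sigma> (x \<sigma>) (part (\<epsilon> \<sigma>) \<phi>))"
proof -
 interpret BS: scalar_ext "betti_sum T" "%e. e" of_rat of_rat "%e. e \<otimes>\<^sub>\<rat> 1"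
  by (rule scalar_ext_betti[OF cmod_betti_sum])
 define XX where "XX = bclass (betti_sum T) [(x, 1)]"
 define Z where "Z \<sigma> = comparison T \<sigma> (bclass (betti T \<sigma>) [(x \<sigma>, 1)])" for \<sigma>
 have comp: "bclass (betti T \<sigma>) (map (%(x, z). (x \<sigma>, z)) (trep XX)) = bclass (betti T \<sigma>) [(x \<sigma>, 1)]" if \<sigma>: "\<sigma> \<in> Emb" for \<sigma>
 proof -
  interpret B\<sigma>: scalar_ext "betti T \<sigma>" "%e. e" of_rat of_rat "%e. e \<otimes>\<^sub>\<rat> 1"
   by (rule scalar_ext_betti[OF cV[OF \<sigma>]])
  have "BS.teqv [(x, 1)] (trep XX)" unfolding XX_def using x by (intro BS.trep_tclass) simp
  from BS.teq_concat[OF this, of "%(x, z). [(x \<sigma>, z)]" "restrict_scalars of_rat (betti T \<sigma>)" "field_mod of_rat"]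
  have "B\<sigma>.teqv (concat (map (%(x, z). [(x \<sigma>, z)]) [(x, 1)])) (concat (map (%(x, z). [(x \<sigma>, z)]) (trep XX)))"
   using \<sigma> by (simp add: betti_sum_at betti_sum_simps(2-4) B\<sigma>.tensor_space_axioms B\<sigma>.eq_add_left B\<sigma>.eq_add_right B\<sigma>.eq_balanced)
  moreover have "concat (map (%(x, z). [(x \<sigma>, z)]) zs) = map (%(x, z). (x \<sigma>, z)) zs" for zs :: "((('f => complex) => 'b) \<times> complex) list"
   by (induction zs) auto
  ultimately show ?thesis using B\<sigma>.tclassI by simp
 qed
 have ZT: "Z \<sigma> \<in> carrier (derhamC T \<sigma>)" if "\<sigma> \<in> Emb" for \<sigma>
  unfolding Z_def by (rule I_closed[OF that betti_sum_at[OF x that]])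
 have trZ: "set (trep (Z \<sigma>)) \<subseteq> carrier D \<times> UNIV" "dclass \<sigma> D (trep (Z \<sigma>)) = Z \<sigma>" if \<sigma>: "\<sigma> \<in> Emb" for \<sigma>
 proof -
  interpret S: scalar_ext D "%e. e \<otimes>\<^sub>\<rat> 1" "%x. 1 \<otimes>\<^sub>\<rat> x" \<sigma> "map_right \<sigma>" by (rule scalar_ext_emb[OF \<sigma>])
  have Z: "Z \<sigma> \<in> S.cls ` lists (carrier (restrict_scalars (%x. 1 \<otimes>\<^sub>\<rat> x) D) \<times> carrier (field_mod \<sigma>))"
   using ZT[OF \<sigma>] unfolding derham_ext_conv[OF cD EmbD[OF \<sigma>]] S.T_simps(1) .
  show "set (trep (Z \<sigma>)) \<subseteq> carrier D \<times> UNIV" using S.sub_trep[OF Z] by simp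
  show "dclass \<sigma> D (trep (Z \<sigma>)) = Z \<sigma>" by (rule S.tclass_trep[OF Z])
 qed
 obtain ys where ys: "set ys \<subseteq> carrier D \<times> UNIV" "!!\<tau>. \<tau> \<in> Emb ==> teqE \<tau> ys (trep (Z \<tau>))"
  and sum: "!!\<phi>. (\<Sum>(h, z)\<leftarrow>ys. 1 \<otimes>\<^sub>\<rat> z * \<phi> h) = (\<Sum>\<sigma>\<in>Emb. \<Sum>(h, z)\<leftarrow>trep (Z \<sigma>). 1 \<otimes>\<^sub>\<rat> z * part (\<epsilon> \<sigma>) \<phi> h)"
  by (rule glue_lists[of "%\<sigma>. trep (Z \<sigma>)", OF trZ(1)]; ((rule that; assumption) | assumption))
 have YT: "Sm.cls ys \<in> carrier (derham_ext \<omega> DN)"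
  unfolding derham_ext_conv[OF cDN field_hom_of_rat_hom] by (rule Sm.cls_in_T) (use ys in simp)
 have cys: "dclass \<sigma> D ys = Z \<sigma>" if \<sigma>: "\<sigma> \<in> Emb" for \<sigma>
 proof -
  interpret S: scalar_ext D "%e. e \<otimes>\<^sub>\<rat> 1" "%x. 1 \<otimes>\<^sub>\<rat> x" \<sigma> "map_right \<sigma>" by (rule scalar_ext_emb[OF \<sigma>])
  show ?thesis using S.tclassI[OF ys(2)[OF \<sigma>]] trZ(2)[OF \<sigma>] by simp
 qed
 \<comment> \<open>The description in the definition is met by the glued class, and by no other
   class according to \<open>rat_class_unique\<close>.\<close>
 have comparison: "comparison N \<omega> (bclass (betti N \<omega>) [(x, 1)]) = Sm.cls ys"
  unfolding restriction_simps XX_def[symmetric]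
 proof (rule the_equality)
  have "dclass \<sigma> D (trep (Sm.cls ys)) = comparison T \<sigma> (bclass (betti T \<sigma>) (map (%(x, z). (x \<sigma>, z)) (trep XX)))" if \<sigma>: "\<sigma> \<in> Emb" for \<sigma>
  proof -
   interpret S: scalar_ext D "%e. e \<otimes>\<^sub>\<rat> 1" "%x. 1 \<otimes>\<^sub>\<rat> x" \<sigma> "map_right \<sigma>" by (rule scalar_ext_emb[OF \<sigma>])
   have "Fm.teqv ys (trep (Fm.cls ys))" using ys(1) by (intro Fm.trep_tclass) simp
   then have "dclass \<sigma> D ys = dclass \<sigma> D (trep (Sm.cls ys))" unfolding DQ by (rule S.tclassI[OF teq_rat_emb[OF \<sigma>]])
   then show ?thesis using cys[OF \<sigma>] unfolding comp[OF \<sigma>] Z_def by simp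
  qed
  then show "Sm.cls ys \<in> carrier (derham_ext \<omega> DN) \<and> (\<forall>\<sigma>\<in>Emb. dclass \<sigma> D (trep (Sm.cls ys)) =
    comparison T \<sigma> (bclass (betti T \<sigma>) (map (%(x, z). (x \<sigma>, z)) (trep XX))))" using YT by simp
  fix Y assume Y: "Y \<in> carrier (derham_ext \<omega> DN) \<and> (\<forall>\<sigma>\<in>Emb. dclass \<sigma> D (trep Y) =
    comparison T \<sigma> (bclass (betti T \<sigma>) (map (%(x, z). (x \<sigma>, z)) (trep XX))))"
  have YS: "Y \<in> Sm.cls ` lists (carrier (restrict_scalars (%x. 1 \<otimes>\<^sub>\<rat> x) DN) \<times> carrier (field_mod \<omega>))"
   using Y unfolding derham_ext_conv[OF cDN field_hom_of_rat_hom] Sm.T_simps(1) by simp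
  have tr: "set (trep Y) \<subseteq> carrier D \<times> UNIV" using Sm.sub_trep[OF YS] by simp
  have "Fm.cls (trep Y) = Fm.cls ys"
  proof (rule rat_class_unique[OF tr ys(1)])
   fix \<sigma> assume \<sigma>: "\<sigma> \<in> Emb"
   interpret S: scalar_ext D "%e. e \<otimes>\<^sub>\<rat> 1" "%x. 1 \<otimes>\<^sub>\<rat> x" \<sigma> "map_right \<sigma>" by (rule scalar_ext_emb[OF \<sigma>])
   have "dclass \<sigma> D (trep Y) = dclass \<sigma> D ys" using Y \<sigma> cys[OF \<sigma>] comp[OF \<sigma>] by (simp add: Z_def)
   then show "teqE \<sigma> (trep Y) ys" using tr by (subst S.tclass_eq[symmetric]) simp_all
  qed
  then show "Y = Sm.cls ys" using Sm.tclass_trep[OF YS] unfolding DQ by simp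
 qed
 then show "comparison N \<omega> (bclass (betti N \<omega>) [(x, 1)]) \<in> carrier (derham_ext \<omega> (derham N))"
  using YT unfolding restriction_simps(1) by simp
 assume \<phi>: "Nfunctional \<phi>"
 have "betti_period N \<omega> x \<phi> = (\<Sum>(h, z)\<leftarrow>ys. 1 \<otimes>\<^sub>\<rat> z * \<phi> h)"
  unfolding betti_period_def comparison by (rule Sm.ev_cls[OF \<phi>]) (use ys in simp)
 also have "\<dots> = (\<Sum>\<sigma>\<in>Emb. betti_period T \<sigma> (x \<sigma>) (part (\<epsilon> \<sigma>) \<phi>))"
  unfolding sum betti_period_def ev_def Z_def ..
 finally show "betti_period N \<omega> x \<phi> = (\<Sum>\<sigma>\<in>Emb. betti_period T \<sigma> (x \<sigma>) (part (\<epsilon> \<sigma>) \<phi>))" .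
qed

lemma semilin_restriction_period:
 assumes \<phi>: "Nfunctional \<phi>"
 shows "semilin (%e. e \<otimes>\<^sub>\<rat> 1) (betti_sum T) (%x. betti_period N \<omega> x \<phi>)"
proof -
 note s = sl[OF _ part_semilin[OF \<phi>]]
 have "semilin (%e. e \<otimes>\<^sub>\<rat> 1) (betti_sum T) (%x. \<Sum>\<sigma>\<in>Emb. betti_period T \<sigma> (x \<sigma>) (part (\<epsilon> \<sigma>) \<phi>))"
  by (auto simp: semilin_def betti_sum_simps(3,4) semilin_add[OF s] semilin_smult[OF s] betti_sum_at sum.distrib sum_distrib_left)
 then show ?thesis using cmodD[OF cmod_betti_sum] by (simp add: semilin_def restriction_period(2)[OF _ \<phi>])
qed

lemma frob_restriction_hom: "frob N \<omega> \<in> LinearCombinations.module_hom class_ring (betti N \<omega>) (betti N \<omega>)"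
proof -
 have cl: "frob N \<omega> x \<in> carrier (betti_sum T)" if "x \<in> carrier (betti_sum T)" for x
  unfolding restriction_simps by (rule betti_sum_closedI) (rule module_hom_closed[OF frob_hom betti_sum_at[OF that]])
 moreover have "frob N \<omega> (x \<oplus>\<^bsub>betti_sum T\<^esub> y) = frob N \<omega> x \<oplus>\<^bsub>betti_sum T\<^esub> frob N \<omega> y"
  if "x \<in> carrier (betti_sum T)" "y \<in> carrier (betti_sum T)" for x y
  unfolding restriction_simps betti_sum_simps
  by (rule restrict_ext) (simp add: module_hom_add[OF frob_hom] betti_sum_at that)
 moreover have "frob N \<omega> (e \<odot>\<^bsub>betti_sum T\<^esub> x) = e \<odot>\<^bsub>betti_sum T\<^esub> frob N \<omega> x" if "x \<in> carrier (betti_sum T)" for e x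
  unfolding restriction_simps betti_sum_simps
  by (rule restrict_ext) (simp add: module_hom_smult[OF frob_hom] betti_sum_at that)
 ultimately show ?thesis unfolding LinearCombinations.module_hom_def restriction_simps(3) by simp
qed

lemma frob_restriction_involution:
 assumes x: "x \<in> carrier (betti N \<omega>)"
 shows "frob N \<omega> (frob N \<omega> x) = x"
proof -
 note c = module_hom_closed[OF frob_restriction_hom]
 have "frob N \<omega> (frob N \<omega> x) \<sigma> = x \<sigma>" if "\<sigma> \<in> Emb" for \<sigma>
  using that x by (simp add: restriction_simps betti_sum_at frob_inv)
 then show ?thesis using c[OF c[OF x]] x unfolding restriction_simps(3) by (intro betti_sum_ext)
qed

lemma period_data_restriction: "period_data N \<omega>"
proof (rule period_data.intro[OF field_hom_of_rat_hom])
 show "cmod (derham N)" unfolding restriction_simps by (rule cDN)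
 show "LinearCombinations.submodule class_ring (hodge_fil N n) (derham N)" for n
  using F_sub[of n] cDN unfolding restriction_simps LinearCombinations.submodule_def by simp
 show "hodge_fil N n \<subseteq> hodge_fil N m" if "m \<le> n" for m n
  unfolding restriction_simps by (rule F_dec[OF that])
 show "comparison N \<omega> (bclass (betti N \<omega>) [(v, 1)]) \<in> carrier (derham_ext \<omega> (derham N))"
  if "v \<in> carrier (betti_eigen N \<omega> s)" for s v
  using that by (intro restriction_period) (simp add: betti_eigen_def restriction_simps)
qed

end

lemma sum_Times_Sigma:
 assumes "finite A" "finite B" "!!\<sigma>. \<sigma> \<in> B ==> finite (K \<sigma>)"
 shows "sum f (A \<times> Sigma B K) = (\<Sum>\<sigma>\<in>B. \<Sum>j\<in>A \<times> K \<sigma>. f (fst j, (\<sigma>, snd j)))"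
proof -
 have "sum f (A \<times> Sigma B K) = (\<Sum>s\<in>A. \<Sum>k\<in>Sigma B K. f (s, k))" by (simp add: sum.cartesian_product)
 also have "\<dots> = (\<Sum>s\<in>A. \<Sum>\<sigma>\<in>B. \<Sum>k\<in>K \<sigma>. f (s, (\<sigma>, k)))" using assms by (simp add: sum.Sigma)
 also have "\<dots> = (\<Sum>\<sigma>\<in>B. \<Sum>s\<in>A. \<Sum>k\<in>K \<sigma>. f (s, (\<sigma>, k)))" by (rule sum.swap)
 also have "\<dots> = (\<Sum>\<sigma>\<in>B. \<Sum>j\<in>A \<times> K \<sigma>. f (fst j, (\<sigma>, snd j)))"
  by (simp add: sum.cartesian_product case_prod_beta')
 finally show ?thesis .
qed

text \<open>Types, degrees and weight are common to all embeddings, whereas the Betti data vary. The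
  restriction then has the types \<open>Emb \<times> P\<close> and block diagonal transition
  matrices.\<close>

locale restriction_frames = restriction_data T \<epsilon>
 for T :: "('e::field_char_0, 'f::field_char_0, 'b, 'd) realizations" and \<epsilon> +
 fixes P :: "'p set" and deg and K :: "('f => complex) => 'k set" and y z \<gamma> G
  and b :: "('f => complex) => int => 'k => 'b" and cb w star v c
 assumes pf: "!!\<sigma>. \<sigma> \<in> real_embeddings ==>
   period_frame T \<sigma> P deg (K \<sigma>) (y \<sigma>) (z \<sigma>) (\<gamma> \<sigma>) (G \<sigma>) (b \<sigma>) (cb \<sigma>) w star (v \<sigma>)"
  and fr: "!!\<sigma>. \<sigma> \<in> real_embeddings ==> frame (betti T \<sigma>) ({1, - 1} \<times> K \<sigma>) (%(s, k). b \<sigma> s k) (c \<sigma>)"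
  and frob_b: "!!\<sigma> s k. \<sigma> \<in> real_embeddings ==> s \<in> {1, - 1} ==> k \<in> K \<sigma> ==>
   frob T \<sigma> (b \<sigma> s k) = of_int s \<odot>\<^bsub>betti T \<sigma>\<^esub> b \<sigma> s k"
  and emb_ex: "(real_embeddings :: ('f => complex) set) \<noteq> {}"
begin

definition "KN = Sigma Emb K"
definition "bN s = (%(\<sigma>, k). \<lambda>\<tau>\<in>Emb. if \<tau> = \<sigma> then b \<sigma> s k else \<zero>\<^bsub>betti T \<tau>\<^esub>)"
definition "cN = (%x (s, (\<sigma>, k)). c \<sigma> (x \<sigma>) (s, k))"
definition "yN = (%(\<sigma>, p) (s, (\<tau>, k)). if \<sigma> = \<tau> then y \<sigma> p (s, k) else 0)"
definition "zN = (%(s, (\<tau>, k)) (\<sigma>, p). if \<sigma> = \<tau> then z \<sigma> (s, k) p else 0)"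
definition "\<gamma>N = (%(\<sigma>, p). \<gamma> \<sigma> p)"
text \<open>A Hodge generator at \<sigma> sees only the component at \<sigma> of a
  functional.\<close>

definition "GN = (%(\<sigma>, p) \<phi>. G \<sigma> p (part (\<epsilon> \<sigma>) \<phi>))"

lemma df: "\<sigma> \<in> Emb ==> dual_frame D (hodge_fil T) (map_right \<sigma>) P deg ({1, - 1} \<times> K \<sigma>) (y \<sigma>) (z \<sigma>) (\<gamma> \<sigma>) (G \<sigma>)
  (%(s, k). betti_period T \<sigma> (b \<sigma> s k))"
 by (rule period_frame.axioms(2)[OF pf])

lemma finK: "\<sigma> \<in> Emb ==> finite (K \<sigma>)"
 by (rule period_frame.finK'[OF pf])

lemma finKN: "finite KN"
 unfolding KN_def by (rule finite_SigmaI[OF fin finK])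

lemma finP: "finite P"
 using emb_ex dual_frame.finP[OF df] by blast

lemma b_closed: "\<sigma> \<in> Emb ==> s \<in> {1, - 1} ==> k \<in> K \<sigma> ==> b \<sigma> s k \<in> carrier (betti T \<sigma>)"
 using frame_closed[OF fr, of \<sigma> "(s, k)"] by simp

lemma bN_closed: "s \<in> {1, - 1} ==> i \<in> KN ==> bN s i \<in> carrier (betti_sum T)"
 unfolding bN_def case_prod_beta'
 by (rule betti_sum_closedI) (auto simp: b_closed KN_def cmod_zero_closed[OF cV])

lemma bN_at: "\<tau> \<in> Emb ==> bN s (\<sigma>, k) \<tau> = (if \<tau> = \<sigma> then b \<sigma> s k else \<zero>\<^bsub>betti T \<tau>\<^esub>)"
 by (simp add: bN_def)

lemma frame_betti_sum: "frame (betti_sum T) ({1, - 1} \<times> KN) (%(s, k). bN s k) cN"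
proof -
 let ?I = "{1, - 1 :: int} \<times> KN" and ?B = "%(s, k). bN s k"
 have B: "?B i \<in> carrier (betti_sum T)" if "i \<in> ?I" for i using that bN_closed by auto
 have ex: "x = lc (betti_sum T) ?I (cN x) ?B" if x: "x \<in> carrier (betti_sum T)" for x
 proof (rule betti_sum_ext[OF x lc_closed[OF cmod_betti_sum B]])
  fix \<tau> assume \<tau>: "\<tau> \<in> Emb"
  interpret V: Module.module class_ring "betti T \<tau>" by (rule cV[OF \<tau>])
  let ?J = "{1, - 1 :: int} \<times> K \<tau>" and ?h = "%j :: int \<times> 'k. (fst j, (\<tau>, snd j))"
  \<comment> \<open>In the component \<tau> the vectors of the other embeddings are zero, so their
    coefficients may be replaced by 0 and the sum shrinks to the basis at \<tau>.\<close>
  let ?a = "%i. if fst (snd i) = \<tau> then cN x i else 0"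
  have Bt: "?B i \<tau> \<in> carrier (betti T \<tau>)" if "i \<in> ?I" for i by (rule betti_sum_at[OF B[OF that] \<tau>])
  have "lc (betti_sum T) ?I (cN x) ?B \<tau> = lc (betti T \<tau>) ?I (cN x) (%i. ?B i \<tau>)"
   by (rule hom_lc[OF cmod_betti_sum cV[OF \<tau>] B, where g = "%x. x \<tau>" and \<eta> = "%r. r"])
    (use \<tau> finKN in \<open>auto simp: betti_sum_simps(3,4) betti_sum_at\<close>)
  also have "\<dots> = lc (betti T \<tau>) ?I ?a (%i. ?B i \<tau>)"
   unfolding lc_def
  proof (rule V.finsum_cong'[OF HOL.refl])
   show "(%i. ?a i \<odot>\<^bsub>betti T \<tau>\<^esub> ?B i \<tau>) \<in> ?I \<rightarrow> carrier (betti T \<tau>)"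
    using Bt by (intro Pi_I cmod_smult_closed[OF cV[OF \<tau>]])
   fix i assume i: "i \<in> ?I"
   obtain s \<sigma> k where sk: "i = (s, (\<sigma>, k))" by (metis surj_pair)
   show "cN x i \<odot>\<^bsub>betti T \<tau>\<^esub> ?B i \<tau> = ?a i \<odot>\<^bsub>betti T \<tau>\<^esub> ?B i \<tau>"
    using \<tau> by (auto simp: sk bN_at cmod_smult_zero[OF cV[OF \<tau>]])
  qed
  also have "\<dots> = lc (betti T \<tau>) ({1, - 1} \<times> ({\<tau>} \<times> K \<tau>)) ?a (%i. ?B i \<tau>)"
  proof (rule lc_subset[OF cV[OF \<tau>] Bt])
   show "{1, - 1} \<times> ({\<tau>} \<times> K \<tau>) \<subseteq> ?I" using \<tau> by (auto simp: KN_def)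
   show "?a i = 0" if "i \<in> ?I - {1, - 1} \<times> ({\<tau>} \<times> K \<tau>)" for i using that by (auto simp: KN_def)
  qed (use finKN in auto)
  also have "\<dots> = lc (betti T \<tau>) ?J (%j. ?a (?h j)) (%j. ?B (?h j) \<tau>)"
  proof (rule lc_reindex[OF cV[OF \<tau>]])
   show "bij_betw ?h ?J ({1, - 1} \<times> ({\<tau>} \<times> K \<tau>))"
    by (rule bij_betwI[where g = "%i. (fst i, snd (snd i))"]) auto
   show "?B i \<tau> \<in> carrier (betti T \<tau>)" if "i \<in> {1, - 1} \<times> ({\<tau>} \<times> K \<tau>)" for i
    using that \<tau> by (intro Bt) (auto simp: KN_def)
  qed
  also have "(%j. ?a (?h j)) = c \<tau> (x \<tau>)" by (rule ext) (simp add: cN_def)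
  also have "(%j. ?B (?h j) \<tau>) = (%(s, k). b \<tau> s k)" using \<tau> by (intro ext) (simp add: bN_at case_prod_beta')
  also have "lc (betti T \<tau>) ?J (c \<tau> (x \<tau>)) (%(s, k). b \<tau> s k) = x \<tau>"
   by (rule frame_expand[OF fr[OF \<tau>] betti_sum_at[OF x \<tau>], symmetric])
  finally show "x \<tau> = lc (betti_sum T) ?I (cN x) ?B \<tau>" ..
 qed
 have co: "semilin (%r. r) (betti_sum T) (%x. cN x i)" if "i \<in> ?I" for i
 proof -
  obtain s \<sigma> k where sk: "i = (s, (\<sigma>, k))" "s \<in> {1, - 1}" "\<sigma> \<in> Emb" "k \<in> K \<sigma>" using \<open>i \<in> ?I\<close> by (auto simp: KN_def)
  have s: "semilin (%r. r) (betti T \<sigma>) (%x. c \<sigma> x (s, k))" by (rule frame_coord[OF fr[OF sk(3)]]) (use sk in auto)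
  show ?thesis using sk(3) by (auto simp: semilin_def cN_def sk(1) betti_sum_simps(3,4) semilin_add[OF s] semilin_smult[OF s] betti_sum_at)
 qed
 have de: "cN (?B j) i = (if i = j then 1 else 0)" if "i \<in> ?I" "j \<in> ?I" for i j
 proof -
  obtain s \<sigma> k where sk: "i = (s, (\<sigma>, k))" "s \<in> {1, - 1}" "\<sigma> \<in> Emb" "k \<in> K \<sigma>" using \<open>i \<in> ?I\<close> by (auto simp: KN_def)
  obtain t \<tau> l where tl: "j = (t, (\<tau>, l))" "t \<in> {1, - 1}" "\<tau> \<in> Emb" "l \<in> K \<tau>" using \<open>j \<in> ?I\<close> by (auto simp: KN_def)
  have sk': "(s, k) \<in> {1, - 1} \<times> K \<sigma>" using sk by simp
  show ?thesis
  proof (cases "\<sigma> = \<tau>")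
   case True
   then show ?thesis using frame_delta[OF fr[OF sk(3)] sk', of "(t, l)"] sk tl by (auto simp: cN_def bN_at)
  next
   case False
   then show ?thesis using semilin_zero[OF frame_coord[OF fr[OF sk(3)] sk'] cV[OF sk(3)]] sk tl by (simp add: cN_def bN_at)
  qed
 qed
 show ?thesis unfolding frame_def
 proof (intro conjI ballI)
  show "finite ?I" using finKN by simp
 qed (use cmod_betti_sum B co de ex in blast)+
qed

lemma frob_bN:
 assumes s: "s \<in> {1, - 1}" and i: "i \<in> KN"
 shows "frob N \<omega> (bN s i) = of_int s \<odot>\<^bsub>betti N \<omega>\<^esub> bN s i"
proof -
 obtain \<sigma> k where sk: "i = (\<sigma>, k)" "\<sigma> \<in> Emb" "k \<in> K \<sigma>" using i by (auto simp: KN_def)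
 have z: "frob T \<tau> \<zero>\<^bsub>betti T \<tau>\<^esub> = \<zero>\<^bsub>betti T \<tau>\<^esub>" if \<tau>: "\<tau> \<in> Emb" for \<tau>
  using module_hom_smult[OF frob_hom[OF \<tau>] cmod_zero_closed[OF cV[OF \<tau>]], of 0]
   module_hom_closed[OF frob_hom[OF \<tau>] cmod_zero_closed[OF cV[OF \<tau>]]]
  by (simp add: cmod_zero_smult[OF cV[OF \<tau>]] cmod_zero_closed[OF cV[OF \<tau>]])
 show ?thesis unfolding restriction_simps betti_sum_simps
  by (rule restrict_ext) (use sk s in \<open>auto simp: bN_at frob_b z cmod_smult_zero[OF cV]\<close>)
qed

lemma period_bN:
 assumes s: "s \<in> {1, - 1}" and \<sigma>: "\<sigma> \<in> Emb" and k: "k \<in> K \<sigma>" and \<phi>: "Nfunctional \<phi>"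
 shows "betti_period N \<omega> (bN s (\<sigma>, k)) \<phi> = betti_period T \<sigma> (b \<sigma> s k) (part (\<epsilon> \<sigma>) \<phi>)"
proof -
 have "betti_period N \<omega> (bN s (\<sigma>, k)) \<phi> = (\<Sum>\<tau>\<in>Emb. betti_period T \<tau> (bN s (\<sigma>, k) \<tau>) (part (\<epsilon> \<tau>) \<phi>))"
  by (rule restriction_period(2)[OF bN_closed[OF s] \<phi>]) (use \<sigma> k in \<open>simp add: KN_def\<close>)
 also have "\<dots> = (\<Sum>\<tau>\<in>Emb. if \<tau> = \<sigma> then betti_period T \<sigma> (b \<sigma> s k) (part (\<epsilon> \<sigma>) \<phi>) else 0)"
  using semilin_zero[OF sl[OF _ part_semilin[OF \<phi>]] cV] by (intro sum.cong) (auto simp: bN_at)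
 finally show ?thesis using fin \<sigma> by simp
qed

text \<open>Block by block: \<open>part_sum\<close> reassembles a functional from its components,
  \<open>part_own\<close> makes generators and dual functionals at different embeddings orthogonal,
  and the filtration, being stable under \<FF>, is respected by \<open>part\<close>.\<close>

lemma dual_frame_restriction:
 "dual_frame (derham N) (hodge_fil N) (map_right of_rat) (Emb \<times> P) (%(\<sigma>, p). deg p) ({1, - 1} \<times> KN) yN zN \<gamma>N GN
  (%(s, k). betti_period N \<omega> (bN s k))"
 unfolding restriction_simps(1,2)
proof
 show "finite (Emb \<times> P)" "finite ({1, - 1 :: int} \<times> KN)" using fin finP finKN by auto
 have S: "sum f ({1, - 1} \<times> KN) = (\<Sum>\<sigma>\<in>Emb. \<Sum>j\<in>{1, - 1} \<times> K \<sigma>. f (fst j, (\<sigma>, snd j)))" for f :: "int \<times> (('f => complex) \<times> 'k) => ('e, complex) qtensor"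
  unfolding KN_def by (rule sum_Times_Sigma) (use fin finK in auto)
 have P: "(\<Sum>q\<in>Emb \<times> P. f q) = (\<Sum>\<sigma>\<in>Emb. \<Sum>p\<in>P. f (\<sigma>, p))" for f :: "('f => complex) \<times> 'p => ('e, complex) qtensor"
  by (simp add: sum.cartesian_product)
 show "(\<Sum>q\<in>Emb \<times> P. zN k q * yN q j) = (if k = j then 1 else 0)" if kj: "k \<in> {1, - 1} \<times> KN" "j \<in> {1, - 1} \<times> KN" for k j
 proof -
  obtain s \<sigma> l where k: "k = (s, (\<sigma>, l))" "(s, l) \<in> {1, - 1} \<times> K \<sigma>" "\<sigma> \<in> Emb" using kj(1) by (auto simp: KN_def)
  obtain t \<tau> m where j: "j = (t, (\<tau>, m))" "(t, m) \<in> {1, - 1} \<times> K \<tau>" "\<tau> \<in> Emb" using kj(2) by (auto simp: KN_def)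
  have "(\<Sum>q\<in>Emb \<times> P. zN k q * yN q j) =
    (\<Sum>\<rho>\<in>Emb. if \<rho> = \<sigma> then (if \<sigma> = \<tau> then (\<Sum>p\<in>P. z \<sigma> (s, l) p * y \<sigma> p (t, m)) else 0) else 0)"
   unfolding P by (intro sum.cong) (auto simp: k(1) j(1) zN_def yN_def)
  also have "\<dots> = (if \<sigma> = \<tau> then (\<Sum>p\<in>P. z \<sigma> (s, l) p * y \<sigma> p (t, m)) else 0)" using fin k(3) by simp
  also have "\<dots> = (if k = j then 1 else 0)"
   using dual_frame.zy[OF df[OF k(3)] k(2), of "(t, m)"] j k by auto
  finally show ?thesis .
 qed
 show "(\<Sum>k\<in>{1, - 1} \<times> KN. yN p k * zN k q) = (if p = q then 1 else 0)" if pq: "p \<in> Emb \<times> P" "q \<in> Emb \<times> P" for p q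
 proof -
  obtain \<sigma> p' where p: "p = (\<sigma>, p')" "\<sigma> \<in> Emb" "p' \<in> P" using pq(1) by auto
  obtain \<tau> q' where q: "q = (\<tau>, q')" "\<tau> \<in> Emb" "q' \<in> P" using pq(2) by auto
  have "(\<Sum>k\<in>{1, - 1} \<times> KN. yN p k * zN k q) =
    (\<Sum>\<rho>\<in>Emb. if \<rho> = \<sigma> then (if \<sigma> = \<tau> then (\<Sum>j\<in>{1, - 1} \<times> K \<sigma>. y \<sigma> p' j * z \<sigma> j q') else 0) else 0)"
   unfolding S by (intro sum.cong) (auto simp: p(1) q(1) zN_def yN_def simp del: sum.insert intro!: sum.neutral)
  also have "\<dots> = (if \<sigma> = \<tau> then (\<Sum>j\<in>{1, - 1} \<times> K \<sigma>. y \<sigma> p' j * z \<sigma> j q') else 0)" using fin p(2) by simp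
  also have "\<dots> = (if p = q then 1 else 0)" using dual_frame.yz[OF df[OF p(2)] p(3) q(3)] p q by auto
  finally show ?thesis .
 qed
 show "Nfunctional (\<gamma>N p)" if "p \<in> Emb \<times> P" for p
  using that by (auto simp: \<gamma>N_def intro!: functional_restrict dual_frame.\<gamma>[OF df])
 show "\<phi> h = (\<Sum>p\<in>Emb \<times> P. \<gamma>N p h * GN p \<phi>)" if \<phi>: "Nfunctional \<phi>" and h: "h \<in> carrier DN" for \<phi> h
 proof -
  have h': "h \<in> carrier D" using h by simp
  have "\<phi> h = (\<Sum>\<sigma>\<in>Emb. part (\<epsilon> \<sigma>) \<phi> h)" by (rule part_sum[OF \<phi> h', symmetric])
  also have "\<dots> = (\<Sum>\<sigma>\<in>Emb. \<Sum>p\<in>P. \<gamma> \<sigma> p h * G \<sigma> p (part (\<epsilon> \<sigma>) \<phi>))"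
   by (intro sum.cong HOL.refl dual_frame.expand[OF df] part_semilin[OF \<phi>] h')
  finally show ?thesis unfolding P by (simp add: \<gamma>N_def GN_def)
 qed
 show "\<gamma>N p h = 0" if p: "p \<in> Emb \<times> P" "(%(\<sigma>, p). deg p) p < n" and h: "h \<in> hodge_fil T n" for p n h
  using p dual_frame.\<gamma>_fil[OF df _ _ h] by (auto simp: \<gamma>N_def)
 show "GN p \<phi> = 0" if \<phi>: "Nfunctional \<phi>" "!!h. h \<in> hodge_fil T n ==> \<phi> h = 0" and p: "p \<in> Emb \<times> P" "n \<le> (%(\<sigma>, p). deg p) p" for \<phi> p n
 proof -
  obtain \<sigma> p' where p': "p = (\<sigma>, p')" "\<sigma> \<in> Emb" "p' \<in> P" "n \<le> deg p'" using p by auto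
  have "part (\<epsilon> \<sigma>) \<phi> h = 0" if "h \<in> hodge_fil T n" for h
   unfolding part_def case_prod_beta' using \<phi>(2) F_sub[of n] that by (simp add: LinearCombinations.submodule_def)
  then show ?thesis unfolding p'(1) GN_def prod.case
   by (intro dual_frame.G_fil[OF df[OF p'(2)] part_semilin[OF \<phi>(1) p'(2)] _ p'(3,4)])
 qed
 show "GN p (\<gamma>N q) = (if p = q then 1 else 0)" if pq: "p \<in> Emb \<times> P" "q \<in> Emb \<times> P" for p q
 proof -
  obtain \<sigma> p' where p: "p = (\<sigma>, p')" "\<sigma> \<in> Emb" "p' \<in> P" using pq(1) by auto
  obtain \<tau> q' where q: "q = (\<tau>, q')" "\<tau> \<in> Emb" "q' \<in> P" using pq(2) by auto
  have \<gamma>: "period_functional T \<tau> (\<gamma> \<tau> q')" "period_functional T \<sigma> (\<gamma> \<sigma> q')"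
   by (rule dual_frame.\<gamma>[OF df[OF q(2)] q(3)], rule dual_frame.\<gamma>[OF df[OF p(2)] q(3)])
  have "G \<sigma> p' (part (\<epsilon> \<sigma>) (\<gamma> \<tau> q')) = (if \<sigma> = \<tau> then 1 else 0) * G \<sigma> p' (\<gamma> \<sigma> q')"
   using part_own[OF q(2) p(2) \<gamma>(1)]
   by (intro dual_frame.G_smult[OF df[OF p(2)] p(3) \<gamma>(2)] part_semilin functional_restrict[OF q(2)] \<gamma>(1) p(2)) auto
  then show ?thesis using dual_frame.G_\<gamma>[OF df[OF p(2)] p(3) q(3)] by (auto simp: p(1) q(1) GN_def \<gamma>N_def)
 qed
 show "GN p \<phi> = (\<Sum>i\<in>I. a i * GN p (\<psi> i))" if pP: "p \<in> Emb \<times> P" and I: "finite I" and \<psi>: "!!i. i \<in> I ==> Nfunctional (\<psi> i)"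
  and \<phi>: "Nfunctional \<phi>" and eq: "!!h. h \<in> carrier DN ==> \<phi> h = (\<Sum>i\<in>I. a i * \<psi> i h)"
  for p a \<phi> \<psi> and I :: "nat set"
 proof -
  obtain \<sigma> p' where p: "p = (\<sigma>, p')" "\<sigma> \<in> Emb" "p' \<in> P" using pP by auto
  have "part (\<epsilon> \<sigma>) \<phi> h = (\<Sum>i\<in>I. a i * part (\<epsilon> \<sigma>) (\<psi> i) h)" if "h \<in> carrier D" for h
  proof -
   have "(\<Sum>x\<leftarrow>xs. f x * (\<Sum>i\<in>I. a i * \<psi> i (g x))) = (\<Sum>i\<in>I. a i * (\<Sum>x\<leftarrow>xs. f x * \<psi> i (g x)))" for xs :: "('f \<times> complex) list" and f g
    by (induction xs) (simp_all add: sum.distrib distrib_left sum_distrib_left mult.left_commute)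
   then show ?thesis unfolding part_def case_prod_beta' using eq smult_D[OF that] by simp
  qed
  then show ?thesis unfolding p(1) GN_def prod.case
   by (intro dual_frame.G_lin[OF df[OF p(2)] p(3) I] part_semilin \<psi> \<phi> p(2))
 qed
 show "GN p \<phi> = (\<Sum>k\<in>{1, - 1} \<times> KN. yN p k * (%(s, k). betti_period N \<omega> (bN s k)) k \<phi>)"
  if \<phi>: "Nfunctional \<phi>" and pP: "p \<in> Emb \<times> P" for p \<phi>
 proof -
  obtain \<sigma> p' where p: "p = (\<sigma>, p')" "\<sigma> \<in> Emb" "p' \<in> P" using pP by auto
  let ?\<beta> = "%j. (%(s, k). betti_period T \<sigma> (b \<sigma> s k)) j (part (\<epsilon> \<sigma>) \<phi>)"
  have "(\<Sum>k\<in>{1, - 1} \<times> KN. yN p k * (%(s, k). betti_period N \<omega> (bN s k)) k \<phi>) =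
    (\<Sum>\<rho>\<in>Emb. if \<rho> = \<sigma> then (\<Sum>j\<in>{1, - 1} \<times> K \<sigma>. y \<sigma> p' j * ?\<beta> j) else 0)"
   unfolding S
  proof (rule sum.cong[OF HOL.refl])
   fix \<rho> assume \<rho>: "\<rho> \<in> Emb"
   show "(\<Sum>j\<in>{1, - 1} \<times> K \<rho>. yN p (fst j, \<rho>, snd j) * (case (fst j, \<rho>, snd j) of (s, k) => betti_period N \<omega> (bN s k)) \<phi>) =
     (if \<rho> = \<sigma> then (\<Sum>j\<in>{1, - 1} \<times> K \<sigma>. y \<sigma> p' j * ?\<beta> j) else 0)"
   proof (cases "\<rho> = \<sigma>")
    case True
    have "(\<Sum>j\<in>{1, - 1} \<times> K \<sigma>. yN p (fst j, \<sigma>, snd j) * (case (fst j, \<sigma>, snd j) of (s, k) => betti_period N \<omega> (bN s k)) \<phi>) =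
      (\<Sum>j\<in>{1, - 1} \<times> K \<sigma>. y \<sigma> p' j * ?\<beta> j)"
     by (rule sum.cong[OF HOL.refl]) (auto simp: p(1) yN_def period_bN[OF _ p(2) _ \<phi>])
    then show ?thesis using True by simp
   next
    case False
    then have "yN p (fst j, \<rho>, snd j) = 0" for j :: "int \<times> 'k" by (simp add: p(1) yN_def)
    then show ?thesis using False by simp
   qed
  qed
  also have "\<dots> = (\<Sum>j\<in>{1, - 1} \<times> K \<sigma>. y \<sigma> p' j * ?\<beta> j)" using fin p(2) by simp
  also have "\<dots> = GN p \<phi>"
   unfolding p(1) GN_def prod.case by (rule dual_frame.G_\<beta>[OF df[OF p(2)] part_semilin[OF \<phi> p(2)] p(3), symmetric])
  finally show ?thesis ..
 qed
qed

lemma period_frame_restriction: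
 "period_frame N \<omega> (Emb \<times> P) (%(\<sigma>, p). deg p) KN yN zN \<gamma>N GN bN (%s x k. cN x (s, k)) w
  (%(\<sigma>, p). (\<sigma>, star p)) (%(\<sigma>, p). v \<sigma> p)"
proof (rule period_frame.intro[OF period_data_restriction dual_frame_restriction], rule period_frame_axioms.intro)
 show "frame (betti_eigen N \<omega> s) KN (bN s) (%x k. cN x (s, k))" if s: "s \<in> {1, - 1}" for s
  using eigen_frame[OF cmod_betti_sum[folded restriction_simps(3)] frob_restriction_hom frob_restriction_involution
    frame_betti_sum[folded restriction_simps(3)] _ s] frob_bN
  unfolding betti_eigen_def by simp
 show "semilin (%e. e \<otimes>\<^sub>\<rat> 1) (betti_eigen N \<omega> s) (%x. betti_period N \<omega> x \<phi>)" if "period_functional N \<omega> \<phi>" for s \<phi>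
  using semilin_restriction_period[of \<phi>] that by (simp add: semilin_def betti_eigen_def restriction_simps)
 show "yN ((%(\<sigma>, p). (\<sigma>, star p)) p) (s, k) = of_int s * (%(\<sigma>, p). v \<sigma> p) p * yN p (s, k)"
  if "p \<in> Emb \<times> P" "s \<in> {1, - 1}" "k \<in> KN" for p s k
  using that period_frame.y_star[OF pf] by (auto simp: yN_def KN_def)
qed (auto simp: period_frame.star[OF pf])

end

section \<open>Existence of the periods of the restriction\<close>

lemma rational_frame:
 assumes "number_field TYPE('f::field_char_0)"
 obtains J d where "frame (field_mod of_rat :: (rat, 'f) module) J (%b. b) d"
proof -
 obtain B :: "'f set" where B: "finite B" "!!x. \<exists>c. x = (\<Sum>b\<in>B. of_rat (c b) * b)"
  using assms by (auto simp: number_field_def)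
 have c: "cmod (field_mod of_rat :: (rat, 'f) module)" by (rule cmod_field_mod[OF comm_ring_hom_of_rat])
 have lcB: "lc (field_mod of_rat) B a (%b. b) = (\<Sum>b\<in>B. of_rat (a b) * b)" for a :: "'f => rat"
  using semilin_lc[OF c, where \<phi> = "%x. x" and \<eta> = of_rat and b = "%b. b" and I = B and a = a] by (simp add: semilin_def)
 have "\<exists>a. x = lc (field_mod of_rat) B a (%b. b)" for x using B(2)[of x] by (simp add: lcB)
 then show thesis using spanning_subframe[OF c B(1), of "%b. b"] that by auto
qed

text \<open>The map id \<otimes> g from \<EE> \<otimes> \<FF> to \<EE> \<otimes> \<rat>, for a
  rational functional g on \<FF>.\<close>

definition rcoord :: "('f => rat) => ('e::field_char_0, 'f::field_char_0) qtensor => ('e, rat) qtensor" where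
 "rcoord g t = (\<Sum>(a, b)\<leftarrow>rep_qtensor t. a \<otimes>\<^sub>\<rat> g b)"

context
 fixes g :: "'f::field_char_0 => rat"
 assumes g: "!!x y. g (x + y) = g x + g y" "!!r x. g (of_rat r * x) = r * g x"
begin

lemma rcoord_list: "rcoord g (\<Sum>(a, b)\<leftarrow>xs. a \<otimes>\<^sub>\<rat> b) = (\<Sum>(a, b)\<leftarrow>xs. a \<otimes>\<^sub>\<rat> g b)"
 unfolding rcoord_def
proof (rule teq_sum)
 show "qteq (rep_qtensor (\<Sum>(a, b)\<leftarrow>xs. a \<otimes>\<^sub>\<rat> b)) xs" by (simp add: qteq_iff flip: qtensor_rep)
 have "g 0 = 0" using g(1)[of 0 0] by simp
 then show "a \<otimes>\<^sub>\<rat> g \<zero>\<^bsub>field_mod of_rat\<^esub> = 0" for a :: 'a by simp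
 show "(r \<odot>\<^bsub>field_mod of_rat\<^esub> a) \<otimes>\<^sub>\<rat> g b = a \<otimes>\<^sub>\<rat> g (r \<odot>\<^bsub>field_mod of_rat\<^esub> b)" for r and a :: 'a and b
  using pure_balanced[of r a "g b"] by (simp add: g(2))
qed (simp_all add: pure_add_left pure_add_right g(1))

lemma rcoord_pure: "rcoord g (a \<otimes>\<^sub>\<rat> b) = a \<otimes>\<^sub>\<rat> g b"
 using rcoord_list[of "[(a, b)]"] by simp

lemma rcoord_add: "rcoord g (s + t) = rcoord g s + rcoord g t"
proof -
 have "s + t = (\<Sum>(a, b)\<leftarrow>rep_qtensor s @ rep_qtensor t. a \<otimes>\<^sub>\<rat> b)"
  using qtensor_rep[of s] qtensor_rep[of t] by simp
 then have "rcoord g (s + t) = (\<Sum>(a, b)\<leftarrow>rep_qtensor s @ rep_qtensor t. a \<otimes>\<^sub>\<rat> g b)"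
  by (simp only: rcoord_list)
 then show ?thesis by (simp add: rcoord_def)
qed

lemma rcoord_zero: "rcoord g 0 = 0"
 using rcoord_add[of 0 0] by simp

lemma rcoord_smult: "rcoord g (map_right of_rat r * t) = r * rcoord g t"
proof -
 have 1: "rcoord g (a \<otimes>\<^sub>\<rat> of_rat b * t) = a \<otimes>\<^sub>\<rat> b * rcoord g t" for a b
  by (induction t rule: qtensor_induct) (simp_all add: rcoord_zero rcoord_add rcoord_pure g(2) distrib_left)
 show ?thesis
  by (induction r rule: qtensor_induct)
   (simp_all add: map_right_zero map_right_add map_right_pure field_hom_of_rat_hom rcoord_zero rcoord_add distrib_right 1)
qed

end

text \<open>A basis of \<FF> over the rationals is one of \<EE> \<otimes> \<FF> over \<EE> \<otimes>
  \<rat>, and bases multiply along a tower; \<open>rcoord\<close> gives the coordinates in the lower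
  step.\<close>

lemma frame_restrict_scalars:
 fixes Q :: "(('e::field_char_0, 'f::field_char_0) qtensor, 'q) module"
 assumes f: "frame Q I ws \<kappa>" and J: "frame (field_mod of_rat :: (rat, 'f) module) J (%b. b) d"
 shows "frame (restrict_scalars (map_right (of_rat :: rat => 'f)) Q) (I \<times> J) (%(i, b). (1 \<otimes>\<^sub>\<rat> b) \<odot>\<^bsub>Q\<^esub> ws i)
  (%X (i, b). rcoord (%x. d x b) (\<kappa> X i))"
proof -
 let ?R = "restrict_scalars (map_right (of_rat :: rat => 'f)) Q" and ?b = "%(i, b). (1 \<otimes>\<^sub>\<rat> b) \<odot>\<^bsub>Q\<^esub> ws i"
  and ?c = "%X (i, b). rcoord (%x. d x b) (\<kappa> X i)"
 note cQ = frame_cmod[OF f]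
 have cR: "cmod ?R" by (rule cmod_restrict_scalars[OF comm_ring_hom_map_right[OF field_hom_of_rat_hom] cQ])
 have g: "d (x + y) b = d x b + d y b" "d (of_rat r * x) b = r * d x b" if "b \<in> J" for x y r b
  using frame_coord[OF J that] by (simp_all add: semilin_def)
 have ex: "t = (\<Sum>b\<in>J. map_right of_rat (rcoord (%x. d x b) t) * (1 \<otimes>\<^sub>\<rat> b))" for t :: "('e, 'f) qtensor"
 proof (induction t rule: qtensor_induct)
  case zero
  then show ?case by (simp add: rcoord_zero[OF g] map_right_zero field_hom_of_rat_hom)
 next
  case (add a h t)
  have h: "h = (\<Sum>b\<in>J. of_rat (d h b) * b)"
   using frame_semilin[OF J, where \<phi> = "%x. x" and \<eta> = of_rat and x = h] by (simp add: semilin_def)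
  have "(\<Sum>b\<in>J. map_right of_rat (rcoord (%x. d x b) (a \<otimes>\<^sub>\<rat> h + t)) * (1 \<otimes>\<^sub>\<rat> b)) =
    (\<Sum>b\<in>J. a \<otimes>\<^sub>\<rat> (of_rat (d h b) * b)) + (\<Sum>b\<in>J. map_right of_rat (rcoord (%x. d x b) t) * (1 \<otimes>\<^sub>\<rat> b))"
   unfolding sum.distrib[symmetric]
   by (intro sum.cong) (simp_all add: rcoord_add[OF g] rcoord_pure[OF g] map_right_add map_right_pure field_hom_of_rat_hom distrib_right)
  also have "\<dots> = a \<otimes>\<^sub>\<rat> (\<Sum>b\<in>J. of_rat (d h b) * b) + t" unfolding add[symmetric] pure_sum_right ..
  finally show ?case unfolding h[symmetric] ..
 qed
 have cl: "?b i \<in> carrier ?R" if "i \<in> I \<times> J" for i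
  using that frame_closed[OF f] by (auto intro!: cmod_smult_closed[OF cQ])
 have \<kappa>: "semilin (map_right of_rat) ?R (%X. \<kappa> X i)" if "i \<in> I" for i
  using frame_coord[OF f that] by (simp add: semilin_def)
 have \<kappa>b: "\<kappa> ((1 \<otimes>\<^sub>\<rat> b) \<odot>\<^bsub>Q\<^esub> ws j) i = (if i = j then 1 \<otimes>\<^sub>\<rat> b else 0)" if "i \<in> I" "j \<in> I" for i j b
  using semilin_smult[OF frame_coord[OF f that(1)] frame_closed[OF f that(2)]] frame_delta[OF f that] by simp
 have exp: "X = lc ?R (I \<times> J) (?c X) ?b" if X: "X \<in> carrier ?R" for X
 proof -
  let ?Y = "lc ?R (I \<times> J) (?c X) ?b"
  have Y: "?Y \<in> carrier Q" using lc_closed[OF cR cl] by simp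
  have "\<kappa> ?Y i = \<kappa> X i" if i: "i \<in> I" for i
  proof -
   have "\<kappa> ?Y i = (\<Sum>jb\<in>I \<times> J. map_right of_rat (?c X jb) * \<kappa> (?b jb) i)" by (rule semilin_lc[OF cR cl \<kappa>[OF i]])
   also have "\<dots> = (\<Sum>j\<in>I. \<Sum>b\<in>J. map_right of_rat (rcoord (%x. d x b) (\<kappa> X j)) * \<kappa> ((1 \<otimes>\<^sub>\<rat> b) \<odot>\<^bsub>Q\<^esub> ws j) i)"
    unfolding sum.cartesian_product by (simp add: case_prod_beta')
   also have "\<dots> = (\<Sum>j\<in>I. if j = i then \<kappa> X i else 0)"
    using ex[of "\<kappa> X i"] i by (intro sum.cong) (auto simp: \<kappa>b)
   finally show ?thesis using i frame_finite[OF f] by simp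
  qed
  then have "lc Q I (\<kappa> ?Y) ws = lc Q I (\<kappa> X) ws" by (intro lc_cong[OF cQ frame_closed[OF f]])
  then show ?thesis using frame_expand[OF f Y] frame_expand[OF f, of X] X by simp
 qed
 have co: "semilin (%r. r) ?R (%X. ?c X i)" if "i \<in> I \<times> J" for i
 proof -
  obtain j b where jb: "i = (j, b)" "j \<in> I" "b \<in> J" using \<open>i \<in> I \<times> J\<close> by auto
  show ?thesis using jb
   by (auto simp: semilin_def semilin_add[OF frame_coord[OF f]] semilin_smult[OF frame_coord[OF f]] rcoord_add[OF g] rcoord_smult[OF g])
 qed
 have de: "?c (?b j) i = (if i = j then 1 else 0)" if iJ: "i \<in> I \<times> J" and jJ: "j \<in> I \<times> J" for i j
 proof -
  obtain k l where i: "i = (k, l)" "k \<in> I" "l \<in> J" using iJ by auto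
  obtain m n where j: "j = (m, n)" "m \<in> I" "n \<in> J" using jJ by auto
  show ?thesis using frame_delta[OF J i(3) j(3)] i j
   by (cases "k = m") (auto simp: \<kappa>b rcoord_pure[OF g] rcoord_zero[OF g])
 qed
 show ?thesis unfolding frame_def
 proof (intro conjI ballI)
  show "finite (I \<times> J)" using frame_finite[OF f] frame_finite[OF J] by simp
 qed (use cR cl co de exp in blast)+
qed

lemma quot_mod_restrict_scalars: "quot_mod (restrict_scalars f D) F = restrict_scalars f (quot_mod D F)"
proof -
 have "set_mult (add_monoid (restrict_scalars f D)) = set_mult (add_monoid D)"
  by (intro ext) (simp add: set_mult_def)
 then show ?thesis
  by (simp add: quot_mod_def restrict_scalars_def A_RCOSETS_def RCOSETS_def a_r_coset_def r_coset_def set_add_def)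
qed

context restriction_frames
begin

text \<open>The step that serves for \<open>T\<close> also serves for its restriction: below it lie
  r types for each embedding, as many as there are Betti vectors of one sign.\<close>

lemma periods_restriction_ex:
 assumes nf: "number_field TYPE('f)" and f: "frame (derham_quot T p) {..<r::nat} ws \<kappa>"
  and r: "!!\<sigma>. \<sigma> \<in> Emb ==> r = card (K \<sigma>)" and s: "s \<in> {1, - 1}"
 shows "periods N \<omega> s \<noteq> {}"
proof -
 interpret X: period_frame N \<omega> "Emb \<times> P" "%(\<sigma>, p). deg p" KN yN zN \<gamma>N GN bN "%s x k. cN x (s, k)" w
  "%(\<sigma>, p). (\<sigma>, star p)" "%(\<sigma>, p). v \<sigma> p" by (rule period_frame_restriction)
 obtain J d where J: "frame (field_mod of_rat :: (rat, 'f) module) J (%b. b) d" by (rule rational_frame[OF nf])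
 have "frame (derham_quot N p) ({..<r} \<times> J) (%(i, b). (1 \<otimes>\<^sub>\<rat> b) \<odot>\<^bsub>derham_quot T p\<^esub> ws i) (%X (i, b). rcoord (%x. d x b) (\<kappa> X i))"
  using frame_restrict_scalars[OF f J] unfolding restriction_simps quot_mod_restrict_scalars .
 then have rank: "has_rank (derham_quot N p) (card ({..<r} \<times> J))" using frame_has_rank by blast
 obtain \<sigma>0 where \<sigma>0: "\<sigma>0 \<in> Emb" using emb_ex by blast
 have "{q\<in>Emb \<times> P. (%(\<sigma>, p). deg p) q < p} = Emb \<times> {q\<in>P. deg q < p}" by auto
 then have "card {q\<in>Emb \<times> P. (%(\<sigma>, p). deg p) q < p} = card Emb * r"
  using period_frame.quot_rank[OF pf[OF \<sigma>0] f] by (simp add: card_cartesian_product)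
 also have "card Emb * r = (\<Sum>\<sigma>\<in>Emb. card (K \<sigma>))" by (simp add: r[symmetric])
 also have "\<dots> = card KN" unfolding KN_def using fin finK by (subst card_SigmaI) auto
 finally show ?thesis by (rule X.periods_ex[OF rank _ s])
qed

text \<open>The relation between the two eigenparts holds embedding by embedding, so a block
  diagonal matrix satisfies it and its determinant is the product of the blocks.\<close>

lemma restriction_ratio:
 assumes c1: "c1 \<in> periods N \<omega> 1" and c2: "c2 \<in> periods N \<omega> (- 1)" and s0: "!!q. s0 q = 1 \<or> s0 q = (- 1 :: int)"
  and \<psi>: "!!\<sigma> q k. \<sigma> \<in> Emb ==> q \<in> P ==> k \<in> K \<sigma> ==> (\<Sum>j\<in>K \<sigma>. \<psi> \<sigma> k j * y \<sigma> q (1, j)) = of_int (s0 q) * y \<sigma> q (- 1, k)"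
 obtains t where "t \<in> runits (range \<omega>)" "c1 = t * c2 * (\<Prod>\<sigma>\<in>Emb. gdet (K \<sigma>) (\<psi> \<sigma>))"
proof -
 interpret X: period_frame N \<omega> "Emb \<times> P" "%(\<sigma>, p). deg p" KN yN zN \<gamma>N GN bN "%s x k. cN x (s, k)" w
  "%(\<sigma>, p). (\<sigma>, star p)" "%(\<sigma>, p). v \<sigma> p" by (rule period_frame_restriction)
 define \<psi>N where "\<psi>N = (%(\<sigma>, k) (\<tau>, j). if \<sigma> = \<tau> then \<psi> \<sigma> k j else 0)"
 have rel: "(\<Sum>j\<in>KN. \<psi>N k j * yN q (1, j)) = of_int (s0 (snd q)) * yN q (- 1, k)" if q: "q \<in> Emb \<times> P" and k: "k \<in> KN" for q k
 proof -
  obtain \<rho> p where p: "q = (\<rho>, p)" "\<rho> \<in> Emb" "p \<in> P" using q by auto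
  obtain \<sigma> l where l: "k = (\<sigma>, l)" "\<sigma> \<in> Emb" "l \<in> K \<sigma>" using k by (auto simp: KN_def)
  have "(\<Sum>j\<in>KN. \<psi>N k j * yN q (1, j)) = (\<Sum>\<tau>\<in>Emb. \<Sum>j\<in>K \<tau>. \<psi>N k (\<tau>, j) * yN q (1, (\<tau>, j)))"
   unfolding KN_def using fin finK by (subst sum.Sigma) (auto simp: case_prod_beta')
  also have "\<dots> = (\<Sum>\<tau>\<in>Emb. if \<tau> = \<sigma> then (if \<rho> = \<sigma> then (\<Sum>j\<in>K \<sigma>. \<psi> \<sigma> l j * y \<sigma> p (1, j)) else 0) else 0)"
   by (intro sum.cong) (auto simp: l(1) p(1) \<psi>N_def yN_def)
  also have "\<dots> = (if \<rho> = \<sigma> then (\<Sum>j\<in>K \<sigma>. \<psi> \<sigma> l j * y \<sigma> p (1, j)) else 0)" using fin l(2) by simp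
  also have "\<dots> = of_int (s0 (snd q)) * yN q (- 1, k)" using \<psi>[OF l(2) p(3) l(3)] by (simp add: l(1) p(1) yN_def)
  finally show ?thesis .
 qed
 have "gdet KN \<psi>N = (\<Prod>\<sigma>\<in>Emb. gdet (K \<sigma>) (%k j. \<psi>N (\<sigma>, k) (\<sigma>, j)))"
  unfolding KN_def by (rule gdet_Sigma[OF fin finK]) (auto simp: \<psi>N_def)
 then have g: "gdet KN \<psi>N = (\<Prod>\<sigma>\<in>Emb. gdet (K \<sigma>) (\<psi> \<sigma>))" by (simp add: \<psi>N_def)
 obtain t where "t \<in> runits (range \<omega>)" "c1 = t * c2 * gdet KN \<psi>N"
  by (rule X.period_ratio[OF c1 c2, of "%q. s0 (snd q)" \<psi>N]) (use s0 rel in auto)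
 then show thesis using that g by simp
qed

end

section \<open>The unit group\<close>

lemma unit_group_simps:
 "x \<in> carrier (unit_group :: ('e::field_char_0, complex) qtensor monoid) \<longleftrightarrow> (\<exists>t. x * t = 1)"
 "x \<otimes>\<^bsub>unit_group\<^esub> y = x * (y :: ('e, complex) qtensor)" "\<one>\<^bsub>unit_group\<^esub> = (1 :: ('e, complex) qtensor)"
 by (auto simp: units_of_def Units_def mult.commute)

lemma comm_group_unit_group: "comm_group (unit_group :: ('e::field_char_0, complex) qtensor monoid)"
 by (rule comm_monoid.units_comm_group[OF cring.axioms(2)[OF class_cring.is_cring]])

lemma unit_group_inv:
 fixes x :: "('e::field_char_0, complex) qtensor"
 assumes "x * t = 1"
 shows "inv\<^bsub>unit_group\<^esub> x = t"
proof -
 interpret comm_group "unit_group :: ('e, complex) qtensor monoid" by (rule comm_group_unit_group)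
 show ?thesis using assms
  by (intro inv_equality) (auto simp: unit_group_simps mult.commute)
qed

lemma unit_group_finprod:
 fixes f :: "'i => ('e::field_char_0, complex) qtensor"
 assumes "finite A" "!!i. i \<in> A ==> f i \<in> carrier unit_group"
 shows "(\<Otimes>\<^bsub>unit_group\<^esub>i\<in>A. f i) = (\<Prod>i\<in>A. f i)"
proof -
 interpret comm_group "unit_group :: ('e, complex) qtensor monoid" by (rule comm_group_unit_group)
 show ?thesis using assms
  by (induction A) (auto simp: Pi_def, auto simp: unit_group_simps)
qed

lemma unit_congI:
 assumes "\<exists>t. x * t = 1" "\<exists>t. y * t = 1" "r \<in> runits K" "x = r * y"
 shows "unit_cong K x y"
 unfolding unit_cong_def Units_right_subring using assms by (auto simp: unit_group_simps)

lemma runits_unit: "r \<in> runits K ==> \<exists>t. r * t = 1"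
 by (auto simp: runits_def)

lemma unit_mult:
 fixes x y :: "'r::comm_ring_1"
 assumes "\<exists>t. x * t = 1" "\<exists>t. y * t = 1"
 shows "\<exists>t. x * y * t = 1"
proof -
 obtain s t where "x * s = 1" "y * t = 1" using assms by blast
 then have "x * y * (s * t) = 1" by (metis mult.assoc mult.left_commute mult_1)
 then show ?thesis by blast
qed

lemma unit_prod:
 fixes f :: "'i => 'r::comm_ring_1"
 assumes "!!i. i \<in> A ==> \<exists>t. f i * t = 1"
 shows "\<exists>t. (\<Prod>i\<in>A. f i) * t = 1"
 using assms
 by (induction A rule: infinite_finite_induct) (auto intro: unit_mult)

text \<open>The ratio a / b is t \<delta>, and its inverse is the inverse of t times \<delta>'.
  Hence its power with exponent 1 or -1 is \<delta> or \<delta>' up to a unit over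
  \<open>K\<close>.\<close>

lemma ratio_power:
 fixes a b \<delta> :: "('e::field_char_0, complex) qtensor"
 assumes t: "t \<in> runits K" and a: "a = t * b * \<delta>" and b: "\<exists>t. b * t = 1" and \<delta>: "\<delta> * \<delta>' = 1" and k: "k = 1 \<or> k = - 1"
 shows "\<exists>r\<in>runits K. (if k = 1 then \<delta> else \<delta>') = r * ((a \<otimes>\<^bsub>unit_group\<^esub> inv\<^bsub>unit_group\<^esub> b) [^]\<^bsub>unit_group\<^esub> (k :: int))"
  and "\<exists>u. ((a \<otimes>\<^bsub>unit_group\<^esub> inv\<^bsub>unit_group\<^esub> b) [^]\<^bsub>unit_group\<^esub> (k :: int)) * u = 1"
proof -
 interpret U: comm_group "unit_group :: ('e, complex) qtensor monoid" by (rule comm_group_unit_group)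
 obtain b' where b': "b * b' = 1" using b by blast
 obtain t' where t': "t * t' = 1" using t by (auto simp: runits_def)
 define q where "q = a \<otimes>\<^bsub>unit_group\<^esub> inv\<^bsub>unit_group\<^esub> b"
 have "q = t * \<delta> * (b * b')" unfolding q_def unit_group_inv[OF b'] unit_group_simps a by (simp only: ac_simps)
 then have q: "q = t * \<delta>" by (simp add: b')
 have "q * (t' * \<delta>') = (t * t') * (\<delta> * \<delta>')" unfolding q by (simp only: ac_simps)
 then have qq: "q * (t' * \<delta>') = 1" by (simp add: t' \<delta>)
 then have qc: "q \<in> carrier unit_group" by (auto simp: unit_group_simps)
 show "\<exists>r\<in>runits K. (if k = 1 then \<delta> else \<delta>') = r * (q [^]\<^bsub>unit_group\<^esub> k)"
 proof (cases "k = 1")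
  case True
  have "\<delta> = (t * t') * \<delta>" by (simp add: t')
  then have "\<delta> = t' * q" unfolding q by (simp only: ac_simps)
  then show ?thesis using True runits_inverse[OF t t'] U.int_pow_1[OF qc] by auto
 next
  case False
  then have "q [^]\<^bsub>unit_group\<^esub> k = t' * \<delta>'"
   using k U.int_pow_neg[OF qc, of 1] U.int_pow_1[OF qc] unit_group_inv[OF qq] by simp
  moreover have "\<delta>' = t * (t' * \<delta>')" by (simp add: mult.assoc[symmetric] t')
  ultimately show ?thesis using False t by auto
 qed
 show "\<exists>u. (q [^]\<^bsub>unit_group\<^esub> k) * u = 1"
  using U.int_pow_closed[OF qc, of k] unfolding unit_group_simps .
qed

theorem theorem4p1:
  fixes M :: "('e::field_char_0, 'f::field_char_0, 'b, 'd) realizations"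
    and M' :: "('e, 'f, 'b2, 'd2) realizations"
  assumes "number_field TYPE('e)" and "number_field TYPE('f)" and "totally_real TYPE('f)"
    and "motive M" and "motive M'"
    and "even (motive_rank M)" and "odd (motive_rank M')"
    and "\<And>p q. hodge_number M p q \<noteq> 0 \<Longrightarrow> hodge_number M p q = 1"
    and "\<And>p q. hodge_number M' p q \<noteq> 0 \<Longrightarrow> hodge_number M' p q = 1"
    and "critical (tensor_motive M M')"
  shows
    \<comment> \<open>the periods are defined and lie in the unit group\<close>
    "(\<forall>s\<in>{1, -1}.
        (\<forall>\<sigma>\<in>real_embeddings.
           periods M \<sigma> s \<noteq> {} \<and> periods M \<sigma> s \<subseteq> carrier unit_group \<and>
           periods (tensor_motive M M') \<sigma> s \<noteq> {} \<and>
           periods (tensor_motive M M') \<sigma> s \<subseteq> carrier unit_group) \<and>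
        periods (restriction (tensor_motive M M')) of_rat s \<noteq> {} \<and>
        periods (restriction (tensor_motive M M')) of_rat s \<subseteq> carrier unit_group) \<and>
     (\<forall>\<sigma>\<in>real_embeddings.
        \<forall>c1\<in>periods (tensor_motive M M') \<sigma> 1. \<forall>c2\<in>periods (tensor_motive M M') \<sigma> (-1).
        \<forall>a\<in>periods M \<sigma> 1. \<forall>b\<in>periods M \<sigma> (-1).
        unit_cong (range \<sigma>)
          (c1 \<otimes>\<^bsub>unit_group\<^esub> inv\<^bsub>unit_group\<^esub> c2)
          ((a \<otimes>\<^bsub>unit_group\<^esub> inv\<^bsub>unit_group\<^esub> b) [^]\<^bsub>unit_group\<^esub> middle_sign M' \<sigma>)) \<and>
     (\<forall>K. subfield K class_ring \<and> (\<forall>\<sigma>\<in>(real_embeddings :: ('f \<Rightarrow> complex) set). range \<sigma> \<subseteq> K) \<longrightarrow>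
       (\<forall>c1\<in>periods (restriction (tensor_motive M M')) of_rat 1.
        \<forall>c2\<in>periods (restriction (tensor_motive M M')) of_rat (-1).
        \<forall>a\<in>(\<Pi> \<sigma>\<in>real_embeddings. periods M \<sigma> 1).
        \<forall>b\<in>(\<Pi> \<sigma>\<in>real_embeddings. periods M \<sigma> (-1)).
        unit_cong K
          (c1 \<otimes>\<^bsub>unit_group\<^esub> inv\<^bsub>unit_group\<^esub> c2)
          (\<Otimes>\<^bsub>unit_group\<^esub>\<sigma>\<in>real_embeddings.
             (a \<sigma> \<otimes>\<^bsub>unit_group\<^esub> inv\<^bsub>unit_group\<^esub> b \<sigma>) [^]\<^bsub>unit_group\<^esub> middle_sign M' \<sigma>)))"
proof -
 interpret M: motive M by fact
 interpret M': motive M' by fact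
 let ?T = "tensor_motive M M'"
 note nf = assms(2) and ev = assms(6) and od = assms(7) and hle = assms(8) and hle' = assms(9) and crit = assms(10)
 obtain w where pure_w: "\<forall>\<sigma>\<in>real_embeddings. \<forall>p q. p + q \<noteq> w \<longrightarrow> hodge_type M \<sigma> p q = {\<zero>\<^bsub>bettiC M \<sigma>\<^esub>}"
  using M.hodge_pure ..
 have w: "hodge_type M \<sigma> p q = {\<zero>\<^bsub>bettiC M \<sigma>\<^esub>}" if "\<sigma> \<in> real_embeddings" "p + q \<noteq> w" for \<sigma> p q
  using pure_w that by simp
 obtain w' where pure_w': "\<forall>\<sigma>\<in>real_embeddings. \<forall>p q. p + q \<noteq> w' \<longrightarrow> hodge_type M' \<sigma> p q = {\<zero>\<^bsub>bettiC M' \<sigma>\<^esub>}"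
  using M'.hodge_pure ..
 have w': "hodge_type M' \<sigma> p q = {\<zero>\<^bsub>bettiC M' \<sigma>\<^esub>}" if "\<sigma> \<in> real_embeddings" "p + q \<noteq> w'" for \<sigma> p q
  using pure_w' that by simp
 let ?P = "hodge_degrees M w \<times> hodge_degrees M' w'" and ?deg = "%(p, p'). p + p' :: int"
  and ?star = "%(p, p'). (w - p, w' - p' :: int)"
 \<comment> \<open>Total realness makes the set of all embeddings, which indexes the components of
   \<FF> \<otimes> \<complex>, coincide with the real embeddings.\<close>
 have emb: "(real_embeddings :: ('f => complex) set) = {\<sigma>. field_hom \<sigma>}"
  using assms(3) by (auto simp: real_embeddings_def totally_real_def)
 obtain \<epsilon> :: "('f => complex) => ('f, complex) qtensor" where
  \<epsilon>: "finite {\<tau>::'f => complex. field_hom \<tau>}" "(\<Sum>\<tau>\<in>{\<tau>. field_hom \<tau>}. \<epsilon> \<tau>) = 1"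
  "!!\<tau> a. field_hom \<tau> ==> a \<otimes>\<^sub>\<rat> 1 * \<epsilon> \<tau> = 1 \<otimes>\<^sub>\<rat> \<tau> a * \<epsilon> \<tau>"
  by (rule number_field_idempotents[OF nf]; ((rule that; assumption) | assumption))
 have fin: "finite (real_embeddings :: ('f => complex) set)" using \<epsilon>(1) unfolding emb .
 \<comment> \<open>An empty sum of components could not be 1.\<close>
 have ne: "(real_embeddings :: ('f => complex) set) \<noteq> {}"
 proof
  assume "(real_embeddings :: ('f => complex) set) = {}"
  then show False using \<epsilon>(2) unfolding emb[symmetric] by simp
 qed
 then obtain \<sigma>0 :: "'f => complex" where \<sigma>0: "\<sigma>0 \<in> real_embeddings" by blast
 have "\<forall>\<sigma>\<in>real_embeddings. \<exists>(K :: ((int \<times> nat) \<times> nat) set) b cb c y z \<gamma> G v \<psi> \<delta> \<delta>'.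
   tensor_frame M M' w w' \<sigma> K b cb c y z \<gamma> G v \<psi> \<delta> \<delta>'"
  by (intro ballI tensor_period_frame assms(4,5) hle hle' w w' ev od)
 then obtain K :: "('f => complex) => ((int \<times> nat) \<times> nat) set" and b cb c y z \<gamma> G v \<psi> \<delta> \<delta>' where
  tf: "!!\<sigma>. \<sigma> \<in> real_embeddings ==>
   tensor_frame M M' w w' \<sigma> (K \<sigma>) (b \<sigma>) (cb \<sigma>) (c \<sigma>) (y \<sigma>) (z \<sigma>) (\<gamma> \<sigma>) (G \<sigma>) (v \<sigma>) (\<psi> \<sigma>) (\<delta> \<sigma>) (\<delta>' \<sigma>)"
  by metis
 note tfs = tf[unfolded tensor_frame_def]
 have mp: "motive_pair M M' \<sigma>" if "\<sigma> \<in> real_embeddings" for \<sigma> using tfs[OF that] by (elim conjE)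
 have pf: "period_frame ?T \<sigma> ?P ?deg (K \<sigma>) (y \<sigma>) (z \<sigma>) (\<gamma> \<sigma>) (G \<sigma>) (b \<sigma>) (cb \<sigma>) (w + w') ?star (v \<sigma>)"
  if "\<sigma> \<in> real_embeddings" for \<sigma> using tfs[OF that] by (elim conjE)
 have fr: "frame (betti ?T \<sigma>) ({1, - 1} \<times> K \<sigma>) (%(s, k). b \<sigma> s k) (c \<sigma>)" if "\<sigma> \<in> real_embeddings" for \<sigma>
  using tfs[OF that] by (elim conjE)
 have frob_b: "\<forall>s\<in>{1, - 1}. \<forall>k\<in>K \<sigma>. frob ?T \<sigma> (b \<sigma> s k) = of_int s \<odot>\<^bsub>betti ?T \<sigma>\<^esub> b \<sigma> s k" if "\<sigma> \<in> real_embeddings" for \<sigma>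
  using tfs[OF that] by (elim conjE)
 have rel: "\<forall>q\<in>?P. \<forall>k\<in>K \<sigma>. (\<Sum>j\<in>K \<sigma>. \<psi> \<sigma> k j * y \<sigma> q (1, j)) =
   of_int (if w div 2 + 1 \<le> fst q then - 1 else 1) * y \<sigma> q (- 1, k)" if "\<sigma> \<in> real_embeddings" for \<sigma>
  using tfs[OF that] by (elim conjE)
 have \<delta>: "\<delta> \<sigma> * \<delta>' \<sigma> = 1" "gdet (K \<sigma>) (\<psi> \<sigma>) = (if middle_sign M' \<sigma> = 1 then \<delta> \<sigma> else \<delta>' \<sigma>)"
  "middle_sign M' \<sigma> = 1 \<or> middle_sign M' \<sigma> = - 1" if "\<sigma> \<in> real_embeddings" for \<sigma>
  using tfs[OF that] by - (elim conjE, assumption)+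
 have ratioM: "\<forall>a\<in>periods M \<sigma> 1. \<forall>b\<in>periods M \<sigma> (- 1). \<exists>t\<in>runits (range \<sigma>). a = t * b * \<delta> \<sigma>"
  and perM: "\<forall>s\<in>{1, - 1}. periods M \<sigma> s \<noteq> {} \<and> (\<forall>c\<in>periods M \<sigma> s. \<exists>t. c * t = 1)" if "\<sigma> \<in> real_embeddings" for \<sigma>
  using tfs[OF that] by - (elim conjE, assumption)+
 note pd0 = motive_pair.period_data_tensor[OF mp[OF \<sigma>0]]
 have rd: "restriction_data ?T \<epsilon>"
 proof (rule restriction_data.intro)
  show "cmod (betti ?T \<sigma>)" if "\<sigma> \<in> real_embeddings" for \<sigma> by (rule frame_cmod[OF fr[OF that]])
  show "frob ?T \<sigma> \<in> LinearCombinations.module_hom class_ring (betti ?T \<sigma>) (betti ?T \<sigma>)" if "\<sigma> \<in> real_embeddings" for \<sigma>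
   by (rule motive_pair.frob_tensor_hom[OF mp[OF that]])
  show "frob ?T \<sigma> (frob ?T \<sigma> v) = v" if "\<sigma> \<in> real_embeddings" "v \<in> carrier (betti ?T \<sigma>)" for \<sigma> v
   by (rule motive_pair.frob_tensor_involution[OF mp[OF that(1)] that(2)])
  show "cmod (derham ?T)" by (rule period_data.cD[OF pd0])
  show "LinearCombinations.submodule class_ring (hodge_fil ?T n) (derham ?T)" for n by (rule period_data.F[OF pd0])
  show "hodge_fil ?T n \<subseteq> hodge_fil ?T m" if "m \<le> n" for m n by (rule period_data.F_dec[OF pd0 that])
  show "comparison ?T \<sigma> (bclass (betti ?T \<sigma>) [(v, 1)]) \<in> carrier (derhamC ?T \<sigma>)"
   if "\<sigma> \<in> real_embeddings" "v \<in> carrier (betti ?T \<sigma>)" for \<sigma> v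
   by (rule motive_pair.tensor_period(1)[OF mp[OF that(1)] that(2)])
  show "semilin (%e. e \<otimes>\<^sub>\<rat> 1) (betti ?T \<sigma>) (%v. betti_period ?T \<sigma> v \<phi>)"
   if "\<sigma> \<in> real_embeddings" "period_functional ?T \<sigma> \<phi>" for \<sigma> \<phi>
   by (rule motive_pair.semilin_tensor_period[OF mp[OF that(1)] that(2)])
  show "finite (real_embeddings :: ('f => complex) set)" by (rule fin)
  show "(\<Sum>\<tau>\<in>real_embeddings. \<epsilon> \<tau>) = 1" using \<epsilon>(2) unfolding emb .
  show "a \<otimes>\<^sub>\<rat> 1 * \<epsilon> \<sigma> = 1 \<otimes>\<^sub>\<rat> \<sigma> a * \<epsilon> \<sigma>" if "\<sigma> \<in> real_embeddings" for \<sigma> a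
   by (rule \<epsilon>(3)[OF real_embeddings_field_hom[OF that]])
  show "eval_emb \<tau> (\<epsilon> \<sigma>) = (if \<sigma> = \<tau> then 1 else 0)" if "\<sigma> \<in> real_embeddings" "\<tau> \<in> real_embeddings" for \<sigma> \<tau>
   by (rule eval_emb_idempotent[OF \<epsilon>]) (use that real_embeddings_field_hom in auto)
 qed
 interpret R: restriction_frames ?T \<epsilon> ?P ?deg K y z \<gamma> G b cb "w + w'" ?star v c
 proof (rule restriction_frames.intro[OF rd], rule restriction_frames_axioms.intro)
  show "frob ?T \<sigma> (b \<sigma> s k) = of_int s \<odot>\<^bsub>betti ?T \<sigma>\<^esub> b \<sigma> s k"
   if "\<sigma> \<in> real_embeddings" "s \<in> {1, - 1}" "k \<in> K \<sigma>" for \<sigma> s k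
   using frob_b[OF that(1)] that(2,3) by blast
 qed (fact pf fr ne)+
 let ?N = "restriction ?T"
 \<comment> \<open>Criticality gives a rank for each \<sigma>, but it is the rank of one and the
   same quotient; so all eigenspaces of sign \<open>s\<close> have this dimension.\<close>
 have crit_rank: "\<exists>p r. has_rank (derham_quot ?T p) r \<and> (\<forall>\<sigma>\<in>real_embeddings. r = card (K \<sigma>))" if s: "s \<in> {1, - 1}" for s :: int
 proof -
  obtain p where p: "\<forall>\<sigma>\<in>real_embeddings. \<exists>n. has_rank (betti_eigen ?T \<sigma> s) n \<and> has_rank (derham_quot ?T p) n"
   using crit s unfolding critical_def by blast
  obtain r where r: "has_rank (derham_quot ?T p) r" using p \<sigma>0 by blast
  obtain ws \<kappa> where f: "frame (derham_quot ?T p) {..<r} ws \<kappa>" using has_rank_frame[OF period_data.cQ[OF pd0] r] by blast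
  have "r = card (K \<sigma>)" if \<sigma>: "\<sigma> \<in> real_embeddings" for \<sigma>
  proof -
   obtain n where n: "has_rank (betti_eigen ?T \<sigma> s) n" "has_rank (derham_quot ?T p) n" using p \<sigma> by blast
   show ?thesis using n frame_has_rank[OF period_frame.frame_eigen[OF pf[OF \<sigma>] s], of n] frame_has_rank[OF f, of n] by simp
  qed
  then show ?thesis using r by blast
 qed
 have perT: "periods ?T \<sigma> s \<noteq> {}" if \<sigma>: "\<sigma> \<in> real_embeddings" and s: "s \<in> {1, - 1}" for \<sigma> and s :: int
 proof -
  obtain p r where p: "has_rank (derham_quot ?T p) r" "r = card (K \<sigma>)" using crit_rank[OF s] \<sigma> by blast
  obtain ws \<kappa> where f: "frame (derham_quot ?T p) {..<r} ws \<kappa>" using has_rank_frame[OF period_data.cQ[OF pd0] p(1)] by blast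
  show ?thesis
   by (rule period_frame.periods_ex[OF pf[OF \<sigma>] p(1) _ s]) (use period_frame.quot_rank[OF pf[OF \<sigma>] f] p(2) in simp)
 qed
 have perN: "periods ?N of_rat s \<noteq> {}" if s: "s \<in> {1, - 1}" for s
 proof -
  obtain p r where p: "has_rank (derham_quot ?T p) r" "\<forall>\<sigma>\<in>real_embeddings. r = card (K \<sigma>)" using crit_rank[OF s] by blast
  obtain ws \<kappa> where f: "frame (derham_quot ?T p) {..<r} ws \<kappa>" using has_rank_frame[OF period_data.cQ[OF pd0] p(1)] by blast
  show ?thesis by (rule R.periods_restriction_ex[OF nf f _ s]) (use p(2) in blast)
 qed
 have unitT: "\<exists>t. c * t = 1" if "\<sigma> \<in> real_embeddings" "s \<in> {1, - 1}" "c \<in> periods ?T \<sigma> s" for \<sigma> s c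
  by (rule period_frame.periods_unit[OF pf[OF that(1)] that(3,2)])
 have unitN: "\<exists>t. c * t = 1" if "s \<in> {1, - 1}" "c \<in> periods ?N of_rat s" for s c
  by (rule period_frame.periods_unit[OF R.period_frame_restriction that(2,1)])
 let ?q = "%\<sigma> a b. (a \<otimes>\<^bsub>unit_group\<^esub> inv\<^bsub>unit_group\<^esub> b) [^]\<^bsub>unit_group\<^esub> middle_sign M' \<sigma>"
 have power: "\<exists>r\<in>runits (range \<sigma>). gdet (K \<sigma>) (\<psi> \<sigma>) = r * ?q \<sigma> a b" "\<exists>u. ?q \<sigma> a b * u = 1"
  if \<sigma>: "\<sigma> \<in> real_embeddings" and a: "a \<in> periods M \<sigma> 1" and b: "b \<in> periods M \<sigma> (- 1)" for \<sigma> a b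
 proof -
  obtain t where t: "t \<in> runits (range \<sigma>)" "a = t * b * \<delta> \<sigma>" using ratioM[OF \<sigma>] a b by blast
  have bu: "\<exists>t. b * t = 1" using perM[OF \<sigma>] b by blast
  show "\<exists>r\<in>runits (range \<sigma>). gdet (K \<sigma>) (\<psi> \<sigma>) = r * ?q \<sigma> a b"
   unfolding \<delta>(2)[OF \<sigma>] by (rule ratio_power(1)[OF t bu \<delta>(1,3)[OF \<sigma>]])
  show "\<exists>u. ?q \<sigma> a b * u = 1" by (rule ratio_power(2)[OF t bu \<delta>(1,3)[OF \<sigma>]])
 qed
 have quotient: "c1 \<otimes>\<^bsub>unit_group\<^esub> inv\<^bsub>unit_group\<^esub> c2 = t * g" if "c1 = t * c2 * g" "\<exists>u. c2 * u = 1"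
  for c1 c2 t g :: "('e, complex) qtensor"
 proof -
  obtain u where u: "c2 * u = 1" using \<open>\<exists>u. c2 * u = 1\<close> by blast
  have "c1 * u = t * g * (c2 * u)" unfolding that(1) by (simp only: ac_simps)
  then show ?thesis unfolding unit_group_inv[OF u] unit_group_simps u by simp
 qed
 show ?thesis
 proof (intro conjI ballI allI impI)
  fix s :: int and \<sigma> :: "'f => complex" assume s: "s \<in> {1, - 1}" and \<sigma>: "\<sigma> \<in> real_embeddings"
  show "periods M \<sigma> s \<noteq> {}" using perM[OF \<sigma>] s by blast
  show "periods M \<sigma> s \<subseteq> carrier unit_group" using perM[OF \<sigma>] s by (auto simp: unit_group_simps)
  show "periods ?T \<sigma> s \<noteq> {}" by (rule perT[OF \<sigma> s])
  show "periods ?T \<sigma> s \<subseteq> carrier unit_group" using unitT[OF \<sigma> s] by (auto simp: unit_group_simps)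
 next
  fix s :: int assume s: "s \<in> {1, - 1}"
  show "periods ?N of_rat s \<noteq> {}" by (rule perN[OF s])
  show "periods ?N of_rat s \<subseteq> carrier unit_group" using unitN[OF s] by (auto simp: unit_group_simps)
 next
  fix \<sigma> c1 c2 a b
  assume \<sigma>: "\<sigma> \<in> real_embeddings" and c1: "c1 \<in> periods ?T \<sigma> 1" and c2: "c2 \<in> periods ?T \<sigma> (- 1)"
   and a: "a \<in> periods M \<sigma> 1" and b: "b \<in> periods M \<sigma> (- 1)"
  obtain t where t: "t \<in> runits (range \<sigma>)" "c1 = t * c2 * gdet (K \<sigma>) (\<psi> \<sigma>)"
   by (rule period_frame.period_ratio[OF pf[OF \<sigma>] c1 c2, of "%q. if w div 2 + 1 \<le> fst q then - 1 else 1" "\<psi> \<sigma>"])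
    (use rel[OF \<sigma>] in auto)
  obtain r where r: "r \<in> runits (range \<sigma>)" "gdet (K \<sigma>) (\<psi> \<sigma>) = r * ?q \<sigma> a b" using power(1)[OF \<sigma> a b] by blast
  have tr: "t * r \<in> runits (range \<sigma>)" 
   by (intro runits_mult[where K = "range \<sigma>"] period_frame.mult_range[OF pf[OF \<sigma>]] t(1) r(1))
  have eq: "c1 \<otimes>\<^bsub>unit_group\<^esub> inv\<^bsub>unit_group\<^esub> c2 = t * r * ?q \<sigma> a b"
   using quotient[OF t(2) unitT[OF \<sigma> _ c2]] unfolding r(2) by (simp add: mult.assoc)
  show "unit_cong (range \<sigma>) (c1 \<otimes>\<^bsub>unit_group\<^esub> inv\<^bsub>unit_group\<^esub> c2) (?q \<sigma> a b)"
   by (rule unit_congI[OF _ power(2)[OF \<sigma> a b] tr eq])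
    (unfold eq, rule unit_mult[OF runits_unit[OF tr] power(2)[OF \<sigma> a b]])
 next
  fix L :: "complex set" and c1 c2 a b
  assume L: "subfield L class_ring \<and> (\<forall>\<sigma>\<in>(real_embeddings :: ('f => complex) set). range \<sigma> \<subseteq> L)"
   and c1: "c1 \<in> periods ?N of_rat 1" and c2: "c2 \<in> periods ?N of_rat (- 1)"
   and a: "a \<in> (\<Pi> \<sigma>\<in>real_embeddings. periods M \<sigma> 1)" and b: "b \<in> (\<Pi> \<sigma>\<in>real_embeddings. periods M \<sigma> (- 1))"
  have sub: "subring L class_ring" using L subfieldE(1) by blast
  have Lm: "x * y \<in> L" if "x \<in> L" "y \<in> L" for x y using subringE(6)[OF sub that] by simp
  have L1: "1 \<in> L" using subringE(3)[OF sub] by simp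
  have LR: "range \<sigma> \<subseteq> L" if "\<sigma> \<in> real_embeddings" for \<sigma> :: "'f => complex" using L that by blast
  \<comment> \<open>The correction factor of the restriction is a unit over the rationals; it
    belongs to \<open>L\<close> because an embedding fixes the rationals.\<close>
  have LQ: "range (of_rat :: rat => complex) \<subseteq> L"
  proof
   fix x :: complex assume "x \<in> range of_rat"
   then obtain q where "x = of_rat q" by blast
   then have "x = \<sigma>0 (of_rat q)" using field_hom_of_rat[OF real_embeddings_field_hom[OF \<sigma>0]] by simp
   then show "x \<in> L" using LR[OF \<sigma>0] by blast
  qed
  have ab: "a \<sigma> \<in> periods M \<sigma> 1" "b \<sigma> \<in> periods M \<sigma> (- 1)" if "\<sigma> \<in> real_embeddings" for \<sigma> using a b that by auto
  let ?Q = "%\<sigma>. ?q \<sigma> (a \<sigma>) (b \<sigma>)"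
  have "\<forall>\<sigma>\<in>real_embeddings. \<exists>r. r \<in> runits (range \<sigma>) \<and> gdet (K \<sigma>) (\<psi> \<sigma>) = r * ?Q \<sigma>"
   using power(1) ab by blast
  from bchoice[OF this] obtain r where r: "\<forall>\<sigma>\<in>real_embeddings. r \<sigma> \<in> runits (range \<sigma>) \<and> gdet (K \<sigma>) (\<psi> \<sigma>) = r \<sigma> * ?Q \<sigma>" ..
  obtain t where t: "t \<in> runits (range of_rat)" "c1 = t * c2 * (\<Prod>\<sigma>\<in>real_embeddings. gdet (K \<sigma>) (\<psi> \<sigma>))"
   by (rule R.restriction_ratio[OF c1 c2, of "%q. if w div 2 + 1 \<le> fst q then - 1 else 1" \<psi>]) (use rel in auto)
  have one: "1 \<in> runits L" using runits_pure[OF L1, of 1 1] by simp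
  have "(\<Prod>\<sigma>\<in>A. r \<sigma>) \<in> runits L" if "finite A" "A \<subseteq> real_embeddings" for A
   using that
  proof (induction A)
   case empty
   show ?case using one by simp
  next
   case (insert \<sigma> A)
   then have "r \<sigma> \<in> runits L" using r runits_mono[OF LR[of \<sigma>]] by blast
   then show ?case using insert by (simp add: runits_mult[OF Lm])
  qed
  from this[OF fin order.refl] have tr: "t * (\<Prod>\<sigma>\<in>real_embeddings. r \<sigma>) \<in> runits L"
   using t(1) runits_mono[OF LQ] by (intro runits_mult[OF Lm]) auto
  have Qu: "\<exists>u. ?Q \<sigma> * u = 1" if "\<sigma> \<in> real_embeddings" for \<sigma> by (rule power(2)[OF that ab[OF that]])
  have fp: "(\<Otimes>\<^bsub>unit_group\<^esub>\<sigma>\<in>real_embeddings. ?Q \<sigma>) = (\<Prod>\<sigma>\<in>real_embeddings. ?Q \<sigma>)"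
   by (rule unit_group_finprod[OF fin]) (unfold unit_group_simps(1), rule Qu)
  have "(\<Prod>\<sigma>\<in>real_embeddings. gdet (K \<sigma>) (\<psi> \<sigma>)) = (\<Prod>\<sigma>\<in>real_embeddings. r \<sigma>) * (\<Prod>\<sigma>\<in>real_embeddings. ?Q \<sigma>)"
   unfolding prod.distrib[symmetric] by (rule prod.cong) (use r in auto)
  then have eq: "c1 \<otimes>\<^bsub>unit_group\<^esub> inv\<^bsub>unit_group\<^esub> c2 = t * (\<Prod>\<sigma>\<in>real_embeddings. r \<sigma>) * (\<Prod>\<sigma>\<in>real_embeddings. ?Q \<sigma>)"
   using quotient[OF t(2) unitN[OF _ c2]] by (simp add: mult.assoc)
  show "unit_cong L (c1 \<otimes>\<^bsub>unit_group\<^esub> inv\<^bsub>unit_group\<^esub> c2) (\<Otimes>\<^bsub>unit_group\<^esub>\<sigma>\<in>real_embeddings. ?Q \<sigma>)"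
   unfolding fp
   by (rule unit_congI[OF _ unit_prod[OF Qu] tr eq])
    (unfold eq, rule unit_mult[OF runits_unit[OF tr] unit_prod[OF Qu]])
 qed
qed

end
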